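(* Let $$R=\mathbb{Z}[t^{\pm1},q,p^{\pm1},s^{\pm1},r^{\pm1},w]\big/ J,$$ where $J$ is the ideal given by the relations $q(p-t)=0$, $q^2=(1-t)(1-p)$, $w(1-s)=0$, $w(t-r)=0$, $w^2=(1-t)(1-rs)$, $w(ps+q-1)=0$, $w(r+q-1)=0$, $w(p-r)=0$, $w^2=q(1-rs)$. For an oriented virtual knot diagram $K$, let $N(K)$ be the $R$-module defined in the context. Then $N(K)$ is an invariant of virtual knots: if $K$ and $K'$ are diagrams of equivalent virtual knots, then $N(K)$ and $N(K')$ are isomorphic as $R$-modules.
   Context: Virtual knots. A virtual knot diagram is a planar 4-valent graph (image of one immersed closed oriented curve) in which each vertex is either a classical crossing (with over/under structure) or is marked as a virtual crossing. Virtual knots are equivalence classes of such diagrams modulo planar isotopy and generalized Reidemeister moves: the classical Reidemeister moves (involving classical crossings only) and the detour move, in which a branch containing several consecutive virtual crossings and no classical crossings is replaced by any other branch with the same endpoints, all new intersections and self-intersections being marked as virtual crossings. Gaussian parity. The chord diagram of $K$ is the circle parametrizing $K$, with one chord for each classical crossing joining its two preimages. A classical crossing is even if its chord intersects an even number of other chords, and odd otherwise. Parity hierarchy. Let $f(K)$ be the diagram obtained from $K$ by turning all odd classical crossings into virtual crossings. A classical crossing of $K$ has type $0$ if it is odd in $K$; it has type $1$ if it is even in $K$ and odd as a crossing of $f(K)$; it has type $2$ if it is even in $K$ and even as a crossing of $f(K)$. Short arcs. A short arc of $K$ is a branch of the diagram that goes from a classical underpass (of any type) or an overpass at a type $0$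 crossing to the next classical underpass (of any type) or overpass at a type $0$ crossing. Thus a short arc may contain virtual crossings and overpasses at crossings of types $1$ and $2$, but in its interior neither classical underpasses nor overpasses of type $0$ crossings. (If there are no such breaking points, the whole closed curve is a single short arc.) The module $N(K)$. $N(K)$ is the $R$-module generated by the short arcs of $K$, subject to the following relations at classical crossings (virtual crossings give no relations). At a crossing of type $2$: let $a$ be the short arc of the overpass, $b$ the under short arc on the right of the oriented overpass, $c$ the under short arc on its left; the relation is $c=t\,b+(1-t)\,a$. At a crossing of type $1$, with the same notation: $c=p\,b+q\,a$. At a crossing of type $0$: let $a_{in},a_{out}$ be the incoming and outgoing short arcs of the overpass, and $b_{in},b_{out}$ the incoming and outgoing short arcs of the underpass (with respect to the orientation of the knot). If the crossing is positive (the underpass goes from the right of the oriented overpass to its left), the two relations are $$a_{out}=s\,a_{in},\qquad b_{out}=r\,b_{in}+w\,a_{in}.$$ If the crossing is negative (the underpass goes from the left of the overpass to its right), the relations are the inverse ones, $$a_{out}=s^{-1}a_{in},\qquad b_{out}=r^{-1}b_{in}-r^{-1}s^{-1}w\,a_{in}.$$ *)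

theory Defs
  imports
    "HOL-Analysis.Analysis"
    "HOL-Library.Poly_Mapping"
    "HOL-Algebra.Module"
    "HOL-Algebra.QuotRing"
begin

section \<open>Virtual knot diagrams\<close>

text \<open>
  The circle is \<open>\<real>/\<int>\<close>, so a closed curve is a function on the reals of period 1,
  and the plane is the type of complex numbers with its standard orientation.
  The set \<open>over\<close> consists of the parameters of the overpasses at classical
  crossings. A double point neither of whose two parameters lies in \<open>over\<close> is a
  virtual crossing.
\<close>

record vdiagram =
  curve :: "real \<Rightarrow> complex"
  over :: "real set"

definition velocity :: "vdiagram \<Rightarrow> real \<Rightarrow> complex" where
  "velocity K x = vector_derivative (curve K) (at x)"

text \<open>Positive iff \<open>w\<close> points to the left of the direction \<open>v\<close>.\<close>

definition det2 :: "complex \<Rightarrow> complex \<Rightarrow> real" where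
  "det2 v w = Re v * Im w - Im v * Re w"

definition double_point :: "vdiagram \<Rightarrow> real \<Rightarrow> real \<Rightarrow> bool" where
  "double_point K x y \<longleftrightarrow> curve K x = curve K y \<and> x - y \<notin> \<int>"

definition virtual_knot_diagram :: "vdiagram \<Rightarrow> bool" where
  "virtual_knot_diagram K \<longleftrightarrow>
     (\<forall>x. curve K (x + 1) = curve K x) \<and>
     curve K C1_differentiable_on UNIV \<and>
     (\<forall>x. velocity K x \<noteq> 0) \<and>
     finite {x \<in> {0..<1}. \<exists>y. double_point K x y} \<and>
     (\<forall>x y z. double_point K x y \<and> double_point K x z \<longrightarrow> y - z \<in> \<int>) \<and>
     (\<forall>x y. double_point K x y \<longrightarrow> det2 (velocity K x) (velocity K y) \<noteq> 0) \<and>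
     (\<forall>x. x + 1 \<in> over K \<longleftrightarrow> x \<in> over K) \<and>
     (\<forall>x \<in> over K. \<exists>y. double_point K x y) \<and>
     (\<forall>x y. double_point K x y \<longrightarrow> \<not> (x \<in> over K \<and> y \<in> over K))"

text \<open>A classical crossing is given by the parameters of its overpass and its underpass.\<close>

definition crossings :: "vdiagram \<Rightarrow> (real \<times> real) set" where
  "crossings K =
     {(v, u). v \<in> {0..<1} \<and> u \<in> {0..<1} \<and> double_point K v u \<and> v \<in> over K}"

text \<open>Positive: the underpass goes from the right of the overpass to its left.\<close>

definition positive :: "vdiagram \<Rightarrow> real \<times> real \<Rightarrow> bool" where
  "positive K = (\<lambda>(v, u). det2 (velocity K v) (velocity K u) > 0)"


section \<open>Equivalence of diagrams\<close>

definition reparametrized :: "vdiagram \<Rightarrow> vdiagram \<Rightarrow> bool" where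
  "reparametrized K K' \<longleftrightarrow>
     (\<exists>\<phi>. (\<forall>x. \<phi> (x + 1) = \<phi> x + 1) \<and> \<phi> C1_differentiable_on UNIV \<and>
          (\<forall>x. deriv \<phi> x > 0) \<and>
          curve K' = curve K \<circ> \<phi> \<and> over K' = \<phi> -` over K)"

text \<open>An ambient isotopy of the plane through \<open>C\<^sup>1\<close> diffeomorphisms; \<open>H'\<close> is its derivative.\<close>

definition plane_isotopy :: "(real \<Rightarrow> complex \<Rightarrow> complex) \<Rightarrow> bool" where
  "plane_isotopy H \<longleftrightarrow>
     (\<forall>z. H 0 z = z) \<and>
     (\<forall>\<tau>\<in>{0..1}. bij (H \<tau>)) \<and>
     continuous_on ({0..1} \<times> UNIV) (\<lambda>(\<tau>, z). H \<tau> z) \<and>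
     (\<exists>H' :: real \<Rightarrow> complex \<Rightarrow> complex \<Rightarrow>\<^sub>L complex.
        (\<forall>\<tau>\<in>{0..1}. \<forall>z. (H \<tau> has_derivative blinfun_apply (H' \<tau> z)) (at z)) \<and>
        (\<forall>\<tau>\<in>{0..1}. \<forall>z. bij (blinfun_apply (H' \<tau> z))) \<and>
        continuous_on ({0..1} \<times> UNIV) (\<lambda>(\<tau>, z). H' \<tau> z))"

definition planar_isotopic :: "vdiagram \<Rightarrow> vdiagram \<Rightarrow> bool" where
  "planar_isotopic K K' \<longleftrightarrow>
     (\<exists>H. plane_isotopy H \<and> curve K' = H 1 \<circ> curve K \<and> over K' = over K)"

text \<open>
  The branch of \<open>K\<close> over the parameters between \<open>a\<close> and \<open>b\<close> has no classical
  crossings and is replaced by another one with the same property. Taking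
  \<open>a\<close> and \<open>b\<close> in \<open>{0<..<1}\<close> only means that the base point is not on the branch.
\<close>

definition detour_move :: "vdiagram \<Rightarrow> vdiagram \<Rightarrow> bool" where
  "detour_move K K' \<longleftrightarrow>
     (\<exists>a b. 0 < a \<and> a < b \<and> b < 1 \<and>
        (\<forall>x\<in>{0..1} - {a<..<b}. curve K' x = curve K x) \<and>
        over K' = over K \<and>
        (\<forall>(v, u) \<in> crossings K \<union> crossings K'. v \<notin> {a<..<b} \<and> u \<notin> {a<..<b}))"

text \<open>
  Classical Reidemeister moves replace one explicit picture in the square
  \<open>[-1,1] \<times> [-1,1]\<close> by another one. Up to planar isotopy and reparametrization every
  Reidemeister move takes place in this square and has this form. A picture with
  \<open>n\<close> strands is given by curves \<open>m i\<close>, \<open>i < n\<close>, on the interval from -1 to 1;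
  each strand may be traversed in either direction (\<open>\<epsilon> i = -1\<close> means backwards), and
  the strands lie above each other in the order of the heights \<open>h i\<close>.
  Outside the strands both diagrams coincide and avoid the square.
\<close>

definition square :: "complex set" where
  "square = {z. \<bar>Re z\<bar> \<le> 1 \<and> \<bar>Im z\<bar> \<le> 1}"

definition has_picture ::
  "nat \<Rightarrow> (nat \<Rightarrow> real \<Rightarrow> complex) \<Rightarrow> (nat \<Rightarrow> real) \<Rightarrow> (nat \<Rightarrow> real) \<Rightarrow>
   (nat \<Rightarrow> real) \<Rightarrow> (nat \<Rightarrow> nat) \<Rightarrow> vdiagram \<Rightarrow> bool" where
  "has_picture n m a b \<epsilon> h K \<longleftrightarrow>
     (\<forall>i<n. \<forall>x\<in>{a i..b i}. curve K x = m i (\<epsilon> i * ((2 * x - a i - b i) / (b i - a i)))) \<and>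
     (\<forall>x\<in>{0..1} - (\<Union>i<n. {a i..b i}). curve K x \<notin> square) \<and>
     (\<forall>i<n. \<forall>j<n. \<forall>x\<in>{a i..b i}. \<forall>y\<in>{a j..b j}. double_point K x y \<longrightarrow>
        (if i = j then x \<in> over K \<or> y \<in> over K else x \<in> over K \<longleftrightarrow> h j < h i))"

definition local_move ::
  "nat \<Rightarrow> (nat \<Rightarrow> real \<Rightarrow> complex) \<Rightarrow> (nat \<Rightarrow> real \<Rightarrow> complex) \<Rightarrow> vdiagram \<Rightarrow> vdiagram \<Rightarrow> bool"
where
  "local_move n m m' K K' \<longleftrightarrow>
     (\<exists>a b \<epsilon> h.
        (\<forall>i<n. 0 < a i \<and> a i < b i \<and> b i < 1) \<and>
        disjoint_family_on (\<lambda>i. {a i..b i}) {..<n} \<and>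
        (\<forall>i<n. \<epsilon> i = 1 \<or> \<epsilon> i = -1) \<and>
        inj_on h {..<n} \<and>
        has_picture n m a b \<epsilon> h K \<and>
        has_picture n m' a b \<epsilon> h K' \<and>
        (\<forall>x\<in>{0..1} - (\<Union>i<n. {a i..b i}).
           curve K' x = curve K x \<and> (x \<in> over K' \<longleftrightarrow> x \<in> over K)))"

text \<open>
  The function \<open>bump\<close> and its derivative vanish at -1 and 1, so the two pictures of each
  move below agree to first order at the ends of the strands.
\<close>

definition bump :: "real \<Rightarrow> real" where
  "bump u = (1 - u\<^sup>2)\<^sup>2"

text \<open>
  First move: the segment \<open>[-1,1]\<close> becomes a curl, whose only double point has the
  parameters \<open>u\<close>, \<open>-u\<close> with \<open>bump u = 1/2\<close>; the curl lies above the segment or (\<open>\<eta> = -1\<close>)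
  below it.
\<close>

definition reidemeister1 :: "vdiagram \<Rightarrow> vdiagram \<Rightarrow> bool" where
  "reidemeister1 K K' \<longleftrightarrow>
     (\<exists>\<eta>\<in>{1, -1}. local_move 1
        (\<lambda>_ u. Complex u 0)
        (\<lambda>_ u. Complex (u * (1 - 2 * bump u)) (\<eta> * bump u)) K K')"

text \<open>
  Second move: strand 1 lies above the horizontal strand 0 in the plane and is pulled
  down across it, creating two crossings.
\<close>

definition reidemeister2 :: "vdiagram \<Rightarrow> vdiagram \<Rightarrow> bool" where
  "reidemeister2 K K' \<longleftrightarrow> local_move 2
     (\<lambda>i u. if i = 0 then Complex u 0 else Complex u (1 / 2))
     (\<lambda>i u. if i = 0 then Complex u 0 else Complex u (1 / 2 - bump u)) K K'"

text \<open>
  Third move: strand 2 is pushed up across the crossing of strands 0 and 1 at the origin.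
\<close>

definition reidemeister3 :: "vdiagram \<Rightarrow> vdiagram \<Rightarrow> bool" where
  "reidemeister3 K K' \<longleftrightarrow> local_move 3
     (\<lambda>i u. if i = 0 then Complex u (u / 2) else if i = 1 then Complex u (- u / 2)
            else Complex u (- 1 / 8))
     (\<lambda>i u. if i = 0 then Complex u (u / 2) else if i = 1 then Complex u (- u / 2)
            else Complex u (- 1 / 8 + bump u / 4)) K K'"

definition virtual_move :: "vdiagram \<Rightarrow> vdiagram \<Rightarrow> bool" where
  "virtual_move K K' \<longleftrightarrow>
     virtual_knot_diagram K \<and> virtual_knot_diagram K' \<and>
     (reparametrized K K' \<or> planar_isotopic K K' \<or> reidemeister1 K K' \<or>
      reidemeister2 K K' \<or> reidemeister3 K K' \<or> detour_move K K')"

definition virtually_equivalent :: "vdiagram \<Rightarrow> vdiagram \<Rightarrow> bool" where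
  "virtually_equivalent = equivclp virtual_move"


section \<open>Gaussian parity and crossing types\<close>

definition chords_intersect :: "real \<times> real \<Rightarrow> real \<times> real \<Rightarrow> bool" where
  "chords_intersect = (\<lambda>(v, u) (v', u').
     (v' \<in> {min v u<..<max v u}) \<noteq> (u' \<in> {min v u<..<max v u}))"

definition odd_crossing :: "vdiagram \<Rightarrow> real \<times> real \<Rightarrow> bool" where
  "odd_crossing K c \<longleftrightarrow> odd (card {d \<in> crossings K. chords_intersect c d})"

text \<open>All odd classical crossings become virtual (the diagram \<open>f(K)\<close>).\<close>

definition virtualize_odd :: "vdiagram \<Rightarrow> vdiagram" where
  "virtualize_odd K = K\<lparr>over :=
     over K - {x. \<exists>(v, u) \<in> crossings K. odd_crossing K (v, u) \<and> x - v \<in> \<int>}\<rparr>"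

definition crossing_type :: "vdiagram \<Rightarrow> real \<times> real \<Rightarrow> nat" where
  "crossing_type K c =
     (if odd_crossing K c then 0
      else if odd_crossing (virtualize_odd K) c then 1 else 2)"


section \<open>Short arcs\<close>

definition break_points :: "vdiagram \<Rightarrow> real set" where
  "break_points K = {x. \<exists>(v, u) \<in> crossings K.
     x - u \<in> \<int> \<or> (crossing_type K (v, u) = 0 \<and> x - v \<in> \<int>)}"

text \<open>
  A short arc is represented by the set of all its (interior) parameters, which is
  invariant under integer translations.
\<close>

definition arc_through :: "vdiagram \<Rightarrow> real \<Rightarrow> real set" where
  "arc_through K x = {y. \<exists>k::int. closed_segment (x + of_int k) y \<inter> break_points K = {}}"

definition short_arcs :: "vdiagram \<Rightarrow> real set set" where
  "short_arcs K = arc_through K ` (- break_points K)"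

definition arc_in :: "vdiagram \<Rightarrow> real \<Rightarrow> real set" where
  "arc_in K x = (THE A. A \<in> short_arcs K \<and> (\<forall>\<^sub>F y in at_left x. y \<in> A))"

definition arc_out :: "vdiagram \<Rightarrow> real \<Rightarrow> real set" where
  "arc_out K x = (THE A. A \<in> short_arcs K \<and> (\<forall>\<^sub>F y in at_right x. y \<in> A))"


section \<open>The coefficient ring\<close>

text \<open>
  Elements of \<open>\<int>[t\<^sup>\<plusminus>\<^sup>1, q, p\<^sup>\<plusminus>\<^sup>1, s\<^sup>\<plusminus>\<^sup>1, r\<^sup>\<plusminus>\<^sup>1, w]\<close>
  as finitely supported functions on exponent vectors, listed in this order.
\<close>

type_synonym laurent = "(int \<times> nat \<times> int \<times> int \<times> int \<times> nat) \<Rightarrow>\<^sub>0 int"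

definition t_L :: laurent where "t_L = Poly_Mapping.single (1, 0, 0, 0, 0, 0) 1"
definition q_L :: laurent where "q_L = Poly_Mapping.single (0, 1, 0, 0, 0, 0) 1"
definition p_L :: laurent where "p_L = Poly_Mapping.single (0, 0, 1, 0, 0, 0) 1"
definition s_L :: laurent where "s_L = Poly_Mapping.single (0, 0, 0, 1, 0, 0) 1"
definition s_inv_L :: laurent where "s_inv_L = Poly_Mapping.single (0, 0, 0, -1, 0, 0) 1"
definition r_L :: laurent where "r_L = Poly_Mapping.single (0, 0, 0, 0, 1, 0) 1"
definition r_inv_L :: laurent where "r_inv_L = Poly_Mapping.single (0, 0, 0, 0, -1, 0) 1"
definition w_L :: laurent where "w_L = Poly_Mapping.single (0, 0, 0, 0, 0, 1) 1"

definition laurent_ring :: "laurent ring" where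
  "laurent_ring = \<lparr>carrier = UNIV, mult = (*), one = 1, zero = 0, add = (+)\<rparr>"

definition relation_ideal :: "laurent set" where
  "relation_ideal = Idl\<^bsub>laurent_ring\<^esub>
     {q_L * (p_L - t_L),
      q_L ^ 2 - (1 - t_L) * (1 - p_L),
      w_L * (1 - s_L),
      w_L * (t_L - r_L),
      w_L ^ 2 - (1 - t_L) * (1 - r_L * s_L),
      w_L * (p_L * s_L + q_L - 1),
      w_L * (r_L + q_L - 1),
      w_L * (p_L - r_L),
      w_L ^ 2 - q_L * (1 - r_L * s_L)}"

definition coeff_ring :: "laurent set ring" where
  "coeff_ring = laurent_ring Quot relation_ideal"

definition cls :: "laurent \<Rightarrow> laurent set" where
  "cls f = relation_ideal +>\<^bsub>laurent_ring\<^esub> f"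


section \<open>Modules given by generators and relations\<close>

text \<open>
  The ring operations \<open>mult\<close> and \<open>one\<close> of a module record have no meaning for a module.
\<close>

definition free_module :: "('c, 'd) ring_scheme \<Rightarrow> 'x set \<Rightarrow> ('c, 'x \<Rightarrow> 'c) module" where
  "free_module S X =
     \<lparr>carrier = {f \<in> X \<rightarrow>\<^sub>E carrier S. finite {x \<in> X. f x \<noteq> \<zero>\<^bsub>S\<^esub>}},
      mult = undefined, one = undefined,
      zero = (\<lambda>x\<in>X. \<zero>\<^bsub>S\<^esub>),
      add = (\<lambda>f g. \<lambda>x\<in>X. f x \<oplus>\<^bsub>S\<^esub> g x),
      smult = (\<lambda>c f. \<lambda>x\<in>X. c \<otimes>\<^bsub>S\<^esub> f x)\<rparr>"

definition free_gen :: "('c, 'd) ring_scheme \<Rightarrow> 'x set \<Rightarrow> 'x \<Rightarrow> 'x \<Rightarrow> 'c" where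
  "free_gen S X a = (\<lambda>x\<in>X. if x = a then \<one>\<^bsub>S\<^esub> else \<zero>\<^bsub>S\<^esub>)"

definition submodule_span ::
  "('c, 'd) ring_scheme \<Rightarrow> ('c, 'm, 'e) module_scheme \<Rightarrow> 'm set \<Rightarrow> 'm set" where
  "submodule_span S M Y = \<Inter>{H. submodule H S M \<and> Y \<subseteq> H}"

definition quotient_module :: "('c, 'm, 'e) module_scheme \<Rightarrow> 'm set \<Rightarrow> ('c, 'm set) module" where
  "quotient_module M H =
     \<lparr>carrier = a_rcosets\<^bsub>M\<^esub> H,
      mult = undefined, one = undefined,
      zero = H,
      add = set_add M,
      smult = (\<lambda>c A. \<Union>m\<in>A. H +>\<^bsub>M\<^esub> (c \<odot>\<^bsub>M\<^esub> m))\<rparr>"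

definition module_isomorphic ::
  "('c, 'd) ring_scheme \<Rightarrow> ('c, 'm, 'e) module_scheme \<Rightarrow> ('c, 'n, 'f) module_scheme \<Rightarrow> bool" where
  "module_isomorphic S M M' \<longleftrightarrow>
     (\<exists>\<phi>. bij_betw \<phi> (carrier M) (carrier M') \<and>
          (\<forall>x\<in>carrier M. \<forall>y\<in>carrier M. \<phi> (x \<oplus>\<^bsub>M\<^esub> y) = \<phi> x \<oplus>\<^bsub>M'\<^esub> \<phi> y) \<and>
          (\<forall>c\<in>carrier S. \<forall>x\<in>carrier M. \<phi> (c \<odot>\<^bsub>M\<^esub> x) = c \<odot>\<^bsub>M'\<^esub> \<phi> x))"


section \<open>The module \<open>N(K)\<close> of a diagram\<close>

abbreviation arc_module :: "vdiagram \<Rightarrow> (laurent set, real set \<Rightarrow> laurent set) module" where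
  "arc_module K \<equiv> free_module coeff_ring (short_arcs K)"

text \<open>The element \<open>z - (\<alpha> y + \<beta> x)\<close> for short arcs \<open>x\<close>, \<open>y\<close>, \<open>z\<close>.\<close>

definition relator ::
  "vdiagram \<Rightarrow> real set \<Rightarrow> laurent \<Rightarrow> real set \<Rightarrow> laurent \<Rightarrow> real set \<Rightarrow>
   real set \<Rightarrow> laurent set" where
  "relator K z \<alpha> y \<beta> x =
     (let g = free_gen coeff_ring (short_arcs K) in
      g z \<ominus>\<^bsub>arc_module K\<^esub>
        (cls \<alpha> \<odot>\<^bsub>arc_module K\<^esub> g y \<oplus>\<^bsub>arc_module K\<^esub> cls \<beta> \<odot>\<^bsub>arc_module K\<^esub> g x))"

definition crossing_relators ::
  "vdiagram \<Rightarrow> real \<times> real \<Rightarrow> (real set \<Rightarrow> laurent set) set" where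
  "crossing_relators K c =
     (let (v, u) = c;
          a_in = arc_in K v; a_out = arc_out K v;
          b_in = arc_in K u; b_out = arc_out K u;
          over_arc = arc_through K v;
          right = (if positive K c then b_in else b_out);
          left = (if positive K c then b_out else b_in)
      in if crossing_type K c = 2 then {relator K left t_L right (1 - t_L) over_arc}
         else if crossing_type K c = 1 then {relator K left p_L right q_L over_arc}
         else if positive K c then
           {relator K a_out s_L a_in 0 a_in,
            relator K b_out r_L b_in w_L a_in}
         else
           {relator K a_out s_inv_L a_in 0 a_in,
            relator K b_out r_inv_L b_in (- (r_inv_L * s_inv_L * w_L)) a_in})"

definition knot_module :: "vdiagram \<Rightarrow> (laurent set, (real set \<Rightarrow> laurent set) set) module" where
  "knot_module K = quotient_module (arc_module K)
     (submodule_span coeff_ring (arc_module K) (\<Union>c\<in>crossings K. crossing_relators K c))"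


section \<open>The modules are well-defined\<close>

lemma cring_laurent_ring: "cring laurent_ring"
proof (rule cringI)
  show "abelian_group laurent_ring"
  proof (rule abelian_groupI)
    fix x :: laurent
    show "\<exists>y\<in>carrier laurent_ring. y \<oplus>\<^bsub>laurent_ring\<^esub> x = \<zero>\<^bsub>laurent_ring\<^esub>"
      by (rule bexI[of _ "- x"]) (simp_all add: laurent_ring_def)
  qed (simp_all add: laurent_ring_def algebra_simps)
  show "comm_monoid laurent_ring"
    by (rule comm_monoidI) (simp_all add: laurent_ring_def algebra_simps)
qed (simp add: laurent_ring_def algebra_simps)

lemma ideal_relation_ideal: "ideal relation_ideal laurent_ring"
proof -
  interpret cring laurent_ring by (rule cring_laurent_ring)
  show ?thesis
    unfolding relation_ideal_def by (rule genideal_ideal) (simp add: laurent_ring_def)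
qed

lemma cring_coeff_ring: "cring coeff_ring"
  unfolding coeff_ring_def
  using ideal.quotient_is_cring[OF ideal_relation_ideal cring_laurent_ring] .

lemma cls_hom: "cls \<in> ring_hom laurent_ring coeff_ring"
  unfolding coeff_ring_def cls_def[abs_def]
  by (rule ideal.rcos_ring_hom[OF ideal_relation_ideal])

lemma module_free_module:
  assumes "cring S"
  shows "Module.module S (free_module S X)"
proof -
  interpret cring S by fact
  have mem: "(\<lambda>x\<in>X. F x) \<in> carrier (free_module S X)"
    if "f \<in> carrier (free_module S X)" "g \<in> carrier (free_module S X)"
       "\<And>x. x \<in> X \<Longrightarrow> F x \<in> carrier S"
       "\<And>x. x \<in> X \<Longrightarrow> f x = \<zero>\<^bsub>S\<^esub> \<Longrightarrow> g x = \<zero>\<^bsub>S\<^esub> \<Longrightarrow> F x = \<zero>\<^bsub>S\<^esub>" for f g F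
  proof -
    have "finite {x \<in> X. f x \<noteq> \<zero>\<^bsub>S\<^esub>}" "finite {x \<in> X. g x \<noteq> \<zero>\<^bsub>S\<^esub>}"
      using that(1,2) by (auto simp: free_module_def)
    then have "finite ({x \<in> X. f x \<noteq> \<zero>\<^bsub>S\<^esub>} \<union> {x \<in> X. g x \<noteq> \<zero>\<^bsub>S\<^esub>})" by blast
    moreover have "{x \<in> X. (\<lambda>x\<in>X. F x) x \<noteq> \<zero>\<^bsub>S\<^esub>} \<subseteq>
        {x \<in> X. f x \<noteq> \<zero>\<^bsub>S\<^esub>} \<union> {x \<in> X. g x \<noteq> \<zero>\<^bsub>S\<^esub>}"
      using that(4) by auto
    ultimately have "finite {x \<in> X. (\<lambda>x\<in>X. F x) x \<noteq> \<zero>\<^bsub>S\<^esub>}" by (rule rev_finite_subset)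
    then show ?thesis using that(3) by (simp add: free_module_def)
  qed
  have val: "f x \<in> carrier S" if "f \<in> carrier (free_module S X)" "x \<in> X" for f x
    using that by (auto simp: free_module_def)
  show ?thesis
  proof (rule moduleI)
    show "abelian_group (free_module S X)"
    proof (rule abelian_groupI)
      fix f assume f: "f \<in> carrier (free_module S X)"
      show "\<exists>g\<in>carrier (free_module S X).
              g \<oplus>\<^bsub>free_module S X\<^esub> f = \<zero>\<^bsub>free_module S X\<^esub>"
      proof
        show "(\<lambda>x\<in>X. \<ominus>\<^bsub>S\<^esub> f x) \<in> carrier (free_module S X)"
          using f by (intro mem[of f f]) (auto simp: val)
        show "(\<lambda>x\<in>X. \<ominus>\<^bsub>S\<^esub> f x) \<oplus>\<^bsub>free_module S X\<^esub> f = \<zero>\<^bsub>free_module S X\<^esub>"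
          using f val[OF f] by (auto simp: free_module_def l_neg intro!: restrict_ext)
      qed
    next
      fix f g assume "f \<in> carrier (free_module S X)" "g \<in> carrier (free_module S X)"
      then have "(\<lambda>x\<in>X. f x \<oplus>\<^bsub>S\<^esub> g x) \<in> carrier (free_module S X)"
        by (intro mem[of f g]) (auto simp: val)
      then show "f \<oplus>\<^bsub>free_module S X\<^esub> g \<in> carrier (free_module S X)"
        by (simp add: free_module_def)
      show "f \<oplus>\<^bsub>free_module S X\<^esub> g = g \<oplus>\<^bsub>free_module S X\<^esub> f"
        using \<open>f \<in> _\<close> \<open>g \<in> _\<close>
        by (auto simp: free_module_def a_comm PiE_iff intro!: restrict_ext)
    next
      fix f g h assume "f \<in> carrier (free_module S X)" "g \<in> carrier (free_module S X)"
        "h \<in> carrier (free_module S X)"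
      then show "f \<oplus>\<^bsub>free_module S X\<^esub> g \<oplus>\<^bsub>free_module S X\<^esub> h =
          f \<oplus>\<^bsub>free_module S X\<^esub> (g \<oplus>\<^bsub>free_module S X\<^esub> h)"
        by (auto simp: free_module_def a_assoc PiE_iff intro!: restrict_ext)
    next
      fix f assume "f \<in> carrier (free_module S X)"
      then show "\<zero>\<^bsub>free_module S X\<^esub> \<oplus>\<^bsub>free_module S X\<^esub> f = f"
        by (auto simp: free_module_def PiE_def Pi_iff extensional_def restrict_def fun_eq_iff)
    qed (auto simp: free_module_def)
  next
    fix c f assume "c \<in> carrier S" "f \<in> carrier (free_module S X)"
    then have "(\<lambda>x\<in>X. c \<otimes>\<^bsub>S\<^esub> f x) \<in> carrier (free_module S X)"
      by (intro mem[of f f]) (auto simp: val)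
    then show "c \<odot>\<^bsub>free_module S X\<^esub> f \<in> carrier (free_module S X)"
      by (simp add: free_module_def)
  next
    fix f assume "f \<in> carrier (free_module S X)"
    then show "\<one>\<^bsub>S\<^esub> \<odot>\<^bsub>free_module S X\<^esub> f = f"
      by (auto simp: free_module_def PiE_def Pi_iff extensional_def restrict_def fun_eq_iff)
  qed (auto simp: free_module_def l_distr r_distr m_assoc PiE_iff assms intro!: restrict_ext)
qed

lemma submodule_submodule_span:
  assumes "Module.module S M" "Y \<subseteq> carrier M"
  shows "submodule (submodule_span S M Y) S M"
proof -
  interpret Module.module S M by fact
  have *: "carrier M \<in> {H. submodule H S M \<and> Y \<subseteq> H}"
    using carrier_is_submodule assms(2) by blast
  show ?thesis
    unfolding submodule_span_def
  proof (rule submoduleI)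
    show "\<Inter> {H. submodule H S M \<and> Y \<subseteq> H} \<subseteq> carrier M" using * by blast
    show "\<zero>\<^bsub>M\<^esub> \<in> \<Inter> {H. submodule H S M \<and> Y \<subseteq> H}"
      using subgroup.one_closed[OF submodule.axioms(1)] by fastforce
  qed (use submoduleE in \<open>auto 0 3\<close>)
qed

lemma module_quotient_module:
  assumes "Module.module S M" "submodule H S M"
  shows "Module.module S (quotient_module M H)"
proof -
  interpret Module.module S M by fact
  interpret H: abelian_subgroup H M
    by (rule abelian_subgroupI3)
       (use assms(2) in \<open>auto simp: additive_subgroup_def submodule_def M.abelian_group_axioms\<close>)
  interpret Q: abelian_group "quotient_module M H"
  proof (rule abelian_groupI)
    show "\<zero>\<^bsub>quotient_module M H\<^esub> \<in> carrier (quotient_module M H)"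
      using H.a_rcosets_carrier H.a_subgroup_in_rcosets by (simp add: quotient_module_def)
  next
    fix A B assume "A \<in> carrier (quotient_module M H)" "B \<in> carrier (quotient_module M H)"
    then show "A \<oplus>\<^bsub>quotient_module M H\<^esub> B \<in> carrier (quotient_module M H)"
      and "A \<oplus>\<^bsub>quotient_module M H\<^esub> B = B \<oplus>\<^bsub>quotient_module M H\<^esub> A"
      by (auto simp: quotient_module_def A_RCOSETS_def' H.a_rcos_sum M.a_comm)
  next
    fix A B C assume "A \<in> carrier (quotient_module M H)" "B \<in> carrier (quotient_module M H)"
      "C \<in> carrier (quotient_module M H)"
    then show "A \<oplus>\<^bsub>quotient_module M H\<^esub> B \<oplus>\<^bsub>quotient_module M H\<^esub> C =
        A \<oplus>\<^bsub>quotient_module M H\<^esub> (B \<oplus>\<^bsub>quotient_module M H\<^esub> C)"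
      by (auto simp: quotient_module_def A_RCOSETS_def' H.a_rcos_sum M.a_assoc)
  next
    fix A assume "A \<in> carrier (quotient_module M H)"
    then show "\<zero>\<^bsub>quotient_module M H\<^esub> \<oplus>\<^bsub>quotient_module M H\<^esub> A = A"
      by (simp add: quotient_module_def H.rcosets_add_eq)
  next
    fix A assume "A \<in> carrier (quotient_module M H)"
    then obtain x where x: "x \<in> carrier M" "A = H +>\<^bsub>M\<^esub> x"
      by (auto simp: quotient_module_def A_RCOSETS_def')
    show "\<exists>B\<in>carrier (quotient_module M H).
        B \<oplus>\<^bsub>quotient_module M H\<^esub> A = \<zero>\<^bsub>quotient_module M H\<^esub>"
      by (rule bexI[of _ "H +>\<^bsub>M\<^esub> (\<ominus>\<^bsub>M\<^esub> x)"])
         (use x in \<open>auto simp: quotient_module_def A_RCOSETS_def' H.a_rcos_sum M.l_neg H.a_rcos_const\<close>)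
  qed
  have sm: "(\<Union>m\<in>H +>\<^bsub>M\<^esub> x. H +>\<^bsub>M\<^esub> (c \<odot>\<^bsub>M\<^esub> m)) = H +>\<^bsub>M\<^esub> (c \<odot>\<^bsub>M\<^esub> x)"
    if "c \<in> carrier S" "x \<in> carrier M" for c x
  proof -
    have "H +>\<^bsub>M\<^esub> (c \<odot>\<^bsub>M\<^esub> m) = H +>\<^bsub>M\<^esub> (c \<odot>\<^bsub>M\<^esub> x)" if m: "m \<in> H +>\<^bsub>M\<^esub> x" for m
    proof -
      obtain h where h: "h \<in> H" "m = h \<oplus>\<^bsub>M\<^esub> x" using m by (auto simp: a_r_coset_def')
      have hc: "h \<in> carrier M" "c \<odot>\<^bsub>M\<^esub> h \<in> H"
        using h submoduleE[OF assms(2)] \<open>c \<in> _\<close> by auto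
      have "c \<odot>\<^bsub>M\<^esub> m = c \<odot>\<^bsub>M\<^esub> h \<oplus>\<^bsub>M\<^esub> c \<odot>\<^bsub>M\<^esub> x"
        using h hc that \<open>c \<in> _\<close> \<open>x \<in> _\<close> by (simp add: smult_r_distr)
      then have "c \<odot>\<^bsub>M\<^esub> m \<in> H +>\<^bsub>M\<^esub> (c \<odot>\<^bsub>M\<^esub> x)"
        using hc by (auto simp: a_r_coset_def')
      then show ?thesis
        using M.a_repr_independence'[OF _ _ H.a_subgroup, folded a_r_coset_def] \<open>c \<in> _\<close> \<open>x \<in> _\<close>
        by (metis smult_closed)
    qed
    moreover have "x \<in> H +>\<^bsub>M\<^esub> x" using H.a_rcos_self that by blast
    ultimately show ?thesis by blast
  qed
  have smQ: "c \<odot>\<^bsub>quotient_module M H\<^esub> (H +>\<^bsub>M\<^esub> x) = H +>\<^bsub>M\<^esub> (c \<odot>\<^bsub>M\<^esub> x)"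
    if "c \<in> carrier S" "x \<in> carrier M" for c x
    using sm[OF that] by (simp add: quotient_module_def)
  have addQ: "(H +>\<^bsub>M\<^esub> x) \<oplus>\<^bsub>quotient_module M H\<^esub> (H +>\<^bsub>M\<^esub> y) = H +>\<^bsub>M\<^esub> (x \<oplus>\<^bsub>M\<^esub> y)"
    if "x \<in> carrier M" "y \<in> carrier M" for x y
    using H.a_rcos_sum[OF that] by (simp add: quotient_module_def)
  have rep: "A \<in> carrier (quotient_module M H) \<longleftrightarrow> (\<exists>x\<in>carrier M. A = H +>\<^bsub>M\<^esub> x)" for A
    by (auto simp: quotient_module_def A_RCOSETS_def')
  show ?thesis
  proof (rule moduleI)
    show "cring S" by (rule R.is_cring)
    show "abelian_group (quotient_module M H)" by (rule Q.abelian_group_axioms)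
  next
    fix c A assume c: "c \<in> carrier S" and "A \<in> carrier (quotient_module M H)"
    then obtain x where "x \<in> carrier M" "A = H +>\<^bsub>M\<^esub> x" using rep by blast
    then show "c \<odot>\<^bsub>quotient_module M H\<^esub> A \<in> carrier (quotient_module M H)"
      unfolding rep using c smQ smult_closed by blast
  qed (auto simp: rep smQ addQ smult_l_distr smult_r_distr smult_assoc1)
qed

lemma free_gen_closed:
  assumes "cring S"
  shows "free_gen S X a \<in> carrier (free_module S X)"
proof -
  interpret cring S by fact
  have "{x \<in> X. free_gen S X a x \<noteq> \<zero>\<^bsub>S\<^esub>} \<subseteq> {a}" by (auto simp: free_gen_def)
  then have "finite {x \<in> X. free_gen S X a x \<noteq> \<zero>\<^bsub>S\<^esub>}" by (rule finite_subset) simp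
  then show ?thesis by (auto simp: free_module_def free_gen_def)
qed

lemma module_knot_module: "Module.module coeff_ring (knot_module K)"
proof -
  interpret M: Module.module coeff_ring "arc_module K"
    by (intro module_free_module cring_coeff_ring)
  have "cls f \<in> carrier coeff_ring" for f
    using ring_hom_closed[OF cls_hom] by (simp add: laurent_ring_def)
  then have "relator K z \<alpha> y \<beta> x \<in> carrier (arc_module K)" for z \<alpha> y \<beta> x
    by (simp add: relator_def Let_def free_gen_closed cring_coeff_ring)
  then have "(\<Union>c\<in>crossings K. crossing_relators K c) \<subseteq> carrier (arc_module K)"
    by (auto simp: crossing_relators_def Let_def split: if_splits)
  then show ?thesis
    unfolding knot_module_def
    by (intro module_quotient_module submodule_submodule_span M.module_axioms)
qed

end

theory Submission
  imports Defs
begin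

text \<open>
  A coloring of a diagram with values in a module \<open>M\<close> is a locally constant function on the
  parameters that satisfies the relations of \<open>N(K)\<close> at the crossings. Colorings correspond to
  module homomorphisms from \<open>N(K)\<close> to \<open>M\<close>, so by the Yoneda argument it suffices to extend
  colorings, uniquely and with the same values outside, over every move. Reparametrizations,
  isotopies and detours preserve the chord diagram with its signs. A Reidemeister move keeps all
  other types of crossings, since an isolated chord and two parallel chords do not change any
  parity, and in the third move every chord outside meets the triangle in an even number of chords.
  The third move allows only few combinations of types, and the relations of \<open>J\<close> are exactly
  what is needed to extend colorings over these.
\<close>

section \<open>Linear algebra over the coefficient ring\<close>

text \<open>A move splits, merges and shifts short arcs, so there is no natural map between the
  generators of \<open>N(K)\<close> and \<open>N(K')\<close>. Colorings do transfer: outside the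
  changed part they are kept, inside they are recomputed from the values at the ends of the strands.
  Only colorings with values in \<open>N(K)\<close> and \<open>N(K')\<close> themselves are needed,
  and these modules have one type, so the quantification over target modules can stay within that
  type. The relations at a negative crossing of type 0 are the positive ones read backwards. In
  terms of left and right the sign disappears, and one relation whose coefficients depend on the
  type covers every crossing. The first two moves then need only that \<open>t\<close>,
  \<open>p\<close>, \<open>s\<close>, \<open>r\<close> are units and that
  \<open>t + (1 - t) = 1\<close>. In the third move the colours of the three edges of the triangle
  determine all others; consistency of the relations before and after the move amounts to three
  identities between coefficients, and evaluated at the ten possible triples of types these
  identities produce the generators of \<open>J\<close>.\<close>

lemma cls_eqI:
  assumes "f - g \<in> relation_ideal"
  shows "cls f = cls g"
proof -
  interpret ideal relation_ideal laurent_ring by (rule ideal_relation_ideal)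
  have "f = (f - g) \<oplus>\<^bsub>laurent_ring\<^esub> g" by (simp add: laurent_ring_def)
  then have "f \<in> relation_ideal +>\<^bsub>laurent_ring\<^esub> g"
    using assms unfolding a_r_coset_def' by blast
  then show ?thesis
    unfolding cls_def using a_repr_independence'[of f g] by (simp add: laurent_ring_def)
qed

definition mod_hom ::
  "(laurent set, 'm, 'e) module_scheme \<Rightarrow> (laurent set, 'n, 'f) module_scheme \<Rightarrow> ('m \<Rightarrow> 'n) \<Rightarrow> bool"
where
  "mod_hom M N \<phi> \<longleftrightarrow>
     \<phi> \<in> carrier M \<rightarrow> carrier N \<and>
     (\<forall>x\<in>carrier M. \<forall>y\<in>carrier M. \<phi> (x \<oplus>\<^bsub>M\<^esub> y) = \<phi> x \<oplus>\<^bsub>N\<^esub> \<phi> y) \<and>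
     (\<forall>c\<in>carrier coeff_ring. \<forall>x\<in>carrier M. \<phi> (c \<odot>\<^bsub>M\<^esub> x) = c \<odot>\<^bsub>N\<^esub> \<phi> x)"

lemma mod_hom_comp: "mod_hom M N \<phi> \<Longrightarrow> mod_hom N P \<psi> \<Longrightarrow> mod_hom M P (\<psi> \<circ> \<phi>)"
  unfolding mod_hom_def by (auto simp: Pi_iff)

lemma mod_hom_id: "mod_hom M M id"
  unfolding mod_hom_def by auto

text \<open>Scalars are Laurent polynomials instead of their cosets, so that coefficients are
  handled by ordinary ring arithmetic; congruence modulo \<open>relation_ideal\<close> enters only
  through \<open>act_cong\<close>.\<close>

definition act :: "(laurent set, 'm, 'e) module_scheme \<Rightarrow> laurent \<Rightarrow> 'm \<Rightarrow> 'm" where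
  "act M f m = cls f \<odot>\<^bsub>M\<^esub> m"

lemma cls_closed [simp]: "cls f \<in> carrier coeff_ring"
  using ring_hom_closed[OF cls_hom] by (simp add: laurent_ring_def)

lemma cls_add: "cls (f + g) = cls f \<oplus>\<^bsub>coeff_ring\<^esub> cls g"
  using ring_hom_add[OF cls_hom, of f g] by (simp add: laurent_ring_def)

lemma cls_mult: "cls (f * g) = cls f \<otimes>\<^bsub>coeff_ring\<^esub> cls g"
  using ring_hom_mult[OF cls_hom, of f g] by (simp add: laurent_ring_def)

lemma cls_one: "cls 1 = \<one>\<^bsub>coeff_ring\<^esub>"
  using ring_hom_one[OF cls_hom] by (simp add: laurent_ring_def)

lemma cls_zero: "cls 0 = \<zero>\<^bsub>coeff_ring\<^esub>"
proof -
  interpret cring coeff_ring by (rule cring_coeff_ring)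
  have "cls 0 \<oplus>\<^bsub>coeff_ring\<^esub> cls 0 = cls 0" using cls_add[of 0 0] by simp
  then show ?thesis by (metis cls_closed add.r_cancel_one)
qed

lemma mod_hom_act: "mod_hom M N \<phi> \<Longrightarrow> x \<in> carrier M \<Longrightarrow> \<phi> (act M f x) = act N f (\<phi> x)"
  by (simp add: mod_hom_def act_def)

locale coeff_module = Module.module coeff_ring M for M (structure)
begin

lemma act_closed [simp]: "x \<in> carrier M \<Longrightarrow> act M f x \<in> carrier M"
  by (simp add: act_def)

lemma act_add: "x \<in> carrier M \<Longrightarrow> act M (f + g) x = act M f x \<oplus> act M g x"
  by (simp add: act_def cls_add smult_l_distr)

lemma act_mult: "x \<in> carrier M \<Longrightarrow> act M (f * g) x = act M f (act M g x)"
  by (simp add: act_def cls_mult smult_assoc1)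

lemma act_act: "x \<in> carrier M \<Longrightarrow> act M f (act M g x) = act M (f * g) x"
  by (simp add: act_mult)

lemma act_one [simp]: "x \<in> carrier M \<Longrightarrow> act M 1 x = x"
  by (simp add: act_def cls_one)

lemma act_zero [simp]: "x \<in> carrier M \<Longrightarrow> act M 0 x = \<zero>"
  by (simp add: act_def cls_zero)

lemma act_zero_right [simp]: "act M f \<zero> = \<zero>"
  by (simp add: act_def)

lemma act_distr: "x \<in> carrier M \<Longrightarrow> y \<in> carrier M \<Longrightarrow> act M f (x \<oplus> y) = act M f x \<oplus> act M f y"
  by (simp add: act_def smult_r_distr)

lemma act_cong: "f - g \<in> relation_ideal \<Longrightarrow> act M f x = act M g x"
  by (simp add: act_def cls_eqI)

lemma act_minus: "x \<in> carrier M \<Longrightarrow> act M (- f) x = \<ominus> act M f x"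
  by (rule minus_equality[symmetric]) (simp_all add: act_add[symmetric])

lemma act_cancel:
  assumes "f * g = 1" "x \<in> carrier M" "y \<in> carrier M" "act M f x = act M f y"
  shows "x = y"
proof -
  have "g * f = 1" using assms(1) by (simp add: mult.commute)
  then have "z = act M g (act M f z)" if "z \<in> carrier M" for z
    using that by (simp add: act_act)
  then show ?thesis using assms by metis
qed

end

lemma coeff_module_free: "coeff_module (free_module coeff_ring X)"
  unfolding coeff_module_def by (rule module_free_module[OF cring_coeff_ring])

lemma coeff_module_knot: "coeff_module (knot_module K)"
  unfolding coeff_module_def by (rule module_knot_module)

lemma mod_hom_zero:
  assumes "coeff_module M" "coeff_module N" "mod_hom M N \<phi>"
  shows "\<phi> \<zero>\<^bsub>M\<^esub> = \<zero>\<^bsub>N\<^esub>"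
proof -
  interpret M: coeff_module M by fact
  interpret N: coeff_module N by fact
  have "\<phi> (act M 0 \<zero>\<^bsub>M\<^esub>) = act N 0 (\<phi> \<zero>\<^bsub>M\<^esub>)" using assms(3) by (rule mod_hom_act) simp
  then show ?thesis using assms(3) by (simp add: mod_hom_def Pi_iff)
qed

lemma mod_hom_minus:
  assumes "coeff_module M" "coeff_module N" "mod_hom M N \<phi>" "x \<in> carrier M" "y \<in> carrier M"
  shows "\<phi> (x \<ominus>\<^bsub>M\<^esub> y) = \<phi> x \<ominus>\<^bsub>N\<^esub> \<phi> y"
proof -
  interpret M: coeff_module M by fact
  interpret N: coeff_module N by fact
  have [simp]: "\<phi> x \<in> carrier N" "\<phi> y \<in> carrier N" using assms by (auto simp: mod_hom_def)
  have "\<phi> (x \<oplus>\<^bsub>M\<^esub> act M (-1) y) = \<phi> x \<oplus>\<^bsub>N\<^esub> act N (-1) (\<phi> y)"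
    using assms by (simp add: mod_hom_act[symmetric] mod_hom_def)
  then show ?thesis using assms by (simp add: M.act_minus N.act_minus a_minus_def)
qed

subsection \<open>Universal properties\<close>

lemma (in coeff_module) free_module_universal:
  assumes g: "g \<in> X \<rightarrow> carrier M"
  shows "\<exists>F. mod_hom (free_module coeff_ring X) M F \<and>
             (\<forall>a\<in>X. F (free_gen coeff_ring X a) = g a)"
proof -
  interpret A: coeff_module "free_module coeff_ring X" by (rule coeff_module_free)
  define F where "F f = (\<Oplus>x\<in>{x\<in>X. f x \<noteq> \<zero>\<^bsub>coeff_ring\<^esub>}. f x \<odot> g x)" for f
  \<comment> \<open>Different functions have different supports. Any finite set containing the
    support gives the same sum, so sums for \<open>f\<close>, \<open>h\<close> and
    \<open>f + h\<close> can be compared over one index set.\<close>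
  have F_eq: "F f = (\<Oplus>x\<in>T. f x \<odot> g x)"
    if "finite T" "T \<subseteq> X" "{x\<in>X. f x \<noteq> \<zero>\<^bsub>coeff_ring\<^esub>} \<subseteq> T" "f \<in> X \<rightarrow> carrier coeff_ring" for f T
    unfolding F_def
    by (rule add.finprod_mono_neutral_cong_left) (use that g in \<open>auto simp: Pi_iff subset_iff\<close>)
  have mem: "f \<in> X \<rightarrow> carrier coeff_ring \<and> finite {x\<in>X. f x \<noteq> \<zero>\<^bsub>coeff_ring\<^esub>}"
    if "f \<in> carrier (free_module coeff_ring X)" for f
    using that by (auto simp: free_module_def)
  have "mod_hom (free_module coeff_ring X) M F"
    unfolding mod_hom_def
  proof (intro conjI ballI)
    show "F \<in> carrier (free_module coeff_ring X) \<rightarrow> carrier M"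
      using mem g by (auto simp: F_def Pi_iff)
  next
    fix f h assume fh: "f \<in> carrier (free_module coeff_ring X)" "h \<in> carrier (free_module coeff_ring X)"
    let ?T = "{x\<in>X. f x \<noteq> \<zero>\<^bsub>coeff_ring\<^esub>} \<union> {x\<in>X. h x \<noteq> \<zero>\<^bsub>coeff_ring\<^esub>}"
    let ?s = "f \<oplus>\<^bsub>free_module coeff_ring X\<^esub> h"
    have s: "?s x = f x \<oplus>\<^bsub>coeff_ring\<^esub> h x" if "x \<in> X" for x
      using that by (simp add: free_module_def)
    have T: "finite ?T" "?T \<subseteq> X" using mem fh by auto
    have "?s \<in> carrier (free_module coeff_ring X)" using fh by simp
    have "F ?s = (\<Oplus>x\<in>?T. ?s x \<odot> g x)"
      by (rule F_eq[OF T]) (use s mem[OF \<open>?s \<in> _\<close>] in auto)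
    also have "\<dots> = (\<Oplus>x\<in>?T. f x \<odot> g x \<oplus> h x \<odot> g x)"
      by (rule add.finprod_cong) (use s mem fh g in \<open>auto simp: smult_l_distr simp_implies_def Pi_iff\<close>)
    also have "\<dots> = (\<Oplus>x\<in>?T. f x \<odot> g x) \<oplus> (\<Oplus>x\<in>?T. h x \<odot> g x)"
      by (rule add.finprod_multf) (use mem fh g in \<open>auto simp: Pi_iff\<close>)
    also have "\<dots> = F f \<oplus> F h"
      using F_eq[OF T, of f] F_eq[OF T, of h] mem fh by auto
    finally show "F ?s = F f \<oplus> F h" .
  next
    fix c f assume c: "c \<in> carrier coeff_ring" and f: "f \<in> carrier (free_module coeff_ring X)"
    let ?T = "{x\<in>X. f x \<noteq> \<zero>\<^bsub>coeff_ring\<^esub>}"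
    let ?s = "c \<odot>\<^bsub>free_module coeff_ring X\<^esub> f"
    have s: "?s x = c \<otimes>\<^bsub>coeff_ring\<^esub> f x" if "x \<in> X" for x
      using that by (simp add: free_module_def)
    have T: "finite ?T" "?T \<subseteq> X" using mem f by auto
    have "?s \<in> carrier (free_module coeff_ring X)" using f c by simp
    have "F ?s = (\<Oplus>x\<in>?T. ?s x \<odot> g x)"
      by (rule F_eq[OF T]) (use s c mem[OF \<open>?s \<in> _\<close>] in auto)
    also have "\<dots> = (\<Oplus>x\<in>?T. c \<odot> (f x \<odot> g x))"
      by (rule add.finprod_cong) (use s mem f g c in \<open>auto simp: smult_assoc1 simp_implies_def Pi_iff\<close>)
    also have "\<dots> = c \<odot> F f"
      unfolding F_def by (rule finsum_smult_ldistr[symmetric]) (use T mem f g c in \<open>auto simp: Pi_iff\<close>)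
    finally show "F ?s = c \<odot> F f" .
  qed
  moreover have "F (free_gen coeff_ring X a) = g a" if "a \<in> X" for a
  proof -
    have "F (free_gen coeff_ring X a) = (\<Oplus>x\<in>{a}. free_gen coeff_ring X a x \<odot> g x)"
      by (rule F_eq) (use that in \<open>auto simp: free_gen_def\<close>)
    also have "\<dots> = g a" using that g by (auto simp: free_gen_def Pi_iff)
    finally show ?thesis .
  qed
  ultimately show ?thesis by blast
qed

text \<open>Induction on a finite set that contains the support: \<open>f\<close> is the sum of a
  function vanishing at \<open>a\<close> and a multiple of the generator \<open>a\<close>.\<close>

lemma free_module_hom_eq:
  assumes "coeff_module M" "mod_hom (free_module coeff_ring X) M F" "mod_hom (free_module coeff_ring X) M G"
    and gen: "\<And>a. a \<in> X \<Longrightarrow> F (free_gen coeff_ring X a) = G (free_gen coeff_ring X a)"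
    and "f \<in> carrier (free_module coeff_ring X)"
  shows "F f = G f"
proof -
  let ?A = "free_module coeff_ring X"
  interpret M: coeff_module M by fact
  interpret A: coeff_module ?A by (rule coeff_module_free)
  have *: "F f = G f" if "finite T" "f \<in> carrier ?A" "{x\<in>X. f x \<noteq> \<zero>\<^bsub>coeff_ring\<^esub>} \<subseteq> T" for T f
    using that
  proof (induction T arbitrary: f rule: finite_induct)
    case empty
    then have "f = \<zero>\<^bsub>?A\<^esub>"
      by (auto simp: free_module_def PiE_def extensional_def fun_eq_iff)
    then show ?case
      using mod_hom_zero[OF coeff_module_free assms(1,2)] mod_hom_zero[OF coeff_module_free assms(1,3)]
      by simp
  next
    case (insert a T)
    show ?case
    proof (cases "a \<in> X")
      case False
      then show ?thesis using insert by (intro insert.IH) auto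
    next
      case True
      define h where "h = (\<lambda>x\<in>X. if x = a then \<zero>\<^bsub>coeff_ring\<^esub> else f x)"
      have "{x \<in> X. h x \<noteq> \<zero>\<^bsub>coeff_ring\<^esub>} \<subseteq> {x \<in> X. f x \<noteq> \<zero>\<^bsub>coeff_ring\<^esub>}"
        by (auto simp: h_def)
      moreover have "finite {x \<in> X. f x \<noteq> \<zero>\<^bsub>coeff_ring\<^esub>}"
        using insert.prems(1) by (simp add: free_module_def)
      ultimately have "finite {x \<in> X. h x \<noteq> \<zero>\<^bsub>coeff_ring\<^esub>}" by (rule finite_subset)
      moreover have "h \<in> X \<rightarrow>\<^sub>E carrier coeff_ring"
        using insert.prems(1) by (auto simp: free_module_def h_def)
      ultimately have h: "h \<in> carrier ?A" by (simp add: free_module_def)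
      have fa: "f a \<in> carrier coeff_ring" using insert.prems(1) True by (auto simp: free_module_def)
      have "f x = (h \<oplus>\<^bsub>?A\<^esub> f a \<odot>\<^bsub>?A\<^esub> free_gen coeff_ring X a) x" for x
        using insert.prems(1) True
        by (auto simp: free_module_def h_def free_gen_def PiE_iff extensional_def)
      then have f: "f = h \<oplus>\<^bsub>?A\<^esub> f a \<odot>\<^bsub>?A\<^esub> free_gen coeff_ring X a" ..
      have "F h = G h"
        by (rule insert.IH[OF h]) (use insert.prems in \<open>auto simp: h_def\<close>)
      moreover have *: "H f = H h \<oplus>\<^bsub>M\<^esub> f a \<odot>\<^bsub>M\<^esub> H (free_gen coeff_ring X a)" if "mod_hom ?A M H" for H
        using that h fa free_gen_closed[OF cring_coeff_ring, of X a] unfolding mod_hom_def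
        by (subst f) auto
      ultimately show ?thesis using *[OF assms(2)] *[OF assms(3)] gen[OF True] by simp
    qed
  qed
  have "finite {x\<in>X. f x \<noteq> \<zero>\<^bsub>coeff_ring\<^esub>}"
    using assms(5) by (simp add: free_module_def)
  then show ?thesis using assms(5) by (rule *) (rule subset_refl)
qed

lemma quotient_module_universal:
  assumes M: "coeff_module M" and N: "coeff_module N" and H: "submodule H coeff_ring M"
    and F: "mod_hom M N F" and ker: "\<And>x. x \<in> H \<Longrightarrow> F x = \<zero>\<^bsub>N\<^esub>"
  shows "\<exists>\<phi>. mod_hom (quotient_module M H) N \<phi> \<and> (\<forall>x\<in>carrier M. \<phi> (H +>\<^bsub>M\<^esub> x) = F x)"
proof -
  interpret M: coeff_module M by fact
  interpret N: coeff_module N by fact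
  interpret H: abelian_subgroup H M
    by (rule abelian_subgroupI3)
       (use H in \<open>auto simp: additive_subgroup_def submodule_def M.abelian_group_axioms\<close>)
  define \<phi> where "\<phi> A = F (SOME x. x \<in> A)" for A
  have \<phi>: "\<phi> (H +>\<^bsub>M\<^esub> x) = F x" if x: "x \<in> carrier M" for x
  proof -
    have "x \<in> H +>\<^bsub>M\<^esub> x" using H.a_rcos_self x by blast
    then have "(SOME y. y \<in> H +>\<^bsub>M\<^esub> x) \<in> H +>\<^bsub>M\<^esub> x" by (rule someI)
    then obtain h where h: "h \<in> H" "(SOME y. y \<in> H +>\<^bsub>M\<^esub> x) = h \<oplus>\<^bsub>M\<^esub> x"
      by (auto simp: a_r_coset_def')
    have "h \<in> carrier M" using h H.a_subset by auto
    then show ?thesis using h ker F x by (simp add: \<phi>_def mod_hom_def Pi_iff)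
  qed
  have rep: "A \<in> carrier (quotient_module M H) \<longleftrightarrow> (\<exists>x\<in>carrier M. A = H +>\<^bsub>M\<^esub> x)" for A
    by (auto simp: quotient_module_def A_RCOSETS_def')
  have add: "(H +>\<^bsub>M\<^esub> x) \<oplus>\<^bsub>quotient_module M H\<^esub> (H +>\<^bsub>M\<^esub> y) = H +>\<^bsub>M\<^esub> (x \<oplus>\<^bsub>M\<^esub> y)"
    if "x \<in> carrier M" "y \<in> carrier M" for x y
    using H.a_rcos_sum[OF that] by (simp add: quotient_module_def)
  have "mod_hom (quotient_module M H) N \<phi>"
    unfolding mod_hom_def
  proof (intro conjI ballI)
    show "\<phi> \<in> carrier (quotient_module M H) \<rightarrow> carrier N"
      using F \<phi> by (auto simp: rep mod_hom_def Pi_iff)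
  next
    fix A B assume "A \<in> carrier (quotient_module M H)" "B \<in> carrier (quotient_module M H)"
    then show "\<phi> (A \<oplus>\<^bsub>quotient_module M H\<^esub> B) = \<phi> A \<oplus>\<^bsub>N\<^esub> \<phi> B"
      using F by (auto simp: rep add \<phi> mod_hom_def)
  next
    fix c A assume c: "c \<in> carrier coeff_ring" and "A \<in> carrier (quotient_module M H)"
    then obtain x where x: "x \<in> carrier M" "A = H +>\<^bsub>M\<^esub> x" using rep by blast
    interpret Q: Module.module coeff_ring "quotient_module M H"
      by (rule module_quotient_module[OF _ H]) (rule M.module_axioms)
    have "c \<odot>\<^bsub>quotient_module M H\<^esub> A \<in> carrier (quotient_module M H)"
      using c \<open>A \<in> _\<close> by (rule Q.smult_closed)
    then obtain z where z: "z \<in> carrier M" "c \<odot>\<^bsub>quotient_module M H\<^esub> A = H +>\<^bsub>M\<^esub> z"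
      using rep by blast
    \<comment> \<open>In \<open>quotient_module\<close> a scalar multiple is a union of cosets of
      \<open>H\<close>. It is also the single coset of \<open>z\<close>, so it coincides with the
      coset of \<open>c\<close> times \<open>x\<close>, one of its members.\<close>
    have "H +>\<^bsub>M\<^esub> (c \<odot>\<^bsub>M\<^esub> x) \<subseteq> H +>\<^bsub>M\<^esub> z"
      using z x H.a_rcos_self[of x] by (auto simp: quotient_module_def)
    then have "c \<odot>\<^bsub>M\<^esub> x \<in> H +>\<^bsub>M\<^esub> z" using H.a_rcos_self[of "c \<odot>\<^bsub>M\<^esub> x"] c x by auto
    then have "H +>\<^bsub>M\<^esub> z = H +>\<^bsub>M\<^esub> (c \<odot>\<^bsub>M\<^esub> x)"
      using H.a_repr_independence'[of "c \<odot>\<^bsub>M\<^esub> x" z] z by simp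
    then show "\<phi> (c \<odot>\<^bsub>quotient_module M H\<^esub> A) = c \<odot>\<^bsub>N\<^esub> \<phi> A"
      using c x z F by (simp add: \<phi> mod_hom_def)
  qed
  with \<phi> show ?thesis by blast
qed

lemma quotient_module_proj:
  assumes M: "coeff_module M" and H: "submodule H coeff_ring M"
  shows "mod_hom M (quotient_module M H) (\<lambda>x. H +>\<^bsub>M\<^esub> x)"
proof -
  interpret M: coeff_module M by fact
  interpret H: abelian_subgroup H M
    by (rule abelian_subgroupI3)
       (use H in \<open>auto simp: additive_subgroup_def submodule_def M.abelian_group_axioms\<close>)
  have sm: "(\<Union>m\<in>H +>\<^bsub>M\<^esub> x. H +>\<^bsub>M\<^esub> (c \<odot>\<^bsub>M\<^esub> m)) = H +>\<^bsub>M\<^esub> (c \<odot>\<^bsub>M\<^esub> x)"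
    if "c \<in> carrier coeff_ring" "x \<in> carrier M" for c x
  proof -
    have "H +>\<^bsub>M\<^esub> (c \<odot>\<^bsub>M\<^esub> m) = H +>\<^bsub>M\<^esub> (c \<odot>\<^bsub>M\<^esub> x)" if m: "m \<in> H +>\<^bsub>M\<^esub> x" for m
    proof -
      obtain h where h: "h \<in> H" "m = h \<oplus>\<^bsub>M\<^esub> x" using m by (auto simp: a_r_coset_def')
      have hc: "h \<in> carrier M" "c \<odot>\<^bsub>M\<^esub> h \<in> H"
        using h M.submoduleE[OF H] \<open>c \<in> _\<close> by auto
      have "c \<odot>\<^bsub>M\<^esub> m \<in> H +>\<^bsub>M\<^esub> (c \<odot>\<^bsub>M\<^esub> x)"
        using h hc \<open>c \<in> _\<close> \<open>x \<in> _\<close> by (auto simp: a_r_coset_def' M.smult_r_distr)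
      then show ?thesis
        by (rule H.a_repr_independence'[symmetric]) (use \<open>c \<in> _\<close> \<open>x \<in> _\<close> in simp)
    qed
    moreover have "x \<in> H +>\<^bsub>M\<^esub> x" using H.a_rcos_self that by blast
    ultimately show ?thesis by blast
  qed
  show ?thesis
    unfolding mod_hom_def
  proof (intro conjI ballI)
    show "(\<lambda>x. H +>\<^bsub>M\<^esub> x) \<in> carrier M \<rightarrow> carrier (quotient_module M H)"
      by (auto simp: quotient_module_def A_RCOSETS_def')
  next
    fix x y assume "x \<in> carrier M" "y \<in> carrier M"
    then show "H +>\<^bsub>M\<^esub> (x \<oplus>\<^bsub>M\<^esub> y) = (H +>\<^bsub>M\<^esub> x) \<oplus>\<^bsub>quotient_module M H\<^esub> (H +>\<^bsub>M\<^esub> y)"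
      using H.a_rcos_sum[of x y] by (simp add: quotient_module_def)
  next
    fix c x assume "c \<in> carrier coeff_ring" "x \<in> carrier M"
    then show "H +>\<^bsub>M\<^esub> (c \<odot>\<^bsub>M\<^esub> x) = c \<odot>\<^bsub>quotient_module M H\<^esub> (H +>\<^bsub>M\<^esub> x)"
      using sm[of c x] by (simp add: quotient_module_def)
  qed
qed

lemma submodule_span_minimal:
  "submodule H S M \<Longrightarrow> Y \<subseteq> H \<Longrightarrow> submodule_span S M Y \<subseteq> H"
  unfolding submodule_span_def by blast

lemma submodule_kernel:
  assumes M: "coeff_module M" and N: "coeff_module N" and F: "mod_hom M N F"
  shows "submodule {x \<in> carrier M. F x = \<zero>\<^bsub>N\<^esub>} coeff_ring M"
proof -
  interpret M: coeff_module M by fact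
  interpret N: coeff_module N by fact
  show ?thesis
  proof (rule M.submoduleI)
    show "\<zero>\<^bsub>M\<^esub> \<in> {x \<in> carrier M. F x = \<zero>\<^bsub>N\<^esub>}"
      using mod_hom_zero[OF M N F] by simp
  next
    fix a assume "a \<in> {x \<in> carrier M. F x = \<zero>\<^bsub>N\<^esub>}"
    then show "\<ominus>\<^bsub>M\<^esub> a \<in> {x \<in> carrier M. F x = \<zero>\<^bsub>N\<^esub>}"
      using mod_hom_minus[OF M N F, of "\<zero>\<^bsub>M\<^esub>" a] mod_hom_zero[OF M N F]
      by (simp add: a_minus_def)
  qed (use F in \<open>auto simp: mod_hom_def\<close>)
qed

section \<open>The universal property of the module of a diagram\<close>

definition knot_relations :: "vdiagram \<Rightarrow> (real set \<Rightarrow> laurent set) set" where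
  "knot_relations K = submodule_span coeff_ring (arc_module K) (\<Union>c\<in>crossings K. crossing_relators K c)"

lemma relator_closed: "relator K z \<alpha> y \<beta> x \<in> carrier (arc_module K)"
proof -
  interpret M: coeff_module "arc_module K" by (rule coeff_module_free)
  show ?thesis by (simp add: relator_def Let_def free_gen_closed cring_coeff_ring)
qed

lemma crossing_relators_closed: "crossing_relators K c \<subseteq> carrier (arc_module K)"
  by (auto simp: crossing_relators_def Let_def relator_closed split: if_splits)

lemma submodule_knot_relations: "submodule (knot_relations K) coeff_ring (arc_module K)"
  unfolding knot_relations_def
proof (rule submodule_submodule_span)
  show "Module.module coeff_ring (arc_module K)"
    by (rule module_free_module[OF cring_coeff_ring])
  show "(\<Union>c\<in>crossings K. crossing_relators K c) \<subseteq> carrier (arc_module K)"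
    by (intro UN_least crossing_relators_closed)
qed

lemma knot_module_eq: "knot_module K = quotient_module (arc_module K) (knot_relations K)"
  by (simp add: knot_module_def knot_relations_def)

definition arc_class :: "vdiagram \<Rightarrow> (real set \<Rightarrow> laurent set) \<Rightarrow> (real set \<Rightarrow> laurent set) set" where
  "arc_class K f = knot_relations K +>\<^bsub>arc_module K\<^esub> f"

lemma mod_hom_arc_class: "mod_hom (arc_module K) (knot_module K) (arc_class K)"
  unfolding knot_module_eq arc_class_def
  by (rule quotient_module_proj[OF coeff_module_free submodule_knot_relations])

lemma arc_class_relator:
  assumes "c \<in> crossings K" "\<rho> \<in> crossing_relators K c"
  shows "arc_class K \<rho> = \<zero>\<^bsub>knot_module K\<^esub>"
proof -
  interpret A: coeff_module "arc_module K" by (rule coeff_module_free)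
  interpret H: abelian_subgroup "knot_relations K" "arc_module K"
    by (rule abelian_subgroupI3)
       (use submodule_knot_relations in \<open>auto simp: additive_subgroup_def submodule_def A.abelian_group_axioms\<close>)
  have "\<rho> \<in> knot_relations K"
    using assms by (auto simp: knot_relations_def submodule_span_def)
  then show ?thesis
    using H.a_rcos_const[of \<rho>] by (simp add: arc_class_def knot_module_eq quotient_module_def)
qed

text \<open>The kernel of \<open>F\<close> is a submodule that contains the relators, hence it
  contains their span, and \<open>F\<close> descends to the quotient.\<close>

lemma knot_module_universal:
  assumes N: "coeff_module N" and F: "mod_hom (arc_module K) N F"
    and rel: "\<And>c \<rho>. c \<in> crossings K \<Longrightarrow> \<rho> \<in> crossing_relators K c \<Longrightarrow> F \<rho> = \<zero>\<^bsub>N\<^esub>"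
  shows "\<exists>\<phi>. mod_hom (knot_module K) N \<phi> \<and> (\<forall>x\<in>carrier (arc_module K). \<phi> (arc_class K x) = F x)"
  unfolding knot_module_eq arc_class_def
proof (rule quotient_module_universal[OF coeff_module_free N submodule_knot_relations F])
  have "knot_relations K \<subseteq> {x \<in> carrier (arc_module K). F x = \<zero>\<^bsub>N\<^esub>}"
    unfolding knot_relations_def
    by (rule submodule_span_minimal[OF submodule_kernel[OF coeff_module_free N F]])
       (intro UN_least subsetI CollectI conjI subsetD[OF crossing_relators_closed] rel)
  then show "F x = \<zero>\<^bsub>N\<^esub>" if "x \<in> knot_relations K" for x using that by blast
qed

lemma knot_module_hom_eq:
  assumes N: "coeff_module N" and "mod_hom (knot_module K) N \<phi>" "mod_hom (knot_module K) N \<psi>"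
    and gen: "\<And>a. a \<in> short_arcs K \<Longrightarrow>
      \<phi> (arc_class K (free_gen coeff_ring (short_arcs K) a)) = \<psi> (arc_class K (free_gen coeff_ring (short_arcs K) a))"
    and "x \<in> carrier (knot_module K)"
  shows "\<phi> x = \<psi> x"
proof -
  obtain f where f: "f \<in> carrier (arc_module K)" "x = arc_class K f"
    using assms(5) unfolding knot_module_eq arc_class_def quotient_module_def A_RCOSETS_def' by auto
  have "(\<phi> \<circ> arc_class K) f = (\<psi> \<circ> arc_class K) f"
    by (rule free_module_hom_eq[OF N mod_hom_comp[OF mod_hom_arc_class assms(2)]
              mod_hom_comp[OF mod_hom_arc_class assms(3)] _ f(1)]) (simp add: gen)
  then show ?thesis using f by simp
qed

section \<open>Isomorphism of modules as an equivalence relation\<close>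

lemma module_isomorphicI:
  assumes \<phi>: "mod_hom M N \<phi>" and \<psi>: "mod_hom N M \<psi>"
    and "\<And>x. x \<in> carrier M \<Longrightarrow> \<psi> (\<phi> x) = x" "\<And>y. y \<in> carrier N \<Longrightarrow> \<phi> (\<psi> y) = y"
  shows "module_isomorphic coeff_ring M N"
proof -
  have "bij_betw \<phi> (carrier M) (carrier N)"
    by (rule bij_betw_byWitness[of _ \<psi>]) (use assms in \<open>auto simp: mod_hom_def\<close>)
  then show ?thesis using \<phi> unfolding module_isomorphic_def mod_hom_def by blast
qed

lemma module_isomorphic_refl: "module_isomorphic S M M"
  unfolding module_isomorphic_def by (intro exI[of _ id]) auto

lemma module_isomorphic_trans:
  assumes "module_isomorphic S M N" "module_isomorphic S N P"
  shows "module_isomorphic S M P"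
proof -
  obtain \<phi> where \<phi>: "bij_betw \<phi> (carrier M) (carrier N)"
      "\<forall>x\<in>carrier M. \<forall>y\<in>carrier M. \<phi> (x \<oplus>\<^bsub>M\<^esub> y) = \<phi> x \<oplus>\<^bsub>N\<^esub> \<phi> y"
      "\<forall>c\<in>carrier S. \<forall>x\<in>carrier M. \<phi> (c \<odot>\<^bsub>M\<^esub> x) = c \<odot>\<^bsub>N\<^esub> \<phi> x"
    using assms(1) unfolding module_isomorphic_def by blast
  obtain \<psi> where \<psi>: "bij_betw \<psi> (carrier N) (carrier P)"
      "\<forall>x\<in>carrier N. \<forall>y\<in>carrier N. \<psi> (x \<oplus>\<^bsub>N\<^esub> y) = \<psi> x \<oplus>\<^bsub>P\<^esub> \<psi> y"
      "\<forall>c\<in>carrier S. \<forall>x\<in>carrier N. \<psi> (c \<odot>\<^bsub>N\<^esub> x) = c \<odot>\<^bsub>P\<^esub> \<psi> x"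
    using assms(2) unfolding module_isomorphic_def by blast
  have "\<phi> x \<in> carrier N" if "x \<in> carrier M" for x
    using \<phi>(1) that by (rule bij_betw_apply)
  then show ?thesis
    unfolding module_isomorphic_def
    using bij_betw_trans[OF \<phi>(1) \<psi>(1)]
    by (intro exI[of _ "\<psi> \<circ> \<phi>"]) (auto simp: \<phi>(2,3) \<psi>(2,3))
qed

text \<open>The equivalence of diagrams also uses moves backwards. Closure of \<open>M\<close> under
  its operations makes the inverse map compatible with them.\<close>

lemma module_isomorphic_sym:
  assumes "coeff_module M" "module_isomorphic coeff_ring M N"
  shows "module_isomorphic coeff_ring N M"
proof -
  interpret coeff_module M by fact
  obtain \<phi> where \<phi>: "bij_betw \<phi> (carrier M) (carrier N)"
      "\<forall>x\<in>carrier M. \<forall>y\<in>carrier M. \<phi> (x \<oplus>\<^bsub>M\<^esub> y) = \<phi> x \<oplus>\<^bsub>N\<^esub> \<phi> y"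
      "\<forall>c\<in>carrier coeff_ring. \<forall>x\<in>carrier M. \<phi> (c \<odot>\<^bsub>M\<^esub> x) = c \<odot>\<^bsub>N\<^esub> \<phi> x"
    using assms(2) unfolding module_isomorphic_def by blast
  have rep: "\<exists>x\<in>carrier M. y = \<phi> x" if "y \<in> carrier N" for y
    using \<phi>(1) that unfolding bij_betw_def by blast
  have inv [simp]: "inv_into (carrier M) \<phi> (\<phi> x) = x" if "x \<in> carrier M" for x
    using \<phi>(1) that by (rule bij_betw_inv_into_left)
  show ?thesis
    unfolding module_isomorphic_def
    by (intro exI[of _ "inv_into (carrier M) \<phi>"])
       (auto simp: bij_betw_inv_into[OF \<phi>(1)] \<phi>(2,3)[rule_format, symmetric] dest!: rep)
qed

section \<open>Chord sets\<close>

text \<open>Parity depends on the chords alone. With the set of chords as an argument, both levels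
  of the hierarchy are one notion, applied to \<open>X\<close> and to \<open>even_chords X\<close>;
  the diagram \<open>f(K)\<close> is then no longer mentioned.\<close>

definition odd_chord :: "(real \<times> real) set \<Rightarrow> real \<times> real \<Rightarrow> bool" where
  "odd_chord X c \<longleftrightarrow> odd (card {d \<in> X. chords_intersect c d})"

definition even_chords :: "(real \<times> real) set \<Rightarrow> (real \<times> real) set" where
  "even_chords X = {c \<in> X. \<not> odd_chord X c}"

definition chord_type :: "(real \<times> real) set \<Rightarrow> real \<times> real \<Rightarrow> nat" where
  "chord_type X c =
     (if odd_chord X c then 0 else if odd_chord (even_chords X) c then 1 else 2)"

definition chord_ends :: "(real \<times> real) set \<Rightarrow> real set" where
  "chord_ends X = fst ` X \<union> snd ` X"

definition chord_set :: "(real \<times> real) set \<Rightarrow> bool" where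
  "chord_set X \<longleftrightarrow> finite X \<and> chord_ends X \<subseteq> {0..<1} \<and> (\<forall>(v, u)\<in>X. v \<noteq> u) \<and>
     (\<forall>c\<in>X. \<forall>d\<in>X. c \<noteq> d \<longrightarrow> {fst c, snd c} \<inter> {fst d, snd d} = {})"

definition crossing_sign :: "vdiagram \<Rightarrow> real \<times> real \<Rightarrow> real" where
  "crossing_sign K = (\<lambda>(v, u). sgn (det2 (velocity K v) (velocity K u)))"

lemma diff_Ints_imp_eq:
  fixes x y :: real
  assumes "x - y \<in> \<int>" "x \<in> {0..<1}" "y \<in> {0..<1}"
  shows "x = y"
proof -
  obtain k :: int where k: "x - y = of_int k" using assms(1) by (auto elim: Ints_cases)
  then have "\<bar>of_int k :: real\<bar> < 1" using assms by auto
  then have "k = 0" by linarith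
  then show ?thesis using k by simp
qed

lemma double_point_sym: "double_point K x y \<Longrightarrow> double_point K y x"
  unfolding double_point_def using Ints_minus[of "x - y"] Ints_minus[of "y - x"] by auto

lemma crossings_sub: "crossings K \<subseteq> {0..<1} \<times> {0..<1}"
  by (auto simp: crossings_def)

lemma chord_ends_simps [simp]:
  "chord_ends {} = {}"
  "chord_ends (insert c X) = {fst c, snd c} \<union> chord_ends X"
  "chord_ends (X \<union> Y) = chord_ends X \<union> chord_ends Y"
  by (auto simp: chord_ends_def)

lemma finite_chord_ends: "finite X \<Longrightarrow> finite (chord_ends X)"
  by (simp add: chord_ends_def)

lemma virtual_knot_diagramD:
  assumes "virtual_knot_diagram K"
  shows "curve K (x + 1) = curve K x" "curve K C1_differentiable_on UNIV" "velocity K x \<noteq> 0"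
    "finite {x \<in> {0..<1}. \<exists>y. double_point K x y}"
    "double_point K x y \<Longrightarrow> double_point K x z \<Longrightarrow> y - z \<in> \<int>"
    "double_point K x y \<Longrightarrow> det2 (velocity K x) (velocity K y) \<noteq> 0"
    "x + 1 \<in> over K \<longleftrightarrow> x \<in> over K"
    "double_point K x y \<Longrightarrow> \<not> (x \<in> over K \<and> y \<in> over K)"
    "x \<in> over K \<Longrightarrow> \<exists>y. double_point K x y"
  using assms unfolding virtual_knot_diagram_def by blast+

lemma chord_set_crossings:
  assumes K: "virtual_knot_diagram K"
  shows "chord_set (crossings K)"
proof -
  let ?S = "{x \<in> {0..<1}. \<exists>y. double_point K x y}"
  have "crossings K \<subseteq> ?S \<times> ?S"
  proof (intro subrelI)
    fix v u assume "(v, u) \<in> crossings K"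
    then have "double_point K v u" "v \<in> {0..<1}" "u \<in> {0..<1}" by (auto simp: crossings_def)
    moreover have "double_point K u v" by (rule double_point_sym) fact
    ultimately show "(v, u) \<in> ?S \<times> ?S" by blast
  qed
  moreover have "finite (?S \<times> ?S)"
    by (intro finite_cartesian_product virtual_knot_diagramD(4)[OF K])
  ultimately have "finite (crossings K)" by (rule finite_subset)
  moreover have "chord_ends (crossings K) \<subseteq> {0..<1}"
    using crossings_sub[of K] by (auto simp: chord_ends_def)
  moreover have "v \<noteq> u" if "(v, u) \<in> crossings K" for v u
    using that by (auto simp: crossings_def double_point_def)
  moreover have "{fst c, snd c} \<inter> {fst d, snd d} = {}"
    if cd: "c \<in> crossings K" "d \<in> crossings K" "c \<noteq> d" for c d
  proof -
    obtain v u v' u' where [simp]: "c = (v, u)" "d = (v', u')" by (cases c, cases d)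
    have c: "double_point K v u" "double_point K u v" "v \<in> over K" "u \<notin> over K"
        "v \<in> {0..<1}" "u \<in> {0..<1}"
      using cd(1) double_point_sym[of K v u] virtual_knot_diagramD(8)[OF K] by (auto simp: crossings_def)
    have d: "double_point K v' u'" "double_point K u' v'" "v' \<in> over K" "u' \<notin> over K"
        "v' \<in> {0..<1}" "u' \<in> {0..<1}"
      using cd(2) double_point_sym[of K v' u'] virtual_knot_diagramD(8)[OF K] by (auto simp: crossings_def)
    have "v \<noteq> v'"
    proof
      assume "v = v'"
      then have "u - u' \<in> \<int>" using virtual_knot_diagramD(5)[OF K, of v u u'] c d by simp
      then have "u = u'" by (rule diff_Ints_imp_eq) fact+
      with \<open>v = v'\<close> cd show False by simp
    qed
    moreover have "u \<noteq> u'"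
    proof
      assume "u = u'"
      then have "v - v' \<in> \<int>" using virtual_knot_diagramD(5)[OF K, of u v v'] c d by simp
      then have "v = v'" by (rule diff_Ints_imp_eq) fact+
      with \<open>u = u'\<close> cd show False by simp
    qed
    \<comment> \<open>The mixed coincidences \<open>v = u'\<close> and \<open>u = v'\<close> are
      impossible, since of the two parameters of a crossing only the first lies in
      \<open>over\<close>.\<close>
    ultimately show ?thesis using c d by auto
  qed
  ultimately show ?thesis unfolding chord_set_def by (intro conjI ballI impI) auto
qed

lemma chord_set_disjoint:
  "chord_set X \<Longrightarrow> c \<in> X \<Longrightarrow> d \<in> X \<Longrightarrow> c \<noteq> d \<Longrightarrow> {fst c, snd c} \<inter> {fst d, snd d} = {}"
  by (simp add: chord_set_def)

lemma odd_crossing_eq: "odd_crossing K c \<longleftrightarrow> odd_chord (crossings K) c"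
  by (simp add: odd_crossing_def odd_chord_def)

text \<open>The curve stays the same and only overpass parameters are deleted. Since distinct
  crossings have disjoint ends, deleting the parameter of an odd crossing removes that crossing and
  no other.\<close>

lemma crossings_virtualize_odd:
  assumes K: "virtual_knot_diagram K"
  shows "crossings (virtualize_odd K) = even_chords (crossings K)"
proof -
  have "(v, u) \<in> crossings (virtualize_odd K) \<longleftrightarrow> (v, u) \<in> even_chords (crossings K)" for v u
  proof -
    have "v \<in> over (virtualize_odd K) \<longleftrightarrow> \<not> odd_chord (crossings K) (v, u)"
      if c: "(v, u) \<in> crossings K"
    proof -
      have uniq: "v' = v \<and> u' = u" if d: "(v', u') \<in> crossings K" "v - v' \<in> \<int>" for v' u'
      proof -
        have "v = v'" using that c by (intro diff_Ints_imp_eq) (auto simp: crossings_def)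
        then show ?thesis
          using chord_set_disjoint[OF chord_set_crossings[OF K] c d(1)] by auto
      qed
      have "(\<exists>(v', u')\<in>crossings K. odd_crossing K (v', u') \<and> v - v' \<in> \<int>) \<longleftrightarrow>
          odd_crossing K (v, u)"
      proof
        assume "\<exists>(v', u')\<in>crossings K. odd_crossing K (v', u') \<and> v - v' \<in> \<int>"
        then obtain v' u' where d: "(v', u') \<in> crossings K" "odd_crossing K (v', u')" "v - v' \<in> \<int>"
          by blast
        then show "odd_crossing K (v, u)" using uniq[OF d(1,3)] by simp
      next
        assume "odd_crossing K (v, u)"
        then show "\<exists>(v', u')\<in>crossings K. odd_crossing K (v', u') \<and> v - v' \<in> \<int>"
          using c by (intro bexI[of _ "(v, u)"]) auto
      qed
      moreover have "v \<in> over K" using c by (simp add: crossings_def)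
      ultimately show ?thesis by (simp add: virtualize_odd_def odd_crossing_eq)
    qed
    moreover have "(v, u) \<in> crossings (virtualize_odd K) \<longleftrightarrow>
        (v, u) \<in> crossings K \<and> v \<in> over (virtualize_odd K)"
      by (auto simp: crossings_def virtualize_odd_def double_point_def)
    ultimately show ?thesis by (auto simp: even_chords_def)
  qed
  then show ?thesis by auto
qed

lemma crossing_type_eq:
  "virtual_knot_diagram K \<Longrightarrow> crossing_type K c = chord_type (crossings K) c"
  by (simp add: crossing_type_def chord_type_def odd_crossing_eq crossings_virtualize_odd)

lemma crossing_sign:
  assumes "virtual_knot_diagram K" "c \<in> crossings K"
  shows "crossing_sign K c = (if positive K c then 1 else -1)"
  using virtual_knot_diagramD(6)[OF assms(1)] assms(2)
  by (auto simp: crossing_sign_def positive_def crossings_def sgn_real_def)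

section \<open>Colorings\<close>

text \<open>Coefficients by type: \<open>al\<close> is the factor picked up along the overpass,
  \<open>be\<close> and \<open>ga\<close> are the coefficients of the right underpass and of the
  left overpass in the colour of the left underpass. The value 1 of \<open>al\<close> for types 1
  and 2 says that the overpass is not broken there.\<close>

definition al :: "nat \<Rightarrow> laurent" where "al n = (if n = 0 then s_L else 1)"
definition be :: "nat \<Rightarrow> laurent" where "be n = (if n = 0 then r_L else if n = 1 then p_L else t_L)"
definition ga :: "nat \<Rightarrow> laurent" where "ga n = (if n = 0 then w_L else if n = 1 then q_L else 1 - t_L)"

text \<open>
  The crossing relations in a form that does not mention the sign: \<open>aL\<close>, \<open>aR\<close> are the
  colours of the overpass on the left and on the right of the oriented underpass, and
  \<open>bL\<close>, \<open>bR\<close> those of the underpass on the left and on the right of the oriented overpass.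
\<close>

definition crossing_relation ::
  "(laurent set, 'm, 'e) module_scheme \<Rightarrow> nat \<Rightarrow> 'm \<Rightarrow> 'm \<Rightarrow> 'm \<Rightarrow> 'm \<Rightarrow> bool" where
  "crossing_relation M n aL aR bL bR \<longleftrightarrow>
     aR = act M (al n) aL \<and> bL = act M (be n) bR \<oplus>\<^bsub>M\<^esub> act M (ga n) aL"

text \<open>The one-sided value of a locally constant function, after \<open>x\<close> for
  \<open>d = 1\<close> and before it for \<open>d = -1\<close>. With the direction as a number, the
  sides at a crossing are addressed by multiples of its sign, without cases.\<close>

definition germ :: "(real \<Rightarrow> 'm) \<Rightarrow> real \<Rightarrow> real \<Rightarrow> 'm \<Rightarrow> bool" where
  "germ c x d a \<longleftrightarrow> (\<exists>\<delta>>0. \<forall>h. 0 < h \<and> h < \<delta> \<longrightarrow> c (x + d * h) = a)"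

definition const_near :: "(real \<Rightarrow> 'm) \<Rightarrow> real \<Rightarrow> bool" where
  "const_near c x \<longleftrightarrow> (\<exists>\<delta>>0. \<forall>y. \<bar>y - x\<bar> < \<delta> \<longrightarrow> c y = c x)"

text \<open>A coloring assigns colours to parameters; the values at crossings are irrelevant.\<close>

definition coloring ::
  "(laurent set, 'm, 'e) module_scheme \<Rightarrow> (real \<times> real) set \<Rightarrow> (real \<times> real \<Rightarrow> real) \<Rightarrow> (real \<Rightarrow> 'm) \<Rightarrow> bool"
where
  "coloring M X \<sigma> c \<longleftrightarrow>
     (\<forall>x. c x \<in> carrier M) \<and> (\<forall>x. c (x + 1) = c x) \<and>
     (\<forall>x. frac x \<notin> chord_ends X \<longrightarrow> const_near c x) \<and>
     (\<forall>(v, u)\<in>X. \<exists>aL aR bL bR.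
        germ c v (- \<sigma> (v, u)) aL \<and> germ c v (\<sigma> (v, u)) aR \<and>
        germ c u (\<sigma> (v, u)) bL \<and> germ c u (- \<sigma> (v, u)) bR \<and>
        crossing_relation M (chord_type X (v, u)) aL aR bL bR)"

lemma germ_unique: "germ c x d a \<Longrightarrow> germ c x d b \<Longrightarrow> a = b"
proof -
  assume "germ c x d a" "germ c x d b"
  then obtain \<delta> \<delta>' where \<delta>: "0 < \<delta>" "\<forall>h. 0 < h \<and> h < \<delta> \<longrightarrow> c (x + d * h) = a"
      "0 < \<delta>'" "\<forall>h. 0 < h \<and> h < \<delta>' \<longrightarrow> c (x + d * h) = b"
    unfolding germ_def by blast
  have "0 < min \<delta> \<delta>' / 2" "min \<delta> \<delta>' / 2 < \<delta>" "min \<delta> \<delta>' / 2 < \<delta>'" using \<delta>(1,3) by auto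
  then show "a = b" using \<delta> by metis
qed

lemma germ_const_near:
  assumes "const_near c x" "\<bar>d\<bar> = 1"
  shows "germ c x d (c x)"
proof -
  obtain \<delta> where \<delta>: "\<delta> > 0" "\<forall>y. \<bar>y - x\<bar> < \<delta> \<longrightarrow> c y = c x"
    using assms(1) unfolding const_near_def by blast
  have "c (x + d * h) = c x" if "0 < h" "h < \<delta>" for h
    by (rule \<delta>(2)[rule_format]) (use that assms(2) in \<open>simp add: abs_mult\<close>)
  with \<delta>(1) show ?thesis unfolding germ_def by blast
qed

lemma germ_cong:
  assumes "germ c x d a" "\<delta> > 0" "\<And>h. 0 < h \<Longrightarrow> h < \<delta> \<Longrightarrow> c' (x' + d' * h) = c (x + d * h)"
  shows "germ c' x' d' a"
proof -
  obtain \<epsilon> where \<epsilon>: "\<epsilon> > 0" "\<forall>h. 0 < h \<and> h < \<epsilon> \<longrightarrow> c (x + d * h) = a"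
    using assms(1) unfolding germ_def by blast
  then have "c' (x' + d' * h) = a" if "0 < h" "h < min \<epsilon> \<delta>" for h
    using assms(3)[of h] that by simp
  then have "\<forall>h. 0 < h \<and> h < min \<epsilon> \<delta> \<longrightarrow> c' (x' + d' * h) = a" by blast
  moreover have "0 < min \<epsilon> \<delta>" using \<epsilon>(1) assms(2) by simp
  ultimately show ?thesis unfolding germ_def by blast
qed

lemma periodic_int:
  fixes c :: "real \<Rightarrow> 'm"
  assumes "\<And>x. c (x + 1) = c x"
  shows "c (x + of_int k) = c x"
proof -
  have nat: "c (x + of_nat n) = c x" for x and n :: nat
  proof (induction n)
    case (Suc n)
    then show ?case using assms[of "x + of_nat n"] by (simp add: add_ac)
  qed simp
  show ?thesis
  proof (cases "k \<ge> 0")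
    case True
    then show ?thesis using nat[of x "nat k"] by simp
  next
    case False
    then show ?thesis using nat[of "x + of_int k" "nat (- k)"] by simp
  qed
qed

lemma periodic_frac:
  assumes "\<And>x::real. c (x + 1) = c x"
  shows "c (frac x) = c x"
  using periodic_int[of c x "- \<lfloor>x\<rfloor>", OF assms] by (simp add: frac_def)

lemma coloring_periodic: "coloring M X \<sigma> c \<Longrightarrow> c (x + of_int k) = c x"
  by (rule periodic_int) (simp add: coloring_def)

lemma coloring_frac: "coloring M X \<sigma> c \<Longrightarrow> c (frac x) = c x"
  by (rule periodic_frac) (simp add: coloring_def)

lemma coloring_carrier: "coloring M X \<sigma> c \<Longrightarrow> c x \<in> carrier M"
  by (simp add: coloring_def)

lemma germ_shift:
  assumes "\<And>x::real. c (x + 1) = c x"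
  shows "germ c (x + of_int k) d a \<longleftrightarrow> germ c x d a"
proof -
  have "c (x + of_int k + d * h) = c (x + d * h)" for h
    using periodic_int[of c "x + d * h" k, OF assms] by (simp only: add_ac)
  then show ?thesis by (simp only: germ_def)
qed

lemma const_segment:
  fixes c :: "real \<Rightarrow> 'm"
  assumes "\<And>x. x \<in> closed_segment a b \<Longrightarrow> const_near c x"
  shows "c a = c b"
proof (rule connected_local_const[where A = "closed_segment a b"])
  show "\<forall>x\<in>closed_segment a b. \<forall>\<^sub>F y in at x within closed_segment a b. c x = c y"
  proof
    fix x assume "x \<in> closed_segment a b"
    then obtain \<delta> where \<delta>: "\<delta> > 0" "\<forall>y. \<bar>y - x\<bar> < \<delta> \<longrightarrow> c y = c x"
      using assms unfolding const_near_def by blast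
    have "c x = c y" if "dist y x < \<delta>" for y
      using \<delta>(2)[rule_format, of y] that by (simp add: dist_real_def)
    then show "\<forall>\<^sub>F y in at x within closed_segment a b. c x = c y"
      unfolding eventually_at using \<delta>(1) by blast
  qed
qed auto

lemma frac_discrete:
  fixes A :: "real set"
  assumes "finite A"
  shows "\<exists>\<delta>>0. \<forall>y. \<bar>y - x\<bar> < \<delta> \<and> y \<noteq> x \<longrightarrow> frac y \<notin> A"
proof -
  \<comment> \<open>Points at distance less than 1 from \<open>x\<close> have integral parts in this
    range, so finitely many translates of \<open>A\<close> have to be avoided.\<close>
  let ?S = "(\<lambda>(a, k). a + of_int k) ` (A \<times> {\<lfloor>x\<rfloor> - 1..\<lfloor>x\<rfloor> + 1})"
  have "finite ?S" using assms by auto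
  then obtain \<delta> where \<delta>: "\<delta> > 0" "\<forall>y\<in>?S. y \<noteq> x \<longrightarrow> \<delta> \<le> dist x y"
    using finite_set_avoid by meson
  show ?thesis
  proof (intro exI[of _ "min \<delta> 1"] conjI allI impI)
    fix y assume y: "\<bar>y - x\<bar> < min \<delta> 1 \<and> y \<noteq> x"
    then have "\<lfloor>y\<rfloor> \<in> {\<lfloor>x\<rfloor> - 1..\<lfloor>x\<rfloor> + 1}" by (auto simp: abs_less_iff) linarith+
    moreover have "y \<notin> ?S" using \<delta>(2) y by (force simp: dist_real_def abs_minus_commute)
    moreover have "y = (\<lambda>(a, k). a + of_int k) (frac y, \<lfloor>y\<rfloor>)" by (simp add: frac_def)
    ultimately show "frac y \<notin> A" by blast
  qed (use \<delta>(1) in auto)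
qed

subsection \<open>Short arcs\<close>

lemma diff_Ints_iff_frac: "y \<in> {0..<1} \<Longrightarrow> (x::real) - y \<in> \<int> \<longleftrightarrow> frac x = y"
  by (auto simp: frac_unique_iff)

definition break_ends :: "vdiagram \<Rightarrow> real set" where
  "break_ends K = snd ` crossings K \<union> fst ` {c \<in> crossings K. crossing_type K c = 0}"

lemma break_ends_sub: "break_ends K \<subseteq> chord_ends (crossings K)"
  by (auto simp: break_ends_def chord_ends_def)

lemma break_points_eq: "x \<in> break_points K \<longleftrightarrow> frac x \<in> break_ends K"
proof -
  have "x - v \<in> \<int> \<longleftrightarrow> frac x = v" "x - u \<in> \<int> \<longleftrightarrow> frac x = u" if "(v, u) \<in> crossings K" for v u
    using that crossings_sub[of K] diff_Ints_iff_frac by auto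
  then have "x \<in> break_points K \<longleftrightarrow>
      (\<exists>(v, u)\<in>crossings K. frac x = u \<or> crossing_type K (v, u) = 0 \<and> frac x = v)"
    unfolding break_points_def by blast
  also have "\<dots> \<longleftrightarrow> frac x \<in> break_ends K"
    by (force simp: break_ends_def)
  finally show ?thesis .
qed

lemma break_points_shift [simp]: "x + of_int k \<in> break_points K \<longleftrightarrow> x \<in> break_points K"
  by (simp add: break_points_eq)

lemma break_points_discrete:
  assumes "virtual_knot_diagram K"
  shows "\<exists>\<delta>>0. \<forall>y. \<bar>y - x\<bar> < \<delta> \<and> y \<noteq> x \<longrightarrow> y \<notin> break_points K"
proof -
  have "finite (break_ends K)"
    using chord_set_crossings[OF assms] finite_chord_ends finite_subset[OF break_ends_sub]
    by (auto simp: chord_set_def)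
  from frac_discrete[OF this] show ?thesis by (simp add: break_points_eq)
qed

lemma segment_shift:
  "closed_segment (a + of_int k) (b + of_int k) \<inter> break_points K = {} \<longleftrightarrow>
   closed_segment a b \<inter> break_points K = {}"
proof -
  have "z \<in> closed_segment (a + of_int k) (b + of_int k) \<longleftrightarrow> z - of_int k \<in> closed_segment a b" for z
    by (auto simp: closed_segment_eq_real_ivl)
  moreover have "z - of_int k \<in> break_points K \<longleftrightarrow> z \<in> break_points K" for z
    using break_points_shift[of z "-k"] by simp
  ultimately show ?thesis
    by (auto simp: disjoint_iff) (metis add_diff_cancel)
qed

lemma arc_through_iff:
  "y \<in> arc_through K x \<longleftrightarrow> (\<exists>k. closed_segment (x + of_int k) y \<inter> break_points K = {})"
  by (simp add: arc_through_def)

lemma arc_through_segment: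
  assumes "closed_segment x y \<inter> break_points K = {}"
  shows "y \<in> arc_through K x"
  unfolding arc_through_iff using assms by (intro exI[of _ 0]) simp

lemma arc_through_sym:
  assumes "y \<in> arc_through K x"
  shows "x \<in> arc_through K y"
proof -
  obtain k where "closed_segment (x + of_int k) y \<inter> break_points K = {}"
    using assms by (auto simp: arc_through_iff)
  then have "closed_segment (y + of_int (- k)) x \<inter> break_points K = {}"
    using segment_shift[of "x + of_int k" "-k" y K] by (simp add: closed_segment_commute)
  then show ?thesis unfolding arc_through_iff by blast
qed

lemma arc_through_trans:
  assumes "y \<in> arc_through K x" "z \<in> arc_through K y"
  shows "z \<in> arc_through K x"
proof -
  obtain k where k: "closed_segment (x + of_int k) y \<inter> break_points K = {}"
    using assms by (auto simp: arc_through_iff)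
  obtain l where l: "closed_segment (y + of_int l) z \<inter> break_points K = {}"
    using assms by (auto simp: arc_through_iff)
  have "closed_segment (x + of_int k + of_int l) (y + of_int l) \<inter> break_points K = {}"
    using k segment_shift by blast
  moreover have "closed_segment (x + of_int k + of_int l) z \<subseteq>
      closed_segment (x + of_int k + of_int l) (y + of_int l) \<union> closed_segment (y + of_int l) z"
    by (auto simp: closed_segment_eq_real_ivl)
  ultimately have "closed_segment (x + of_int (k + l)) z \<inter> break_points K = {}"
    using l by (auto simp: add.assoc)
  then show ?thesis unfolding arc_through_iff by blast
qed

lemma arc_through_eq: "y \<in> arc_through K x \<Longrightarrow> arc_through K y = arc_through K x"
  using arc_through_sym arc_through_trans by blast

lemma arc_through_shift: "arc_through K (x + 1) = arc_through K x"
proof -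
  have "(\<exists>k. closed_segment (x + 1 + of_int k) y \<inter> break_points K = {}) \<longleftrightarrow>
      (\<exists>k. closed_segment (x + of_int k) y \<inter> break_points K = {})" (is "?l \<longleftrightarrow> ?r") for y
  proof
    assume ?l
    then obtain k :: int where "closed_segment (x + 1 + of_int k) y \<inter> break_points K = {}" by blast
    then show ?r by (intro exI[of _ "1 + k"]) (simp add: add.assoc)
  next
    assume ?r
    then obtain k :: int where "closed_segment (x + of_int k) y \<inter> break_points K = {}" by blast
    then show ?l by (intro exI[of _ "k - 1"]) (simp add: add.assoc)
  qed
  then show ?thesis unfolding arc_through_def by simp
qed

lemma short_arc_eq:
  assumes "A \<in> short_arcs K" "y \<in> A"
  shows "A = arc_through K y"
  using assms arc_through_eq by (auto simp: short_arcs_def)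

lemma short_arcs_arc_through: "x \<notin> break_points K \<Longrightarrow> arc_through K x \<in> short_arcs K"
  by (auto simp: short_arcs_def)

definition arc_side :: "vdiagram \<Rightarrow> real \<Rightarrow> real \<Rightarrow> real set" where
  "arc_side K x d = (if d > 0 then arc_out K x else arc_in K x)"

text \<open>\<open>arc_in\<close> and \<open>arc_out\<close> are definite descriptions and need
  existence and uniqueness. Both hold because break points are discrete: all points close to
  \<open>x\<close> on one side can be joined without meeting a break point, so they lie on one
  common short arc.\<close>

lemma arc_side:
  assumes K: "virtual_knot_diagram K" and d: "\<bar>d\<bar> = 1"
  shows "\<exists>\<delta>>0. \<forall>h. 0 < h \<and> h < \<delta> \<longrightarrow> x + d * h \<notin> break_points K \<and> arc_through K (x + d * h) = arc_side K x d"
proof -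
  obtain \<delta> where \<delta>: "\<delta> > 0" "\<forall>y. \<bar>y - x\<bar> < \<delta> \<and> y \<noteq> x \<longrightarrow> y \<notin> break_points K"
    using break_points_discrete[OF K] by blast
  have cases: "d = 1 \<or> d = -1" using d by auto
  define A where "A = arc_through K (x + d * (\<delta>/2))"
  have nb: "x + d * h \<notin> break_points K" if "0 < h" "h < \<delta>" for h
    by (rule \<delta>(2)[rule_format]) (use that cases in auto)
  have A: "arc_through K (x + d * h) = A" if h: "0 < h" "h < \<delta>" for h
    unfolding A_def
  proof (intro arc_through_eq arc_through_segment, intro equals0I)
    fix z assume "z \<in> closed_segment (x + d * (\<delta>/2)) (x + d * h) \<inter> break_points K"
    then have z: "z \<in> closed_segment (x + d * (\<delta>/2)) (x + d * h)" "z \<in> break_points K" by auto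
    have "\<bar>z - x\<bar> < \<delta> \<and> z \<noteq> x"
      using z(1) h \<delta>(1) cases by (auto simp: closed_segment_eq_real_ivl split: if_splits)
    then show False using \<delta>(2) z(2) by blast
  qed
  have "A \<in> short_arcs K" unfolding A_def using nb[of "\<delta>/2"] \<delta>(1) by (intro short_arcs_arc_through) auto
  have self: "x + d * h \<in> A" if "0 < h" "h < \<delta>" for h
    using A[OF that] arc_through_segment[of "x + d * h" "x + d * h" K] nb[OF that] by simp
  have uniq: "B = A" if "B \<in> short_arcs K" "0 < h" "h < \<delta>" "x + d * h \<in> B" for B h
    using short_arc_eq[OF that(1,4)] A[OF that(2,3)] by simp
  have "arc_side K x d = A"
  proof (cases "d > 0")
    case True
    then have [simp]: "d = 1" using cases by simp
    have ev: "(\<forall>\<^sub>F y in at_right x. y \<in> B) \<Longrightarrow> \<exists>h. 0 < h \<and> h < \<delta> \<and> x + d * h \<in> B" for B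
    proof -
      assume "\<forall>\<^sub>F y in at_right x. y \<in> B"
      then obtain b where b: "b > x" "\<And>y. y > x \<Longrightarrow> y < b \<Longrightarrow> y \<in> B"
        unfolding eventually_at_right_field by blast
      define h where "h = min \<delta> (b - x) / 2"
      have "0 < h" "h < \<delta>" "h < b - x" using b(1) \<delta>(1) by (auto simp: h_def min_def)
      then show ?thesis using b(2)[of "x + h"] by auto
    qed
    have "\<forall>\<^sub>F y in at_right x. y \<in> A"
      unfolding eventually_at_right_field
    proof (intro exI[of _ "x + \<delta>"] conjI allI impI)
      fix y assume "x < y" "y < x + \<delta>"
      then show "y \<in> A" using self[of "y - x"] by simp
    qed (use \<delta>(1) in simp)
    then have "arc_out K x = A"
      unfolding arc_out_def using \<open>A \<in> short_arcs K\<close> ev uniq by (intro the_equality) blast+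
    then show ?thesis by (simp add: arc_side_def)
  next
    case False
    then have [simp]: "d = -1" using cases by simp
    have ev: "(\<forall>\<^sub>F y in at_left x. y \<in> B) \<Longrightarrow> \<exists>h. 0 < h \<and> h < \<delta> \<and> x + d * h \<in> B" for B
    proof -
      assume "\<forall>\<^sub>F y in at_left x. y \<in> B"
      then obtain b where b: "b < x" "\<And>y. y > b \<Longrightarrow> y < x \<Longrightarrow> y \<in> B"
        unfolding eventually_at_left_field by blast
      define h where "h = min \<delta> (x - b) / 2"
      have "0 < h" "h < \<delta>" "h < x - b" using b(1) \<delta>(1) by (auto simp: h_def min_def)
      then show ?thesis using b(2)[of "x - h"] by auto
    qed
    have "\<forall>\<^sub>F y in at_left x. y \<in> A"
      unfolding eventually_at_left_field
    proof (intro exI[of _ "x - \<delta>"] conjI allI impI)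
      fix y assume "x - \<delta> < y" "y < x"
      then show "y \<in> A" using self[of "x - y"] by simp
    qed (use \<delta>(1) in simp)
    then have "arc_in K x = A"
      unfolding arc_in_def using \<open>A \<in> short_arcs K\<close> ev uniq by (intro the_equality) blast+
    then show ?thesis by (simp add: arc_side_def)
  qed
  then show ?thesis using \<delta>(1) nb A by blast
qed

lemma arc_side_short_arc:
  assumes "virtual_knot_diagram K" "\<bar>d\<bar> = 1"
  shows "arc_side K x d \<in> short_arcs K"
proof -
  obtain \<delta> where \<delta>: "\<delta> > 0"
    "\<forall>h. 0 < h \<and> h < \<delta> \<longrightarrow> x + d * h \<notin> break_points K \<and> arc_through K (x + d * h) = arc_side K x d"
    using arc_side[OF assms] by blast
  have "0 < \<delta>/2" "\<delta>/2 < \<delta>" using \<delta>(1) by auto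
  then show ?thesis using \<delta>(2) short_arcs_arc_through by metis
qed

lemma arc_through_near:
  assumes K: "virtual_knot_diagram K" and x: "x \<notin> break_points K"
  shows "const_near (arc_through K) x"
proof -
  obtain \<delta> where \<delta>: "\<delta> > 0" "\<forall>y. \<bar>y - x\<bar> < \<delta> \<and> y \<noteq> x \<longrightarrow> y \<notin> break_points K"
    using break_points_discrete[OF K] by blast
  have "arc_through K y = arc_through K x" if "\<bar>y - x\<bar> < \<delta>" for y
  proof (intro arc_through_eq arc_through_segment equals0I)
    fix z assume z: "z \<in> closed_segment x y \<inter> break_points K"
    then have "\<bar>z - x\<bar> < \<delta>"
      using that by (auto simp: closed_segment_eq_real_ivl split: if_splits)
    moreover have "z \<noteq> x" using z x by auto
    ultimately show False using \<delta>(2) z by blast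
  qed
  then show ?thesis using \<delta>(1) unfolding const_near_def by blast
qed

lemma germ_arc_through:
  assumes "virtual_knot_diagram K" "\<bar>d\<bar> = 1"
  shows "germ (arc_through K) x d (arc_side K x d)"
  using arc_side[OF assms] unfolding germ_def by blast

lemma arc_side_through:
  assumes "virtual_knot_diagram K" "\<bar>d\<bar> = 1" "x \<notin> break_points K"
  shows "arc_side K x d = arc_through K x"
  using germ_unique[OF germ_arc_through[OF assms(1,2)] germ_const_near[OF arc_through_near[OF assms(1,3)] assms(2)]] .

lemma germ_comp: "germ c x d a \<Longrightarrow> germ (\<lambda>y. f (c y)) x d (f a)"
  unfolding germ_def by blast

lemma const_near_comp: "const_near c x \<Longrightarrow> const_near (\<lambda>y. f (c y)) x"
  unfolding const_near_def by metis

subsection \<open>Crossing relations\<close>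

definition t_inv_L :: laurent where "t_inv_L = Poly_Mapping.single (-1, 0, 0, 0, 0, 0) 1"
definition p_inv_L :: laurent where "p_inv_L = Poly_Mapping.single (0, 0, -1, 0, 0, 0) 1"

lemma single_0_eq_1: "Poly_Mapping.single (0, 0, 0, 0, 0, 0) 1 = (1 :: laurent)"
  by (metis single_one zero_prod_def)

lemma laurent_units:
  "t_L * t_inv_L = 1" "p_L * p_inv_L = 1" "s_L * s_inv_L = 1" "r_L * r_inv_L = 1"
  by (simp_all add: t_L_def t_inv_L_def p_L_def p_inv_L_def s_L_def s_inv_L_def r_L_def r_inv_L_def
      mult_single single_0_eq_1)

lemma al_unit: "\<exists>f. al n * f = 1" and be_unit: "\<exists>f. be n * f = 1"
  using laurent_units by (auto simp: al_def be_def intro: exI[of _ 1])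

context coeff_module
begin

lemma act_minus_right: "x \<in> carrier M \<Longrightarrow> act M f (\<ominus> x) = \<ominus> act M f x"
  by (simp add: act_def smult_r_minus)

lemma act_inverse_iff:
  assumes "f * g = 1" "x \<in> carrier M" "y \<in> carrier M"
  shows "y = act M g x \<longleftrightarrow> x = act M f y"
proof -
  have "g * f = 1" using assms(1) by (simp add: mult.commute)
  then show ?thesis using assms by (auto simp: act_act)
qed

text \<open>The relations of a negative crossing of type 0 turn into those of a positive one when
  incoming and outgoing arcs are exchanged. This is what allows a single
  \<open>crossing_relation\<close> for both signs.\<close>

lemma negative_crossing_iff:
  assumes "a \<in> carrier M" "a' \<in> carrier M" "b \<in> carrier M" "b' \<in> carrier M"
  shows "a' = act M s_inv_L a \<and> b' = act M r_inv_L b \<oplus> act M (- (r_inv_L * s_inv_L * w_L)) a \<longleftrightarrow>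
         a = act M s_L a' \<and> b = act M r_L b' \<oplus> act M w_L a'"
proof -
  have 1: "a' = act M s_inv_L a \<longleftrightarrow> a = act M s_L a'"
    using act_inverse_iff[OF laurent_units(3)] assms by blast
  have 2: "b' = act M r_inv_L b \<oplus> act M (- (r_inv_L * s_inv_L * w_L)) a \<longleftrightarrow>
      b = act M r_L b' \<oplus> act M w_L a'" if a': "a' = act M s_inv_L a"
  proof -
    have "act M (- (r_inv_L * s_inv_L * w_L)) a = \<ominus> act M (r_inv_L * w_L * s_inv_L) a"
      using assms by (simp add: act_minus mult.assoc mult.commute mult.left_commute)
    also have "\<dots> = act M r_inv_L (\<ominus> act M w_L a')"
      using assms by (simp add: a' act_act act_minus_right mult.assoc)
    finally have "act M r_inv_L b \<oplus> act M (- (r_inv_L * s_inv_L * w_L)) a =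
        act M r_inv_L (b \<ominus> act M w_L a')"
      using assms by (simp add: act_distr minus_eq)
    then have "b' = act M r_inv_L b \<oplus> act M (- (r_inv_L * s_inv_L * w_L)) a \<longleftrightarrow>
        b \<ominus> act M w_L a' = act M r_L b'"
      using act_inverse_iff[OF laurent_units(4), of "b \<ominus> act M w_L a'" b'] assms by simp
    also have "\<dots> \<longleftrightarrow> b = act M r_L b' \<oplus> act M w_L a'"
    proof
      assume "b \<ominus> act M w_L a' = act M r_L b'"
      then have "act M r_L b' \<oplus> act M w_L a' = b \<ominus> act M w_L a' \<oplus> act M w_L a'" by simp
      then show "b = act M r_L b' \<oplus> act M w_L a'"
        using assms by (simp add: minus_eq a_assoc l_neg)
    next
      assume "b = act M r_L b' \<oplus> act M w_L a'"
      then show "b \<ominus> act M w_L a' = act M r_L b'"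
        using assms by (simp add: minus_eq a_assoc r_neg)
    qed
    finally show ?thesis .
  qed
  show ?thesis using 1 2 by blast
qed

lemma minus_zero_iff: "x \<in> carrier M \<Longrightarrow> y \<in> carrier M \<Longrightarrow> x \<ominus> y = \<zero> \<longleftrightarrow> x = y"
proof
  assume "x \<in> carrier M" "y \<in> carrier M" "x \<ominus> y = \<zero>"
  then have "x \<ominus> y \<oplus> y = y" by simp
  then show "x = y" using \<open>x \<in> carrier M\<close> \<open>y \<in> carrier M\<close> by (simp add: minus_eq a_assoc l_neg)
qed (simp add: minus_eq r_neg)

end

lemma mod_hom_add:
  "mod_hom M N \<phi> \<Longrightarrow> x \<in> carrier M \<Longrightarrow> y \<in> carrier M \<Longrightarrow> \<phi> (x \<oplus>\<^bsub>M\<^esub> y) = \<phi> x \<oplus>\<^bsub>N\<^esub> \<phi> y"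
  by (simp add: mod_hom_def)

lemma mod_hom_closed: "mod_hom M N \<phi> \<Longrightarrow> x \<in> carrier M \<Longrightarrow> \<phi> x \<in> carrier N"
  by (auto simp: mod_hom_def)

lemma relator_zero_iff:
  assumes M: "coeff_module M" and F: "mod_hom (arc_module K) M F"
  defines "\<phi> \<equiv> \<lambda>a. F (free_gen coeff_ring (short_arcs K) a)"
  shows "F (relator K z \<alpha> y \<beta> x) = \<zero>\<^bsub>M\<^esub> \<longleftrightarrow> \<phi> z = act M \<alpha> (\<phi> y) \<oplus>\<^bsub>M\<^esub> act M \<beta> (\<phi> x)"
proof -
  interpret M: coeff_module M by fact
  interpret A: coeff_module "arc_module K" by (rule coeff_module_free)
  let ?g = "free_gen coeff_ring (short_arcs K)"
  have g [simp]: "?g a \<in> carrier (arc_module K)" for a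
    by (rule free_gen_closed[OF cring_coeff_ring])
  have \<phi> [simp]: "\<phi> a \<in> carrier M" for a unfolding \<phi>_def by (rule mod_hom_closed[OF F g])
  let ?r = "act (arc_module K) \<alpha> (?g y) \<oplus>\<^bsub>arc_module K\<^esub> act (arc_module K) \<beta> (?g x)"
  have r: "?r \<in> carrier (arc_module K)" by simp
  have 1: "F ?r = act M \<alpha> (\<phi> y) \<oplus>\<^bsub>M\<^esub> act M \<beta> (\<phi> x)"
    unfolding \<phi>_def by (simp only: mod_hom_add[OF F] mod_hom_act[OF F] A.act_closed g)
  have "relator K z \<alpha> y \<beta> x = ?g z \<ominus>\<^bsub>arc_module K\<^esub> ?r"
    by (simp only: relator_def act_def Let_def)
  then have "F (relator K z \<alpha> y \<beta> x) = \<phi> z \<ominus>\<^bsub>M\<^esub> (act M \<alpha> (\<phi> y) \<oplus>\<^bsub>M\<^esub> act M \<beta> (\<phi> x))"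
    unfolding 1[symmetric] using mod_hom_minus[OF coeff_module_free M F g r] by (simp only: \<phi>_def)
  then show ?thesis by (simp add: M.minus_zero_iff)
qed

text \<open>The bridge from the presentation to colorings: the arcs before and after a crossing
  become its left and right arcs, with directions given by multiples of the sign.\<close>

lemma crossing_relators_zero_iff:
  assumes K: "virtual_knot_diagram K" and c: "(v, u) \<in> crossings K"
    and M: "coeff_module M" and F: "mod_hom (arc_module K) M F"
  defines "\<phi> \<equiv> \<lambda>x d. F (free_gen coeff_ring (short_arcs K) (arc_side K x d))"
    and "\<sigma> \<equiv> crossing_sign K (v, u)"
  shows "(\<forall>\<rho>\<in>crossing_relators K (v, u). F \<rho> = \<zero>\<^bsub>M\<^esub>) \<longleftrightarrow>
    crossing_relation M (chord_type (crossings K) (v, u)) (\<phi> v (- \<sigma>)) (\<phi> v \<sigma>) (\<phi> u \<sigma>) (\<phi> u (- \<sigma>))"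
proof -
  interpret M: coeff_module M by fact
  let ?g = "\<lambda>a. F (free_gen coeff_ring (short_arcs K) a)"
  have g [simp]: "?g a \<in> carrier M" for a
    by (rule mod_hom_closed[OF F free_gen_closed[OF cring_coeff_ring]])
  have \<sigma>: "\<sigma> = (if positive K (v, u) then 1 else -1)"
    unfolding \<sigma>_def by (rule crossing_sign[OF K c])
  have sides: "\<phi> x 1 = ?g (arc_out K x)" "\<phi> x (-1) = ?g (arc_in K x)" for x
    by (simp_all add: \<phi>_def arc_side_def)
  have ty: "crossing_type K (v, u) = chord_type (crossings K) (v, u)" by (rule crossing_type_eq[OF K])
  have ty3: "chord_type (crossings K) (v, u) \<in> {0, 1, 2}" by (simp add: chord_type_def)
  note iff = relator_zero_iff[OF M F]
  show ?thesis
  proof (cases "chord_type (crossings K) (v, u) = 0")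
    case True
    then show ?thesis
      using M.negative_crossing_iff[of "?g (arc_in K v)" "?g (arc_out K v)" "?g (arc_in K u)" "?g (arc_out K u)"]
      by (auto simp: crossing_relators_def Let_def ty iff \<sigma> sides crossing_relation_def
          al_def be_def ga_def)
  next
    case False
    \<comment> \<open>At types 1 and 2 the overpass does not end a short arc, so its colours on both
      sides are that of the arc through \<open>v\<close>, in accordance with
      \<open>al = 1\<close>.\<close>
    have "v \<notin> break_points K"
    proof -
      have "frac v = v" using c by (simp add: crossings_def)
      moreover have "v \<notin> break_ends K"
      proof
        assume "v \<in> break_ends K"
        then obtain d where d: "d \<in> crossings K" "v = snd d \<or> crossing_type K d = 0 \<and> v = fst d"
          by (auto simp: break_ends_def)
        have "v \<noteq> u" using chord_set_crossings[OF K] c by (auto simp: chord_set_def)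
        have "v \<in> {fst d, snd d}" using d(2) by blast
        then have "{fst (v, u), snd (v, u)} \<inter> {fst d, snd d} \<noteq> {}" by auto
        then have d': "d = (v, u)" using chord_set_disjoint[OF chord_set_crossings[OF K] c d(1)] by blast
        show False using d(2) \<open>v \<noteq> u\<close> False ty unfolding d' by auto
      qed
      ultimately show ?thesis by (simp add: break_points_eq)
    qed
    then have "arc_out K v = arc_through K v" "arc_in K v = arc_through K v"
      using arc_side_through[OF K, of 1 v] arc_side_through[OF K, of "-1" v]
      by (simp_all add: arc_side_def)
    then show ?thesis
      using False ty3
      by (auto simp: crossing_relators_def Let_def ty iff \<sigma> sides crossing_relation_def
          al_def be_def ga_def)
  qed
qed

subsection \<open>The universal coloring\<close>

text \<open>At a break point \<open>arc_through\<close> is empty, which is no short arc, and the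
  value is the class of 0. This does no harm, because colorings are constrained only by their values
  next to crossings and at regular parameters.\<close>

definition universal_coloring :: "vdiagram \<Rightarrow> real \<Rightarrow> (real set \<Rightarrow> laurent set) set" where
  "universal_coloring K x = arc_class K (free_gen coeff_ring (short_arcs K) (arc_through K x))"

lemma coloring_universal:
  assumes K: "virtual_knot_diagram K"
  shows "coloring (knot_module K) (crossings K) (crossing_sign K) (universal_coloring K)"
  unfolding coloring_def
proof (intro conjI allI impI ballI)
  fix x
  show "universal_coloring K x \<in> carrier (knot_module K)"
    unfolding universal_coloring_def
    by (rule mod_hom_closed[OF mod_hom_arc_class free_gen_closed[OF cring_coeff_ring]])
  show "universal_coloring K (x + 1) = universal_coloring K x"
    by (simp add: universal_coloring_def arc_through_shift)
next
  fix x assume "frac x \<notin> chord_ends (crossings K)"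
  then have "x \<notin> break_points K" using break_ends_sub by (auto simp: break_points_eq)
  from const_near_comp[OF arc_through_near[OF K this]]
  show "const_near (universal_coloring K) x"
    by (simp add: universal_coloring_def[abs_def])
next
  fix c assume c: "c \<in> crossings K"
  obtain v u where [simp]: "c = (v, u)" by (cases c)
  let ?\<sigma> = "crossing_sign K (v, u)"
  let ?f = "\<lambda>a. arc_class K (free_gen coeff_ring (short_arcs K) a)"
  have \<sigma>: "\<bar>?\<sigma>\<bar> = 1" "\<bar>- ?\<sigma>\<bar> = 1" using crossing_sign[OF K c] by auto
  have g: "germ (universal_coloring K) x d (?f (arc_side K x d))" if "\<bar>d\<bar> = 1" for x d
    using germ_comp[OF germ_arc_through[OF K that], where f = ?f] by (simp add: universal_coloring_def[abs_def])
  have "crossing_relation (knot_module K) (chord_type (crossings K) (v, u))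
      (?f (arc_side K v (- ?\<sigma>))) (?f (arc_side K v ?\<sigma>)) (?f (arc_side K u ?\<sigma>)) (?f (arc_side K u (- ?\<sigma>)))"
    using crossing_relators_zero_iff[OF K _ coeff_module_knot mod_hom_arc_class, of v u] c arc_class_relator[of "(v, u)" K]
    by simp
  then show "case c of (v, u) \<Rightarrow> \<exists>aL aR bL bR.
      germ (universal_coloring K) v (- crossing_sign K (v, u)) aL \<and>
      germ (universal_coloring K) v (crossing_sign K (v, u)) aR \<and>
      germ (universal_coloring K) u (crossing_sign K (v, u)) bL \<and>
      germ (universal_coloring K) u (- crossing_sign K (v, u)) bR \<and>
      crossing_relation (knot_module K) (chord_type (crossings K) (v, u)) aL aR bL bR"
    using g \<sigma> by (simp only: prod.case \<open>c = (v, u)\<close>) blast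
qed

lemma germ_const_nearI:
  assumes "germ c x 1 a" "germ c x (-1) a" "c x = a"
  shows "const_near c x"
proof -
  obtain \<delta> where \<delta>: "\<delta> > 0" "\<And>h. 0 < h \<Longrightarrow> h < \<delta> \<Longrightarrow> c (x + 1 * h) = a"
    using assms(1) unfolding germ_def by blast
  obtain \<epsilon> where \<epsilon>: "\<epsilon> > 0" "\<And>h. 0 < h \<Longrightarrow> h < \<epsilon> \<Longrightarrow> c (x + -1 * h) = a"
    using assms(2) unfolding germ_def by blast
  have "c y = c x" if "\<bar>y - x\<bar> < min \<delta> \<epsilon>" for y
  proof -
    consider "y > x" | "y = x" | "y < x" by linarith
    then show ?thesis
    proof cases
      case 1
      then show ?thesis using \<delta>(2)[of "y - x"] that assms(3) by simp
    next
      case 3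
      then show ?thesis using \<epsilon>(2)[of "x - y"] that assms(3) by simp
    qed simp
  qed
  moreover have "min \<delta> \<epsilon> > 0" using \<delta>(1) \<epsilon>(1) by simp
  ultimately show ?thesis unfolding const_near_def by blast
qed

lemma coloring_germs:
  assumes "coloring M X \<sigma> c" "(v, u) \<in> X"
  obtains aL aR bL bR where
    "germ c v (- \<sigma> (v, u)) aL" "germ c v (\<sigma> (v, u)) aR" "germ c u (\<sigma> (v, u)) bL"
    "germ c u (- \<sigma> (v, u)) bR" "crossing_relation M (chord_type X (v, u)) aL aR bL bR"
  using assms unfolding coloring_def by fast

lemma germ_carrier:
  assumes "germ c x d a" "\<And>x. c x \<in> A"
  shows "a \<in> A"
proof -
  obtain \<delta> where \<delta>: "\<delta> > 0" "\<forall>h. 0 < h \<and> h < \<delta> \<longrightarrow> c (x + d * h) = a"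
    using assms(1) unfolding germ_def by blast
  have "c (x + d * (\<delta>/2)) = a" by (rule \<delta>(2)[rule_format]) (use \<delta>(1) in auto)
  then show ?thesis using assms(2) by metis
qed

text \<open>At a crossing of type 1 or 2 the colour does not change along the overpass.\<close>

lemma coloring_arc_const:
  assumes K: "virtual_knot_diagram K" and M: "coeff_module M"
    and c: "coloring M (crossings K) (crossing_sign K) c"
    and xy: "y \<in> arc_through K x" "frac x \<notin> chord_ends (crossings K)" "frac y \<notin> chord_ends (crossings K)"
  shows "c x = c y"
proof -
  interpret M: coeff_module M by fact
  let ?E = "chord_ends (crossings K)"
  \<comment> \<open>The values of \<open>c\<close> at chord ends are arbitrary. Replacing them by
    the values just before makes the function locally constant also at overpasses of types 1 and 2,
    so that it is constant along a whole segment without break points.\<close>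
  define c' where "c' z = (if frac z \<in> ?E then (THE a. germ c z (-1) a) else c z)" for z
  obtain k where k: "closed_segment (x + of_int k) y \<inter> break_points K = {}"
    using xy(1) by (auto simp: arc_through_iff)
  have eqn: "germ c' z d a" if g: "germ c z d a" and d: "\<bar>d\<bar> = 1" for z d a
  proof -
    have "finite ?E" using chord_set_crossings[OF K] finite_chord_ends by (auto simp: chord_set_def)
    from frac_discrete[OF this, of z] obtain \<delta> where
      \<delta>: "\<delta> > 0" "\<forall>y. \<bar>y - z\<bar> < \<delta> \<and> y \<noteq> z \<longrightarrow> frac y \<notin> ?E" by blast
    have "c' (z + d * h) = c (z + d * h)" if "0 < h" "h < \<delta>" for h
    proof -
      have "frac (z + d * h) \<notin> ?E"
        by (rule \<delta>(2)[rule_format]) (use that d in \<open>auto simp: abs_mult\<close>)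
      then show ?thesis by (simp add: c'_def)
    qed
    then show ?thesis by (rule germ_cong[OF g \<delta>(1)])
  qed
  have "const_near c' z" if z: "z \<in> closed_segment (x + of_int k) y" for z
  proof (cases "frac z \<in> ?E")
    case False
    then have "const_near c z" using c unfolding coloring_def by blast
    then have "germ c z 1 (c z)" "germ c z (-1) (c z)" using germ_const_near by fastforce+
    then show ?thesis using eqn False by (intro germ_const_nearI[of _ _ "c z"]) (auto simp: c'_def)
  next
    case True
    have "z \<notin> break_points K" using z k by blast
    then have nb: "frac z \<notin> break_ends K" by (simp add: break_points_eq)
    then obtain u where u: "(frac z, u) \<in> crossings K" "crossing_type K (frac z, u) \<noteq> 0"
      using True by (force simp: chord_ends_def break_ends_def)
    let ?\<sigma> = "crossing_sign K (frac z, u)"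
    obtain aL aR bL bR where g: "germ c (frac z) (- ?\<sigma>) aL" "germ c (frac z) ?\<sigma> aR"
        "crossing_relation M (chord_type (crossings K) (frac z, u)) aL aR bL bR"
      using coloring_germs[OF c u(1)] by metis
    have "aL \<in> carrier M" using germ_carrier[OF g(1)] coloring_carrier[OF c] by blast
    moreover have "al (chord_type (crossings K) (frac z, u)) = 1"
      using u(2) crossing_type_eq[OF K] by (simp add: al_def)
    ultimately have "aR = aL" using g(3) by (simp add: crossing_relation_def)
    moreover have "germ c (frac z) d a = germ c z d a" for d a
      using germ_shift[of c "frac z" "\<lfloor>z\<rfloor>" d a] c by (simp add: coloring_def frac_def)
    moreover have "?\<sigma> = 1 \<or> ?\<sigma> = -1" using crossing_sign[OF K u(1)] by auto
    ultimately have g: "germ c z 1 aL" "germ c z (-1) aL" using g by auto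
    have "(THE a. germ c z (-1) a) = aL" using g(2) germ_unique by (intro the_equality) auto
    then show ?thesis using eqn g True by (intro germ_const_nearI[of _ _ "aL"]) (auto simp: c'_def)
  qed
  then have "c' (x + of_int k) = c' y" by (rule const_segment)
  then show ?thesis using xy coloring_periodic[OF c] by (simp add: c'_def)
qed

lemma regular_near:
  assumes "virtual_knot_diagram K" "\<delta> > 0" "\<bar>d\<bar> = 1"
  shows "\<exists>h. 0 < h \<and> h < \<delta> \<and> frac (x + d * h) \<notin> chord_ends (crossings K)"
proof -
  have "finite (chord_ends (crossings K))"
    using chord_set_crossings[OF assms(1)] finite_chord_ends by (auto simp: chord_set_def)
  from frac_discrete[OF this, of x] obtain \<epsilon> where
    \<epsilon>: "\<epsilon> > 0" "\<forall>y. \<bar>y - x\<bar> < \<epsilon> \<and> y \<noteq> x \<longrightarrow> frac y \<notin> chord_ends (crossings K)" by blast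
  let ?h = "min \<delta> \<epsilon> / 2"
  have h: "0 < ?h" "?h < \<delta>" "?h < \<epsilon>" using \<epsilon>(1) assms(2) by auto
  have "frac (x + d * ?h) \<notin> chord_ends (crossings K)"
    by (rule \<epsilon>(2)[rule_format]) (use h assms(3) in \<open>auto simp: abs_mult\<close>)
  with h show ?thesis by blast
qed

text \<open>The arc does not change near any of its points, and chord ends are discrete, so a
  regular parameter is found close by.\<close>

lemma short_arc_regular_point:
  assumes K: "virtual_knot_diagram K" and A: "A \<in> short_arcs K"
  obtains x where "A = arc_through K x" "frac x \<notin> chord_ends (crossings K)"
proof -
  obtain y where y: "A = arc_through K y" "y \<notin> break_points K" using A by (auto simp: short_arcs_def)
  obtain \<delta> where \<delta>: "\<delta> > 0" "\<forall>z. \<bar>z - y\<bar> < \<delta> \<longrightarrow> arc_through K z = arc_through K y"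
    using arc_through_near[OF K y(2)] unfolding const_near_def by blast
  obtain h where "0 < h" "h < \<delta>" "frac (y + 1 * h) \<notin> chord_ends (crossings K)"
    using regular_near[OF K \<delta>(1), of 1 y] by auto
  then show ?thesis using that[of "y + h"] \<delta>(2)[rule_format, of "y + h"] y by simp
qed

text \<open>Existence in the universal property. A generator is sent to the value of
  \<open>c\<close> at any regular parameter of the arc; the choice does not matter by
  \<open>coloring_arc_const\<close>, and the relators vanish because their arcs can be sampled at
  regular points next to the crossing.\<close>

lemma universal_coloring_factor:
  assumes K: "virtual_knot_diagram K" and M: "coeff_module M"
    and c: "coloring M (crossings K) (crossing_sign K) c"
  shows "\<exists>\<phi>. mod_hom (knot_module K) M \<phi> \<and>
    (\<forall>x. frac x \<notin> chord_ends (crossings K) \<longrightarrow> \<phi> (universal_coloring K x) = c x)"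
proof -
  interpret M: coeff_module M by fact
  let ?E = "chord_ends (crossings K)"
  define g where "g A = c (SOME x. A = arc_through K x \<and> frac x \<notin> ?E)" for A
  have g: "g (arc_through K x) = c x" if x: "frac x \<notin> ?E" for x
  proof -
    let ?y = "SOME y. arc_through K x = arc_through K y \<and> frac y \<notin> ?E"
    have y: "arc_through K x = arc_through K ?y \<and> frac ?y \<notin> ?E"
      by (rule someI[of _ x]) (use x in simp)
    have "x \<in> arc_through K x"
      using x break_ends_sub by (intro arc_through_segment) (auto simp: break_points_eq)
    then have "x \<in> arc_through K ?y" using y by simp
    then have "c ?y = c x" using coloring_arc_const[OF K M c, of x ?y] y x by simp
    then show ?thesis by (simp add: g_def)
  qed
  have "g \<in> short_arcs K \<rightarrow> carrier M" using coloring_carrier[OF c] by (auto simp: g_def)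
  from M.free_module_universal[OF this] obtain F where F: "mod_hom (arc_module K) M F"
    "\<And>a. a \<in> short_arcs K \<Longrightarrow> F (free_gen coeff_ring (short_arcs K) a) = g a" by blast
  have "F \<rho> = \<zero>\<^bsub>M\<^esub>" if cr: "cr \<in> crossings K" and \<rho>: "\<rho> \<in> crossing_relators K cr" for cr \<rho>
  proof -
    obtain v u where [simp]: "cr = (v, u)" by (cases cr)
    let ?\<sigma> = "crossing_sign K (v, u)"
    have vu: "(v, u) \<in> crossings K" using cr by simp
    have side: "F (free_gen coeff_ring (short_arcs K) (arc_side K x d)) = a"
      if d: "\<bar>d\<bar> = 1" and ge: "germ c x d a" for x d a
    proof -
      obtain \<delta> where \<delta>: "\<delta> > 0" "\<forall>h. 0 < h \<and> h < \<delta> \<longrightarrow> arc_through K (x + d * h) = arc_side K x d"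
        using germ_arc_through[OF K d, of x] unfolding germ_def by blast
      obtain \<epsilon> where \<epsilon>: "\<epsilon> > 0" "\<forall>h. 0 < h \<and> h < \<epsilon> \<longrightarrow> c (x + d * h) = a"
        using ge unfolding germ_def by blast
      obtain h where h: "0 < h" "h < min \<delta> \<epsilon>" "frac (x + d * h) \<notin> ?E"
        using regular_near[OF K _ d, of "min \<delta> \<epsilon>" x] \<delta>(1) \<epsilon>(1) by auto
      have "g (arc_side K x d) = c (x + d * h)"
        using \<delta>(2)[rule_format, of h] h g[of "x + d * h"] by simp
      then show ?thesis
        using \<epsilon>(2)[rule_format, of h] h F(2)[OF arc_side_short_arc[OF K d]] by simp
    qed
    obtain aL aR bL bR where ge: "germ c v (- ?\<sigma>) aL" "germ c v ?\<sigma> aR" "germ c u ?\<sigma> bL" "germ c u (- ?\<sigma>) bR"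
        and rel: "crossing_relation M (chord_type (crossings K) (v, u)) aL aR bL bR"
      using coloring_germs[OF c vu] by metis
    have \<sigma>: "\<bar>?\<sigma>\<bar> = 1" "\<bar>- ?\<sigma>\<bar> = 1" using crossing_sign[OF K vu] by auto
    have "\<forall>\<rho>\<in>crossing_relators K (v, u). F \<rho> = \<zero>\<^bsub>M\<^esub>"
      unfolding crossing_relators_zero_iff[OF K vu M F(1)]
      using rel by (simp add: side[OF \<sigma>(2) ge(1)] side[OF \<sigma>(1) ge(2)] side[OF \<sigma>(1) ge(3)] side[OF \<sigma>(2) ge(4)])
    then show ?thesis using \<rho> by simp
  qed
  then have "\<exists>\<phi>. mod_hom (knot_module K) M \<phi> \<and> (\<forall>x\<in>carrier (arc_module K). \<phi> (arc_class K x) = F x)"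
    by (rule knot_module_universal[OF M F(1)])
  then obtain \<phi> where \<phi>: "mod_hom (knot_module K) M \<phi>"
    "\<forall>x\<in>carrier (arc_module K). \<phi> (arc_class K x) = F x" by blast
  have "\<phi> (universal_coloring K x) = c x" if x: "frac x \<notin> ?E" for x
  proof -
    have "arc_through K x \<in> short_arcs K"
      using x break_ends_sub by (intro short_arcs_arc_through) (auto simp: break_points_eq)
    then show ?thesis
      using \<phi>(2)[rule_format, OF free_gen_closed[OF cring_coeff_ring]] F(2) g[OF x]
      by (simp add: universal_coloring_def)
  qed
  with \<phi>(1) show ?thesis by blast
qed

text \<open>Uniqueness in the universal property: the classes of short arcs generate the module, and
  each of them is a value of the universal coloring at a regular parameter.\<close>

lemma universal_coloring_hom_eq:
  assumes K: "virtual_knot_diagram K" and M: "coeff_module M"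
    and \<phi>: "mod_hom (knot_module K) M \<phi>" and \<psi>: "mod_hom (knot_module K) M \<psi>"
    and eq: "\<And>x. frac x \<notin> chord_ends (crossings K) \<Longrightarrow>
      \<phi> (universal_coloring K x) = \<psi> (universal_coloring K x)"
    and z: "z \<in> carrier (knot_module K)"
  shows "\<phi> z = \<psi> z"
proof (rule knot_module_hom_eq[OF M \<phi> \<psi> _ z])
  fix a assume "a \<in> short_arcs K"
  then obtain x where "a = arc_through K x" "frac x \<notin> chord_ends (crossings K)"
    using short_arc_regular_point[OF K] by blast
  then show "\<phi> (arc_class K (free_gen coeff_ring (short_arcs K) a)) =
      \<psi> (arc_class K (free_gen coeff_ring (short_arcs K) a))"
    using eq by (simp add: universal_coloring_def)
qed

lemma crossing_relation_hom:
  assumes "mod_hom M N \<phi>" "aL \<in> carrier M" "bR \<in> carrier M"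
    and "crossing_relation M n aL aR bL bR" "coeff_module M"
  shows "crossing_relation N n (\<phi> aL) (\<phi> aR) (\<phi> bL) (\<phi> bR)"
proof -
  interpret M: coeff_module M by fact
  have "\<phi> (act M (be n) bR \<oplus>\<^bsub>M\<^esub> act M (ga n) aL) = \<phi> (act M (be n) bR) \<oplus>\<^bsub>N\<^esub> \<phi> (act M (ga n) aL)"
    by (rule mod_hom_add[OF assms(1)]) (simp_all add: assms(2,3))
  then show ?thesis
    using assms(2-4) by (simp add: crossing_relation_def mod_hom_act[OF assms(1)])
qed

lemma coloring_hom:
  assumes c: "coloring M X \<sigma> c" and \<phi>: "mod_hom M N \<phi>" and M: "coeff_module M"
  shows "coloring N X \<sigma> (\<lambda>x. \<phi> (c x))"
  unfolding coloring_def
proof (intro conjI allI impI ballI)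
  fix x
  show "\<phi> (c x) \<in> carrier N" by (rule mod_hom_closed[OF \<phi> coloring_carrier[OF c]])
  show "\<phi> (c (x + 1)) = \<phi> (c x)" using c by (simp add: coloring_def)
next
  fix x assume "frac x \<notin> chord_ends X"
  then show "const_near (\<lambda>x. \<phi> (c x)) x" using c const_near_comp unfolding coloring_def by blast
next
  fix cr assume "cr \<in> X"
  then obtain v u where vu [simp]: "cr = (v, u)" "(v, u) \<in> X" by (cases cr) auto
  obtain aL aR bL bR where ge: "germ c v (- \<sigma> (v, u)) aL" "germ c v (\<sigma> (v, u)) aR"
      "germ c u (\<sigma> (v, u)) bL" "germ c u (- \<sigma> (v, u)) bR"
      and rel: "crossing_relation M (chord_type X (v, u)) aL aR bL bR"
    using coloring_germs[OF c vu(2)] by metis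
  have "aL \<in> carrier M" "bR \<in> carrier M"
    using germ_carrier[OF ge(1)] germ_carrier[OF ge(4)] coloring_carrier[OF c] by blast+
  note crossing_relation_hom[OF \<phi> this rel M]
  then show "case cr of (v, u) \<Rightarrow> \<exists>aL aR bL bR.
      germ (\<lambda>x. \<phi> (c x)) v (- \<sigma> (v, u)) aL \<and> germ (\<lambda>x. \<phi> (c x)) v (\<sigma> (v, u)) aR \<and>
      germ (\<lambda>x. \<phi> (c x)) u (\<sigma> (v, u)) bL \<and> germ (\<lambda>x. \<phi> (c x)) u (- \<sigma> (v, u)) bR \<and>
      crossing_relation N (chord_type X (v, u)) aL aR bL bR"
    using ge[THEN germ_comp, of \<phi>] by (simp only: prod.case vu(1)) blast
qed

text \<open>
  Colorings of \<open>K\<close> in \<open>M\<close> correspond to homomorphisms \<open>N(K) \<rightarrow> M\<close>, so \<open>N(K)\<close> is determined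
  by its colorings (Yoneda). The parameters \<open>e i\<close> of \<open>K\<close> and \<open>e' i\<close> of \<open>K'\<close> are matched.
\<close>

lemma knot_module_isomorphicI:
  fixes e e' :: "'i \<Rightarrow> real"
  assumes K: "virtual_knot_diagram K" and K': "virtual_knot_diagram K'"
    and e: "\<And>i. i \<in> I \<Longrightarrow> frac (e i) \<notin> chord_ends (crossings K)"
    and e': "\<And>i. i \<in> I \<Longrightarrow> frac (e' i) \<notin> chord_ends (crossings K')"
    and ext: "\<And>(M :: (laurent set, (real set \<Rightarrow> laurent set) set) module) c.
      coeff_module M \<Longrightarrow> coloring M (crossings K) (crossing_sign K) c \<Longrightarrow>
      \<exists>c'. coloring M (crossings K') (crossing_sign K') c' \<and> (\<forall>i\<in>I. c' (e' i) = c (e i))"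
    and ext': "\<And>(M :: (laurent set, (real set \<Rightarrow> laurent set) set) module) c'.
      coeff_module M \<Longrightarrow> coloring M (crossings K') (crossing_sign K') c' \<Longrightarrow>
      \<exists>c. coloring M (crossings K) (crossing_sign K) c \<and> (\<forall>i\<in>I. c (e i) = c' (e' i))"
    and uniq: "\<And>(M :: (laurent set, (real set \<Rightarrow> laurent set) set) module) c1 c2 x.
      coeff_module M \<Longrightarrow> coloring M (crossings K) (crossing_sign K) c1 \<Longrightarrow>
      coloring M (crossings K) (crossing_sign K) c2 \<Longrightarrow> (\<And>i. i \<in> I \<Longrightarrow> c1 (e i) = c2 (e i)) \<Longrightarrow>
      frac x \<notin> chord_ends (crossings K) \<Longrightarrow> c1 x = c2 x"
    and uniq': "\<And>(M :: (laurent set, (real set \<Rightarrow> laurent set) set) module) c1 c2 x.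
      coeff_module M \<Longrightarrow> coloring M (crossings K') (crossing_sign K') c1 \<Longrightarrow>
      coloring M (crossings K') (crossing_sign K') c2 \<Longrightarrow> (\<And>i. i \<in> I \<Longrightarrow> c1 (e' i) = c2 (e' i)) \<Longrightarrow>
      frac x \<notin> chord_ends (crossings K') \<Longrightarrow> c1 x = c2 x"
  shows "module_isomorphic coeff_ring (knot_module K) (knot_module K')"
proof -
  let ?u = "universal_coloring K" and ?u' = "universal_coloring K'"
  note u = coloring_universal[OF K] and u' = coloring_universal[OF K']
  note N = coeff_module_knot
  obtain c' where c': "coloring (knot_module K) (crossings K') (crossing_sign K') c'"
      "\<And>i. i \<in> I \<Longrightarrow> c' (e' i) = ?u (e i)"
    using ext[OF N u] by blast
  obtain c where c: "coloring (knot_module K') (crossings K) (crossing_sign K) c"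
      "\<And>i. i \<in> I \<Longrightarrow> c (e i) = ?u' (e' i)"
    using ext'[OF N u'] by blast
  obtain \<psi> where \<psi>: "mod_hom (knot_module K') (knot_module K) \<psi>"
      "\<And>x. frac x \<notin> chord_ends (crossings K') \<Longrightarrow> \<psi> (?u' x) = c' x"
    using universal_coloring_factor[OF K' N c'(1)] by blast
  obtain \<phi> where \<phi>: "mod_hom (knot_module K) (knot_module K') \<phi>"
      "\<And>x. frac x \<notin> chord_ends (crossings K) \<Longrightarrow> \<phi> (?u x) = c x"
    using universal_coloring_factor[OF K N c(1)] by blast
  have "(\<psi> \<circ> \<phi>) z = id z" if "z \<in> carrier (knot_module K)" for z
  proof (rule universal_coloring_hom_eq[OF K N mod_hom_comp[OF \<phi>(1) \<psi>(1)] mod_hom_id _ that])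
    fix x assume x: "frac x \<notin> chord_ends (crossings K)"
    \<comment> \<open>Applying both homomorphisms to the universal coloring gives again a coloring
      of \<open>K\<close>. It has the same values at the matched parameters, so by uniqueness it is
      the universal coloring itself.\<close>
    have "\<psi> (\<phi> (?u x)) = ?u x"
      by (rule uniq[OF N coloring_hom[OF coloring_hom[OF u \<phi>(1) N] \<psi>(1) N] u _ x])
         (simp add: \<phi>(2) \<psi>(2) e e' c(2) c'(2))
    then show "(\<psi> \<circ> \<phi>) (?u x) = id (?u x)" by simp
  qed
  moreover have "(\<phi> \<circ> \<psi>) z = id z" if "z \<in> carrier (knot_module K')" for z
  proof (rule universal_coloring_hom_eq[OF K' N mod_hom_comp[OF \<psi>(1) \<phi>(1)] mod_hom_id _ that])
    fix x assume x: "frac x \<notin> chord_ends (crossings K')"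
    have "\<phi> (\<psi> (?u' x)) = ?u' x"
      by (rule uniq'[OF N coloring_hom[OF coloring_hom[OF u' \<psi>(1) N] \<phi>(1) N] u' _ x])
         (simp add: \<phi>(2) \<psi>(2) e e' c(2) c'(2))
    then show "(\<phi> \<circ> \<psi>) (?u' x) = id (?u' x)" by simp
  qed
  ultimately show ?thesis by (intro module_isomorphicI[OF \<phi>(1) \<psi>(1)]) simp_all
qed

section \<open>Moves that preserve the chord diagram\<close>

lemma coloring_cong:
  assumes "\<And>d. d \<in> X \<Longrightarrow> \<sigma> d = \<sigma>' d"
  shows "coloring M X \<sigma> c \<longleftrightarrow> coloring M X \<sigma>' c"
  unfolding coloring_def by (intro conj_cong refl ball_cong) (clarsimp simp: assms)

text \<open>The notion of a coloring sees a diagram only through its chords and their signs, so the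
  same functions are colorings of both diagrams.\<close>

lemma isomorphic_same_chords:
  assumes K: "virtual_knot_diagram K" and K': "virtual_knot_diagram K'"
    and X: "crossings K' = crossings K"
    and \<sigma>: "\<And>c. c \<in> crossings K \<Longrightarrow> crossing_sign K' c = crossing_sign K c"
  shows "module_isomorphic coeff_ring (knot_module K) (knot_module K')"
proof (rule knot_module_isomorphicI[OF K K', where I = "{x. frac x \<notin> chord_ends (crossings K)}"
      and e = "\<lambda>x. x" and e' = "\<lambda>x. x"])
  fix M :: "(laurent set, (real set \<Rightarrow> laurent set) set) module" and c
  have "coloring M (crossings K) (crossing_sign K) c \<longleftrightarrow> coloring M (crossings K') (crossing_sign K') c" for c
    unfolding X by (rule coloring_cong) (simp add: \<sigma>)
  then show "coloring M (crossings K) (crossing_sign K) c \<Longrightarrow>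
      \<exists>c'. coloring M (crossings K') (crossing_sign K') c' \<and>
        (\<forall>i\<in>{x. frac x \<notin> chord_ends (crossings K)}. c' i = c i)"
    and "coloring M (crossings K') (crossing_sign K') c \<Longrightarrow>
      \<exists>c'. coloring M (crossings K) (crossing_sign K) c' \<and>
        (\<forall>i\<in>{x. frac x \<notin> chord_ends (crossings K)}. c' i = c i)"
    by blast+
qed (auto simp: X)

lemma curve_has_velocity:
  assumes "virtual_knot_diagram K"
  shows "(curve K has_vector_derivative velocity K x) (at x)"
proof -
  have "curve K differentiable at x"
    using virtual_knot_diagramD(2)[OF assms]
    by (auto simp: C1_differentiable_on_def differentiable_def has_vector_derivative_def)
  then show ?thesis unfolding velocity_def by (simp add: vector_derivative_works)
qed

subsection \<open>Planar isotopies\<close>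

lemma det2_linear:
  assumes "linear L"
  shows "det2 (L v) (L w) = det2 (L 1) (L \<i>) * det2 v w"
proof -
  interpret linear L by fact
  have "L z = Re z *\<^sub>R L 1 + Im z *\<^sub>R L \<i>" for z
  proof -
    have "z = Re z *\<^sub>R 1 + Im z *\<^sub>R \<i>" by (simp add: complex_eq_iff)
    then show ?thesis by (metis add scale)
  qed
  from this[of v] this[of w] show ?thesis by (simp add: det2_def algebra_simps)
qed

lemma det2_bij_nonzero:
  assumes "linear L" "bij L"
  shows "det2 (L 1) (L \<i>) \<noteq> 0"
proof -
  obtain v w where "L v = 1" "L w = \<i>" using assms(2) unfolding bij_def surj_def by metis
  then show ?thesis using det2_linear[OF assms(1), of v w] by (auto simp: det2_def)
qed

text \<open>The Jacobian determinant is 1 at time 0, depends continuously on time and never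
  vanishes, so by the intermediate value theorem it is still positive at time 1. Hence isotopies
  preserve the signs of crossings.\<close>

lemma isotopy_det_pos:
  assumes "plane_isotopy H"
  obtains L where "\<And>z. (H 1 has_derivative L z) (at z)" "\<And>z. linear (L z)"
    "\<And>z. det2 (L z 1) (L z \<i>) > 0"
proof -
  from assms obtain H' :: "real \<Rightarrow> complex \<Rightarrow> complex \<Rightarrow>\<^sub>L complex" where
    H0: "\<And>z. H 0 z = z"
    and D: "\<And>\<tau> z. \<tau> \<in> {0..1} \<Longrightarrow> (H \<tau> has_derivative blinfun_apply (H' \<tau> z)) (at z)"
    and B: "\<And>\<tau> z. \<tau> \<in> {0..1} \<Longrightarrow> bij (blinfun_apply (H' \<tau> z))"
    and C: "continuous_on ({0..1} \<times> UNIV) (\<lambda>(\<tau>, z). H' \<tau> z)"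
    unfolding plane_isotopy_def by blast
  have lin: "linear (blinfun_apply (H' \<tau> z))" for \<tau> z
    by (rule bounded_linear.linear) (rule blinfun.bounded_linear_right)
  have "det2 (H' 1 z 1) (H' 1 z \<i>) > 0" for z
  proof (rule ccontr)
    let ?D = "\<lambda>\<tau>. det2 (H' \<tau> z 1) (H' \<tau> z \<i>)"
    assume "\<not> ?D 1 > 0"
    have "continuous_on {0..1} (\<lambda>\<tau>. (\<lambda>(\<tau>, z). H' \<tau> z) (\<tau>, z))"
      by (rule continuous_on_compose2[OF C]) (auto intro!: continuous_intros)
    then have c: "continuous_on {0..1} (\<lambda>\<tau>. H' \<tau> z)" by simp
    have "continuous_on {0..1} ?D"
      unfolding det2_def by (intro continuous_intros blinfun.continuous_on c)
    moreover have "?D 0 = 1"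
    proof -
      have "H 0 = (\<lambda>z. z)" using H0 by auto
      then have "((\<lambda>z. z) has_derivative blinfun_apply (H' 0 z)) (at z)" using D[of 0 z] by simp
      then have "blinfun_apply (H' 0 z) = (\<lambda>h. h)"
        using has_derivative_unique[OF _ has_derivative_ident] by blast
      then show ?thesis by (simp add: det2_def)
    qed
    ultimately obtain \<tau> where "0 \<le> \<tau>" "\<tau> \<le> 1" "?D \<tau> = 0"
      using IVT2'[of ?D 1 0 0] \<open>\<not> ?D 1 > 0\<close> by auto
    then show False using det2_bij_nonzero[OF lin B, of \<tau> z] by simp
  qed
  then show ?thesis using that[of "\<lambda>z. blinfun_apply (H' 1 z)"] D[of 1] lin by simp
qed

lemma isomorphic_planar_isotopic:
  assumes K: "virtual_knot_diagram K" and K': "virtual_knot_diagram K'" and "planar_isotopic K K'"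
  shows "module_isomorphic coeff_ring (knot_module K) (knot_module K')"
proof -
  from assms(3) obtain H where H: "plane_isotopy H"
    and cv: "curve K' = H 1 \<circ> curve K" and ov: "over K' = over K"
    unfolding planar_isotopic_def by blast
  from H have "inj (H 1)" unfolding plane_isotopy_def bij_def by auto
  then have "double_point K' x y \<longleftrightarrow> double_point K x y" for x y
    by (auto simp: double_point_def cv inj_def)
  then have X: "crossings K' = crossings K" by (simp add: crossings_def ov)
  obtain L where L: "\<And>z. (H 1 has_derivative L z) (at z)" "\<And>z. linear (L z)"
    "\<And>z. det2 (L z 1) (L z \<i>) > 0" using isotopy_det_pos[OF H] by blast
  have vel: "velocity K' x = L (curve K x) (velocity K x)" for x
  proof -
    have "(curve K has_derivative (\<lambda>h. h *\<^sub>R velocity K x)) (at x)"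
      using curve_has_velocity[OF K] by (simp add: has_vector_derivative_def)
    from has_derivative_compose[OF this L(1)]
    have "(curve K' has_derivative (\<lambda>h. L (curve K x) (h *\<^sub>R velocity K x))) (at x)"
      by (simp add: cv o_def)
    then have "(curve K' has_vector_derivative L (curve K x) (velocity K x)) (at x)"
      using L(2) by (simp add: has_vector_derivative_def linear_cmul)
    then show ?thesis unfolding velocity_def by (rule vector_derivative_at)
  qed
  show ?thesis
  proof (rule isomorphic_same_chords[OF K K' X])
    fix c assume "c \<in> crossings K"
    then obtain v u where [simp]: "c = (v, u)" and "curve K v = curve K u"
      by (auto simp: crossings_def double_point_def)
    then show "crossing_sign K' c = crossing_sign K c"
      using L(3)[of "curve K u"] det2_linear[OF L(2), of "curve K u" "velocity K v" "velocity K u"]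
      by (simp add: crossing_sign_def vel sgn_mult)
  qed
qed

subsection \<open>Detour moves\<close>

text \<open>At an end of a replaced branch the two curves agree on one side only. Agreement at
  points accumulating at \<open>x\<close> is already enough: a nonzero difference of derivatives
  would separate the curves at nearby points.\<close>

lemma vector_derivative_eq_if_agree:
  fixes f g :: "real \<Rightarrow> 'a :: real_normed_vector"
  assumes f: "(f has_vector_derivative D) (at x)" and g: "(g has_vector_derivative D') (at x)"
    and eq: "f x = g x" "\<And>\<delta>. \<delta> > 0 \<Longrightarrow> \<exists>y. y \<noteq> x \<and> \<bar>y - x\<bar> < \<delta> \<and> f y = g y"
  shows "D = D'"
proof (rule ccontr)
  assume "D \<noteq> D'"
  then have pos: "norm (D - D') / 2 > 0" by simp
  have "((\<lambda>y. f y - g y) has_derivative (\<lambda>h. h *\<^sub>R (D - D'))) (at x)"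
    using has_vector_derivative_diff[OF f g] by (simp add: has_vector_derivative_def)
  then obtain \<delta> where \<delta>: "\<delta> > 0" "\<And>y. norm (y - x) < \<delta> \<Longrightarrow>
      norm ((f y - g y) - (f x - g x) - (y - x) *\<^sub>R (D - D')) \<le> norm (D - D') / 2 * norm (y - x)"
    using pos unfolding has_derivative_at_alt by blast
  obtain y where y: "y \<noteq> x" "\<bar>y - x\<bar> < \<delta>" "f y = g y" using eq(2)[OF \<delta>(1)] by blast
  then have "\<bar>y - x\<bar> * norm (D - D') \<le> norm (D - D') / 2 * \<bar>y - x\<bar>"
    using \<delta>(2)[of y] eq(1) by simp
  moreover have "\<bar>y - x\<bar> * norm (D - D') > 0" using y(1) \<open>D \<noteq> D'\<close> by simp
  ultimately show False by (simp add: mult.commute)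
qed

lemma velocity_eq_if_agree:
  assumes "virtual_knot_diagram K" "virtual_knot_diagram K'" "curve K x = curve K' x"
    and "\<And>\<delta>. \<delta> > 0 \<Longrightarrow> \<exists>y. y \<noteq> x \<and> \<bar>y - x\<bar> < \<delta> \<and> curve K y = curve K' y"
  shows "velocity K x = velocity K' x"
  using vector_derivative_eq_if_agree[OF curve_has_velocity[OF assms(1)] curve_has_velocity[OF assms(2)] assms(3,4)] .

lemma isomorphic_detour:
  assumes K: "virtual_knot_diagram K" and K': "virtual_knot_diagram K'" and "detour_move K K'"
  shows "module_isomorphic coeff_ring (knot_module K) (knot_module K')"
proof -
  from assms(3) obtain a b where ab: "0 < a" "a < b" "b < 1"
    and agree: "\<And>x. x \<in> {0..1} - {a<..<b} \<Longrightarrow> curve K' x = curve K x"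
    and ov: "over K' = over K"
    and cr: "\<And>v u. (v, u) \<in> crossings K \<union> crossings K' \<Longrightarrow> v \<notin> {a<..<b} \<and> u \<notin> {a<..<b}"
    unfolding detour_move_def by blast
  have dp: "curve K' v = curve K v \<and> curve K' u = curve K u" if "(v, u) \<in> crossings K \<union> crossings K'" for v u
    using that cr[OF that] agree by (auto simp: crossings_def)
  have "(v, u) \<in> crossings K' \<longleftrightarrow> (v, u) \<in> crossings K" for v u
    using dp[of v u] by (auto simp: crossings_def double_point_def ov)
  then have X: "crossings K' = crossings K" by auto
  have vel: "velocity K' x = velocity K x" if x: "x \<in> {0..<1} - {a<..<b}" for x
  proof (rule velocity_eq_if_agree[OF K' K])
    show "curve K' x = curve K x" using x by (intro agree) auto
    fix \<delta> :: real assume \<delta>: "\<delta> > 0"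
    \<comment> \<open>Agreement is known only within \<open>{0..1}\<close> and off the branch. The
      point is taken to the right of \<open>x\<close>, which also works at 0, except for
      \<open>x = a\<close>, where the branch lies on the right.\<close>
    show "\<exists>y. y \<noteq> x \<and> \<bar>y - x\<bar> < \<delta> \<and> curve K' y = curve K y"
    proof (cases "x < a")
      case True
      define h where "h = min \<delta> (a - x) / 2"
      have "0 < h" "h < \<delta>" "h < a - x" using True \<delta> by (auto simp: h_def min_def)
      then show ?thesis using x ab by (intro exI[of _ "x + h"]) (auto intro!: agree)
    next
      case False
      show ?thesis
      proof (cases "x = a")
        case True
        define h where "h = min \<delta> a / 2"
        have "0 < h" "h < \<delta>" "h < a" using ab \<delta> by (auto simp: h_def min_def)
        then show ?thesis using True ab by (intro exI[of _ "x - h"]) (auto intro!: agree)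
      next
        case False
        then have "x \<ge> b" using x \<open>\<not> x < a\<close> by auto
        define h where "h = min \<delta> (1 - x) / 2"
        have "0 < h" "h < \<delta>" "h < 1 - x" using x \<delta> by (auto simp: h_def min_def)
        then show ?thesis using x ab \<open>x \<ge> b\<close> by (intro exI[of _ "x + h"]) (auto intro!: agree)
      qed
    qed
  qed
  show ?thesis
  proof (rule isomorphic_same_chords[OF K K' X])
    fix c assume c: "c \<in> crossings K"
    obtain v u where [simp]: "c = (v, u)" by (cases c)
    have "v \<in> {0..<1} - {a<..<b}" "u \<in> {0..<1} - {a<..<b}"
      using c cr[of v u] by (auto simp: crossings_def)
    then show "crossing_sign K' c = crossing_sign K c" by (simp add: crossing_sign_def vel)
  qed
qed

subsection \<open>Reparametrizations\<close>

text \<open>The lift to the real line of an orientation preserving homeomorphism of the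
  circle.\<close>

definition circle_map :: "(real \<Rightarrow> real) \<Rightarrow> bool" where
  "circle_map \<phi> \<longleftrightarrow> strict_mono \<phi> \<and> surj \<phi> \<and> (\<forall>x. \<phi> (x + 1) = \<phi> x + 1)"

lemma circle_map_add_int:
  assumes "circle_map \<phi>"
  shows "\<phi> (x + of_int k) = \<phi> x + of_int k"
  using periodic_int[of "\<lambda>x. \<phi> x - x" x k] assms by (simp add: circle_map_def)

lemma circle_map_frac: "circle_map \<phi> \<Longrightarrow> frac (\<phi> (frac x)) = frac (\<phi> x)"
  using circle_map_add_int[of \<phi> x "- \<lfloor>x\<rfloor>"] frac_add_of_int_right[of "\<phi> x" "- \<lfloor>x\<rfloor>"]
  by (simp add: frac_def)

lemma circle_map_less_iff: "circle_map \<phi> \<Longrightarrow> \<phi> x < \<phi> y \<longleftrightarrow> x < y"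
  and circle_map_eq_iff: "circle_map \<phi> \<Longrightarrow> \<phi> x = \<phi> y \<longleftrightarrow> x = y"
  by (simp_all add: circle_map_def strict_mono_less strict_mono_eq)

lemma circle_map_inv:
  assumes "circle_map \<phi>"
  shows "circle_map (inv_into UNIV \<phi>)" "inv_into UNIV \<phi> (\<phi> x) = x" "\<phi> (inv_into UNIV \<phi> x) = x"
proof -
  have inj: "inj \<phi>" using assms strict_mono_eq by (auto simp: circle_map_def inj_def)
  then show 1: "inv_into UNIV \<phi> (\<phi> x) = x" for x by simp
  show 2: "\<phi> (inv_into UNIV \<phi> x) = x" for x using assms by (simp add: circle_map_def surj_f_inv_f)
  show "circle_map (inv_into UNIV \<phi>)"
    unfolding circle_map_def
  proof (intro conjI allI)
    show "strict_mono (inv_into UNIV \<phi>)"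
      using 2 circle_map_less_iff[OF assms] by (metis strict_mono_def)
    show "surj (inv_into UNIV \<phi>)" using 1 by (metis surjI)
    fix x show "inv_into UNIV \<phi> (x + 1) = inv_into UNIV \<phi> x + 1"
      using assms 1 2 by (metis circle_map_def)
  qed
qed

lemma circle_map_diff_Ints:
  assumes "circle_map \<phi>"
  shows "\<phi> x - \<phi> y \<in> \<int> \<longleftrightarrow> x - y \<in> \<int>"
proof
  assume "\<phi> x - \<phi> y \<in> \<int>"
  then obtain k :: int where "\<phi> x - \<phi> y = of_int k" by (auto elim: Ints_cases)
  then have "\<phi> x = \<phi> (y + of_int k)" using circle_map_add_int[OF assms, of y k] by simp
  then have "x = y + of_int k" using circle_map_eq_iff[OF assms] by blast
  then show "x - y \<in> \<int>" by simp
next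
  assume "x - y \<in> \<int>"
  then obtain k :: int where "x - y = of_int k" by (auto elim: Ints_cases)
  then have "x = y + of_int k" by simp
  then show "\<phi> x - \<phi> y \<in> \<int>" using circle_map_add_int[OF assms, of y k] by simp
qed

lemma frac_eq_iff_diff_Ints: "frac x = frac y \<longleftrightarrow> x - y \<in> \<int>" for x y :: real
  using frac_unique_iff[of x "frac y"] frac_lt_1[of y]
  by (simp add: frac_diff_eq) (metis frac_diff_simp frac_eq_0_iff frac_neg_frac diff_conv_add_uminus)

lemma germ_circle_map:
  assumes "circle_map \<phi>" "germ c (\<phi> x) d a" "\<bar>d\<bar> = 1"
  shows "germ (\<lambda>y. c (\<phi> y)) x d a"
proof -
  obtain \<delta> where \<delta>: "\<delta> > 0" "\<forall>h. 0 < h \<and> h < \<delta> \<longrightarrow> c (\<phi> x + d * h) = a"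
    using assms(2) unfolding germ_def by blast
  have d: "d = 1 \<or> d = -1" using assms(3) by auto
  \<comment> \<open>A circle map preserves sides but not distances: the admissible neighbourhood of
    \<open>x\<close> is bounded by the preimage of the point at distance \<open>\<delta>\<close>
    from \<open>\<phi> x\<close>.\<close>
  define y where "y = inv_into UNIV \<phi> (\<phi> x + d * \<delta>)"
  have \<phi>y: "\<phi> y = \<phi> x + d * \<delta>" unfolding y_def by (rule circle_map_inv(3)[OF assms(1)])
  note less = circle_map_less_iff[OF assms(1)]
  have "c (\<phi> (x + d * h)) = a" if h: "0 < h" "h < d * (y - x)" for h
  proof -
    have "0 < d * (\<phi> (x + d * h) - \<phi> x) \<and> d * (\<phi> (x + d * h) - \<phi> x) < \<delta>"
      using d
    proof
      assume "d = 1"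
      then have "\<phi> x < \<phi> (x + h)" "\<phi> (x + h) < \<phi> y" unfolding less using h by simp_all
      then show ?thesis using \<phi>y \<open>d = 1\<close> by simp
    next
      assume "d = -1"
      then have "\<phi> (x - h) < \<phi> x" "\<phi> y < \<phi> (x - h)" unfolding less using h by simp_all
      then show ?thesis using \<phi>y \<open>d = -1\<close> by simp
    qed
    then have "c (\<phi> x + d * (d * (\<phi> (x + d * h) - \<phi> x))) = a" using \<delta>(2) by blast
    moreover have "d * d = 1" using d by auto
    then have "d * (d * z) = z" for z by (simp flip: mult.assoc)
    ultimately show ?thesis by simp
  qed
  moreover have "0 < d * (y - x)"
    using d
  proof
    assume "d = 1"
    then have "x < y" unfolding less[of x y, symmetric] using \<phi>y \<delta>(1) by simp
    then show ?thesis using \<open>d = 1\<close> by simp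
  next
    assume "d = -1"
    then have "y < x" unfolding less[of y x, symmetric] using \<phi>y \<delta>(1) by simp
    then show ?thesis using \<open>d = -1\<close> by simp
  qed
  ultimately show ?thesis unfolding germ_def by blast
qed

definition chord_map :: "(real \<Rightarrow> real) \<Rightarrow> real \<times> real \<Rightarrow> real \<times> real" where
  "chord_map \<phi> = (\<lambda>(v, u). (frac (\<phi> v), frac (\<phi> u)))"

text \<open>A change of base point. Taking fractional parts cuts the period starting at
  \<open>\<rho>\<close> at 1 and moves its upper part to the front. Being between the ends of the
  chord is then either preserved for both \<open>x\<close> and \<open>y\<close>, or, if 1 separates
  \<open>a\<close> from \<open>b\<close>, negated for both; whether exactly one of them is between
  does not change.\<close>

lemma chords_intersect_wrap:
  fixes a b x y :: real
  assumes "\<rho> \<ge> 0" "\<rho> < 1" "{a, b, x, y} \<subseteq> {\<rho>..<\<rho> + 1}"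
    "x \<noteq> a" "x \<noteq> b" "y \<noteq> a" "y \<noteq> b"
  shows "chords_intersect (frac a, frac b) (frac x, frac y) \<longleftrightarrow> chords_intersect (a, b) (x, y)"
proof -
  have frac: "frac z = (if z < 1 then z else z - 1)" if "\<rho> \<le> z" "z < \<rho> + 1" for z
    using that assms(1,2) by (auto simp: frac_unique_iff)
  have "frac z \<in> {min (frac a) (frac b)<..<max (frac a) (frac b)} \<longleftrightarrow>
      (z \<in> {min a b<..<max a b}) \<noteq> ((a < 1) \<noteq> (b < 1))"
    if z: "\<rho> \<le> z" "z < \<rho> + 1" "z \<noteq> a" "z \<noteq> b" for z
  proof -
    have "\<rho> \<le> a" "a < \<rho> + 1" "\<rho> \<le> b" "b < \<rho> + 1" using assms(3) by auto
    then have f: "frac a = (if a < 1 then a else a - 1)" "frac b = (if b < 1 then b else b - 1)"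
      "frac z = (if z < 1 then z else z - 1)" and l: "a < b + 1" "b < a + 1" "z < a + 1" "z < b + 1" "a < z + 1" "b < z + 1"
      using frac z by auto
    show ?thesis
      unfolding f min_def max_def greaterThanLessThan_iff using z(3,4) l
      by (cases "a < 1"; cases "b < 1"; cases "z < 1"; simp; linarith)
  qed
  from this[of x] this[of y] show ?thesis
    unfolding chords_intersect_def prod.case using assms(3-7) by (simp del: greaterThanLessThan_iff) blast
qed

lemma chords_intersect_mono:
  assumes "strict_mono g"
  shows "chords_intersect (g a, g b) (g x, g y) \<longleftrightarrow> chords_intersect (a, b) (x, y)"
  using strict_mono_less[OF assms]
  by (auto simp: chords_intersect_def min_def max_def strict_mono_less_eq[OF assms])

lemma chords_intersect_circle_map:
  assumes \<phi>: "circle_map \<phi>" and X: "chord_set X" and cd: "c \<in> X" "d \<in> X"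
  shows "chords_intersect (chord_map \<phi> c) (chord_map \<phi> d) \<longleftrightarrow> chords_intersect c d"
proof (cases "c = d")
  case True
  have "\<not> chords_intersect e e" for e by (cases e) (auto simp: chords_intersect_def)
  then show ?thesis using True by simp
next
  case False
  obtain a b x y where [simp]: "c = (a, b)" "d = (x, y)" by (cases c, cases d)
  \<comment> \<open>The lift is shifted by an integer so that it maps \<open>{0..<1}\<close>
    monotonically into the period starting at \<open>frac (\<phi> 0)\<close>.\<close>
  define g where "g z = \<phi> z - of_int \<lfloor>\<phi> 0\<rfloor>" for z
  have g: "strict_mono g" using \<phi> by (simp add: g_def circle_map_def strict_mono_def)
  have ne: "x \<noteq> a" "x \<noteq> b" "y \<noteq> a" "y \<noteq> b"
    using chord_set_disjoint[OF X cd False] by auto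
  have "{a, b, x, y} \<subseteq> {0..<1}"
    using X cd by (auto simp: chord_set_def chord_ends_def)
  moreover have "g z \<in> {frac (\<phi> 0)..<frac (\<phi> 0) + 1}" if "z \<in> {0..<1}" for z
  proof -
    have "\<phi> 0 \<le> \<phi> z" using that \<phi> by (simp add: circle_map_def strict_mono_less_eq)
    moreover have "\<phi> z < \<phi> (0 + 1)" using that circle_map_less_iff[OF \<phi>] by simp
    then have "\<phi> z < \<phi> 0 + 1" using \<phi> unfolding circle_map_def by metis
    ultimately show ?thesis by (simp add: g_def frac_def)
  qed
  ultimately have "{g a, g b, g x, g y} \<subseteq> {frac (\<phi> 0)..<frac (\<phi> 0) + 1}" by blast
  then have "chords_intersect (frac (g a), frac (g b)) (frac (g x), frac (g y)) \<longleftrightarrow>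
      chords_intersect (g a, g b) (g x, g y)"
    using ne g by (intro chords_intersect_wrap[of "frac (\<phi> 0)"]) (auto simp: strict_mono_eq frac_lt_1)
  moreover have "frac (g z) = frac (\<phi> z)" for z
    using frac_add_of_int_right[of "\<phi> z" "- \<lfloor>\<phi> 0\<rfloor>"] by (simp add: g_def)
  ultimately show ?thesis using chords_intersect_mono[OF g] by (simp add: chord_map_def)
qed

lemma odd_chord_bij:
  assumes "bij_betw F X' X" "\<And>c d. c \<in> X' \<Longrightarrow> d \<in> X' \<Longrightarrow> chords_intersect (F c) (F d) \<longleftrightarrow> chords_intersect c d"
    and "c \<in> X'"
  shows "odd_chord X (F c) \<longleftrightarrow> odd_chord X' c"
proof -
  have "bij_betw F {d \<in> X'. chords_intersect c d} {d \<in> X. chords_intersect (F c) d}"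
    unfolding bij_betw_def
  proof
    show "inj_on F {d \<in> X'. chords_intersect c d}"
      using assms(1) unfolding bij_betw_def by (auto intro: inj_on_subset)
    have X: "X = F ` X'" using assms(1) unfolding bij_betw_def by simp
    have iff: "chords_intersect (F c) (F d) \<longleftrightarrow> chords_intersect c d" if "d \<in> X'" for d
      using assms(2)[OF assms(3) that] .
    show "F ` {d \<in> X'. chords_intersect c d} = {d \<in> X. chords_intersect (F c) d}"
      unfolding X using iff by blast
  qed
  from bij_betw_same_card[OF this] show ?thesis by (simp add: odd_chord_def)
qed

text \<open>A bijection that preserves intersections preserves parity, hence restricts to a
  bijection of the even chords, where it preserves parity again.\<close>

lemma chord_type_bij:
  assumes F: "bij_betw F X' X" and int: "\<And>c d. c \<in> X' \<Longrightarrow> d \<in> X' \<Longrightarrow> chords_intersect (F c) (F d) \<longleftrightarrow> chords_intersect c d"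
    and c: "c \<in> X'"
  shows "chord_type X (F c) = chord_type X' c"
proof (cases "odd_chord X' c")
  case True
  then show ?thesis using odd_chord_bij[OF F int c] by (simp add: chord_type_def)
next
  case False
  have "bij_betw F (even_chords X') (even_chords X)"
    unfolding bij_betw_def
  proof
    show "inj_on F (even_chords X')"
      using F unfolding bij_betw_def even_chords_def by (auto intro: inj_on_subset)
    have X: "X = F ` X'" using F unfolding bij_betw_def by simp
    show "F ` even_chords X' = even_chords X"
      using odd_chord_bij[OF F int] unfolding even_chords_def X by blast
  qed
  then have "odd_chord (even_chords X) (F c) \<longleftrightarrow> odd_chord (even_chords X') c"
    by (rule odd_chord_bij) (use int c False in \<open>auto simp: even_chords_def\<close>)
  then show ?thesis using False odd_chord_bij[OF F int c] by (simp add: chord_type_def)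
qed

lemma bij_chord_map:
  assumes \<phi>: "circle_map \<phi>"
  shows "bij_betw (chord_map \<phi>) ({0..<1} \<times> {0..<1}) ({0..<1} \<times> {0..<1})"
proof -
  have *: "frac (\<psi>' (frac (\<psi> x))) = x" if "x \<in> {0..<1}" "circle_map \<psi>'" "\<And>x. \<psi>' (\<psi> x) = x" for x \<psi> \<psi>'
    using that circle_map_frac[of \<psi>' "\<psi> x"] by simp
  show ?thesis
    by (rule bij_betw_byWitness[where f' = "chord_map (inv_into UNIV \<phi>)"])
       (use circle_map_inv[OF \<phi>] \<phi> in \<open>auto simp: chord_map_def frac_lt_1 *\<close>)
qed

lemma coloring_circle_map:
  assumes \<phi>: "circle_map \<phi>" and X': "chord_set X'"
    and X: "X = chord_map \<phi> ` X'" and \<sigma>: "\<And>c. c \<in> X' \<Longrightarrow> \<sigma>' c = \<sigma> (chord_map \<phi> c)"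
    and \<sigma>1: "\<And>c. c \<in> X' \<Longrightarrow> \<bar>\<sigma>' c\<bar> = 1"
    and c: "coloring M X \<sigma> c"
  shows "coloring M X' \<sigma>' (\<lambda>x. c (\<phi> x))"
  unfolding coloring_def
proof (intro conjI allI impI ballI)
  have sub: "X' \<subseteq> {0..<1} \<times> {0..<1}" using X' by (auto simp: chord_set_def chord_ends_def)
  have bij: "bij_betw (chord_map \<phi>) X' X"
    using bij_chord_map[OF \<phi>] sub unfolding X bij_betw_def by (auto intro: inj_on_subset)
  fix x
  show "c (\<phi> x) \<in> carrier M" using c by (simp add: coloring_def)
  show "c (\<phi> (x + 1)) = c (\<phi> x)" using c \<phi> by (simp add: coloring_def circle_map_def)
  show "const_near (\<lambda>x. c (\<phi> x)) x" if "frac x \<notin> chord_ends X'"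
  proof -
    have "frac (\<phi> x) \<noteq> frac (\<phi> v)" if "v \<in> chord_ends X'" for v
    proof
      assume "frac (\<phi> x) = frac (\<phi> v)"
      then have "x - v \<in> \<int>" using circle_map_diff_Ints[OF \<phi>] frac_eq_iff_diff_Ints by blast
      then have "frac x = v" using that X' diff_Ints_iff_frac by (auto simp: chord_set_def)
      then show False using that \<open>frac x \<notin> _\<close> by simp
    qed
    then have "frac (\<phi> x) \<notin> chord_ends X" by (auto simp: X chord_ends_def chord_map_def) force+
    then have cn: "const_near c (\<phi> x)" using c by (simp add: coloring_def)
    have "germ (\<lambda>y. c (\<phi> y)) x d (c (\<phi> x))" if "\<bar>d\<bar> = 1" for d
      by (rule germ_circle_map[OF \<phi> germ_const_near[OF cn that] that])
    then show ?thesis by (intro germ_const_nearI[where a = "c (\<phi> x)"]) auto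
  qed
  fix cr assume cr: "cr \<in> X'"
  obtain v u where vu [simp]: "cr = (v, u)" by (cases cr)
  have F: "chord_map \<phi> (v, u) = (frac (\<phi> v), frac (\<phi> u))" by (simp add: chord_map_def)
  have in_X: "(frac (\<phi> v), frac (\<phi> u)) \<in> X" unfolding X F[symmetric] using cr by simp
  have "chord_type X (chord_map \<phi> cr) = chord_type X' cr"
    by (rule chord_type_bij[OF bij chords_intersect_circle_map[OF \<phi> X'] cr])
  then have ty: "chord_type X (frac (\<phi> v), frac (\<phi> u)) = chord_type X' (v, u)" by (simp add: F)
  have \<sigma>': "\<sigma> (frac (\<phi> v), frac (\<phi> u)) = \<sigma>' (v, u)" using \<sigma>[OF cr] by (simp add: F)
  have g: "germ (\<lambda>x. c (\<phi> x)) y d a" if "germ c (frac (\<phi> y)) d a" "\<bar>d\<bar> = 1" for y d a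
  proof -
    have "germ c (\<phi> y) d a"
      using germ_shift[of c "frac (\<phi> y)" "\<lfloor>\<phi> y\<rfloor>" d a] c that(1) by (simp add: coloring_def frac_def)
    then show ?thesis by (rule germ_circle_map[OF \<phi> _ that(2)])
  qed
  have abs: "\<bar>\<sigma>' (v, u)\<bar> = 1" "\<bar>- \<sigma>' (v, u)\<bar> = 1" using \<sigma>1[OF cr] by auto
  from coloring_germs[OF c in_X] obtain aL aR bL bR where
    "germ c (frac (\<phi> v)) (- \<sigma>' (v, u)) aL" "germ c (frac (\<phi> v)) (\<sigma>' (v, u)) aR"
    "germ c (frac (\<phi> u)) (\<sigma>' (v, u)) bL" "germ c (frac (\<phi> u)) (- \<sigma>' (v, u)) bR"
    "crossing_relation M (chord_type X' (v, u)) aL aR bL bR"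
    unfolding ty \<sigma>' by metis
  then show "case cr of (v, u) \<Rightarrow> \<exists>aL aR bL bR.
      germ (\<lambda>x. c (\<phi> x)) v (- \<sigma>' (v, u)) aL \<and> germ (\<lambda>x. c (\<phi> x)) v (\<sigma>' (v, u)) aR \<and>
      germ (\<lambda>x. c (\<phi> x)) u (\<sigma>' (v, u)) bL \<and> germ (\<lambda>x. c (\<phi> x)) u (- \<sigma>' (v, u)) bR \<and>
      crossing_relation M (chord_type X' (v, u)) aL aR bL bR"
    using g abs by (simp only: prod.case vu) blast
qed

lemma isomorphic_reparametrized:
  assumes K: "virtual_knot_diagram K" and K': "virtual_knot_diagram K'" and "reparametrized K K'"
  shows "module_isomorphic coeff_ring (knot_module K) (knot_module K')"
proof -
  from assms(3) obtain \<phi> where \<phi>: "\<And>x. \<phi> (x + 1) = \<phi> x + 1" "\<phi> C1_differentiable_on UNIV"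
    "\<And>x. deriv \<phi> x > 0" "curve K' = curve K \<circ> \<phi>" "over K' = \<phi> -` over K"
    unfolding reparametrized_def by blast
  have diff: "\<phi> differentiable at x" for x
    using \<phi>(2) by (auto simp: C1_differentiable_on_def differentiable_def has_vector_derivative_def)
  have D: "(\<phi> has_real_derivative deriv \<phi> x) (at x)" for x
    using diff[of x] by (simp add: DERIV_deriv_iff_real_differentiable)
  have sm: "strict_mono \<phi>"
    unfolding strict_mono_def using D \<phi>(3) by (meson DERIV_pos_imp_increasing)
  have "surj \<phi>"
  proof (rule surjI[of _ "\<lambda>y. SOME x. \<phi> x = y"])
    fix y
    have int: "\<phi> (0 + of_int k) = \<phi> 0 + of_int k" for k
      using periodic_int[of "\<lambda>x. \<phi> x - x" 0 k] \<phi>(1) by simp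
    \<comment> \<open>Since \<open>\<phi>\<close> commutes with integer shifts, \<open>y\<close>
      lies between the values of \<open>\<phi>\<close> at \<open>k\<close> and at
      \<open>k + 1\<close>.\<close>
    define k where "k = \<lfloor>y - \<phi> 0\<rfloor>"
    have "\<phi> (of_int k) \<le> y" "y \<le> \<phi> (of_int (k + 1))"
      using int[of k] int[of "k + 1"] unfolding k_def by (simp_all, linarith+)
    moreover have "continuous_on {of_int k..of_int (k + 1)} \<phi>"
      using diff by (intro differentiable_imp_continuous_on) (auto simp: differentiable_on_def differentiable_at_withinI)
    ultimately have "\<exists>x. \<phi> x = y" using IVT'[of \<phi> "of_int k" y "of_int (k + 1)"] by auto
    then show "\<phi> (SOME x. \<phi> x = y) = y" by (rule someI_ex)
  qed
  with sm \<phi>(1) have cm: "circle_map \<phi>" by (simp add: circle_map_def)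
  have per: "curve K (frac x) = curve K x" "velocity K (frac x) = velocity K x" "frac x \<in> over K \<longleftrightarrow> x \<in> over K" for x
  proof -
    show c: "curve K (frac x) = curve K x" for x
      by (rule periodic_frac) (rule virtual_knot_diagramD(1)[OF K])
    show "frac x \<in> over K \<longleftrightarrow> x \<in> over K"
      by (rule periodic_frac) (rule virtual_knot_diagramD(7)[OF K])
    have "velocity K (y + 1) = velocity K y" for y
    proof -
      have "((curve K \<circ> (\<lambda>y. y + 1)) has_vector_derivative 1 *\<^sub>R velocity K (y + 1)) (at y)"
        by (rule vector_diff_chain_at[OF _ curve_has_velocity[OF K]]) (auto intro!: derivative_eq_intros)
      moreover have "curve K \<circ> (\<lambda>y. y + 1) = curve K" using virtual_knot_diagramD(1)[OF K] by auto
      ultimately show ?thesis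
        using vector_derivative_unique_at[OF curve_has_velocity[OF K]] by simp
    qed
    then show "velocity K (frac x) = velocity K x" by (rule periodic_frac)
  qed
  have vel: "velocity K' x = deriv \<phi> x *\<^sub>R velocity K (\<phi> x)" for x
  proof -
    have "(curve K' has_vector_derivative deriv \<phi> x *\<^sub>R velocity K (\<phi> x)) (at x)"
      unfolding \<phi>(4)
      by (rule vector_diff_chain_at[OF _ curve_has_velocity[OF K]])
         (use D in \<open>simp add: has_real_derivative_iff_has_vector_derivative\<close>)
    then show ?thesis unfolding velocity_def[of K'] by (rule vector_derivative_at)
  qed
  have X'_iff: "(v, u) \<in> crossings K' \<longleftrightarrow> (v, u) \<in> {0..<1} \<times> {0..<1} \<and> chord_map \<phi> (v, u) \<in> crossings K" for v u
  proof -
    have "frac (\<phi> v) - frac (\<phi> u) \<in> \<int> \<longleftrightarrow> v - u \<in> \<int>"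
      using frac_eq_iff_diff_Ints[of "frac (\<phi> v)" "frac (\<phi> u)"] frac_eq_iff_diff_Ints[of "\<phi> v" "\<phi> u"]
        circle_map_diff_Ints[OF cm, of v u] by simp
    then show ?thesis
      by (auto simp: crossings_def double_point_def chord_map_def per \<phi>(4,5) frac_lt_1)
  qed
  have X: "crossings K = chord_map \<phi> ` crossings K'"
  proof
    show "chord_map \<phi> ` crossings K' \<subseteq> crossings K" using X'_iff by auto
    show "crossings K \<subseteq> chord_map \<phi> ` crossings K'"
    proof
      fix c assume c: "c \<in> crossings K"
      then have "c \<in> chord_map \<phi> ` ({0..<1} \<times> {0..<1})"
        using bij_chord_map[OF cm] crossings_sub[of K] unfolding bij_betw_def by blast
      then obtain d where d: "d \<in> {0..<1} \<times> {0..<1}" "c = chord_map \<phi> d" by blast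
      then have "d \<in> crossings K'" using X'_iff[of "fst d" "snd d"] c by simp
      with d show "c \<in> chord_map \<phi> ` crossings K'" by blast
    qed
  qed
  have inv: "chord_map (inv_into UNIV \<phi>) (chord_map \<phi> d) = d" if "d \<in> crossings K'" for d
    using that crossings_sub[of K'] circle_map_frac[OF circle_map_inv(1)[OF cm]] circle_map_inv(2)[OF cm]
    by (auto simp: chord_map_def)
  have X': "crossings K' = chord_map (inv_into UNIV \<phi>) ` crossings K"
    unfolding X image_image using inv by simp
  have \<sigma>: "crossing_sign K' d = crossing_sign K (chord_map \<phi> d)" for d
  proof (cases d)
    case (Pair v u)
    have "det2 (x *\<^sub>R p) (y *\<^sub>R q) = (x * y) * det2 p q" for x y p q
      by (simp add: det2_def algebra_simps)
    then show ?thesis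
      using \<phi>(3) by (simp add: Pair crossing_sign_def chord_map_def vel per sgn_mult)
  qed
  have abs: "\<bar>crossing_sign K' c\<bar> = 1" if "c \<in> crossings K'" for c using crossing_sign[OF K' that] by simp
  have abs': "\<bar>crossing_sign K c\<bar> = 1" if "c \<in> crossings K" for c using crossing_sign[OF K that] by simp
  have \<sigma>': "crossing_sign K c = crossing_sign K' (chord_map (inv_into UNIV \<phi>) c)" if "c \<in> crossings K" for c
    using that inv \<sigma> unfolding X by auto
  have reg: "frac (\<phi> x) \<notin> chord_ends (crossings K)" if "frac x \<notin> chord_ends (crossings K')" for x
  proof
    assume "frac (\<phi> x) \<in> chord_ends (crossings K)"
    then obtain c where "c \<in> crossings K'" "frac (\<phi> x) = frac (\<phi> (fst c)) \<or> frac (\<phi> x) = frac (\<phi> (snd c))"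
      unfolding X by (auto simp: chord_ends_def chord_map_def)
    then obtain y where y: "y \<in> chord_ends (crossings K')" "frac (\<phi> x) = frac (\<phi> y)"
      unfolding chord_ends_def by blast
    then have "x - y \<in> \<int>" using circle_map_diff_Ints[OF cm] frac_eq_iff_diff_Ints by blast
    then have "frac x = y"
      using y(1) chord_set_crossings[OF K'] diff_Ints_iff_frac by (auto simp: chord_set_def)
    then show False using y that by simp
  qed
  have reg': "frac (inv_into UNIV \<phi> x) \<notin> chord_ends (crossings K')" if "frac x \<notin> chord_ends (crossings K)" for x
  proof
    assume "frac (inv_into UNIV \<phi> x) \<in> chord_ends (crossings K')"
    then have "frac (\<phi> (frac (inv_into UNIV \<phi> x))) \<in> chord_ends (crossings K)"
      unfolding X by (force simp: chord_ends_def chord_map_def)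
    then show False using that by (simp add: circle_map_frac[OF cm] circle_map_inv(3)[OF cm])
  qed
  show ?thesis
  proof (rule knot_module_isomorphicI[OF K K', where I = "{x. frac x \<notin> chord_ends (crossings K')}"
        and e = \<phi> and e' = "\<lambda>x. x"])
    fix M :: "(laurent set, (real set \<Rightarrow> laurent set) set) module" and c
    assume "coloring M (crossings K) (crossing_sign K) c"
    from coloring_circle_map[OF cm chord_set_crossings[OF K'] X \<sigma> abs this]
    show "\<exists>c'. coloring M (crossings K') (crossing_sign K') c' \<and>
        (\<forall>i\<in>{x. frac x \<notin> chord_ends (crossings K')}. c' i = c (\<phi> i))" by blast
  next
    fix M :: "(laurent set, (real set \<Rightarrow> laurent set) set) module" and c'
    assume "coloring M (crossings K') (crossing_sign K') c'"
    from coloring_circle_map[OF circle_map_inv(1)[OF cm] chord_set_crossings[OF K] X' \<sigma>' abs' this]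
    show "\<exists>c. coloring M (crossings K) (crossing_sign K) c \<and>
        (\<forall>i\<in>{x. frac x \<notin> chord_ends (crossings K')}. c (\<phi> i) = c' i)"
      by (intro exI[of _ "\<lambda>x. c' (inv_into UNIV \<phi> x)"]) (simp add: circle_map_inv(2)[OF cm])
  next
    fix M :: "(laurent set, (real set \<Rightarrow> laurent set) set) module" and c1 c2 x
    assume eq: "\<And>i. i \<in> {x. frac x \<notin> chord_ends (crossings K')} \<Longrightarrow> c1 (\<phi> i) = c2 (\<phi> i)"
      and x: "frac x \<notin> chord_ends (crossings K)"
    show "c1 x = c2 x" using eq[of "inv_into UNIV \<phi> x"] reg'[OF x] by (simp add: circle_map_inv(3)[OF cm])
  qed (use reg in auto)
qed

section \<open>Parity under local changes of a chord set\<close>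

lemma not_chords_intersect_self [simp]: "\<not> chords_intersect c c"
  by (cases c) (auto simp: chords_intersect_def)

text \<open>A new chord flips the parity of exactly those chords that it meets. \<open>c\<close>
  need not belong to \<open>X\<close>, so chords may be added one after another.\<close>

lemma odd_chord_insert:
  assumes "finite X" "p \<notin> X"
  shows "odd_chord (insert p X) c \<longleftrightarrow> odd_chord X c \<noteq> chords_intersect c p"
proof (cases "chords_intersect c p")
  case True
  then have "{d \<in> insert p X. chords_intersect c d} = insert p {d \<in> X. chords_intersect c d}" by auto
  then show ?thesis using assms True by (simp add: odd_chord_def)
next
  case False
  then have "{d \<in> insert p X. chords_intersect c d} = {d \<in> X. chords_intersect c d}" by auto
  then show ?thesis using False by (simp add: odd_chord_def)
qed

lemma odd_chord_empty [simp]: "\<not> odd_chord {} c"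
  by (simp add: odd_chord_def)

lemma odd_chord_cong:
  assumes "\<And>d. d \<in> X \<Longrightarrow> chords_intersect c d \<longleftrightarrow> chords_intersect c' d"
  shows "odd_chord X c \<longleftrightarrow> odd_chord X c'"
proof -
  have "{d \<in> X. chords_intersect c d} = {d \<in> X. chords_intersect c' d}" using assms by blast
  then show ?thesis by (simp add: odd_chord_def)
qed

text \<open>The chords met by \<open>c\<close> form the symmetric difference of those met by
  \<open>c'\<close> and by \<open>c''\<close>, and the cardinality modulo 2 is additive for
  symmetric differences.\<close>

lemma odd_chord_xor:
  assumes "finite X"
    and "\<And>d. d \<in> X \<Longrightarrow> chords_intersect c d = (chords_intersect c' d \<noteq> chords_intersect c'' d)"
  shows "odd_chord X c \<longleftrightarrow> odd_chord X c' \<noteq> odd_chord X c''"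
  using assms by (induction X rule: finite_induct) (auto simp: odd_chord_insert)

text \<open>Both orders are listed because \<open>chords_intersect\<close> is symmetric only for
  chords without common ends.\<close>

definition isolated_chord :: "(real \<times> real) set \<Rightarrow> real \<times> real \<Rightarrow> bool" where
  "isolated_chord Y p \<longleftrightarrow> finite Y \<and> p \<notin> Y \<and> (\<forall>d\<in>Y. \<not> chords_intersect d p \<and> \<not> chords_intersect p d)"

lemma isolated_chord_odd:
  assumes "isolated_chord Y p"
  shows "\<not> odd_chord (insert p Y) p" "d \<in> Y \<Longrightarrow> odd_chord (insert p Y) d \<longleftrightarrow> odd_chord Y d"
proof -
  have "{d \<in> insert p Y. chords_intersect p d} = {}"
    using assms by (auto simp: isolated_chord_def)
  then show "\<not> odd_chord (insert p Y) p" unfolding odd_chord_def by (simp only: card.empty even_zero not_not)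
  show "d \<in> Y \<Longrightarrow> odd_chord (insert p Y) d \<longleftrightarrow> odd_chord Y d"
    using assms by (simp add: isolated_chord_def odd_chord_insert)
qed

text \<open>An isolated chord is even, so it survives among the even chords and is isolated there
  too. Thus the crossing of a curl has type 2, the type for which constant colours satisfy the
  relation.\<close>

lemma isolated_chord_type:
  assumes "isolated_chord Y p"
  shows "chord_type (insert p Y) p = 2" "d \<in> Y \<Longrightarrow> chord_type (insert p Y) d = chord_type Y d"
proof -
  have "even_chords (insert p Y) = insert p (even_chords Y)"
    using isolated_chord_odd[OF assms] unfolding even_chords_def by blast
  moreover have iso: "isolated_chord (even_chords Y) p"
    using assms by (auto simp: isolated_chord_def even_chords_def)
  ultimately show "chord_type (insert p Y) p = 2"
    using isolated_chord_odd[OF assms] isolated_chord_odd[OF iso] by (simp add: chord_type_def)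
  show "chord_type (insert p Y) d = chord_type Y d" if d: "d \<in> Y"
  proof (cases "odd_chord Y d")
    case True
    then show ?thesis using isolated_chord_odd(2)[OF assms d] by (simp add: chord_type_def)
  next
    case False
    then have "d \<in> even_chords Y" using d by (simp add: even_chords_def)
    then show ?thesis
      using \<open>even_chords (insert p Y) = _\<close> isolated_chord_odd(2)[OF assms d] isolated_chord_odd(2)[OF iso]
      by (simp add: chord_type_def)
  qed
qed

definition parallel_chords :: "(real \<times> real) set \<Rightarrow> real \<times> real \<Rightarrow> real \<times> real \<Rightarrow> bool" where
  "parallel_chords Y p p' \<longleftrightarrow> finite Y \<and> p \<notin> Y \<and> p' \<notin> Y \<and> p \<noteq> p' \<and>
     chords_intersect p p' = chords_intersect p' p \<and>
     (\<forall>d\<in>Y. chords_intersect d p = chords_intersect d p' \<and> chords_intersect p d = chords_intersect p' d)"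

lemma parallel_chords_odd:
  assumes "parallel_chords Y p p'"
  shows "odd_chord (insert p (insert p' Y)) p = odd_chord (insert p (insert p' Y)) p'"
    "d \<in> Y \<Longrightarrow> odd_chord (insert p (insert p' Y)) d \<longleftrightarrow> odd_chord Y d"
proof -
  have "odd_chord Y p = odd_chord Y p'"
    using assms by (intro odd_chord_cong) (auto simp: parallel_chords_def)
  then show "odd_chord (insert p (insert p' Y)) p = odd_chord (insert p (insert p' Y)) p'"
    using assms by (auto simp: parallel_chords_def odd_chord_insert)
  show "d \<in> Y \<Longrightarrow> odd_chord (insert p (insert p' Y)) d \<longleftrightarrow> odd_chord Y d"
    using assms by (auto simp: parallel_chords_def odd_chord_insert)
qed

text \<open>The two chords have equal parity, so at the second level they disappear together or
  remain parallel. In both cases they contribute an even number of intersections to every other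
  chord.\<close>

lemma parallel_chords_type:
  assumes "parallel_chords Y p p'"
  shows "chord_type (insert p (insert p' Y)) p = chord_type (insert p (insert p' Y)) p'"
    "d \<in> Y \<Longrightarrow> chord_type (insert p (insert p' Y)) d = chord_type Y d"
proof -
  let ?X = "insert p (insert p' Y)"
  note o = parallel_chords_odd[OF assms]
  have ev: "even_chords ?X = (if odd_chord ?X p then even_chords Y else insert p (insert p' (even_chords Y)))"
    using o unfolding even_chords_def by auto
  have par: "parallel_chords (even_chords Y) p p'"
    using assms by (auto simp: parallel_chords_def even_chords_def)
  note o' = parallel_chords_odd[OF par]
  show "chord_type ?X p = chord_type ?X p'"
    using o(1) o'(1) by (simp add: chord_type_def ev)
  show "chord_type ?X d = chord_type Y d" if d: "d \<in> Y"
  proof (cases "odd_chord Y d")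
    case True
    then show ?thesis using o(2)[OF d] by (simp add: chord_type_def)
  next
    case False
    then have "d \<in> even_chords Y" using d by (simp add: even_chords_def)
    then show ?thesis using o(2)[OF d] o'(2) by (simp add: chord_type_def ev)
  qed
qed

text \<open>
  In a third Reidemeister move the two ends of the three chords on each strand are swapped, so
  the intersections of the three chords with each other are all reversed.
\<close>

definition triangle_chords ::
  "(real \<times> real) set \<Rightarrow> (real \<times> real) \<times> (real \<times> real) \<times> (real \<times> real) \<Rightarrow>
   (real \<times> real) \<times> (real \<times> real) \<times> (real \<times> real) \<Rightarrow> bool" where
  "triangle_chords Y = (\<lambda>(p1, p2, p3) (p1', p2', p3').
     finite Y \<and> {p1, p2, p3, p1', p2', p3'} \<inter> Y = {} \<and> distinct [p1, p2, p3] \<and> distinct [p1', p2', p3'] \<and>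
     (\<forall>d\<in>Y. (chords_intersect d p1 = chords_intersect d p1') \<and> (chords_intersect d p2 = chords_intersect d p2') \<and>
       (chords_intersect d p3 = chords_intersect d p3') \<and>
       (chords_intersect p1 d = chords_intersect p1' d) \<and> (chords_intersect p2 d = chords_intersect p2' d) \<and>
       (chords_intersect p3 d = chords_intersect p3' d) \<and>
       (chords_intersect p3 d = (chords_intersect p1 d \<noteq> chords_intersect p2 d))) \<and>
     (chords_intersect p1 p2 = chords_intersect p2 p1) \<and> (chords_intersect p1 p3 = chords_intersect p3 p1) \<and>
     (chords_intersect p2 p3 = chords_intersect p3 p2) \<and>
     (chords_intersect p1' p2' = (\<not> chords_intersect p1 p2)) \<and> (chords_intersect p2' p1' = (\<not> chords_intersect p2 p1)) \<and>
     (chords_intersect p1' p3' = (\<not> chords_intersect p1 p3)) \<and> (chords_intersect p3' p1' = (\<not> chords_intersect p3 p1)) \<and>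
     (chords_intersect p2' p3' = (\<not> chords_intersect p2 p3)) \<and> (chords_intersect p3' p2' = (\<not> chords_intersect p3 p2)))"

lemma triangle_chords_subset:
  "triangle_chords Y P P' \<Longrightarrow> Z \<subseteq> Y \<Longrightarrow> triangle_chords Z P P'"
proof -
  assume T: "triangle_chords Y P P'" and Z: "Z \<subseteq> Y"
  have "finite Z" if "finite Y" using finite_subset[OF Z that] .
  moreover have "S \<inter> Z = {}" if "S \<inter> Y = {}" for S :: "(real \<times> real) set" using that Z by blast
  moreover have "\<forall>d\<in>Z. Q d" if "\<forall>d\<in>Y. Q d" for Q using that Z by blast
  ultimately show ?thesis
    using T unfolding triangle_chords_def case_prod_unfold by (elim conjE, intro conjI) assumption+
qed

text \<open>Each of the three chords has its intersections with the two others reversed, which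
  changes its count by an even number. For the relation between the three parities, intersections
  within the triangle cancel in pairs in their sum, and every chord outside meets an even number of
  the three.\<close>

lemma triangle_chords_odd:
  assumes T: "triangle_chords Y (p1, p2, p3) (p1', p2', p3')"
  defines "X \<equiv> insert p1 (insert p2 (insert p3 Y))" and "X' \<equiv> insert p1' (insert p2' (insert p3' Y))"
  shows "odd_chord X p1 = odd_chord X' p1'" "odd_chord X p2 = odd_chord X' p2'"
    "odd_chord X p3 = odd_chord X' p3'" "odd_chord X p3 \<longleftrightarrow> odd_chord X p1 \<noteq> odd_chord X p2"
    "d \<in> Y \<Longrightarrow> odd_chord X d = odd_chord X' d"
proof -
  have Y: "odd_chord Y p1 = odd_chord Y p1'" "odd_chord Y p2 = odd_chord Y p2'" "odd_chord Y p3 = odd_chord Y p3'"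
    using T unfolding triangle_chords_def prod.case by (intro odd_chord_cong; simp)+
  have x: "odd_chord Y p3 \<longleftrightarrow> odd_chord Y p1 \<noteq> odd_chord Y p2"
    using T unfolding triangle_chords_def prod.case by (intro odd_chord_xor; simp)
  have ins: "odd_chord X c \<longleftrightarrow> ((odd_chord Y c \<noteq> chords_intersect c p3) \<noteq> chords_intersect c p2) \<noteq> chords_intersect c p1"
    "odd_chord X' c \<longleftrightarrow> ((odd_chord Y c \<noteq> chords_intersect c p3') \<noteq> chords_intersect c p2') \<noteq> chords_intersect c p1'" for c
  proof -
    have n: "finite Y" "p1 \<notin> Y" "p2 \<notin> Y" "p3 \<notin> Y" "p1' \<notin> Y" "p2' \<notin> Y" "p3' \<notin> Y"
      "distinct [p1, p2, p3]" "distinct [p1', p2', p3']"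
      using T by (simp_all add: triangle_chords_def)
    then show "odd_chord X c \<longleftrightarrow> ((odd_chord Y c \<noteq> chords_intersect c p3) \<noteq> chords_intersect c p2) \<noteq> chords_intersect c p1"
      "odd_chord X' c \<longleftrightarrow> ((odd_chord Y c \<noteq> chords_intersect c p3') \<noteq> chords_intersect c p2') \<noteq> chords_intersect c p1'"
      unfolding X_def X'_def by (simp_all add: odd_chord_insert)
  qed
  have i: "(chords_intersect p1 p2 = chords_intersect p2 p1) \<and> (chords_intersect p1 p3 = chords_intersect p3 p1) \<and>
     (chords_intersect p2 p3 = chords_intersect p3 p2) \<and>
     (chords_intersect p1' p2' = (\<not> chords_intersect p1 p2)) \<and> (chords_intersect p2' p1' = (\<not> chords_intersect p2 p1)) \<and>
     (chords_intersect p1' p3' = (\<not> chords_intersect p1 p3)) \<and> (chords_intersect p3' p1' = (\<not> chords_intersect p3 p1)) \<and>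
     (chords_intersect p2' p3' = (\<not> chords_intersect p2 p3)) \<and> (chords_intersect p3' p2' = (\<not> chords_intersect p3 p2))"
    using T by (simp add: triangle_chords_def)
  have self: "\<not> chords_intersect p1 p1" "\<not> chords_intersect p2 p2" "\<not> chords_intersect p3 p3"
    "\<not> chords_intersect p1' p1'" "\<not> chords_intersect p2' p2'" "\<not> chords_intersect p3' p3'" by simp_all
  show "odd_chord X p1 = odd_chord X' p1'"
    unfolding ins using Y i self by argo
  show "odd_chord X p2 = odd_chord X' p2'"
    unfolding ins using Y i self by argo
  show "odd_chord X p3 = odd_chord X' p3'"
    unfolding ins using Y i self by argo
  show "odd_chord X p3 \<longleftrightarrow> odd_chord X p1 \<noteq> odd_chord X p2"
    unfolding ins using x i self by argo
  show "odd_chord X d = odd_chord X' d" if "d \<in> Y"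
    unfolding ins using T that by (simp add: triangle_chords_def)
qed

text \<open>The ten triples that parity allows. The number of odd crossings is 0 or 2. If it is 2,
  the third crossing may have type 1 or 2. If it is 0, all three survive at the second level, where
  the same rule leaves none or two of type 1.\<close>

definition triangle_types :: "nat \<Rightarrow> nat \<Rightarrow> nat \<Rightarrow> bool" where
  "triangle_types t1 t2 t3 \<longleftrightarrow> (t1, t2, t3) \<in>
     {(2, 2, 2), (2, 1, 1), (1, 2, 1), (1, 1, 2), (1, 0, 0), (2, 0, 0),
      (0, 1, 0), (0, 2, 0), (0, 0, 1), (0, 0, 2)}"

lemma triangle_chords_type:
  assumes T: "triangle_chords Y (p1, p2, p3) (p1', p2', p3')"
  defines "X \<equiv> insert p1 (insert p2 (insert p3 Y))" and "X' \<equiv> insert p1' (insert p2' (insert p3' Y))"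
  shows "chord_type X p1 = chord_type X' p1'" "chord_type X p2 = chord_type X' p2'"
    "chord_type X p3 = chord_type X' p3'"
    "triangle_types (chord_type X p1) (chord_type X p2) (chord_type X p3)"
    "d \<in> Y \<Longrightarrow> chord_type X d = chord_type X' d"
proof -
  note o = triangle_chords_odd[OF T, folded X_def X'_def]
  define Z where "Z = {d \<in> Y. \<not> odd_chord X d}"
  have Z': "Z = {d \<in> Y. \<not> odd_chord X' d}" using o(5) by (auto simp: Z_def)
  have ev: "even_chords X = Z \<union> {p \<in> {p1, p2, p3}. \<not> odd_chord X p}"
    unfolding even_chords_def Z_def X_def by auto
  have ev': "even_chords X' = Z \<union> {p \<in> {p1', p2', p3'}. \<not> odd_chord X' p}"
    unfolding even_chords_def Z' X'_def by auto
  have TZ: "triangle_chords Z (p1, p2, p3) (p1', p2', p3')"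
    by (rule triangle_chords_subset[OF T]) (auto simp: Z_def)
  have Z: "finite Z" "p1 \<notin> Z" "p2 \<notin> Z" "p3 \<notin> Z" "p1' \<notin> Z" "p2' \<notin> Z" "p3' \<notin> Z"
    using TZ by (simp_all add: triangle_chords_def)
  have Zo: "odd_chord Z p1 = odd_chord Z p1'" "odd_chord Z p2 = odd_chord Z p2'" "odd_chord Z p3 = odd_chord Z p3'"
    using TZ unfolding triangle_chords_def prod.case by (intro odd_chord_cong; simp)+
  have sw: "chords_intersect d p1 = chords_intersect d p1'" "chords_intersect d p2 = chords_intersect d p2'"
    "chords_intersect d p3 = chords_intersect d p3'" if "d \<in> Z" for d
    using TZ that by (simp_all add: triangle_chords_def)
  have Y_Z: "d \<in> Z" if "d \<in> Y" "\<not> odd_chord X d" for d using that by (simp add: Z_def)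
  consider "\<not> odd_chord X p1" "\<not> odd_chord X p2" "\<not> odd_chord X p3"
    | "odd_chord X p1" "odd_chord X p2" "\<not> odd_chord X p3"
    | "odd_chord X p1" "\<not> odd_chord X p2" "odd_chord X p3"
    | "\<not> odd_chord X p1" "odd_chord X p2" "odd_chord X p3"
    using o(4) by blast
  then have "chord_type X p1 = chord_type X' p1' \<and> chord_type X p2 = chord_type X' p2' \<and>
    chord_type X p3 = chord_type X' p3' \<and>
    triangle_types (chord_type X p1) (chord_type X p2) (chord_type X p3) \<and>
    (\<forall>d\<in>Y. chord_type X d = chord_type X' d)"
  proof cases
    \<comment> \<open>All three chords are even, so the even chords contain the whole triangle and
      the parity rule applies once more.\<close>
    case 1
    have e: "even_chords X = insert p1 (insert p2 (insert p3 Z))"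
      "even_chords X' = insert p1' (insert p2' (insert p3' Z))"
      unfolding ev ev' using 1 o by auto
    note o' = triangle_chords_odd[OF TZ, folded e]
    have "chord_type X d = chord_type X' d" if "d \<in> Y" for d
      using o(5)[OF that] o'(5)[OF Y_Z[OF that]] by (auto simp: chord_type_def)
    then show ?thesis
      using 1 o o'(1-4) by (auto simp: chord_type_def triangle_types_def)
  next
    \<comment> \<open>Only one chord of the triangle survives. It meets the same chords of
      \<open>Z\<close> before and after the move, and it may have type 1 or 2.\<close>
    case 2
    have e: "even_chords X = insert p3 Z" "even_chords X' = insert p3' Z"
      unfolding ev ev' using 2 o by auto
    have "chord_type X d = chord_type X' d" if "d \<in> Y" for d
      using o(5)[OF that] sw[OF Y_Z[OF that]] Z by (auto simp: chord_type_def e odd_chord_insert)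
    then show ?thesis
      using 2 o Zo Z by (auto simp: chord_type_def triangle_types_def e odd_chord_insert)
  next
    case 3
    have e: "even_chords X = insert p2 Z" "even_chords X' = insert p2' Z"
      unfolding ev ev' using 3 o by auto
    have "chord_type X d = chord_type X' d" if "d \<in> Y" for d
      using o(5)[OF that] sw[OF Y_Z[OF that]] Z by (auto simp: chord_type_def e odd_chord_insert)
    then show ?thesis
      using 3 o Zo Z by (auto simp: chord_type_def triangle_types_def e odd_chord_insert)
  next
    case 4
    have e: "even_chords X = insert p1 Z" "even_chords X' = insert p1' Z"
      unfolding ev ev' using 4 o by auto
    have "chord_type X d = chord_type X' d" if "d \<in> Y" for d
      using o(5)[OF that] sw[OF Y_Z[OF that]] Z by (auto simp: chord_type_def e odd_chord_insert)
    then show ?thesis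
      using 4 o Zo Z by (auto simp: chord_type_def triangle_types_def e odd_chord_insert)
  qed
  then show "chord_type X p1 = chord_type X' p1'" "chord_type X p2 = chord_type X' p2'"
    "chord_type X p3 = chord_type X' p3'"
    "triangle_types (chord_type X p1) (chord_type X p2) (chord_type X p3)"
    "d \<in> Y \<Longrightarrow> chord_type X d = chord_type X' d"
    by blast+
qed

section \<open>The algebra of the third Reidemeister move\<close>

lemma relation_ideal_gens:
  "q_L * (p_L - t_L) \<in> relation_ideal" "q_L ^ 2 - (1 - t_L) * (1 - p_L) \<in> relation_ideal"
  "w_L * (1 - s_L) \<in> relation_ideal" "w_L * (t_L - r_L) \<in> relation_ideal"
  "w_L ^ 2 - (1 - t_L) * (1 - r_L * s_L) \<in> relation_ideal"
  "w_L * (p_L * s_L + q_L - 1) \<in> relation_ideal" "w_L * (r_L + q_L - 1) \<in> relation_ideal"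
  "w_L * (p_L - r_L) \<in> relation_ideal" "w_L ^ 2 - q_L * (1 - r_L * s_L) \<in> relation_ideal"
proof -
  interpret cring laurent_ring by (rule cring_laurent_ring)
  have "{q_L * (p_L - t_L), q_L ^ 2 - (1 - t_L) * (1 - p_L), w_L * (1 - s_L), w_L * (t_L - r_L),
      w_L ^ 2 - (1 - t_L) * (1 - r_L * s_L), w_L * (p_L * s_L + q_L - 1), w_L * (r_L + q_L - 1),
      w_L * (p_L - r_L), w_L ^ 2 - q_L * (1 - r_L * s_L)} \<subseteq> relation_ideal"
    unfolding relation_ideal_def by (rule genideal_self) (simp add: laurent_ring_def)
  then show "q_L * (p_L - t_L) \<in> relation_ideal" "q_L ^ 2 - (1 - t_L) * (1 - p_L) \<in> relation_ideal"
    "w_L * (1 - s_L) \<in> relation_ideal" "w_L * (t_L - r_L) \<in> relation_ideal"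
    "w_L ^ 2 - (1 - t_L) * (1 - r_L * s_L) \<in> relation_ideal"
    "w_L * (p_L * s_L + q_L - 1) \<in> relation_ideal" "w_L * (r_L + q_L - 1) \<in> relation_ideal"
    "w_L * (p_L - r_L) \<in> relation_ideal" "w_L ^ 2 - q_L * (1 - r_L * s_L) \<in> relation_ideal"
    unfolding insert_subset by - (elim conjE, assumption)+
qed

lemma relation_ideal_mult: "f \<in> relation_ideal \<Longrightarrow> g * f \<in> relation_ideal"
  using ideal.I_l_closed[OF ideal_relation_ideal, of f g] by (simp add: laurent_ring_def)

lemma relation_ideal_0: "0 \<in> relation_ideal"
  using relation_ideal_mult[OF relation_ideal_gens(1), of 0] by simp

lemma relation_ideal_uminus: "f \<in> relation_ideal \<Longrightarrow> - f \<in> relation_ideal"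
  using relation_ideal_mult[of f "-1"] by simp

text \<open>This is the origin of the generators of \<open>J\<close>. The triples (2,1,1) and
  (1,2,1) give \<open>q * (p - t)\<close>, and (1,2,1) also \<open>q^2 - (1 - t) * (1 - p)\<close>.
  From (2,0,0) comes \<open>w * (t - r)\<close>, from (1,0,0) come \<open>w * (p - r)\<close> and
  \<open>w * (r + q - 1)\<close>. The triples that begin with 0 give \<open>w * (1 - s)\<close>; the
  third identity gives \<open>w^2 - q * (1 - r * s)\<close> at (0,1,0),
  \<open>w^2 - (1 - t) * (1 - r * s)\<close> at (0,2,0) and \<open>w * (p * s + q - 1)\<close> at
  (0,0,1). At (0,0,2) it gives a multiple of \<open>w * (1 - s)\<close>, namely by
  \<open>- t\<close>. The triples (2,2,2) and (1,1,2) give only 0.\<close>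

lemma triangle_types_coefficients:
  assumes "triangle_types t1 t2 t3"
  shows "ga t1 * al t3 - ga t1 * al t2 \<in> relation_ideal"
    "ga t3 * be t1 - be t2 * ga t3 \<in> relation_ideal"
    "be t3 * (ga t2 * al t1) + ga t3 * ga t1 - ga t2 \<in> relation_ideal"
proof -
  note gens = relation_ideal_gens relation_ideal_gens[THEN relation_ideal_uminus] relation_ideal_0
    relation_ideal_mult[OF relation_ideal_gens(3), of "- t_L"]
  from assms have t: "(t1, t2, t3) \<in>
     {(2, 2, 2), (2, 1, 1), (1, 2, 1), (1, 1, 2), (1, 0, 0), (2, 0, 0),
      (0, 1, 0), (0, 2, 0), (0, 0, 1), (0, 0, 2)}" by (simp add: triangle_types_def)
  show "ga t1 * al t3 - ga t1 * al t2 \<in> relation_ideal"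
    using t gens by (auto simp: al_def ga_def algebra_simps)
  show "ga t3 * be t1 - be t2 * ga t3 \<in> relation_ideal"
    using t gens by (auto simp: be_def ga_def algebra_simps)
  show "be t3 * (ga t2 * al t1) + ga t3 * ga t1 - ga t2 \<in> relation_ideal"
    using t gens by (auto simp: al_def be_def ga_def algebra_simps power2_eq_square)
qed

context coeff_module
begin

text \<open>Since \<open>al n\<close> and \<open>be n\<close> are units, one colour on the overpass
  determines the other one, and then one colour on the underpass determines the other one.\<close>

lemma crossing_relation_unique:
  assumes r: "crossing_relation M n aL aR bL bR" and r': "crossing_relation M n aL' aR' bL' bR'"
    and C: "{aL, aR, bL, bR, aL', aR', bL', bR'} \<subseteq> carrier M"
    and a: "aL = aL' \<or> aR = aR'" and b: "bL = bL' \<or> bR = bR'"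
  shows "aL = aL' \<and> aR = aR' \<and> bL = bL' \<and> bR = bR'"
proof -
  obtain f where f: "al n * f = 1" using al_unit by blast
  obtain g where g: "be n * g = 1" using be_unit by blast
  have aL: "aL = aL'"
    using a act_cancel[OF f, of aL aL'] r r' C by (auto simp: crossing_relation_def)
  moreover have "aR = aR'" using aL r r' by (simp add: crossing_relation_def)
  moreover have bR: "bR = bR'"
  proof (rule disjE[OF b])
    assume "bL = bL'"
    then have "act M (be n) bR \<oplus> act M (ga n) aL = act M (be n) bR' \<oplus> act M (ga n) aL"
      using r r' aL by (simp add: crossing_relation_def)
    then have "act M (be n) bR = act M (be n) bR'" using C by simp
    then show ?thesis using act_cancel[OF g, of bR bR'] C by simp
  qed
  moreover have "bL = bL'" using aL bR r r' by (simp add: crossing_relation_def)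
  ultimately show ?thesis by blast
qed

lemma act_solve:
  assumes "f * g = 1" "m \<in> carrier M" "z \<in> carrier M"
  shows "\<exists>y\<in>carrier M. act M f y \<oplus> z = m"
proof
  show "act M g (m \<ominus> z) \<in> carrier M" using assms by simp
  have "act M f (act M g (m \<ominus> z)) = m \<ominus> z" using assms by (simp add: act_act)
  then show "act M f (act M g (m \<ominus> z)) \<oplus> z = m" using assms by (simp add: minus_eq a_assoc l_neg)
qed

lemma act_solve0: "f * g = 1 \<Longrightarrow> m \<in> carrier M \<Longrightarrow> \<exists>y\<in>carrier M. act M f y = m"
  using act_solve[of f g m \<zero>] by auto

lemma crossing_relation_solve:
  assumes "x \<in> carrier M" "y \<in> carrier M"
  shows "\<exists>aL aR bL bR. {aL, aR, bL, bR} \<subseteq> carrier M \<and> crossing_relation M n aL aR bL bR \<and>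
    (if l then aL else aR) = x \<and> (if l' then bL else bR) = y"
proof -
  obtain f where f: "al n * f = 1" using al_unit by blast
  obtain g where g: "be n * g = 1" using be_unit by blast
  obtain aL where aL: "aL \<in> carrier M" "(if l then aL else act M (al n) aL) = x"
    using act_solve0[OF f assms(1)] assms(1) by (cases l) auto
  obtain bR where bR: "bR \<in> carrier M" "(if l' then act M (be n) bR \<oplus> act M (ga n) aL else bR) = y"
    using act_solve[OF g assms(2), of "act M (ga n) aL"] assms(2) aL(1) by (cases l') auto
  show ?thesis
    by (rule exI[of _ aL], rule exI[of _ "act M (al n) aL"],
        rule exI[of _ "act M (be n) bR \<oplus> act M (ga n) aL"], rule exI[of _ bR])
       (use aL bR in \<open>auto simp: crossing_relation_def\<close>)
qed

text \<open>
  Three strands \<open>T\<close>, \<open>M\<close>, \<open>B\<close> (from top to bottom) are coloured by functions of the side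
  (\<open>True\<close> is left) with respect to the two other strands. Before the move the crossing of two
  strands lies on the side \<open>\<tau>\<close> of the third one, after the move it lies on the other side. All
  crossing relations on both sides have common solutions, parametrized by the colours
  \<open>T0\<close>, \<open>M0\<close>, \<open>B0\<close> of one piece of each strand.
\<close>

lemma triangle_relations:
  assumes ty: "triangle_types t1 t2 t3"
    and C: "\<And>x y. T x y \<in> carrier M" "\<And>x y. N x y \<in> carrier M" "\<And>x y. B x y \<in> carrier M"
    and r1: "crossing_relation M t1 (T True \<tau>B) (T False \<tau>B) (N True \<tau>B) (N False \<tau>B)"
    and r2: "crossing_relation M t2 (T \<tau>M True) (T \<tau>M False) (B True \<tau>M) (B False \<tau>M)"
    and r3: "crossing_relation M t3 (N \<tau>T True) (N \<tau>T False) (B \<tau>T True) (B \<tau>T False)"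
  shows "\<exists>T' N' B'. (\<forall>x y. T' x y \<in> carrier M \<and> N' x y \<in> carrier M \<and> B' x y \<in> carrier M) \<and>
    crossing_relation M t1 (T' True (\<not> \<tau>B)) (T' False (\<not> \<tau>B)) (N' True (\<not> \<tau>B)) (N' False (\<not> \<tau>B)) \<and>
    crossing_relation M t2 (T' (\<not> \<tau>M) True) (T' (\<not> \<tau>M) False) (B' True (\<not> \<tau>M)) (B' False (\<not> \<tau>M)) \<and>
    crossing_relation M t3 (N' (\<not> \<tau>T) True) (N' (\<not> \<tau>T) False) (B' (\<not> \<tau>T) True) (B' (\<not> \<tau>T) False) \<and>
    (\<forall>x. T' x \<tau>B = T x \<tau>B \<and> T' \<tau>M x = T \<tau>M x \<and> N' x \<tau>B = N x \<tau>B \<and> N' \<tau>T x = N \<tau>T x \<and>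
         B' x \<tau>M = B x \<tau>M \<and> B' \<tau>T x = B \<tau>T x)"
proof -
  let ?a = "act M"
  \<comment> \<open>\<open>T0\<close>, \<open>N0\<close>, \<open>B0\<close> are the colours of the
    top strand on the left of both others, of the middle strand on the right of the top and the left
    of the bottom one, and of the bottom strand on the right of both. From these pieces all other
    colours are obtained without dividing by units.\<close>
  define Tc where "Tc T0 x y = ?a ((if x then 1 else al t1) * (if y then 1 else al t2)) T0" for T0 x y
  define Nc where "Nc T0 N0 x y =
    ?a (if y then 1 else al t3) (if x then ?a (be t1) N0 \<oplus> ?a (ga t1) T0 else N0)" for T0 N0 x y
  define Bc where "Bc T0 N0 B0 x y =
    (if x then ?a (be t2) (if y then ?a (be t3) B0 \<oplus> ?a (ga t3) N0 else B0) \<oplus> ?a (ga t2) (Tc T0 y True)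
     else if y then ?a (be t3) B0 \<oplus> ?a (ga t3) N0 else B0)" for T0 N0 B0 x y
  obtain f1 f2 f3 g1 g2 g3 where u: "al t1 * f1 = 1" "al t2 * f2 = 1" "al t3 * f3 = 1"
    "be t1 * g1 = 1" "be t2 * g2 = 1" "be t3 * g3 = 1"
    using al_unit be_unit by metis
  have al12: "(al t1 * al t2) * (f1 * f2) = 1" using u(1,2) by (simp add: mult.left_commute mult.assoc)
      (metis mult.assoc mult.commute mult_1)
  \<comment> \<open>\<open>T \<tau>M \<tau>B\<close>, \<open>N \<tau>T \<tau>B\<close> and
    \<open>B \<tau>T \<tau>M\<close> are the edges of the given triangle, that is the pieces between
    the two crossings of a strand. The three parameters are solved for so that these edges get their
    given colours.\<close>
  have "\<exists>f. ((if \<tau>M then 1 else al t1) * (if \<tau>B then 1 else al t2)) * f = 1"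
    using u(1,2) al12 by (cases \<tau>M; cases \<tau>B) (auto intro: exI[of _ 1])
  then obtain f where "((if \<tau>M then 1 else al t1) * (if \<tau>B then 1 else al t2)) * f = 1" by blast
  from act_solve0[OF this C(1)] obtain T0 where T0: "T0 \<in> carrier M" "Tc T0 \<tau>M \<tau>B = T \<tau>M \<tau>B"
    unfolding Tc_def by blast
  have Tc [simp]: "Tc T0 x y \<in> carrier M" for x y using T0(1) by (simp add: Tc_def)
  have "\<exists>N1\<in>carrier M. ?a (if \<tau>B then 1 else al t3) N1 = N \<tau>T \<tau>B"
    using act_solve0[OF u(3) C(2)] C(2) by (cases \<tau>B) auto
  then obtain N1 where N1: "N1 \<in> carrier M" "?a (if \<tau>B then 1 else al t3) N1 = N \<tau>T \<tau>B" by blast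
  have "\<exists>N0\<in>carrier M. (if \<tau>T then ?a (be t1) N0 \<oplus> ?a (ga t1) T0 else N0) = N1"
    using act_solve[OF u(4) N1(1), of "?a (ga t1) T0"] T0(1) N1(1) by (cases \<tau>T) auto
  then obtain N0 where N0: "N0 \<in> carrier M" "Nc T0 N0 \<tau>T \<tau>B = N \<tau>T \<tau>B"
    using N1(2) by (auto simp: Nc_def)
  have Nc [simp]: "Nc T0 N0 x y \<in> carrier M" for x y using T0(1) N0(1) by (simp add: Nc_def)
  have "\<exists>B1\<in>carrier M. (if \<tau>T then ?a (be t2) B1 \<oplus> ?a (ga t2) (Tc T0 \<tau>M True) else B1) = B \<tau>T \<tau>M"
    using act_solve[OF u(5) C(3), of "?a (ga t2) (Tc T0 \<tau>M True)"] C(3) by (cases \<tau>T) auto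
  then obtain B1 where B1: "B1 \<in> carrier M"
    "(if \<tau>T then ?a (be t2) B1 \<oplus> ?a (ga t2) (Tc T0 \<tau>M True) else B1) = B \<tau>T \<tau>M" by blast
  have "\<exists>B0\<in>carrier M. (if \<tau>M then ?a (be t3) B0 \<oplus> ?a (ga t3) N0 else B0) = B1"
    using act_solve[OF u(6) B1(1), of "?a (ga t3) N0"] N0(1) B1(1) by (cases \<tau>M) auto
  then obtain B0 where B0: "B0 \<in> carrier M" "Bc T0 N0 B0 \<tau>T \<tau>M = B \<tau>T \<tau>M"
    using B1(2) by (cases \<tau>T; cases \<tau>M) (auto simp: Bc_def)
  have Bc [simp]: "Bc T0 N0 B0 x y \<in> carrier M" for x y using T0(1) N0(1) B0(1) by (simp add: Bc_def)
  note coeffs = triangle_types_coefficients[OF ty]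
  \<comment> \<open>The relations are shown on both sides of the third strand, which covers the
    situations before and after the move. \<open>c2\<close> holds by construction, \<open>c1\<close>
    uses the first coefficient identity, and \<open>c3\<close> on the left of the top strand uses
    the other two.\<close>
  have c1: "crossing_relation M t1 (Tc T0 True y) (Tc T0 False y) (Nc T0 N0 True y) (Nc T0 N0 False y)" for y
    unfolding crossing_relation_def
  proof
    show "Tc T0 False y = ?a (al t1) (Tc T0 True y)" using T0(1) by (simp add: Tc_def act_act)
    have "?a (ga t1 * al t3) T0 = ?a (ga t1 * al t2) T0" by (rule act_cong[OF coeffs(1)])
    then show "Nc T0 N0 True y = ?a (be t1) (Nc T0 N0 False y) \<oplus> ?a (ga t1) (Tc T0 True y)"
      using T0(1) N0(1) by (cases y) (simp_all add: Tc_def Nc_def act_act act_distr mult.commute)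
  qed
  have c2: "crossing_relation M t2 (Tc T0 x True) (Tc T0 x False) (Bc T0 N0 B0 True x) (Bc T0 N0 B0 False x)" for x
    using T0(1) by (simp add: crossing_relation_def Bc_def) (simp add: Tc_def act_act mult.commute)
  have c3: "crossing_relation M t3 (Nc T0 N0 x True) (Nc T0 N0 x False) (Bc T0 N0 B0 x True) (Bc T0 N0 B0 x False)" for x
    unfolding crossing_relation_def
  proof
    show "Nc T0 N0 x False = ?a (al t3) (Nc T0 N0 x True)" using T0(1) N0(1) by (simp add: Nc_def)
    show "Bc T0 N0 B0 x True = ?a (be t3) (Bc T0 N0 B0 x False) \<oplus> ?a (ga t3) (Nc T0 N0 x True)"
    proof (cases x)
      case True
      have 1: "?a (ga t3 * be t1) N0 = ?a (be t2 * ga t3) N0" by (rule act_cong[OF coeffs(2)])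
      have 2: "?a (be t3 * (ga t2 * al t1)) T0 \<oplus> ?a (ga t3 * ga t1) T0 = ?a (ga t2) T0"
        using act_cong[OF coeffs(3), of T0] T0(1) by (simp add: act_add)
      have "?a (be t3) (Bc T0 N0 B0 True False) \<oplus> ?a (ga t3) (Nc T0 N0 True True) =
        (?a (be t3 * be t2) B0 \<oplus> ?a (be t3 * (ga t2 * al t1)) T0) \<oplus> (?a (ga t3 * be t1) N0 \<oplus> ?a (ga t3 * ga t1) T0)"
        using T0(1) N0(1) B0(1) by (simp add: Bc_def Nc_def Tc_def act_act act_distr)
      also have "\<dots> = (?a (be t3 * be t2) B0 \<oplus> ?a (ga t3 * be t1) N0) \<oplus>
          (?a (be t3 * (ga t2 * al t1)) T0 \<oplus> ?a (ga t3 * ga t1) T0)"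
        using T0(1) N0(1) B0(1) by (simp add: a_ac)
      also have "\<dots> = Bc T0 N0 B0 True True"
        unfolding 1 2 using T0(1) N0(1) B0(1) by (simp add: Bc_def Tc_def act_act act_distr mult.commute)
      finally show ?thesis using True by simp
    qed (use T0(1) N0(1) B0(1) in \<open>simp add: Bc_def Nc_def\<close>)
  qed
  \<comment> \<open>The new colours agree with the old ones on the edges of the triangle; uniqueness
    at each crossing extends the agreement to the pieces beyond.\<close>
  have "Tc T0 True \<tau>B = T True \<tau>B \<and> Tc T0 False \<tau>B = T False \<tau>B \<and>
      Nc T0 N0 True \<tau>B = N True \<tau>B \<and> Nc T0 N0 False \<tau>B = N False \<tau>B"
    by (rule crossing_relation_unique[OF c1 r1]) (use C T0(2) N0(2) in \<open>cases \<tau>M; cases \<tau>T; auto\<close>)+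
  moreover have "Tc T0 \<tau>M True = T \<tau>M True \<and> Tc T0 \<tau>M False = T \<tau>M False \<and>
      Bc T0 N0 B0 True \<tau>M = B True \<tau>M \<and> Bc T0 N0 B0 False \<tau>M = B False \<tau>M"
    by (rule crossing_relation_unique[OF c2 r2]) (use C T0(2) B0(2) in \<open>cases \<tau>B; cases \<tau>T; auto\<close>)+
  moreover have "Nc T0 N0 \<tau>T True = N \<tau>T True \<and> Nc T0 N0 \<tau>T False = N \<tau>T False \<and>
      Bc T0 N0 B0 \<tau>T True = B \<tau>T True \<and> Bc T0 N0 B0 \<tau>T False = B \<tau>T False"
    by (rule crossing_relation_unique[OF c3 r3]) (use C N0(2) B0(2) in \<open>cases \<tau>B; cases \<tau>M; auto\<close>)+
  ultimately have "\<forall>x. Tc T0 x \<tau>B = T x \<tau>B \<and> Tc T0 \<tau>M x = T \<tau>M x \<and> Nc T0 N0 x \<tau>B = N x \<tau>B \<and>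
      Nc T0 N0 \<tau>T x = N \<tau>T x \<and> Bc T0 N0 B0 x \<tau>M = B x \<tau>M \<and> Bc T0 N0 B0 \<tau>T x = B \<tau>T x"
    by (metis (full_types))
  then show ?thesis
    using c1 c2 c3 Tc Nc Bc by (intro exI[of _ "Tc T0"] exI[of _ "Nc T0 N0"] exI[of _ "Bc T0 N0 B0"]) blast
qed

end

section \<open>Colorings of local pictures\<close>

text \<open>
  A crossing of a picture is \<open>((i, p), (j, q), s, t)\<close>: strand \<open>i\<close> at the parameter \<open>p\<close> passes
  over strand \<open>j\<close> at the parameter \<open>q\<close>, where \<open>s\<close> is the sign if both strands are traversed
  forwards, and the crossing has type \<open>t\<close>. If strand \<open>i\<close> is traversed in the direction
  \<open>\<epsilon> i\<close>, the actual sign is \<open>s * \<epsilon> i * \<epsilon> j\<close>.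
\<close>

type_synonym picture = "((nat \<times> real) \<times> (nat \<times> real) \<times> real \<times> nat) set"

definition picture_ends :: "picture \<Rightarrow> (nat \<times> real) set" where
  "picture_ends Q = fst ` Q \<union> (\<lambda>x. fst (snd x)) ` Q"

text \<open>The actual sign of a crossing is \<open>s * \<epsilon> i * \<epsilon> j\<close>. In the
  coordinate of strand \<open>i\<close>, which runs against the parameter if
  \<open>\<epsilon> i = -1\<close>, it is multiplied by \<open>\<epsilon> i\<close> once more, which
  leaves \<open>s * \<epsilon> j\<close>; on strand \<open>j\<close> it leaves
  \<open>s * \<epsilon> i\<close>.\<close>

definition strand_coloring ::
  "(laurent set, 'm, 'e) module_scheme \<Rightarrow> nat \<Rightarrow> (nat \<Rightarrow> real) \<Rightarrow> picture \<Rightarrow> (nat \<Rightarrow> real \<Rightarrow> 'm) \<Rightarrow> bool"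
where
  "strand_coloring M n \<epsilon> Q F \<longleftrightarrow>
     (\<forall>i<n. \<forall>u. F i u \<in> carrier M) \<and>
     (\<forall>i<n. \<forall>u. -1 < u \<and> u < 1 \<and> (i, u) \<notin> picture_ends Q \<longrightarrow> const_near (F i) u) \<and>
     (\<forall>i<n. germ (F i) (-1) 1 (F i (-1)) \<and> germ (F i) 1 (-1) (F i 1)) \<and>
     (\<forall>((i, p), (j, q), s, t)\<in>Q. \<exists>aL aR bL bR.
        germ (F i) p (- s * \<epsilon> j) aL \<and> germ (F i) p (s * \<epsilon> j) aR \<and>
        germ (F j) q (s * \<epsilon> i) bL \<and> germ (F j) q (- s * \<epsilon> i) bR \<and>
        crossing_relation M t aL aR bL bR)"

definition same_ends :: "nat \<Rightarrow> (nat \<Rightarrow> real \<Rightarrow> 'm) \<Rightarrow> (nat \<Rightarrow> real \<Rightarrow> 'm) \<Rightarrow> bool" where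
  "same_ends n F F' \<longleftrightarrow> (\<forall>i<n. F i (-1) = F' i (-1) \<and> F i 1 = F' i 1)"

definition picture_extends ::
  "(laurent set, 'm, 'e) module_scheme \<Rightarrow> nat \<Rightarrow> (nat \<Rightarrow> real) \<Rightarrow> picture \<Rightarrow> picture \<Rightarrow> bool" where
  "picture_extends M n \<epsilon> Q Q' \<longleftrightarrow>
     (\<forall>F. strand_coloring M n \<epsilon> Q F \<longrightarrow> (\<exists>F'. strand_coloring M n \<epsilon> Q' F' \<and> same_ends n F F'))"

definition picture_rigid ::
  "(laurent set, 'm, 'e) module_scheme \<Rightarrow> nat \<Rightarrow> (nat \<Rightarrow> real) \<Rightarrow> picture \<Rightarrow> bool" where
  "picture_rigid M n \<epsilon> Q \<longleftrightarrow>
     (\<forall>F F'. strand_coloring M n \<epsilon> Q F \<longrightarrow> strand_coloring M n \<epsilon> Q F' \<longrightarrow> same_ends n F F' \<longrightarrow>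
        (\<forall>i<n. \<forall>u\<in>{-1..1}. (i, u) \<notin> picture_ends Q \<longrightarrow> F i u = F' i u))"

lemma strand_coloringD:
  assumes "strand_coloring M n \<epsilon> Q F"
  shows "i < n \<Longrightarrow> F i u \<in> carrier M"
    "i < n \<Longrightarrow> -1 < u \<Longrightarrow> u < 1 \<Longrightarrow> (i, u) \<notin> picture_ends Q \<Longrightarrow> const_near (F i) u"
    "i < n \<Longrightarrow> germ (F i) (-1) 1 (F i (-1))" "i < n \<Longrightarrow> germ (F i) 1 (-1) (F i 1)"
  using assms unfolding strand_coloring_def by blast+

lemma strand_coloring_crossing:
  assumes "strand_coloring M n \<epsilon> Q F" "((i, p), (j, q), s, t) \<in> Q"
  obtains aL aR bL bR where
    "germ (F i) p (- s * \<epsilon> j) aL" "germ (F i) p (s * \<epsilon> j) aR"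
    "germ (F j) q (s * \<epsilon> i) bL" "germ (F j) q (- s * \<epsilon> i) bR"
    "crossing_relation M t aL aR bL bR"
proof -
  have "\<forall>((i, p), (j, q), s, t)\<in>Q. \<exists>aL aR bL bR.
        germ (F i) p (- s * \<epsilon> j) aL \<and> germ (F i) p (s * \<epsilon> j) aR \<and>
        germ (F j) q (s * \<epsilon> i) bL \<and> germ (F j) q (- s * \<epsilon> i) bR \<and>
        crossing_relation M t aL aR bL bR"
    using assms(1) unfolding strand_coloring_def by blast
  from bspec[OF this assms(2)] show ?thesis using that unfolding prod.case by blast
qed

lemma germ_cong_near:
  assumes "germ c x d a" "\<delta> > 0" "\<And>h. 0 < h \<Longrightarrow> h < \<delta> \<Longrightarrow> c' (x + d * h) = c (x + d * h)"
  shows "germ c' x d a"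
  using germ_cong[OF assms(1,2)] assms(3) by blast

lemma const_near_cong:
  assumes "const_near c x" "\<delta> > 0" "\<And>y. \<bar>y - x\<bar> < \<delta> \<Longrightarrow> c' y = c y"
  shows "const_near c' x"
proof -
  obtain \<epsilon> where \<epsilon>: "\<epsilon> > 0" "\<And>y. \<bar>y - x\<bar> < \<epsilon> \<Longrightarrow> c y = c x"
    using assms(1) unfolding const_near_def by blast
  have "c' y = c' x" if "\<bar>y - x\<bar> < min \<delta> \<epsilon>" for y
    using assms(3)[of y] assms(3)[of x] \<epsilon>(2)[of y] that assms(2) by simp
  moreover have "min \<delta> \<epsilon> > 0" using assms(2) \<epsilon>(1) by simp
  ultimately show ?thesis unfolding const_near_def by blast
qed

lemma const_near_const [simp]: "const_near (\<lambda>_. a) x"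
  unfolding const_near_def by (auto intro: exI[of _ 1])

lemma germ_const [simp]: "germ (\<lambda>_. a) x d a"
  unfolding germ_def by (auto intro: exI[of _ 1])

text \<open>Beyond \<open>-1\<close> and \<open>1\<close> the strand is prolonged by constants in order to apply \<open>const_segment\<close>.\<close>

lemma strand_const:
  assumes F: "strand_coloring M n \<epsilon> Q F" and i: "i < n" and u: "-1 \<le> u" "u \<le> u'" "u' \<le> 1"
    and no: "\<And>x. u \<le> x \<Longrightarrow> x \<le> u' \<Longrightarrow> -1 < x \<Longrightarrow> x < 1 \<Longrightarrow> (i, x) \<notin> picture_ends Q"
  shows "F i u = F i u'"
proof -
  define G where "G x = F i (max (-1) (min 1 x))" for x
  have "const_near G x" if x: "x \<in> closed_segment u u'" for x
  proof -
    have x': "u \<le> x" "x \<le> u'" using x u(2) by (auto simp: closed_segment_eq_real_ivl)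
    consider "-1 < x" "x < 1" | "x = -1" | "x = 1" using x' u by linarith
    then show ?thesis
    proof cases
      case 1
      have "const_near (F i) x" by (rule strand_coloringD(2)[OF F i 1 no[OF x' 1]])
      moreover have "G y = F i y" if "\<bar>y - x\<bar> < min (x + 1) (1 - x)" for y
        using that by (simp add: G_def abs_less_iff)
      moreover have "min (x + 1) (1 - x) > 0" using 1 by simp
      ultimately show ?thesis using const_near_cong by blast
    next
      case 2
      have "germ G (-1) 1 (F i (-1))"
        by (rule germ_cong_near[OF strand_coloringD(3)[OF F i], of 1]) (auto simp: G_def)
      moreover have "germ G (-1) (-1) (F i (-1))"
        unfolding germ_def by (intro exI[of _ 1]) (auto simp: G_def)
      ultimately show ?thesis
        unfolding 2 by (intro germ_const_nearI[of _ _ "F i (-1)"]) (auto simp: G_def)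
    next
      case 3
      have "germ G 1 (-1) (F i 1)"
        by (rule germ_cong_near[OF strand_coloringD(4)[OF F i], of 1]) (auto simp: G_def)
      moreover have "germ G 1 1 (F i 1)"
        unfolding germ_def by (intro exI[of _ 1]) (auto simp: G_def)
      ultimately show ?thesis
        unfolding 3 by (intro germ_const_nearI[of _ _ "F i 1"]) (auto simp: G_def)
    qed
  qed
  then have "G u = G u'" by (rule const_segment)
  then show ?thesis using u by (simp add: G_def)
qed

lemma strand_const_segment:
  assumes F: "strand_coloring M n \<epsilon> Q F" and i: "i < n" and u: "u \<in> {-1..1}" "u' \<in> {-1..1}"
    and no: "\<And>x. x \<in> closed_segment u u' \<Longrightarrow> (i, x) \<notin> picture_ends Q"
  shows "F i u = F i u'"
proof (cases "u \<le> u'")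
  case True
  then show ?thesis
    using u by (intro strand_const[OF F i] no) (auto simp: closed_segment_eq_real_ivl)
next
  case False
  then show ?thesis
    using u by (intro strand_const[OF F i, symmetric] no) (auto simp: closed_segment_eq_real_ivl)
qed

lemma strand_germ_right:
  assumes F: "strand_coloring M n \<epsilon> Q F" and i: "i < n" and u: "-1 \<le> p" "p < u" "u \<le> 1"
    and no: "\<And>x. p < x \<Longrightarrow> x \<le> u \<Longrightarrow> x < 1 \<Longrightarrow> (i, x) \<notin> picture_ends Q"
  shows "germ (F i) p 1 (F i u)"
  unfolding germ_def
proof (intro exI[of _ "u - p"] conjI allI impI)
  fix h assume "0 < h \<and> h < u - p"
  then show "F i (p + 1 * h) = F i u"
    using u by (intro strand_const[OF F i] no) auto
qed (use u in simp)

lemma strand_germ_left: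
  assumes F: "strand_coloring M n \<epsilon> Q F" and i: "i < n" and u: "-1 \<le> u" "u < p" "p \<le> 1"
    and no: "\<And>x. u \<le> x \<Longrightarrow> x < p \<Longrightarrow> -1 < x \<Longrightarrow> (i, x) \<notin> picture_ends Q"
  shows "germ (F i) p (-1) (F i u)"
  unfolding germ_def
proof (intro exI[of _ "p - u"] conjI allI impI)
  fix h assume "0 < h \<and> h < p - u"
  then show "F i (p + -1 * h) = F i u"
    using u by (intro strand_const[OF F i, symmetric] no) auto
qed (use u in simp)

lemma strand_coloring_empty:
  assumes "strand_coloring M n \<epsilon> {} F" "i < n" "-1 \<le> u" "u \<le> 1"
  shows "F i u = F i (-1)"
  using strand_const[OF assms(1,2), of "-1" u] assms(3,4) by (simp add: picture_ends_def)

lemma strand_coloring_const: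
  "(\<And>i. i < n \<Longrightarrow> A i \<in> carrier M) \<Longrightarrow> strand_coloring M n \<epsilon> {} (\<lambda>i u. A i)"
  unfolding strand_coloring_def by simp

lemma picture_rigid_empty: "picture_rigid M n \<epsilon> {}"
  unfolding picture_rigid_def same_ends_def
  using strand_coloring_empty by (metis atLeastAtMost_iff)

context coeff_module
begin

subsection \<open>First move\<close>

text \<open>Here \<open>t + (1 - t) = 1\<close> is used: a crossing of type 2 imposes nothing on a
  constant coloring.\<close>

lemma crossing_relation_const: "A \<in> carrier M \<Longrightarrow> crossing_relation M 2 A A A A"
  by (simp add: crossing_relation_def al_def be_def ga_def flip: act_add)

text \<open>The loop of the curl is adjacent to the overpass and to the underpass. Type 2 does not
  break the overpass, so one colour of the underpass equals the colour of the overpass, and by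
  uniqueness so does the other.\<close>

lemma curl_const:
  assumes F: "strand_coloring M 1 \<epsilon> {((0, p), (0, - p), s, 2)} F"
    and p: "\<bar>p\<bar> = u0" "0 < u0" "u0 < 1" and s: "\<bar>s\<bar> = 1" and \<epsilon>: "\<bar>\<epsilon> 0\<bar> = 1"
    and u: "-1 \<le> u" "u \<le> 1" "\<bar>u\<bar> \<noteq> u0"
  shows "F 0 u = F 0 (-1)"
proof -
  let ?Q = "{((0::nat, p), (0::nat, - p), s, 2::nat)}"
  have ends: "(0, x) \<in> picture_ends ?Q \<longleftrightarrow> \<bar>x\<bar> = u0" for x
    using p by (auto simp: picture_ends_def)
  have g: "germ (F 0) (- u0) (-1) (F 0 (-1))" "germ (F 0) (- u0) 1 (F 0 0)"
    "germ (F 0) u0 (-1) (F 0 0)" "germ (F 0) u0 1 (F 0 1)"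
    using p by (auto intro!: strand_germ_left[OF F] strand_germ_right[OF F] simp: ends)
  have C: "F 0 x \<in> carrier M" for x using strand_coloringD(1)[OF F] by simp
  obtain aL aR bL bR where ge: "germ (F 0) p (- s * \<epsilon> 0) aL" "germ (F 0) p (s * \<epsilon> 0) aR"
    "germ (F 0) (- p) (s * \<epsilon> 0) bL" "germ (F 0) (- p) (- s * \<epsilon> 0) bR"
    and rel: "crossing_relation M 2 aL aR bL bR"
    by (rule strand_coloring_crossing[OF F, of 0 p 0 "- p" s 2]) simp
  have d: "s * \<epsilon> 0 = 1 \<or> s * \<epsilon> 0 = -1" using s \<epsilon> by (auto simp: abs_if split: if_splits)
  have p': "p = u0 \<or> p = - u0" using p by auto
  have unique: "F 0 1 = F 0 (-1) \<and> F 0 0 = F 0 (-1)"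
  proof -
    \<comment> \<open>The strand has three pieces, sampled at -1, 0 and 1. The cases tell which
      passage of the curl is the overpass and on which side of it the left of the other passage
      lies.\<close>
    have cs: "(aL = F 0 0 \<and> aR = F 0 1 \<and> bL = F 0 0 \<and> bR = F 0 (-1)) \<or>
        (aL = F 0 1 \<and> aR = F 0 0 \<and> bL = F 0 (-1) \<and> bR = F 0 0) \<or>
        (aL = F 0 (-1) \<and> aR = F 0 0 \<and> bL = F 0 1 \<and> bR = F 0 0) \<or>
        (aL = F 0 0 \<and> aR = F 0 (-1) \<and> bL = F 0 0 \<and> bR = F 0 1)"
    proof -
      note U = germ_unique[OF ge(1)] germ_unique[OF ge(2)] germ_unique[OF ge(3)] germ_unique[OF ge(4)]
      consider "p = u0" "s * \<epsilon> 0 = 1" | "p = u0" "s * \<epsilon> 0 = -1"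
        | "p = - u0" "s * \<epsilon> 0 = 1" | "p = - u0" "s * \<epsilon> 0 = -1" using d p' by blast
      then show ?thesis
      proof cases
        case 1
        then show ?thesis
          using U(1)[of "F 0 0"] U(2)[of "F 0 1"] U(3)[of "F 0 0"] U(4)[of "F 0 (-1)"] g by simp
      next
        case 2
        then show ?thesis
          using U(1)[of "F 0 1"] U(2)[of "F 0 0"] U(3)[of "F 0 (-1)"] U(4)[of "F 0 0"] g by simp
      next
        case 3
        then show ?thesis
          using U(1)[of "F 0 (-1)"] U(2)[of "F 0 0"] U(3)[of "F 0 1"] U(4)[of "F 0 0"] g by simp
      next
        case 4
        then show ?thesis
          using U(1)[of "F 0 0"] U(2)[of "F 0 (-1)"] U(3)[of "F 0 0"] U(4)[of "F 0 1"] g by simp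
      qed
    qed
    have aR: "aR = aL" using rel C cs by (auto simp: crossing_relation_def al_def)
    have b: "bL = aL \<or> bR = aL" using cs aR by (elim disjE) simp_all
    have c: "aL \<in> carrier M" "aR \<in> carrier M" "bL \<in> carrier M" "bR \<in> carrier M"
      using cs C by (elim disjE; simp)+
    have "bL = aL \<and> bR = aL"
      using crossing_relation_unique[OF rel crossing_relation_const[OF c(1)] _ disjI1[OF refl] b] c by simp
    then show ?thesis using cs aR by (elim disjE) simp_all
  qed
  consider "u < - u0" | "- u0 < u" "u < u0" | "u0 < u" using u(3) p by linarith
  then show ?thesis
  proof cases
    case 1
    show ?thesis
      by (rule strand_const_segment[OF F])
         (use 1 u p in \<open>auto simp: ends closed_segment_eq_real_ivl split: if_splits\<close>)
  next
    case 2
    have "F 0 u = F 0 0"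
      by (rule strand_const_segment[OF F])
         (use 2 u p in \<open>auto simp: ends closed_segment_eq_real_ivl split: if_splits\<close>)
    then show ?thesis using unique by simp
  next
    case 3
    have "F 0 u = F 0 1"
      by (rule strand_const_segment[OF F])
         (use 3 u p in \<open>auto simp: ends closed_segment_eq_real_ivl split: if_splits\<close>)
    then show ?thesis using unique by simp
  qed
qed

lemma curl_picture:
  assumes p: "\<bar>p\<bar> = u0" "0 < u0" "u0 < 1" and s: "\<bar>s\<bar> = 1" and \<epsilon>: "\<bar>\<epsilon> 0\<bar> = 1"
  defines "Q \<equiv> {((0, p), (0, - p), s, 2)}"
  shows "picture_extends M 1 \<epsilon> {} Q" "picture_extends M 1 \<epsilon> Q {}" "picture_rigid M 1 \<epsilon> Q"
proof -
  note const = curl_const[where \<epsilon> = \<epsilon>, OF _ p s \<epsilon>, folded Q_def]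
  show "picture_extends M 1 \<epsilon> {} Q"
    unfolding picture_extends_def
  proof (intro allI impI)
    fix F :: "nat \<Rightarrow> real \<Rightarrow> _" assume F: "strand_coloring M 1 \<epsilon> {} F"
    have C: "F 0 (-1) \<in> carrier M" using strand_coloringD(1)[OF F] by simp
    have "strand_coloring M 1 \<epsilon> Q (\<lambda>i u. F 0 (-1))"
      unfolding strand_coloring_def Q_def using crossing_relation_const[OF C] C
      by (auto intro!: exI[of _ "F 0 (-1)"])
    moreover have "same_ends 1 F (\<lambda>i u. F 0 (-1))"
      using strand_coloring_empty[OF F, of 0 1] by (simp add: same_ends_def)
    ultimately show "\<exists>F'. strand_coloring M 1 \<epsilon> Q F' \<and> same_ends 1 F F'" by blast
  qed
  show "picture_extends M 1 \<epsilon> Q {}"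
    unfolding picture_extends_def
  proof (intro allI impI)
    fix F :: "nat \<Rightarrow> real \<Rightarrow> _" assume F: "strand_coloring M 1 \<epsilon> Q F"
    have "strand_coloring M 1 \<epsilon> {} (\<lambda>i u. F 0 (-1))"
      by (rule strand_coloring_const) (use strand_coloringD(1)[OF F] in simp)
    moreover have "same_ends 1 F (\<lambda>i u. F 0 (-1))"
      using const[OF F, of 1] p by (simp add: same_ends_def)
    ultimately show "\<exists>F'. strand_coloring M 1 \<epsilon> {} F' \<and> same_ends 1 F F'" by blast
  qed
  show "picture_rigid M 1 \<epsilon> Q"
    unfolding picture_rigid_def
  proof (intro allI impI ballI)
    fix F F' :: "nat \<Rightarrow> real \<Rightarrow> _" and i u
    assume "strand_coloring M 1 \<epsilon> Q F" "strand_coloring M 1 \<epsilon> Q F'" "same_ends 1 F F'" "i < (1::nat)"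
      "u \<in> {-1..1::real}" "(i, u) \<notin> picture_ends Q"
    moreover from this have "\<bar>u\<bar> \<noteq> u0" using p by (auto simp: Q_def picture_ends_def)
    ultimately show "F i u = F' i u" using const[of F u] const[of F' u] by (simp add: same_ends_def)
  qed
qed

end

lemma strand_coloringI:
  assumes "\<And>i u. i < n \<Longrightarrow> F i u \<in> carrier M"
    "\<And>i u. i < n \<Longrightarrow> -1 < u \<Longrightarrow> u < 1 \<Longrightarrow> (i, u) \<notin> picture_ends Q \<Longrightarrow> const_near (F i) u"
    "\<And>i. i < n \<Longrightarrow> germ (F i) (-1) 1 (F i (-1))" "\<And>i. i < n \<Longrightarrow> germ (F i) 1 (-1) (F i 1)"
    "\<And>i p j q s t. ((i, p), (j, q), s, t) \<in> Q \<Longrightarrow> \<exists>aL aR bL bR.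
        germ (F i) p (- s * \<epsilon> j) aL \<and> germ (F i) p (s * \<epsilon> j) aR \<and>
        germ (F j) q (s * \<epsilon> i) bL \<and> germ (F j) q (- s * \<epsilon> i) bR \<and>
        crossing_relation M t aL aR bL bR"
  shows "strand_coloring M n \<epsilon> Q F"
proof -
  have "case c of ((i, p), (j, q), s, t) \<Rightarrow> \<exists>aL aR bL bR.
        germ (F i) p (- s * \<epsilon> j) aL \<and> germ (F i) p (s * \<epsilon> j) aR \<and>
        germ (F j) q (s * \<epsilon> i) bL \<and> germ (F j) q (- s * \<epsilon> i) bR \<and>
        crossing_relation M t aL aR bL bR" if "c \<in> Q" for c
  proof -
    obtain i p j q s t where c: "c = ((i, p), (j, q), s, t)" by (metis surj_pair)
    show ?thesis unfolding c prod.case by (rule assms(5)) (use that c in simp)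
  qed
  then show ?thesis
    unfolding strand_coloring_def using assms(1-4) by blast
qed

context coeff_module
begin

subsection \<open>Second move\<close>

text \<open>Both crossings give the same relation between the inner and the outer pieces: from one
  to the other the sign of the crossing changes, and so does the direction that leads out of the
  bigon. \<open>e\<close> selects the crossing, and \<open>w k d\<close> is the outer piece of
  strand \<open>k\<close> for \<open>d = 1\<close> and the inner piece otherwise.\<close>

lemma bigon_relation:
  assumes F: "strand_coloring M 2 \<epsilon> {((i, u0), (j, u0), s, t), ((i, - u0), (j, - u0), - s, t)} F"
    and ij: "i < 2" "j < 2" "i \<noteq> j" and u0: "0 < u0" "u0 < 1" and s: "\<bar>s\<bar> = 1" and \<epsilon>: "\<bar>\<epsilon> i\<bar> = 1" "\<bar>\<epsilon> j\<bar> = 1"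
    and e: "e = 1 \<or> e = -1"
  defines "w \<equiv> \<lambda>k d. if d = 1 then F k e else F k 0"
  shows "crossing_relation M t (w i (- s * \<epsilon> j)) (w i (s * \<epsilon> j)) (w j (s * \<epsilon> i)) (w j (- s * \<epsilon> i))"
proof -
  let ?Q = "{((i, u0), (j, u0), s, t), ((i, - u0), (j, - u0), - s, t)}"
  have ends: "(k, x) \<in> picture_ends ?Q \<longleftrightarrow> (k = i \<or> k = j) \<and> \<bar>x\<bar> = u0" for k x
    using u0 by (auto simp: picture_ends_def)
  have g: "germ (F k) (- u0) (-1) (F k (-1))" "germ (F k) (- u0) 1 (F k 0)"
    "germ (F k) u0 (-1) (F k 0)" "germ (F k) u0 1 (F k 1)" if "k < 2" for k
    using u0 that by (auto intro!: strand_germ_left[OF F] strand_germ_right[OF F] simp: ends)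
  have g': "germ (F k) (e * u0) (e * d) (w k d)" if "k < 2" "d = 1 \<or> d = -1" for k d
    using g[OF that(1)] that(2) e by (auto simp: w_def)
  have "((i, e * u0), (j, e * u0), e * s, t) \<in> ?Q" using e by auto
  then obtain aL aR bL bR where ge: "germ (F i) (e * u0) (- (e * s) * \<epsilon> j) aL" "germ (F i) (e * u0) (e * s * \<epsilon> j) aR"
    "germ (F j) (e * u0) (e * s * \<epsilon> i) bL" "germ (F j) (e * u0) (- (e * s) * \<epsilon> i) bR"
    and rel: "crossing_relation M t aL aR bL bR"
    by (rule strand_coloring_crossing[OF F])
  have d: "s * \<epsilon> j = 1 \<or> s * \<epsilon> j = -1" "s * \<epsilon> i = 1 \<or> s * \<epsilon> i = -1"
    using s \<epsilon> by (auto simp: abs_if split: if_splits)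
  have "aL = w i (- s * \<epsilon> j)"
    using germ_unique[OF ge(1), of "w i (- s * \<epsilon> j)"] g'[OF ij(1), of "- s * \<epsilon> j"] d by (auto simp: mult.assoc)
  moreover have "aR = w i (s * \<epsilon> j)"
    using germ_unique[OF ge(2), of "w i (s * \<epsilon> j)"] g'[OF ij(1), of "s * \<epsilon> j"] d by (auto simp: mult.assoc)
  moreover have "bL = w j (s * \<epsilon> i)"
    using germ_unique[OF ge(3), of "w j (s * \<epsilon> i)"] g'[OF ij(2), of "s * \<epsilon> i"] d by (auto simp: mult.assoc)
  moreover have "bR = w j (- s * \<epsilon> i)"
    using germ_unique[OF ge(4), of "w j (- s * \<epsilon> i)"] g'[OF ij(2), of "- s * \<epsilon> i"] d by (auto simp: mult.assoc)
  ultimately show ?thesis using rel by simp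
qed

lemma bigon_picture:
  fixes t :: nat
  assumes ij: "i < 2" "j < 2" "i \<noteq> j" and u0: "0 < u0" "u0 < 1" and s: "\<bar>s\<bar> = 1" and \<epsilon>: "\<bar>\<epsilon> i\<bar> = 1" "\<bar>\<epsilon> j\<bar> = 1"
  defines "Q \<equiv> {((i, u0), (j, u0), s, t), ((i, - u0), (j, - u0), - s, t)}"
  shows "picture_extends M 2 \<epsilon> {} Q" "picture_extends M 2 \<epsilon> Q {}" "picture_rigid M 2 \<epsilon> Q"
proof -
  note rel = bigon_relation[where \<epsilon> = \<epsilon> and t = t, OF _ ij u0 s \<epsilon>, folded Q_def]
  have d: "s * \<epsilon> j = 1 \<or> s * \<epsilon> j = -1" "s * \<epsilon> i = 1 \<or> s * \<epsilon> i = -1"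
    using s \<epsilon> by (auto simp: abs_if split: if_splits)
  have ends: "(k, x) \<in> picture_ends Q \<longleftrightarrow> (k = i \<or> k = j) \<and> \<bar>x\<bar> = u0" for k x
    using u0 by (auto simp: picture_ends_def Q_def)
  have k: "k < 2 \<longleftrightarrow> k = i \<or> k = j" for k :: nat using ij by auto
  \<comment> \<open>At either crossing the outer and the inner colours determine each other. With
    \<open>F = F'\<close> and opposite \<open>e\<close>, \<open>e'\<close> this shows that the
    colours before and after the bigon agree; with different \<open>F\<close> it gives
    rigidity.\<close>
  have uniq: "F i e = F' i e' \<and> F j e = F' j e' \<longleftrightarrow> F i 0 = F' i 0 \<and> F j 0 = F' j 0"
    if F: "strand_coloring M 2 \<epsilon> Q F" and F': "strand_coloring M 2 \<epsilon> Q F'"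
      and e: "e = 1 \<or> e = -1" "e' = 1 \<or> e' = -1" for F F' :: "nat \<Rightarrow> real \<Rightarrow> _" and e e'
  proof -
    have C: "F i x \<in> carrier M" "F j x \<in> carrier M" "F' i x \<in> carrier M" "F' j x \<in> carrier M" for x
      using strand_coloringD(1)[OF F] strand_coloringD(1)[OF F'] ij by auto
    note u = crossing_relation_unique[OF rel[OF F e(1)] rel[OF F' e(2)]]
    show ?thesis
    proof
      assume "F i e = F' i e' \<and> F j e = F' j e'"
      then show "F i 0 = F' i 0 \<and> F j 0 = F' j 0" using u C d by (auto split: if_splits)
    next
      assume "F i 0 = F' i 0 \<and> F j 0 = F' j 0"
      then show "F i e = F' i e' \<and> F j e = F' j e'" using u C d by (auto split: if_splits)
    qed
  qed
  show "picture_extends M 2 \<epsilon> {} Q"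
    unfolding picture_extends_def
  proof (intro allI impI)
    fix F :: "nat \<Rightarrow> real \<Rightarrow> _" assume F: "strand_coloring M 2 \<epsilon> {} F"
    have C: "F i (-1) \<in> carrier M" "F j (-1) \<in> carrier M" using strand_coloringD(1)[OF F] ij by auto
    obtain aL aR bL bR where r: "{aL, aR, bL, bR} \<subseteq> carrier M" "crossing_relation M t aL aR bL bR"
      "(if s * \<epsilon> j = -1 then aL else aR) = F i (-1)" "(if s * \<epsilon> i = 1 then bL else bR) = F j (-1)"
      using crossing_relation_solve[OF C, where l = "s * \<epsilon> j = -1" and l' = "s * \<epsilon> i = 1" and n = t] by blast
    \<comment> \<open>The relation has been solved with the outer colours prescribed;
      \<open>A\<close> and \<open>B\<close> are the two remaining colours, those of the inner
      pieces.\<close>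
    define A where "A = (if s * \<epsilon> j = -1 then aR else aL)"
    define B where "B = (if s * \<epsilon> i = 1 then bR else bL)"
    define F' where "F' k u = (if \<bar>u\<bar> < u0 then if k = i then A else B else F k (-1))" for k u
    have F'_c: "const_near (F' k) u" if "\<bar>u\<bar> \<noteq> u0" for k u
    proof -
      have "F' k y = F' k u" if "\<bar>y - u\<bar> < \<bar>\<bar>u\<bar> - u0\<bar>" for y
        using that by (auto simp: F'_def)
      moreover have "\<bar>\<bar>u\<bar> - u0\<bar> > 0" using that by simp
      ultimately show ?thesis unfolding const_near_def by blast
    qed
    have g: "germ (F' k) (e * u0) (e * d) (if d = 1 then F k (-1) else if k = i then A else B)"
      if "e = 1 \<or> e = -1" "d = 1 \<or> d = -1" for k e d
      unfolding germ_def using u0 that by (intro exI[of _ u0]) (auto simp: F'_def abs_if)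
    have "strand_coloring M 2 \<epsilon> Q F'"
    proof (rule strand_coloringI)
      fix k u assume "k < (2::nat)"
      then show "F' k u \<in> carrier M"
        using r(1) C by (auto simp: F'_def A_def B_def k)
      show "germ (F' k) (-1) 1 (F' k (-1))" "germ (F' k) 1 (-1) (F' k 1)"
        using u0 by (auto intro!: germ_const_near F'_c)
      show "const_near (F' k) u" if "(k, u) \<notin> picture_ends Q"
        using that \<open>k < 2\<close> by (intro F'_c) (auto simp: ends k)
    next
      fix i' p j' q s' t' assume "((i', p), (j', q), s', t') \<in> Q"
      then have "((i', p), (j', q), s', t') = ((i, 1 * u0), (j, 1 * u0), 1 * s, t) \<or>
          ((i', p), (j', q), s', t') = ((i, -1 * u0), (j, -1 * u0), -1 * s, t)"
        by (auto simp: Q_def)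
      then obtain e where "((i', p), (j', q), s', t') = ((i, e * u0), (j, e * u0), e * s, t)"
        and e: "e = 1 \<or> e = -1"
        by blast
      then have c: "i' = i" "j' = j" "p = e * u0" "q = e * u0" "s' = e * s" "t' = t" by simp_all
      have "germ (F' i) (e * u0) (- (e * s) * \<epsilon> j) aL" "germ (F' i) (e * u0) (e * s * \<epsilon> j) aR"
        using g[OF e, of "- (s * \<epsilon> j)" i] g[OF e, of "s * \<epsilon> j" i] d r(3) by (auto simp: A_def mult.assoc)
      moreover have "germ (F' j) (e * u0) (e * s * \<epsilon> i) bL" "germ (F' j) (e * u0) (- (e * s) * \<epsilon> i) bR"
        using g[OF e, of "- (s * \<epsilon> i)" j] g[OF e, of "s * \<epsilon> i" j] d r(4) ij by (auto simp: B_def mult.assoc)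
      ultimately show "\<exists>aL aR bL bR.
        germ (F' i') p (- s' * \<epsilon> j') aL \<and> germ (F' i') p (s' * \<epsilon> j') aR \<and>
        germ (F' j') q (s' * \<epsilon> i') bL \<and> germ (F' j') q (- s' * \<epsilon> i') bR \<and>
        crossing_relation M t' aL aR bL bR"
        using r(2) unfolding c by blast
    qed
    moreover have "same_ends 2 F F'"
      using strand_coloring_empty[OF F _, of _ 1] u0 by (simp add: same_ends_def F'_def)
    ultimately show "\<exists>F'. strand_coloring M 2 \<epsilon> Q F' \<and> same_ends 2 F F'" by blast
  qed
  show "picture_extends M 2 \<epsilon> Q {}"
    unfolding picture_extends_def
  proof (intro allI impI)
    fix F :: "nat \<Rightarrow> real \<Rightarrow> _" assume F: "strand_coloring M 2 \<epsilon> Q F"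
    have "strand_coloring M 2 \<epsilon> {} (\<lambda>k u. F k (-1))"
      by (rule strand_coloring_const) (use strand_coloringD(1)[OF F] in simp)
    moreover have "same_ends 2 F (\<lambda>k u. F k (-1))"
      using uniq[OF F F, of 1 "-1"] by (auto simp: same_ends_def k)
    ultimately show "\<exists>F'. strand_coloring M 2 \<epsilon> {} F' \<and> same_ends 2 F F'" by blast
  qed
  show "picture_rigid M 2 \<epsilon> Q"
    unfolding picture_rigid_def
  proof (intro allI impI ballI)
    fix F F' :: "nat \<Rightarrow> real \<Rightarrow> _" and l u
    assume F: "strand_coloring M 2 \<epsilon> Q F" and F': "strand_coloring M 2 \<epsilon> Q F'" and E: "same_ends 2 F F'"
      and l: "l < (2::nat)" and u: "u \<in> {-1..1::real}" "(l, u) \<notin> picture_ends Q"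
    have 0: "F l 0 = F' l 0" using uniq[OF F F', of 1 1] E l by (auto simp: same_ends_def k)
    have u': "\<bar>u\<bar> \<noteq> u0" using u(2) l by (auto simp: ends k)
    have region: "G l u = G l (if u < - u0 then -1 else if u < u0 then 0 else 1)"
      if G: "strand_coloring M 2 \<epsilon> Q G" for G :: "nat \<Rightarrow> real \<Rightarrow> _"
      by (rule strand_const_segment[OF G l])
         (use u u' u0 in \<open>auto simp: ends closed_segment_eq_real_ivl split: if_splits\<close>)
    show "F l u = F' l u"
      using region[OF F] region[OF F'] 0 E l by (auto simp: same_ends_def)
  qed
qed

end

subsection \<open>Third move\<close>

text \<open>
  The colour of a strand that crosses two others at \<open>x\<close> and \<open>y\<close> depends only on the sides of
  the two other strands; \<open>d\<close> and \<open>e\<close> are the directions in which their left sides lie.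
\<close>

definition side_coloring :: "real \<Rightarrow> real \<Rightarrow> real \<Rightarrow> real \<Rightarrow> (bool \<Rightarrow> bool \<Rightarrow> 'm) \<Rightarrow> real \<Rightarrow> 'm" where
  "side_coloring x d y e T u = T (sgn (u - x) = d) (sgn (u - y) = e)"

lemma side_coloring_swap: "side_coloring x d y e T = side_coloring y e x d (\<lambda>b c. T c b)"
  by (simp add: side_coloring_def fun_eq_iff)

lemma sgn_near:
  fixes u x :: real
  assumes "u \<noteq> x" "\<bar>y - u\<bar> < \<bar>u - x\<bar>"
  shows "sgn (y - x) = sgn (u - x)"
  using assms by (auto simp: sgn_real_def)

lemma side_coloring_const_near:
  assumes "u \<noteq> x" "u \<noteq> y"
  shows "const_near (side_coloring x d y e T) u"
proof -
  have "side_coloring x d y e T z = side_coloring x d y e T u" if "\<bar>z - u\<bar> < min \<bar>u - x\<bar> \<bar>u - y\<bar>" for z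
    using sgn_near[of u x z] sgn_near[of u y z] assms that by (simp add: side_coloring_def)
  moreover have "min \<bar>u - x\<bar> \<bar>u - y\<bar> > 0" using assms by simp
  ultimately show ?thesis unfolding const_near_def by blast
qed

lemma side_coloring_germ:
  assumes "x \<noteq> y" "\<bar>d'\<bar> = 1"
  shows "germ (side_coloring x d y e T) x d' (T (d' = d) (sgn (x - y) = e))"
  unfolding germ_def
proof (intro exI[of _ "\<bar>x - y\<bar>"] conjI allI impI)
  fix h assume h: "0 < h \<and> h < \<bar>x - y\<bar>"
  have d': "d' = 1 \<or> d' = -1" using assms(2) by auto
  have "sgn (x + d' * h - x) = d'" using d' h by auto
  moreover have "sgn (x + d' * h - y) = sgn (x - y)"
    by (rule sgn_near) (use d' h assms in auto)
  ultimately show "side_coloring x d y e T (x + d' * h) = T (d' = d) (sgn (x - y) = e)"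
    unfolding side_coloring_def by simp
qed (use assms in simp)

lemma side_coloring_germ2:
  assumes "x \<noteq> y" "\<bar>d'\<bar> = 1"
  shows "germ (side_coloring x d y e T) y d' (T (sgn (y - x) = d) (d' = e))"
  using side_coloring_germ[of y x d' e d "\<lambda>b c. T c b"] assms by (subst side_coloring_swap) auto

lemma sgn_eqI:
  fixes a b d :: real
  assumes "a \<noteq> 0" "b \<noteq> 0" "\<bar>d\<bar> = 1" "(sgn a = d) = (sgn b = d)"
  shows "sgn a = sgn b"
  using assms by (cases "a > 0"; cases "b > 0"; cases "d > 0") simp_all

lemma strand_side_coloring:
  assumes F: "strand_coloring M n \<epsilon> Q F" and i: "i < n"
    and ends: "\<And>u. (i, u) \<in> picture_ends Q \<Longrightarrow> u = x \<or> u = y"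
    and de: "\<bar>d\<bar> = 1" "\<bar>e\<bar> = 1"
  shows "\<exists>T. (\<forall>b c. T b c \<in> carrier M) \<and>
    (\<forall>u. u \<in> {-1..1} \<and> u \<noteq> x \<and> u \<noteq> y \<longrightarrow> F i u = side_coloring x d y e T u)"
proof -
  let ?P = "\<lambda>b c u. u \<in> {-1..1} \<and> u \<noteq> x \<and> u \<noteq> y \<and> (sgn (u - x) = d) = b \<and> (sgn (u - y) = e) = c"
  \<comment> \<open>Parameters with equal sides lie in one piece of the strand, so the choice does
    not matter. A pair of sides that no parameter realizes gets an arbitrary colour.\<close>
  define T where "T b c = F i (SOME u. ?P b c u)" for b c
  have C: "T b c \<in> carrier M" for b c unfolding T_def by (rule strand_coloringD(1)[OF F i])
  have "F i u = side_coloring x d y e T u" if u: "u \<in> {-1..1}" "u \<noteq> x" "u \<noteq> y" for u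
  proof -
    let ?v = "SOME v. ?P (sgn (u - x) = d) (sgn (u - y) = e) v"
  have v: "?P (sgn (u - x) = d) (sgn (u - y) = e) ?v" by (rule someI[of _ u]) (use u in simp)
  define w where "w = ?v"
  have w: "w \<in> {-1..1}" "w \<noteq> x" "w \<noteq> y" "(sgn (w - x) = d) = (sgn (u - x) = d)"
    "(sgn (w - y) = e) = (sgn (u - y) = e)" using v unfolding w_def by blast+
  have sx: "sgn (w - x) = sgn (u - x)" by (rule sgn_eqI[OF _ _ de(1) w(4)]) (use w u in auto)
  have sy: "sgn (w - y) = sgn (u - y)" by (rule sgn_eqI[OF _ _ de(2) w(5)]) (use w u in auto)
  have "F i u = F i w"
  proof (rule strand_const_segment[OF F i u(1) w(1)])
    fix z assume z: "z \<in> closed_segment u w"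
    have "z \<noteq> x" using z sx u(2) by (auto simp: closed_segment_eq_real_ivl sgn_real_def split: if_splits)
    moreover have "z \<noteq> y" using z sy u(3) by (auto simp: closed_segment_eq_real_ivl sgn_real_def split: if_splits)
    ultimately show "(i, z) \<notin> picture_ends Q" using ends by blast
  qed
  then show "F i u = side_coloring x d y e T u" unfolding side_coloring_def T_def w_def .
  qed
  with C show ?thesis by blast
qed

lemma germ_side_coloring:
  assumes eq: "\<And>u. u \<in> {-1..1} \<Longrightarrow> u \<noteq> x \<Longrightarrow> u \<noteq> y \<Longrightarrow> f u = side_coloring x d y e T u"
    and x: "-1 < x" "x < 1" "x \<noteq> y" and d': "\<bar>d'\<bar> = 1"
  shows "germ f x d' (T (d' = d) (sgn (x - y) = e))"
proof (rule germ_cong_near[OF side_coloring_germ[OF x(3) d']])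
  have d'': "d' = 1 \<or> d' = -1" using d' by auto
  show "min (min (1 - x) (x + 1)) \<bar>x - y\<bar> > 0" using x by simp
  fix h assume "0 < h" "h < min (min (1 - x) (x + 1)) \<bar>x - y\<bar>"
  then show "f (x + d' * h) = side_coloring x d y e T (x + d' * h)"
    using d'' by (intro eq) auto
qed

lemma germ_side_coloring2:
  assumes eq: "\<And>u. u \<in> {-1..1} \<Longrightarrow> u \<noteq> x \<Longrightarrow> u \<noteq> y \<Longrightarrow> f u = side_coloring x d y e T u"
    and y: "-1 < y" "y < 1" "x \<noteq> y" and d': "\<bar>d'\<bar> = 1"
  shows "germ f y d' (T (sgn (y - x) = d) (d' = e))"
  using germ_side_coloring[of y x f e d "\<lambda>b c. T c b" d'] eq y d'
  by (simp add: side_coloring_swap[of x d y e T])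

definition triangle_picture ::
  "nat \<Rightarrow> nat \<Rightarrow> nat \<Rightarrow> real \<Rightarrow> real \<Rightarrow> real \<Rightarrow> nat \<Rightarrow> nat \<Rightarrow> nat \<Rightarrow> real \<Rightarrow> real \<Rightarrow> real \<Rightarrow> picture" where
  "triangle_picture T N B s1 s2 s3 t1 t2 t3 x y z =
     {((T, x), (N, x), s1, t1), ((T, y), (B, y), s2, t2), ((N, z), (B, z), s3, t3)}"

text \<open>
  The crossing of two strands lies on the left of the third one iff the corresponding \<open>\<tau>\<close> holds;
  this can be read off on each of the two strands.
\<close>

locale triangle = coeff_module +
  fixes T N B :: nat and \<epsilon> :: "nat \<Rightarrow> real" and s1 s2 s3 :: real and t1 t2 t3 :: nat
  assumes strands: "T < 3" "N < 3" "B < 3" "T \<noteq> N" "T \<noteq> B" "N \<noteq> B"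
    and \<epsilon>: "\<And>i. i < 3 \<Longrightarrow> \<bar>\<epsilon> i\<bar> = 1" and s: "\<bar>s1\<bar> = 1" "\<bar>s2\<bar> = 1" "\<bar>s3\<bar> = 1"
begin

text \<open>In these names the first letter is the strand travelled along and the second one the
  strand crossed: the number is the direction, in the coordinate of the first strand, that leads to
  the left side of the second.\<close>

definition dTN :: real where "dTN = - s1 * \<epsilon> N"
definition dTB :: real where "dTB = - s2 * \<epsilon> B"
definition dNT :: real where "dNT = s1 * \<epsilon> T"
definition dNB :: real where "dNB = - s3 * \<epsilon> B"
definition dBT :: real where "dBT = s2 * \<epsilon> T"
definition dBN :: real where "dBN = s3 * \<epsilon> N"

lemma dirs [simp]: "\<bar>dTN\<bar> = 1" "\<bar>dTB\<bar> = 1" "\<bar>dNT\<bar> = 1" "\<bar>dNB\<bar> = 1" "\<bar>dBT\<bar> = 1" "\<bar>dBN\<bar> = 1"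
  using \<epsilon>[OF strands(1)] \<epsilon>[OF strands(2)] \<epsilon>[OF strands(3)] s
  by (simp_all add: dTN_def dTB_def dNT_def dNB_def dBT_def dBN_def abs_mult)

lemma dirs_nonzero [simp]: "dTN \<noteq> 0" "dTB \<noteq> 0" "dNT \<noteq> 0" "dNB \<noteq> 0" "dBT \<noteq> 0" "dBN \<noteq> 0"
  using dirs by (auto simp del: dirs)

lemma dir_eqs:
  "- s1 * \<epsilon> N = dTN" "s1 * \<epsilon> N = - dTN" "- s2 * \<epsilon> B = dTB" "s2 * \<epsilon> B = - dTB"
  "s1 * \<epsilon> T = dNT" "- s1 * \<epsilon> T = - dNT" "- s3 * \<epsilon> B = dNB" "s3 * \<epsilon> B = - dNB"
  "s2 * \<epsilon> T = dBT" "- s2 * \<epsilon> T = - dBT" "s3 * \<epsilon> N = dBN" "- s3 * \<epsilon> N = - dBN"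
  by (simp_all add: dTN_def dTB_def dNT_def dNB_def dBT_def dBN_def)

definition located :: "real \<Rightarrow> real \<Rightarrow> real \<Rightarrow> bool \<Rightarrow> bool \<Rightarrow> bool \<Rightarrow> bool" where
  "located x y z \<tau>T \<tau>N \<tau>B \<longleftrightarrow>
     {x, y, z} \<subseteq> {-1<..<1} \<and> x \<noteq> y \<and> x \<noteq> z \<and> y \<noteq> z \<and>
     (sgn (x - y) = dTB) = \<tau>B \<and> (sgn (x - z) = dNB) = \<tau>B \<and>
     (sgn (y - x) = dTN) = \<tau>N \<and> (sgn (y - z) = dBN) = \<tau>N \<and>
     (sgn (z - x) = dNT) = \<tau>T \<and> (sgn (z - y) = dBT) = \<tau>T"

abbreviation pic :: "real \<Rightarrow> real \<Rightarrow> real \<Rightarrow> picture" where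
  "pic \<equiv> triangle_picture T N B s1 s2 s3 t1 t2 t3"

lemma pic_ends:
  "(T, u) \<in> picture_ends (pic x y z) \<longleftrightarrow> u = x \<or> u = y"
  "(N, u) \<in> picture_ends (pic x y z) \<longleftrightarrow> u = x \<or> u = z"
  "(B, u) \<in> picture_ends (pic x y z) \<longleftrightarrow> u = y \<or> u = z"
  using strands by (auto simp: picture_ends_def triangle_picture_def)

lemma strand_cases: "i < 3 \<longleftrightarrow> i = T \<or> i = N \<or> i = B"
  using strands by auto

text \<open>All four pieces at a crossing of two strands lie on the same side of the third strand,
  the side \<open>\<tau>\<close> that contains the crossing. Therefore one argument is fixed in each
  relation.\<close>

definition relations ::
  "bool \<Rightarrow> bool \<Rightarrow> bool \<Rightarrow> (bool \<Rightarrow> bool \<Rightarrow> 'a) \<Rightarrow> (bool \<Rightarrow> bool \<Rightarrow> 'a) \<Rightarrow> (bool \<Rightarrow> bool \<Rightarrow> 'a) \<Rightarrow> bool" where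
  "relations \<tau>T \<tau>N \<tau>B fT fN fB \<longleftrightarrow>
     (\<forall>b c. fT b c \<in> carrier M \<and> fN b c \<in> carrier M \<and> fB b c \<in> carrier M) \<and>
     crossing_relation M t1 (fT True \<tau>B) (fT False \<tau>B) (fN True \<tau>B) (fN False \<tau>B) \<and>
     crossing_relation M t2 (fT \<tau>N True) (fT \<tau>N False) (fB True \<tau>N) (fB False \<tau>N) \<and>
     crossing_relation M t3 (fN \<tau>T True) (fN \<tau>T False) (fB \<tau>T True) (fB \<tau>T False)"

lemma relations_of_coloring:
  assumes loc: "located x y z \<tau>T \<tau>N \<tau>B" and F: "strand_coloring M 3 \<epsilon> (pic x y z) F"
  obtains fT fN fB where "relations \<tau>T \<tau>N \<tau>B fT fN fB"
    "\<And>u. u \<in> {-1..1} \<Longrightarrow> u \<noteq> x \<Longrightarrow> u \<noteq> y \<Longrightarrow> F T u = side_coloring x dTN y dTB fT u"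
    "\<And>u. u \<in> {-1..1} \<Longrightarrow> u \<noteq> x \<Longrightarrow> u \<noteq> z \<Longrightarrow> F N u = side_coloring x dNT z dNB fN u"
    "\<And>u. u \<in> {-1..1} \<Longrightarrow> u \<noteq> y \<Longrightarrow> u \<noteq> z \<Longrightarrow> F B u = side_coloring y dBT z dBN fB u"
proof -
  obtain fT where fT: "\<And>b c. fT b c \<in> carrier M"
    "\<And>u. u \<in> {-1..1} \<Longrightarrow> u \<noteq> x \<Longrightarrow> u \<noteq> y \<Longrightarrow> F T u = side_coloring x dTN y dTB fT u"
    using strand_side_coloring[OF F strands(1) pic_ends(1)[of _ x y z, THEN iffD1] dirs(1,2)] by blast
  obtain fN where fN: "\<And>b c. fN b c \<in> carrier M"
    "\<And>u. u \<in> {-1..1} \<Longrightarrow> u \<noteq> x \<Longrightarrow> u \<noteq> z \<Longrightarrow> F N u = side_coloring x dNT z dNB fN u"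
    using strand_side_coloring[OF F strands(2) pic_ends(2)[of _ x y z, THEN iffD1] dirs(3,4)] by blast
  obtain fB where fB: "\<And>b c. fB b c \<in> carrier M"
    "\<And>u. u \<in> {-1..1} \<Longrightarrow> u \<noteq> y \<Longrightarrow> u \<noteq> z \<Longrightarrow> F B u = side_coloring y dBT z dBN fB u"
    using strand_side_coloring[OF F strands(3) pic_ends(3)[of _ x y z, THEN iffD1] dirs(5,6)] by blast
  have L: "-1 < x" "x < 1" "-1 < y" "y < 1" "-1 < z" "z < 1" "x \<noteq> y" "x \<noteq> z" "y \<noteq> z"
    "(sgn (x - y) = dTB) = \<tau>B" "(sgn (x - z) = dNB) = \<tau>B" "(sgn (y - x) = dTN) = \<tau>N"
    "(sgn (y - z) = dBN) = \<tau>N" "(sgn (z - x) = dNT) = \<tau>T" "(sgn (z - y) = dBT) = \<tau>T"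
    using loc by (auto simp: located_def)
  have mem: "((T, x), (N, x), s1, t1) \<in> pic x y z" "((T, y), (B, y), s2, t2) \<in> pic x y z"
    "((N, z), (B, z), s3, t3) \<in> pic x y z" by (auto simp: triangle_picture_def)
  have r1: "crossing_relation M t1 (fT True \<tau>B) (fT False \<tau>B) (fN True \<tau>B) (fN False \<tau>B)"
  proof -
    obtain aL aR bL bR where g: "germ (F T) x dTN aL" "germ (F T) x (- dTN) aR"
      "germ (F N) x dNT bL" "germ (F N) x (- dNT) bR" and r: "crossing_relation M t1 aL aR bL bR"
      by (rule strand_coloring_crossing[OF F mem(1)]) (simp add: dTN_def dNT_def)
    have "aL = fT True \<tau>B"
      using germ_unique[OF g(1) germ_side_coloring[OF fT(2) L(1,2,7)]] L(10) by simp
    moreover have "aR = fT False \<tau>B"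
      using germ_unique[OF g(2) germ_side_coloring[OF fT(2) L(1,2,7)]] L(10) by simp
    moreover have "bL = fN True \<tau>B"
      using germ_unique[OF g(3) germ_side_coloring[OF fN(2) L(1,2,8)]] L(11) by simp
    moreover have "bR = fN False \<tau>B"
      using germ_unique[OF g(4) germ_side_coloring[OF fN(2) L(1,2,8)]] L(11) by simp
    ultimately show ?thesis using r by simp
  qed
  have r2: "crossing_relation M t2 (fT \<tau>N True) (fT \<tau>N False) (fB True \<tau>N) (fB False \<tau>N)"
  proof -
    obtain aL aR bL bR where g: "germ (F T) y dTB aL" "germ (F T) y (- dTB) aR"
      "germ (F B) y dBT bL" "germ (F B) y (- dBT) bR" and r: "crossing_relation M t2 aL aR bL bR"
      by (rule strand_coloring_crossing[OF F mem(2)]) (simp add: dTB_def dBT_def)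
    have "aL = fT \<tau>N True"
      using germ_unique[OF g(1) germ_side_coloring2[OF fT(2) L(3,4,7)]] L(12) by simp
    moreover have "aR = fT \<tau>N False"
      using germ_unique[OF g(2) germ_side_coloring2[OF fT(2) L(3,4,7)]] L(12) by simp
    moreover have "bL = fB True \<tau>N"
      using germ_unique[OF g(3) germ_side_coloring[OF fB(2) L(3,4,9)]] L(13) by simp
    moreover have "bR = fB False \<tau>N"
      using germ_unique[OF g(4) germ_side_coloring[OF fB(2) L(3,4,9)]] L(13) by simp
    ultimately show ?thesis using r by simp
  qed
  have r3: "crossing_relation M t3 (fN \<tau>T True) (fN \<tau>T False) (fB \<tau>T True) (fB \<tau>T False)"
  proof -
    obtain aL aR bL bR where g: "germ (F N) z dNB aL" "germ (F N) z (- dNB) aR"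
      "germ (F B) z dBN bL" "germ (F B) z (- dBN) bR" and r: "crossing_relation M t3 aL aR bL bR"
      by (rule strand_coloring_crossing[OF F mem(3)]) (simp add: dNB_def dBN_def)
    have "aL = fN \<tau>T True"
      using germ_unique[OF g(1) germ_side_coloring2[OF fN(2) L(5,6,8)]] L(14) by simp
    moreover have "aR = fN \<tau>T False"
      using germ_unique[OF g(2) germ_side_coloring2[OF fN(2) L(5,6,8)]] L(14) by simp
    moreover have "bL = fB \<tau>T True"
      using germ_unique[OF g(3) germ_side_coloring2[OF fB(2) L(5,6,9)]] L(15) by simp
    moreover have "bR = fB \<tau>T False"
      using germ_unique[OF g(4) germ_side_coloring2[OF fB(2) L(5,6,9)]] L(15) by simp
    ultimately show ?thesis using r by simp
  qed
  have "relations \<tau>T \<tau>N \<tau>B fT fN fB"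
    unfolding relations_def using fT(1) fN(1) fB(1) r1 r2 r3 by blast
  then show thesis using that fT(2) fN(2) fB(2) by blast
qed

lemma coloring_of_relations:
  assumes loc: "located x y z \<tau>T \<tau>N \<tau>B" and r: "relations \<tau>T \<tau>N \<tau>B fT fN fB"
  shows "strand_coloring M 3 \<epsilon> (pic x y z)
    (\<lambda>i. if i = T then side_coloring x dTN y dTB fT else if i = N then side_coloring x dNT z dNB fN
         else side_coloring y dBT z dBN fB)" (is "strand_coloring M 3 \<epsilon> _ ?F")
proof (rule strand_coloringI)
  have C: "fT b c \<in> carrier M" "fN b c \<in> carrier M" "fB b c \<in> carrier M" for b c
    using r by (auto simp: relations_def)
  have L: "-1 < x" "x < 1" "-1 < y" "y < 1" "-1 < z" "z < 1" "x \<noteq> y" "x \<noteq> z" "y \<noteq> z"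
    "(sgn (x - y) = dTB) = \<tau>B" "(sgn (x - z) = dNB) = \<tau>B" "(sgn (y - x) = dTN) = \<tau>N"
    "(sgn (y - z) = dBN) = \<tau>N" "(sgn (z - x) = dNT) = \<tau>T" "(sgn (z - y) = dBT) = \<tau>T"
    using loc by (auto simp: located_def)
  have F: "?F T = side_coloring x dTN y dTB fT" "?F N = side_coloring x dNT z dNB fN"
    "?F B = side_coloring y dBT z dBN fB" using strands by auto
  fix i u assume i: "i < (3::nat)"
  show "?F i u \<in> carrier M" using C by (simp add: side_coloring_def)
  have cn: "const_near (?F i) u" if "(i, u) \<notin> picture_ends (pic x y z)" for u
  proof -
    consider "i = T" | "i = N" | "i = B" using i strand_cases by blast
    then show ?thesis
    proof cases
      case 1
      have "const_near (side_coloring x dTN y dTB fT) u"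
        by (rule side_coloring_const_near) (use that[unfolded 1 pic_ends] in auto)
      then show ?thesis unfolding 1 F .
    next
      case 2
      have "const_near (side_coloring x dNT z dNB fN) u"
        by (rule side_coloring_const_near) (use that[unfolded 2 pic_ends] in auto)
      then show ?thesis unfolding 2 F .
    next
      case 3
      have "const_near (side_coloring y dBT z dBN fB) u"
        by (rule side_coloring_const_near) (use that[unfolded 3 pic_ends] in auto)
      then show ?thesis unfolding 3 F .
    qed
  qed
  then show "(i, u) \<notin> picture_ends (pic x y z) \<Longrightarrow> const_near (?F i) u" .
  have "(i, -1) \<notin> picture_ends (pic x y z)" "(i, 1) \<notin> picture_ends (pic x y z)"
    using i L(1-6) by (auto simp: strand_cases pic_ends)
  then show "germ (?F i) (-1) 1 (?F i (-1))" "germ (?F i) 1 (-1) (?F i 1)"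
    by (intro germ_const_near cn; simp)+
next
  have L: "-1 < x" "x < 1" "-1 < y" "y < 1" "-1 < z" "z < 1" "x \<noteq> y" "x \<noteq> z" "y \<noteq> z"
    "(sgn (x - y) = dTB) = \<tau>B" "(sgn (x - z) = dNB) = \<tau>B" "(sgn (y - x) = dTN) = \<tau>N"
    "(sgn (y - z) = dBN) = \<tau>N" "(sgn (z - x) = dNT) = \<tau>T" "(sgn (z - y) = dBT) = \<tau>T"
    using loc by (auto simp: located_def)
  have F: "?F T = side_coloring x dTN y dTB fT" "?F N = side_coloring x dNT z dNB fN"
    "?F B = side_coloring y dBT z dBN fB" using strands by auto
  have r1: "crossing_relation M t1 (fT True \<tau>B) (fT False \<tau>B) (fN True \<tau>B) (fN False \<tau>B)"
    and r2: "crossing_relation M t2 (fT \<tau>N True) (fT \<tau>N False) (fB True \<tau>N) (fB False \<tau>N)"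
    and r3: "crossing_relation M t3 (fN \<tau>T True) (fN \<tau>T False) (fB \<tau>T True) (fB \<tau>T False)"
    using r by (simp_all add: relations_def)
  fix i p j q s' t' assume c: "((i, p), (j, q), s', t') \<in> pic x y z"
  show "\<exists>aL aR bL bR. germ (?F i) p (- s' * \<epsilon> j) aL \<and> germ (?F i) p (s' * \<epsilon> j) aR \<and>
      germ (?F j) q (s' * \<epsilon> i) bL \<and> germ (?F j) q (- s' * \<epsilon> i) bR \<and> crossing_relation M t' aL aR bL bR"
    (is "\<exists>aL aR bL bR. ?P i p j q s' t' aL aR bL bR")
  proof -
    have "?P T x N x s1 t1 (fT True \<tau>B) (fT False \<tau>B) (fN True \<tau>B) (fN False \<tau>B)"
    proof (intro conjI)
      show "germ (?F T) x (- s1 * \<epsilon> N) (fT True \<tau>B)" "germ (?F T) x (s1 * \<epsilon> N) (fT False \<tau>B)"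
        using side_coloring_germ[OF L(7), of dTN dTN dTB fT] side_coloring_germ[OF L(7), of "- dTN" dTN dTB fT] L(10)
        unfolding F dir_eqs by simp_all
      show "germ (?F N) x (s1 * \<epsilon> T) (fN True \<tau>B)" "germ (?F N) x (- s1 * \<epsilon> T) (fN False \<tau>B)"
        using side_coloring_germ[OF L(8), of dNT dNT dNB fN] side_coloring_germ[OF L(8), of "- dNT" dNT dNB fN] L(11)
        unfolding F dir_eqs by simp_all
    qed (rule r1)
    moreover have "?P T y B y s2 t2 (fT \<tau>N True) (fT \<tau>N False) (fB True \<tau>N) (fB False \<tau>N)"
    proof (intro conjI)
      show "germ (?F T) y (- s2 * \<epsilon> B) (fT \<tau>N True)" "germ (?F T) y (s2 * \<epsilon> B) (fT \<tau>N False)"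
        using side_coloring_germ2[OF L(7), of dTB dTN dTB fT] side_coloring_germ2[OF L(7), of "- dTB" dTN dTB fT] L(12)
        unfolding F dir_eqs by simp_all
      show "germ (?F B) y (s2 * \<epsilon> T) (fB True \<tau>N)" "germ (?F B) y (- s2 * \<epsilon> T) (fB False \<tau>N)"
        using side_coloring_germ[OF L(9), of dBT dBT dBN fB] side_coloring_germ[OF L(9), of "- dBT" dBT dBN fB] L(13)
        unfolding F dir_eqs by simp_all
    qed (rule r2)
    moreover have "?P N z B z s3 t3 (fN \<tau>T True) (fN \<tau>T False) (fB \<tau>T True) (fB \<tau>T False)"
    proof (intro conjI)
      show "germ (?F N) z (- s3 * \<epsilon> B) (fN \<tau>T True)" "germ (?F N) z (s3 * \<epsilon> B) (fN \<tau>T False)"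
        using side_coloring_germ2[OF L(8), of dNB dNT dNB fN] side_coloring_germ2[OF L(8), of "- dNB" dNT dNB fN] L(14)
        unfolding F dir_eqs by simp_all
      show "germ (?F B) z (s3 * \<epsilon> N) (fB \<tau>T True)" "germ (?F B) z (- s3 * \<epsilon> N) (fB \<tau>T False)"
        using side_coloring_germ2[OF L(9), of dBN dBT dBN fB] side_coloring_germ2[OF L(9), of "- dBN" dBT dBN fB] L(15)
        unfolding F dir_eqs by simp_all
    qed (rule r3)
    moreover have "(i = T \<and> p = x \<and> j = N \<and> q = x \<and> s' = s1 \<and> t' = t1) \<or>
        (i = T \<and> p = y \<and> j = B \<and> q = y \<and> s' = s2 \<and> t' = t2) \<or>
        (i = N \<and> p = z \<and> j = B \<and> q = z \<and> s' = s3 \<and> t' = t3)"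
      using c by (auto simp: triangle_picture_def)
    ultimately show ?thesis by (elim disjE conjE; hypsubst; blast)
  qed
qed

lemma sgn_end:
  "e = 1 \<or> e = -1 \<Longrightarrow> -1 < x \<Longrightarrow> x < 1 \<Longrightarrow> sgn (e - x) = e" for e x :: real
  by (auto simp: sgn_real_def)

text \<open>Each end of a strand with crossings at \<open>x\<close> and \<open>y\<close> lies beyond \<open>x\<close> or beyond \<open>y\<close>.\<close>

lemma end_beyond:
  "e = 1 \<or> e = -1 \<Longrightarrow> x \<noteq> y \<Longrightarrow> sgn (x - y) = e \<or> sgn (y - x) = e" for e x y :: real
  by (auto simp: sgn_real_def)

lemma triangle_extends:
  assumes loc: "located x y z \<tau>T \<tau>N \<tau>B" and loc': "located x' y' z' (\<not> \<tau>T) (\<not> \<tau>N) (\<not> \<tau>B)"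
    and ty: "triangle_types t1 t2 t3"
  shows "picture_extends M 3 \<epsilon> (pic x y z) (pic x' y' z')"
  unfolding picture_extends_def
proof (intro allI impI)
  fix F assume "strand_coloring M 3 \<epsilon> (pic x y z) F"
  then obtain fT fN fB where r: "relations \<tau>T \<tau>N \<tau>B fT fN fB"
    and F: "\<And>u. u \<in> {-1..1} \<Longrightarrow> u \<noteq> x \<Longrightarrow> u \<noteq> y \<Longrightarrow> F T u = side_coloring x dTN y dTB fT u"
      "\<And>u. u \<in> {-1..1} \<Longrightarrow> u \<noteq> x \<Longrightarrow> u \<noteq> z \<Longrightarrow> F N u = side_coloring x dNT z dNB fN u"
      "\<And>u. u \<in> {-1..1} \<Longrightarrow> u \<noteq> y \<Longrightarrow> u \<noteq> z \<Longrightarrow> F B u = side_coloring y dBT z dBN fB u"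
    using relations_of_coloring[OF loc] by blast
  from r obtain gT gN gB where g: "relations (\<not> \<tau>T) (\<not> \<tau>N) (\<not> \<tau>B) gT gN gB"
    and eq: "\<And>b. gT b \<tau>B = fT b \<tau>B \<and> gT \<tau>N b = fT \<tau>N b \<and> gN b \<tau>B = fN b \<tau>B \<and> gN \<tau>T b = fN \<tau>T b \<and>
         gB b \<tau>N = fB b \<tau>N \<and> gB \<tau>T b = fB \<tau>T b"
    using triangle_relations[OF ty, of fT fN fB \<tau>B \<tau>N \<tau>T] unfolding relations_def by blast
  let ?G = "\<lambda>i. if i = T then side_coloring x' dTN y' dTB gT else if i = N then side_coloring x' dNT z' dNB gN
         else side_coloring y' dBT z' dBN gB"
  have L: "-1 < x" "x < 1" "-1 < y" "y < 1" "-1 < z" "z < 1" "x \<noteq> y" "x \<noteq> z" "y \<noteq> z"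
    "(sgn (x - y) = dTB) = \<tau>B" "(sgn (x - z) = dNB) = \<tau>B" "(sgn (y - x) = dTN) = \<tau>N"
    "(sgn (y - z) = dBN) = \<tau>N" "(sgn (z - x) = dNT) = \<tau>T" "(sgn (z - y) = dBT) = \<tau>T"
    using loc by (auto simp: located_def)
  have L': "-1 < x'" "x' < 1" "-1 < y'" "y' < 1" "-1 < z'" "z' < 1"
    using loc' by (auto simp: located_def)
  have "F T e = ?G T e \<and> F N e = ?G N e \<and> F B e = ?G B e" if e: "e = 1 \<or> e = -1" for e
  proof -
    have e': "e \<in> {-1..1}" "e \<noteq> x" "e \<noteq> y" "e \<noteq> z" using e L by auto
    \<comment> \<open>Old and new colours of the top strand may differ only at the pair
      \<open>(\<not> \<tau>N, \<not> \<tau>B)\<close>. No parameter had this pair before the move,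
      and afterwards it is the edge of the new triangle; an end of the strand never has it. The
      other strands are treated likewise.\<close>
    have "(e = dTN) = \<tau>N \<or> (e = dTB) = \<tau>B"
      using end_beyond[OF e L(7)] L(10,12) by (elim disjE) simp_all
    then have ET: "gT (e = dTN) (e = dTB) = fT (e = dTN) (e = dTB)"
      by (elim disjE) (simp_all add: eq)
    have "(e = dNT) = \<tau>T \<or> (e = dNB) = \<tau>B"
      using end_beyond[OF e L(8)] L(11,14) by (elim disjE) simp_all
    then have EN: "gN (e = dNT) (e = dNB) = fN (e = dNT) (e = dNB)"
      by (elim disjE) (simp_all add: eq)
    have "(e = dBT) = \<tau>T \<or> (e = dBN) = \<tau>N"
      using end_beyond[OF e L(9)] L(13,15) by (elim disjE) simp_all
    then have EB: "gB (e = dBT) (e = dBN) = fB (e = dBT) (e = dBN)"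
      by (elim disjE) (simp_all add: eq)
    have F1: "F T e = fT (e = dTN) (e = dTB)" "F N e = fN (e = dNT) (e = dNB)" "F B e = fB (e = dBT) (e = dBN)"
      using F(1)[OF e'(1,2,3)] F(2)[OF e'(1,2,4)] F(3)[OF e'(1,3,4)]
      by (simp_all only: side_coloring_def sgn_end[OF e] L)
    have G1: "?G T e = gT (e = dTN) (e = dTB)" "?G N e = gN (e = dNT) (e = dNB)" "?G B e = gB (e = dBT) (e = dBN)"
      using strands by (simp_all add: side_coloring_def sgn_end[OF e] L')
    show ?thesis unfolding F1 G1 ET EN EB by simp
  qed
  then have "same_ends 3 F ?G" unfolding same_ends_def strand_cases by blast
  with coloring_of_relations[OF loc' g]
  show "\<exists>F'. strand_coloring M 3 \<epsilon> (pic x' y' z') F' \<and> same_ends 3 F F'" by blast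
qed

text \<open>The colours at three ends, one on each strand, are already enough. Uniqueness at the
  crossing of top and middle strand gives the adjacent edges of the triangle, then the crossing of
  top and bottom and finally that of middle and bottom can be settled.\<close>

lemma triangle_rigid:
  assumes loc: "located x y z \<tau>T \<tau>N \<tau>B"
  shows "picture_rigid M 3 \<epsilon> (pic x y z)"
  unfolding picture_rigid_def
proof (intro allI impI ballI)
  fix F G i u
  assume F: "strand_coloring M 3 \<epsilon> (pic x y z) F" and G: "strand_coloring M 3 \<epsilon> (pic x y z) G"
    and E: "same_ends 3 F G" and i: "i < (3::nat)" and u: "u \<in> {-1..1::real}" "(i, u) \<notin> picture_ends (pic x y z)"
  obtain fT fN fB where r: "relations \<tau>T \<tau>N \<tau>B fT fN fB"
    and F': "\<And>u. u \<in> {-1..1} \<Longrightarrow> u \<noteq> x \<Longrightarrow> u \<noteq> y \<Longrightarrow> F T u = side_coloring x dTN y dTB fT u"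
      "\<And>u. u \<in> {-1..1} \<Longrightarrow> u \<noteq> x \<Longrightarrow> u \<noteq> z \<Longrightarrow> F N u = side_coloring x dNT z dNB fN u"
      "\<And>u. u \<in> {-1..1} \<Longrightarrow> u \<noteq> y \<Longrightarrow> u \<noteq> z \<Longrightarrow> F B u = side_coloring y dBT z dBN fB u"
    using relations_of_coloring[OF loc F] by blast
  obtain gT gN gB where g: "relations \<tau>T \<tau>N \<tau>B gT gN gB"
    and G': "\<And>u. u \<in> {-1..1} \<Longrightarrow> u \<noteq> x \<Longrightarrow> u \<noteq> y \<Longrightarrow> G T u = side_coloring x dTN y dTB gT u"
      "\<And>u. u \<in> {-1..1} \<Longrightarrow> u \<noteq> x \<Longrightarrow> u \<noteq> z \<Longrightarrow> G N u = side_coloring x dNT z dNB gN u"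
      "\<And>u. u \<in> {-1..1} \<Longrightarrow> u \<noteq> y \<Longrightarrow> u \<noteq> z \<Longrightarrow> G B u = side_coloring y dBT z dBN gB u"
    using relations_of_coloring[OF loc G] by blast
  have L: "-1 < x" "x < 1" "-1 < y" "y < 1" "-1 < z" "z < 1" "x \<noteq> y" "x \<noteq> z" "y \<noteq> z"
    "(sgn (x - y) = dTB) = \<tau>B" "(sgn (x - z) = dNB) = \<tau>B" "(sgn (y - x) = dTN) = \<tau>N"
    "(sgn (y - z) = dBN) = \<tau>N" "(sgn (z - x) = dNT) = \<tau>T" "(sgn (z - y) = dBT) = \<tau>T"
    using loc by (auto simp: located_def)
  have ends: "fT (e = dTN) (e = dTB) = gT (e = dTN) (e = dTB) \<and> fN (e = dNT) (e = dNB) = gN (e = dNT) (e = dNB) \<and>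
      fB (e = dBT) (e = dBN) = gB (e = dBT) (e = dBN)" if e: "e = 1 \<or> e = -1" for e
  proof -
    have e': "e \<in> {-1..1}" "e \<noteq> x" "e \<noteq> y" "e \<noteq> z" using e L by auto
    have "F T e = G T e" "F N e = G N e" "F B e = G B e" using E e strands by (auto simp: same_ends_def)
    moreover have "F T e = fT (e = dTN) (e = dTB)" "F N e = fN (e = dNT) (e = dNB)" "F B e = fB (e = dBT) (e = dBN)"
      using F'(1)[OF e'(1,2,3)] F'(2)[OF e'(1,2,4)] F'(3)[OF e'(1,3,4)]
      by (simp_all only: side_coloring_def sgn_end[OF e] L)
    moreover have "G T e = gT (e = dTN) (e = dTB)" "G N e = gN (e = dNT) (e = dNB)" "G B e = gB (e = dBT) (e = dBN)"
      using G'(1)[OF e'(1,2,3)] G'(2)[OF e'(1,2,4)] G'(3)[OF e'(1,3,4)]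
      by (simp_all only: side_coloring_def sgn_end[OF e] L)
    ultimately show ?thesis by simp
  qed
  have sgn: "sgn (a - b) = 1 \<or> sgn (a - b) = -1" "sgn (b - a) = - sgn (a - b)" if "a \<noteq> b" for a b :: real
    using that by (auto simp: sgn_real_def)
  have opp: "(- a = d) = (a \<noteq> d)" if "a = 1 \<or> a = -1" "\<bar>d\<bar> = 1" for a d :: real using that by auto
  have nT: "(sgn (x - y) = dTN) = (\<not> \<tau>N)" "(sgn (x - z) = dNT) = (\<not> \<tau>T)" "(sgn (y - z) = dBT) = (\<not> \<tau>T)"
    using L(12) L(14) L(15) unfolding sgn(2)[OF L(7)] sgn(2)[OF L(8)] sgn(2)[OF L(9)]
      opp[OF sgn(1)[OF L(7)] dirs(1)] opp[OF sgn(1)[OF L(8)] dirs(3)] opp[OF sgn(1)[OF L(9)] dirs(5)] by blast+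
  \<comment> \<open>These are the end pieces beyond the crossing \<open>T N\<close> on the two
    strands through it, and beyond the crossing \<open>T B\<close> on the bottom strand.\<close>
  have known: "fT (\<not> \<tau>N) \<tau>B = gT (\<not> \<tau>N) \<tau>B" "fN (\<not> \<tau>T) \<tau>B = gN (\<not> \<tau>T) \<tau>B" "fB (\<not> \<tau>T) \<tau>N = gB (\<not> \<tau>T) \<tau>N"
    using ends[OF sgn(1)[OF L(7)]] ends[OF sgn(1)[OF L(8)]] ends[OF sgn(1)[OF L(9)]] L(10,11,13) nT by simp_all
  have C: "{fT b c, fN b' c', fB b'' c'', gT b c, gN b' c', gB b'' c''} \<subseteq> carrier M" for b c b' c' b'' c''
    using r g by (auto simp: relations_def)
  have either: "h True = h' True \<or> h False = h' False" if "h b = h' b" for h h' :: "bool \<Rightarrow> 'a" and b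
    using that by (cases b) auto
  have e1: "fT b \<tau>B = gT b \<tau>B \<and> fN b \<tau>B = gN b \<tau>B" for b
  proof -
    have "fT True \<tau>B = gT True \<tau>B \<and> fT False \<tau>B = gT False \<tau>B \<and> fN True \<tau>B = gN True \<tau>B \<and> fN False \<tau>B = gN False \<tau>B"
      by (rule crossing_relation_unique[where n = t1])
        (use r g C either[of "\<lambda>b. fT b \<tau>B" _ "\<lambda>b. gT b \<tau>B", OF known(1)]
          either[of "\<lambda>b. fN b \<tau>B" _ "\<lambda>b. gN b \<tau>B", OF known(2)] in \<open>simp_all add: relations_def\<close>)
    then show ?thesis by (cases b) simp_all
  qed
  have e2: "fT \<tau>N b = gT \<tau>N b \<and> fB b \<tau>N = gB b \<tau>N" for b
  proof -
    have "fT \<tau>N True = gT \<tau>N True \<and> fT \<tau>N False = gT \<tau>N False \<and> fB True \<tau>N = gB True \<tau>N \<and> fB False \<tau>N = gB False \<tau>N"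
      by (rule crossing_relation_unique[where n = t2])
        (use r g C either[of "fT \<tau>N" \<tau>B "gT \<tau>N"] e1[of \<tau>N]
          either[of "\<lambda>b. fB b \<tau>N" _ "\<lambda>b. gB b \<tau>N", OF known(3)] in \<open>simp_all add: relations_def\<close>)
    then show ?thesis by (cases b) simp_all
  qed
  have e3: "fN \<tau>T b = gN \<tau>T b \<and> fB \<tau>T b = gB \<tau>T b" for b
  proof -
    have "fN \<tau>T True = gN \<tau>T True \<and> fN \<tau>T False = gN \<tau>T False \<and> fB \<tau>T True = gB \<tau>T True \<and> fB \<tau>T False = gB \<tau>T False"
      by (rule crossing_relation_unique[where n = t3])
        (use r g C either[of "fN \<tau>T" \<tau>B "gN \<tau>T"] e1[of \<tau>T] either[of "fB \<tau>T" \<tau>N "gB \<tau>T"] e2[of \<tau>T]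
          in \<open>simp_all add: relations_def\<close>)
    then show ?thesis by (cases b) simp_all
  qed
  have near: "sgn (u - a) = sgn (b - a) \<or> sgn (u - b) = sgn (a - b)" if "a \<noteq> b" "u \<noteq> a" "u \<noteq> b" for a b
    using that by (auto simp: sgn_real_def)
  consider "i = T" | "i = N" | "i = B" using i strand_cases by blast
  then show "F i u = G i u"
  proof cases
    case 1
    then have n: "u \<noteq> x" "u \<noteq> y" using u(2) pic_ends by auto
    have "(sgn (u - x) = dTN) = \<tau>N \<or> (sgn (u - y) = dTB) = \<tau>B" using near[OF L(7) n] L(10,12) by auto
    then have "fT (sgn (u - x) = dTN) (sgn (u - y) = dTB) = gT (sgn (u - x) = dTN) (sgn (u - y) = dTB)"
      by (elim disjE) (simp_all add: e1 e2)
    then show ?thesis using F'(1)[OF u(1) n] G'(1)[OF u(1) n] \<open>i = T\<close> by (simp add: side_coloring_def)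
  next
    case 2
    then have n: "u \<noteq> x" "u \<noteq> z" using u(2) pic_ends by auto
    have "(sgn (u - x) = dNT) = \<tau>T \<or> (sgn (u - z) = dNB) = \<tau>B" using near[OF L(8) n] L(11,14) by auto
    then have "fN (sgn (u - x) = dNT) (sgn (u - z) = dNB) = gN (sgn (u - x) = dNT) (sgn (u - z) = dNB)"
      by (elim disjE) (simp_all add: e1 e3)
    then show ?thesis using F'(2)[OF u(1) n] G'(2)[OF u(1) n] \<open>i = N\<close> by (simp add: side_coloring_def)
  next
    case 3
    then have n: "u \<noteq> y" "u \<noteq> z" using u(2) pic_ends by auto
    have "(sgn (u - y) = dBT) = \<tau>T \<or> (sgn (u - z) = dBN) = \<tau>N" using near[OF L(9) n] L(13,15) by auto
    then have "fB (sgn (u - y) = dBT) (sgn (u - z) = dBN) = gB (sgn (u - y) = dBT) (sgn (u - z) = dBN)"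
      by (elim disjE) (simp_all add: e2 e3)
    then show ?thesis using F'(3)[OF u(1) n] G'(3)[OF u(1) n] \<open>i = B\<close> by (simp add: side_coloring_def)
  qed
qed

end

section \<open>Replacing a local picture in a diagram\<close>

text \<open>
  Strand \<open>i\<close> is the parameter interval from \<open>a i\<close> to \<open>b i\<close>; \<open>to_strand i\<close> is its affine
  map onto the interval from -1 to 1, in the direction \<open>\<epsilon> i\<close>.
\<close>

locale strands =
  fixes n :: nat and a b \<epsilon> :: "nat \<Rightarrow> real"
  assumes ab: "\<And>i. i < n \<Longrightarrow> 0 < a i \<and> a i < b i \<and> b i < 1"
    and disj: "disjoint_family_on (\<lambda>i. {a i..b i}) {..<n}"
    and eps: "\<And>i. i < n \<Longrightarrow> \<epsilon> i = 1 \<or> \<epsilon> i = -1"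
begin

definition to_strand :: "nat \<Rightarrow> real \<Rightarrow> real" where
  "to_strand i x = \<epsilon> i * ((2 * x - a i - b i) / (b i - a i))"

definition of_strand :: "nat \<Rightarrow> real \<Rightarrow> real" where
  "of_strand i u = (a i + b i + \<epsilon> i * (b i - a i) * u) / 2"

lemma eps_sq: "i < n \<Longrightarrow> \<epsilon> i * \<epsilon> i = 1" and eps_abs: "i < n \<Longrightarrow> \<bar>\<epsilon> i\<bar> = 1"
  using eps[of i] by auto

lemma to_of_strand: "i < n \<Longrightarrow> to_strand i (of_strand i u) = u"
proof -
  assume i: "i < n"
  have "2 * of_strand i u - a i - b i = \<epsilon> i * (b i - a i) * u" by (simp add: of_strand_def add_divide_distrib)
  then have "to_strand i (of_strand i u) = (\<epsilon> i * \<epsilon> i) * u"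
    using ab[OF i] by (simp add: to_strand_def)
  then show ?thesis by (simp add: eps_sq[OF i])
qed

lemma of_to_strand: "i < n \<Longrightarrow> of_strand i (to_strand i x) = x"
proof -
  assume i: "i < n"
  have "of_strand i (to_strand i x) = (a i + b i + (\<epsilon> i * \<epsilon> i) * (2 * x - a i - b i)) / 2"
    using ab[OF i] by (simp add: to_strand_def of_strand_def)
  then show ?thesis by (simp add: eps_sq[OF i])
qed

lemma of_strand_eq_iff: "i < n \<Longrightarrow> of_strand i u = of_strand i u' \<longleftrightarrow> u = u'"
  by (metis to_of_strand)

lemma of_strand_diff: "i < n \<Longrightarrow> of_strand i u - of_strand i u' = \<epsilon> i * ((b i - a i) / 2) * (u - u')"
  by (simp add: of_strand_def field_simps)

lemma of_strand_in: "i < n \<Longrightarrow> of_strand i u \<in> {a i..b i} \<longleftrightarrow> u \<in> {-1..1}"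
proof -
  assume i: "i < n"
  let ?r = "(b i - a i) / 2"
  have r: "?r > 0" using ab[OF i] by simp
  have "of_strand i u \<in> {a i..b i} \<longleftrightarrow> \<bar>of_strand i u - of_strand i 0\<bar> \<le> ?r"
    by (auto simp: of_strand_def abs_le_iff field_simps)
  also have "\<dots> \<longleftrightarrow> ?r * \<bar>u\<bar> \<le> ?r"
    using r eps_abs[OF i] by (simp add: of_strand_diff[OF i] abs_mult)
  also have "\<dots> \<longleftrightarrow> u \<in> {-1..1}" using r by (auto simp: abs_le_iff)
  finally show ?thesis .
qed

lemma of_strand_in_open: "i < n \<Longrightarrow> of_strand i u \<in> {a i<..<b i} \<longleftrightarrow> u \<in> {-1<..<1}"
proof -
  assume i: "i < n"
  let ?r = "(b i - a i) / 2"
  have r: "?r > 0" using ab[OF i] by simp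
  have "of_strand i u \<in> {a i<..<b i} \<longleftrightarrow> \<bar>of_strand i u - of_strand i 0\<bar> < ?r"
    by (auto simp: of_strand_def abs_less_iff field_simps)
  also have "\<dots> \<longleftrightarrow> ?r * \<bar>u\<bar> < ?r"
    using r eps_abs[OF i] by (simp add: of_strand_diff[OF i] abs_mult)
  also have "\<dots> \<longleftrightarrow> u \<in> {-1<..<1}" using r by (auto simp: abs_less_iff)
  finally show ?thesis .
qed

lemma of_strand_less_iff:
  assumes "i < n"
  shows "of_strand i u < of_strand i u' \<longleftrightarrow> (if \<epsilon> i = 1 then u < u' else u' < u)"
  using eps[OF assms] ab[OF assms] by (auto simp: of_strand_def)

lemma strand_unique: "i < n \<Longrightarrow> j < n \<Longrightarrow> x \<in> {a i..b i} \<Longrightarrow> x \<in> {a j..b j} \<Longrightarrow> i = j"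
  using disj unfolding disjoint_family_on_def by blast

lemma strand_sub: "i < n \<Longrightarrow> x \<in> {a i..b i} \<Longrightarrow> 0 < x \<and> x < 1"
  using ab[of i] by auto

lemma frac_of_strand: "i < n \<Longrightarrow> u \<in> {-1..1} \<Longrightarrow> frac (of_strand i u) = of_strand i u"
  using strand_sub[of i "of_strand i u"] of_strand_in[of i u] by (simp add: frac_eq)

section \<open>Pasting the colours of strands into a coloring of the circle\<close>

definition interior :: "real set" where "interior = (\<Union>i<n. {a i<..<b i})"
definition region :: "real set" where "region = (\<Union>i<n. {a i..b i})"

definition chord_of :: "(nat \<times> real) \<times> (nat \<times> real) \<times> real \<times> nat \<Rightarrow> real \<times> real" where
  "chord_of = (\<lambda>((i, p), (j, q), s, t). (of_strand i p, of_strand j q))"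

definition replaced :: "(real \<Rightarrow> 'm) \<Rightarrow> (nat \<Rightarrow> real \<Rightarrow> 'm) \<Rightarrow> real \<Rightarrow> 'm" where
  "replaced c F x = (if frac x \<in> region
     then (let i = (THE i. i < n \<and> frac x \<in> {a i..b i}) in F i (to_strand i (frac x))) else c x)"

lemma replaced_in:
  assumes "i < n" "frac x \<in> {a i..b i}"
  shows "replaced c F x = F i (to_strand i (frac x))"
proof -
  have "(THE i. i < n \<and> frac x \<in> {a i..b i}) = i"
    using assms strand_unique by (intro the_equality) auto
  moreover have "frac x \<in> region" using assms by (auto simp: region_def)
  ultimately show ?thesis by (simp add: replaced_def)
qed

lemma replaced_out: "frac x \<notin> region \<Longrightarrow> replaced c F x = c x"
  by (simp add: replaced_def)

lemma germ_scale:
  assumes "germ f (k + m * p) d v" "m \<noteq> 0"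
  shows "germ (\<lambda>u. f (k + m * u)) p (sgn m * d) v"
proof -
  obtain \<delta> where \<delta>: "\<delta> > 0" "\<forall>h. 0 < h \<and> h < \<delta> \<longrightarrow> f (k + m * p + d * h) = v"
    using assms(1) unfolding germ_def by blast
  have "f (k + m * (p + sgn m * d * h)) = v" if h: "0 < h" "h < \<delta> / \<bar>m\<bar>" for h
  proof -
    have "f (k + m * p + d * (\<bar>m\<bar> * h)) = v"
      by (rule \<delta>(2)[rule_format]) (use h assms(2) in \<open>auto simp: field_simps\<close>)
    moreover have "m * sgn m = \<bar>m\<bar>" by (simp add: abs_sgn mult.commute)
    then have "k + m * (p + sgn m * d * h) = k + m * p + d * (\<bar>m\<bar> * h)"
      by (simp add: algebra_simps)
    ultimately show ?thesis by (simp only:)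
  qed
  moreover have "\<delta> / \<bar>m\<bar> > 0" using \<delta>(1) assms(2) by simp
  ultimately show ?thesis unfolding germ_def by blast
qed

lemma germ_of_strand:
  assumes i: "i < n" and "germ f (of_strand i p) d v"
  shows "germ (\<lambda>u. f (of_strand i u)) p (\<epsilon> i * d) v"
proof -
  let ?k = "(a i + b i) / 2" and ?m = "\<epsilon> i * (b i - a i) / 2"
  have eq: "of_strand i u = ?k + ?m * u" for u by (simp add: of_strand_def field_simps)
  have "?m \<noteq> 0" "sgn ?m = \<epsilon> i" using ab[OF i] eps[OF i] by auto
  then show ?thesis using germ_scale[of f ?k ?m p d v] assms(2) by (simp add: eq)
qed

lemma germ_to_strand:
  assumes i: "i < n" and "germ f (to_strand i x) d v"
  shows "germ (\<lambda>x. f (to_strand i x)) x (\<epsilon> i * d) v"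
proof -
  let ?k = "- (\<epsilon> i * (a i + b i) / (b i - a i))" and ?m = "\<epsilon> i * 2 / (b i - a i)"
  have eq: "to_strand i x = ?k + ?m * x" for x
    by (simp add: to_strand_def diff_divide_distrib add_divide_distrib algebra_simps)
  have "?m \<noteq> 0" "sgn ?m = \<epsilon> i" using ab[OF i] eps[OF i] by auto
  then show ?thesis using germ_scale[of f ?k ?m x d v] assms(2) by (simp add: eq)
qed

lemma frac_avoids:
  fixes x \<alpha> \<beta> :: real
  assumes "0 < \<alpha>" "\<alpha> < \<beta>" "\<beta> < 1" "frac x \<notin> {\<alpha>..\<beta>}"
  shows "\<exists>\<delta>>0. \<forall>y. \<bar>y - x\<bar> < \<delta> \<longrightarrow> frac y \<notin> {\<alpha>..\<beta>}"
proof -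
  define k where "k = \<lfloor>x\<rfloor>"
  have f: "frac x = x - of_int k" by (simp add: k_def frac_def)
  have f01: "0 \<le> frac x" "frac x < 1" by (simp_all add: frac_lt_1)
  \<comment> \<open>The first bound keeps \<open>frac y\<close> on its side of the interval; the
    second one takes care of points \<open>y\<close> that pass an integer and would approach the
    interval from its other end.\<close>
  define \<delta> where "\<delta> = (if frac x < \<alpha> then min (\<alpha> - frac x) (1 - \<beta>) else min (frac x - \<beta>) \<alpha>)"
  have "\<delta> > 0" using assms by (auto simp: \<delta>_def)
  moreover have "frac y \<notin> {\<alpha>..\<beta>}" if y: "\<bar>y - x\<bar> < \<delta>" for y
  proof -
    define z where "z = y - of_int k"
    have z: "\<bar>z - frac x\<bar> < \<delta>" using y f by (simp add: z_def)
    have zl: "z > frac x - \<delta>" "z < frac x + \<delta>" using z by (simp_all add: abs_less_iff)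
    have fy: "frac y = frac z" using frac_add_of_int_right[of z k] by (simp add: z_def)
    show ?thesis
    proof (cases "frac x < \<alpha>")
      case True
      then have d: "\<delta> \<le> \<alpha> - frac x" "\<delta> \<le> 1 - \<beta>" by (simp_all add: \<delta>_def)
      show ?thesis
      proof (cases "z \<ge> 0")
        case True
        have "z < \<alpha>" using zl d by linarith
        moreover have "frac z = z" using True \<open>z < \<alpha>\<close> assms(2,3) by (simp add: frac_eq)
        ultimately show ?thesis using fy by simp
      next
        case False
        have "z + 1 > \<beta>" using zl d f01 by linarith
        moreover have "frac z = z + 1"
          using frac_unique_iff[of z "z + 1"] False \<open>z + 1 > \<beta>\<close> assms(1,2) by simp
        ultimately show ?thesis using fy by simp
      qed
    next
      case False
      then have d: "\<delta> \<le> frac x - \<beta>" "\<delta> \<le> \<alpha>" by (simp_all add: \<delta>_def)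
      show ?thesis
      proof (cases "z < 1")
        case True
        have "z > \<beta>" using zl d by linarith
        moreover have "frac z = z" using True \<open>z > \<beta>\<close> assms(1,2) by (simp add: frac_eq)
        ultimately show ?thesis using fy by simp
      next
        case False
        have "z - 1 < \<alpha>" using zl d f01 by linarith
        moreover have "frac z = z - 1"
          using frac_unique_iff[of z "z - 1"] False \<open>z - 1 < \<alpha>\<close> assms(2,3) by simp
        ultimately show ?thesis using fy by simp
      qed
    qed
  qed
  ultimately show ?thesis by blast
qed

text \<open>Close to \<open>x\<close> the fractional part meets only strands that contain \<open>frac x\<close>.\<close>

lemma near_strands:
  "\<exists>\<delta>>0. \<forall>y. \<bar>y - x\<bar> < \<delta> \<longrightarrow> (\<forall>i<n. frac y \<in> {a i..b i} \<longrightarrow> frac x \<in> {a i..b i})"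
proof -
  have "\<exists>\<delta>>0. \<forall>y. \<bar>y - x\<bar> < \<delta> \<longrightarrow> (\<forall>i<m. frac y \<in> {a i..b i} \<longrightarrow> frac x \<in> {a i..b i})" if "m \<le> n" for m
    using that
  proof (induction m)
    case 0
    then show ?case by (auto intro: exI[of _ 1])
  next
    case (Suc m)
    then obtain \<delta> where \<delta>: "\<delta> > 0"
      "\<And>y. \<bar>y - x\<bar> < \<delta> \<Longrightarrow> \<forall>i<m. frac y \<in> {a i..b i} \<longrightarrow> frac x \<in> {a i..b i}" by auto
    have "\<exists>\<delta>'>0. \<forall>y. \<bar>y - x\<bar> < \<delta>' \<longrightarrow> frac y \<in> {a m..b m} \<longrightarrow> frac x \<in> {a m..b m}"
    proof (cases "frac x \<in> {a m..b m}")
      case True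
      then show ?thesis by (auto intro: exI[of _ 1])
    next
      case False
      then show ?thesis using frac_avoids[of "a m" "b m" x] ab[of m] Suc.prems by auto
    qed
    then obtain \<delta>' where \<delta>': "\<delta>' > 0"
      "\<And>y. \<bar>y - x\<bar> < \<delta>' \<Longrightarrow> frac y \<in> {a m..b m} \<longrightarrow> frac x \<in> {a m..b m}" by auto
    have "\<forall>i<Suc m. frac y \<in> {a i..b i} \<longrightarrow> frac x \<in> {a i..b i}" if "\<bar>y - x\<bar> < min \<delta> \<delta>'" for y
      using \<delta>(2)[of y] \<delta>'(2)[of y] that less_Suc_eq by auto
    moreover have "min \<delta> \<delta>' > 0" using \<delta>(1) \<delta>'(1) by simp
    ultimately show ?case by blast
  qed
  then show ?thesis by blast
qed

lemma replaced_near_out: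
  assumes "frac x \<notin> region"
  shows "\<exists>\<delta>>0. \<forall>y. \<bar>y - x\<bar> < \<delta> \<longrightarrow> replaced c F y = c y"
proof -
  obtain \<delta> where \<delta>: "\<delta> > 0" "\<forall>y. \<bar>y - x\<bar> < \<delta> \<longrightarrow> (\<forall>i<n. frac y \<in> {a i..b i} \<longrightarrow> frac x \<in> {a i..b i})"
    using near_strands by blast
  have "frac y \<notin> region" if "\<bar>y - x\<bar> < \<delta>" for y
    using \<delta>(2)[rule_format, OF that] assms unfolding region_def by blast
  then have "\<forall>y. \<bar>y - x\<bar> < \<delta> \<longrightarrow> replaced c F y = c y" using replaced_out by blast
  with \<delta>(1) show ?thesis by blast
qed

lemma replaced_near_in:
  assumes i: "i < n" and x: "x \<in> {a i<..<b i}"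
  shows "\<exists>\<delta>>0. \<forall>y. \<bar>y - x\<bar> < \<delta> \<longrightarrow> replaced c F y = F i (to_strand i y)"
proof -
  have "replaced c F y = F i (to_strand i y)" if "\<bar>y - x\<bar> < min (x - a i) (b i - x)" for y
  proof -
    have y: "y \<in> {a i..b i}" using that by (auto simp: abs_less_iff)
    then have "frac y = y" using strand_sub[OF i y] by (simp add: frac_eq)
    then show ?thesis using replaced_in[OF i, of y] y by simp
  qed
  moreover have "min (x - a i) (b i - x) > 0" using x by simp
  ultimately show ?thesis by blast
qed

lemma replaced_periodic: "c (x + 1) = c x \<Longrightarrow> replaced c F (x + 1) = replaced c F x"
  by (simp add: replaced_def frac_1_eq)

lemma const_near_frac:
  assumes "\<And>x::real. c (x + 1) = c x" "const_near c (frac x)"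
  shows "const_near c x"
proof -
  obtain \<delta> where \<delta>: "\<delta> > 0" "\<And>y. \<bar>y - frac x\<bar> < \<delta> \<Longrightarrow> c y = c (frac x)"
    using assms(2) unfolding const_near_def by blast
  have "c y = c x" if "\<bar>y - x\<bar> < \<delta>" for y
  proof -
    have "c (y - of_int \<lfloor>x\<rfloor>) = c (frac x)" by (rule \<delta>(2)) (use that in \<open>simp add: frac_def\<close>)
    moreover have "c (y - of_int \<lfloor>x\<rfloor>) = c y" using periodic_int[of c y "- \<lfloor>x\<rfloor>", OF assms(1)] by simp
    moreover have "c (frac x) = c x" by (rule periodic_frac[of c x, OF assms(1)])
    ultimately show ?thesis by simp
  qed
  with \<delta>(1) show ?thesis unfolding const_near_def by blast
qed

text \<open>No chord may have one end on a strand and the other end outside: a chord either avoids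
  all strands or belongs to the picture. The picture records signs and types, so that extending a
  coloring over the strands is a question about \<open>Q\<close> alone.\<close>

definition split_chords :: "(real \<times> real) set \<Rightarrow> (real \<times> real) set \<Rightarrow> picture \<Rightarrow> (real \<times> real \<Rightarrow> real) \<Rightarrow> bool" where
  "split_chords X Y Q \<sigma> \<longleftrightarrow>
     X = Y \<union> chord_of ` Q \<and> (\<forall>d\<in>Y. fst d \<notin> region \<and> snd d \<notin> region \<and> fst d \<in> {0..<1} \<and> snd d \<in> {0..<1}) \<and>
     (\<forall>((i, p), (j, q), s, t)\<in>Q. i < n \<and> j < n \<and> p \<in> {-1<..<1} \<and> q \<in> {-1<..<1} \<and> \<bar>s\<bar> = 1 \<and>
        \<sigma> (of_strand i p, of_strand j q) = s * \<epsilon> i * \<epsilon> j \<and>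
        chord_type X (of_strand i p, of_strand j q) = t)"

lemma germ_cong_nbhd:
  assumes "germ f x d v" "\<bar>d\<bar> = 1" "\<exists>\<delta>>0. \<forall>y. \<bar>y - x\<bar> < \<delta> \<longrightarrow> g y = f y"
  shows "germ g x d v"
proof -
  obtain \<delta> where \<delta>: "\<delta> > 0" "\<forall>y. \<bar>y - x\<bar> < \<delta> \<longrightarrow> g y = f y" using assms(3) by blast
  show ?thesis
  proof (rule germ_cong_near[OF assms(1) \<delta>(1)])
    fix h assume "0 < h" "h < \<delta>"
    then show "g (x + d * h) = f (x + d * h)"
      using assms(2) by (intro \<delta>(2)[rule_format]) (simp add: abs_mult)
  qed
qed

lemma split_chordsD:
  assumes "split_chords X Y Q \<sigma>"
  shows "X = Y \<union> chord_of ` Q"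
    "d \<in> Y \<Longrightarrow> fst d \<notin> region \<and> snd d \<notin> region \<and> fst d \<in> {0..<1} \<and> snd d \<in> {0..<1}"
    "((i, p), (j, q), s, t) \<in> Q \<Longrightarrow> i < n \<and> j < n \<and> p \<in> {-1<..<1} \<and> q \<in> {-1<..<1} \<and> \<bar>s\<bar> = 1 \<and>
        \<sigma> (of_strand i p, of_strand j q) = s * \<epsilon> i * \<epsilon> j \<and> chord_type X (of_strand i p, of_strand j q) = t"
  using assms unfolding split_chords_def by fast+

lemma split_ends_in:
  assumes S: "split_chords X Y Q \<sigma>" and i: "i < n" and u: "u \<in> {-1..1}"
  shows "of_strand i u \<in> chord_ends X \<longleftrightarrow> (i, u) \<in> picture_ends Q"
proof
  have reg: "of_strand i u \<in> region" using i of_strand_in[OF i] u by (auto simp: region_def)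
  assume "of_strand i u \<in> chord_ends X"
  then obtain c where c: "c \<in> X" "of_strand i u = fst c \<or> of_strand i u = snd c"
    by (auto simp: chord_ends_def)
  have "c \<notin> Y" using split_chordsD(2)[OF S, of c] c(2) reg by auto
  then obtain j p k q s t where Q: "((j, p), (k, q), s, t) \<in> Q" and c': "c = (of_strand j p, of_strand k q)"
    using c(1) split_chordsD(1)[OF S] by (auto simp: chord_of_def)
  note q = split_chordsD(3)[OF S Q]
  have "i = l \<and> u = v" if "of_strand i u = of_strand l v" "l < n" "v \<in> {-1<..<1}" for l v
  proof -
    have "of_strand l v \<in> {a i..b i}" "of_strand l v \<in> {a l..b l}"
      using that of_strand_in[OF i, of u] of_strand_in[of l v] u by auto
    then have "i = l" using strand_unique[OF i that(2)] by blast
    then show ?thesis using that of_strand_eq_iff[OF i] by simp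
  qed
  then have "(i, u) = (j, p) \<or> (i, u) = (k, q)" using c(2) q unfolding c' by auto
  then show "(i, u) \<in> picture_ends Q" using Q by (force simp: picture_ends_def)
next
  assume "(i, u) \<in> picture_ends Q"
  then obtain c where c: "c \<in> Q" "(i, u) = fst c \<or> (i, u) = fst (snd c)" by (auto simp: picture_ends_def)
  then have "of_strand i u = fst (chord_of c) \<or> of_strand i u = snd (chord_of c)"
    by (cases c) (auto simp: chord_of_def)
  moreover have "chord_of c \<in> X" using c(1) split_chordsD(1)[OF S] by blast
  ultimately show "of_strand i u \<in> chord_ends X" by (auto simp: chord_ends_def)
qed

lemma split_ends_out:
  assumes S: "split_chords X Y Q \<sigma>" and x: "x \<notin> interior"
  shows "x \<in> chord_ends X \<longleftrightarrow> x \<in> chord_ends Y"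
proof
  assume "x \<in> chord_ends X"
  then obtain c where c: "c \<in> X" "x = fst c \<or> x = snd c" by (auto simp: chord_ends_def)
  have "c \<in> Y"
  proof (rule ccontr)
    assume "c \<notin> Y"
    then obtain j p k q s t where Q: "((j, p), (k, q), s, t) \<in> Q" and c': "c = (of_strand j p, of_strand k q)"
      using c(1) split_chordsD(1)[OF S] by (auto simp: chord_of_def)
    have "of_strand j p \<in> interior" "of_strand k q \<in> interior"
      using split_chordsD(3)[OF S Q] of_strand_in_open by (auto simp: interior_def)
    then show False using c(2) x c' by auto
  qed
  then show "x \<in> chord_ends Y" using c(2) by (auto simp: chord_ends_def)
next
  assume "x \<in> chord_ends Y"
  then show "x \<in> chord_ends X" using split_chordsD(1)[OF S] by (auto simp: chord_ends_def)
qed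

lemma strand_coloring_restrict:
  assumes S: "split_chords X Y Q \<sigma>" and c: "coloring M X \<sigma> c"
  shows "strand_coloring M n \<epsilon> Q (\<lambda>i u. c (of_strand i u))"
proof (rule strand_coloringI)
  fix i u assume i: "i < n"
  show "c (of_strand i u) \<in> carrier M" by (rule coloring_carrier[OF c])
  have cn: "const_near c (of_strand i u)" if "u \<in> {-1..1}" "(i, u) \<notin> picture_ends Q" for u
  proof -
    have "frac (of_strand i u) \<notin> chord_ends X"
      unfolding frac_of_strand[OF i that(1)] split_ends_in[OF S i that(1)] by (rule that(2))
    then show ?thesis using c by (simp add: coloring_def)
  qed
  have g: "germ (\<lambda>u. c (of_strand i u)) u d (c (of_strand i u))"
    if "u \<in> {-1..1}" "(i, u) \<notin> picture_ends Q" "\<bar>d\<bar> = 1" for u d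
  proof -
    have "germ c (of_strand i u) (\<epsilon> i * d) (c (of_strand i u))"
      by (rule germ_const_near[OF cn[OF that(1,2)]]) (simp add: abs_mult eps_abs[OF i] that(3))
    from germ_of_strand[OF i this] show ?thesis by (simp add: eps_sq[OF i] flip: mult.assoc)
  qed
  have ne: "(i, -1) \<notin> picture_ends Q" "(i, 1) \<notin> picture_ends Q"
    using split_chordsD(3)[OF S] by (fastforce simp: picture_ends_def)+
  show "germ (\<lambda>u. c (of_strand i u)) (-1) 1 (c (of_strand i (-1)))"
    "germ (\<lambda>u. c (of_strand i u)) 1 (-1) (c (of_strand i 1))"
    using g[of "-1" 1] g[of 1 "-1"] ne by simp_all
  show "const_near (\<lambda>u. c (of_strand i u)) u" if "-1 < u" "u < 1" "(i, u) \<notin> picture_ends Q"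
    using g[of u 1] g[of u "-1"] that by (intro germ_const_nearI[of _ _ "c (of_strand i u)"]) auto
next
  fix i p j q s t assume Q: "((i, p), (j, q), s, t) \<in> Q"
  note q = split_chordsD(3)[OF S Q]
  let ?v = "of_strand i p" and ?w = "of_strand j q"
  have i: "i < n" and j: "j < n" and \<sigma>: "\<sigma> (?v, ?w) = s * \<epsilon> i * \<epsilon> j" and t: "chord_type X (?v, ?w) = t"
    using q by auto
  have "chord_of ((i, p), (j, q), s, t) \<in> chord_of ` Q" using Q by (rule imageI)
  then have "(?v, ?w) \<in> X" using split_chordsD(1)[OF S] by (simp add: chord_of_def)
  from coloring_germs[OF c this] obtain aL aR bL bR where
    "germ c ?v (- (s * \<epsilon> i * \<epsilon> j)) aL" "germ c ?v (s * \<epsilon> i * \<epsilon> j) aR"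
    "germ c ?w (s * \<epsilon> i * \<epsilon> j) bL" "germ c ?w (- (s * \<epsilon> i * \<epsilon> j)) bR"
    and rel: "crossing_relation M t aL aR bL bR" unfolding \<sigma> t by metis
  from germ_of_strand[OF i this(1)] germ_of_strand[OF i this(2)] germ_of_strand[OF j this(3)] germ_of_strand[OF j this(4)]
  have "germ (\<lambda>u. c (of_strand i u)) p (- s * \<epsilon> j) aL" "germ (\<lambda>u. c (of_strand i u)) p (s * \<epsilon> j) aR"
    "germ (\<lambda>u. c (of_strand j u)) q (s * \<epsilon> i) bL" "germ (\<lambda>u. c (of_strand j u)) q (- s * \<epsilon> i) bR"
    using eps_sq[OF i] eps_sq[OF j] by (simp_all add: mult.assoc mult.commute mult.left_commute)
       (simp_all add: algebra_simps flip: mult.assoc)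
  with rel show "\<exists>aL aR bL bR. germ (\<lambda>u. c (of_strand i u)) p (- s * \<epsilon> j) aL \<and>
      germ (\<lambda>u. c (of_strand i u)) p (s * \<epsilon> j) aR \<and> germ (\<lambda>u. c (of_strand j u)) q (s * \<epsilon> i) bL \<and>
      germ (\<lambda>u. c (of_strand j u)) q (- s * \<epsilon> i) bR \<and> crossing_relation M t aL aR bL bR" by blast
qed

lemma strand_end_cases:
  assumes i: "i < n" and x: "x \<in> {a i..b i}" "x \<notin> {a i<..<b i}"
  obtains e where "e = 1 \<or> e = -1" "x = of_strand i e"
proof -
  have "to_strand i x \<in> {-1..1}" using of_strand_in[OF i, of "to_strand i x"] x(1) of_to_strand[OF i] by simp
  moreover have "to_strand i x \<notin> {-1<..<1}"
    using of_strand_in_open[OF i, of "to_strand i x"] x(2) of_to_strand[OF i] by simp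
  ultimately have "to_strand i x = 1 \<or> to_strand i x = -1" by auto
  then show ?thesis using that of_to_strand[OF i, of x] by metis
qed

text \<open>Outside the strands the coloring is kept, inside it is taken from \<open>F\<close>. The
  delicate points are the ends of the strands, where one side is governed by \<open>c\<close> and
  the other one by \<open>F\<close>; equality of the values there makes the pasted function locally
  constant.\<close>

lemma coloring_replaced:
  assumes S: "split_chords X Y Q \<sigma>" and S': "split_chords X' Y Q' \<sigma>'" and c: "coloring M X \<sigma> c"
    and Y: "\<And>d. d \<in> Y \<Longrightarrow> chord_type X' d = chord_type X d \<and> \<sigma>' d = \<sigma> d"
    and F: "strand_coloring M n \<epsilon> Q' F" and E: "same_ends n (\<lambda>i u. c (of_strand i u)) F"
  shows "coloring M X' \<sigma>' (replaced c F)" "frac x \<notin> interior \<Longrightarrow> replaced c F x = c x"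
proof -
  have per: "replaced c F (x + 1) = replaced c F x" for x
    by (rule replaced_periodic) (use c in \<open>simp add: coloring_def\<close>)
  have ends: "F i e = c (of_strand i e)" if "i < n" "e = 1 \<or> e = -1" for i e
    using E that by (auto simp: same_ends_def)
  have out: "replaced c F x = c x" if x: "frac x \<notin> interior" for x
  proof (cases "frac x \<in> region")
    case True
    then obtain i where i: "i < n" "frac x \<in> {a i..b i}" by (auto simp: region_def)
    moreover have "frac x \<notin> {a i<..<b i}" using x i(1) by (auto simp: interior_def)
    ultimately obtain e where e: "e = 1 \<or> e = -1" "frac x = of_strand i e" by (rule strand_end_cases)
    then show ?thesis
      using replaced_in[OF i, of c F] to_of_strand[OF i(1), of e] ends[OF i(1) e(1)] coloring_frac[OF c, of x]
      by simp
  qed (rule replaced_out)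
  then show "frac x \<notin> interior \<Longrightarrow> replaced c F x = c x" .
  have cn_out: "const_near (replaced c F) x"
    if x: "x \<notin> interior" "x \<notin> chord_ends X'" "0 \<le> x" "x < 1" for x
  proof -
    have fx: "frac x = x" using x by (simp add: frac_eq)
    have "frac x \<notin> chord_ends X"
      unfolding fx using x split_ends_out[OF S x(1)] split_ends_out[OF S' x(1)] by simp
    then obtain \<delta>1 where \<delta>1: "\<delta>1 > 0" "\<And>y. \<bar>y - x\<bar> < \<delta>1 \<Longrightarrow> c y = c x"
      using c unfolding coloring_def const_near_def by blast
    obtain \<delta>2 where \<delta>2: "\<delta>2 > 0"
      "\<And>y. \<bar>y - x\<bar> < \<delta>2 \<Longrightarrow> \<forall>i<n. frac y \<in> {a i..b i} \<longrightarrow> frac x \<in> {a i..b i}"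
      using near_strands by blast
    show ?thesis
    proof (cases "x \<in> region")
      case False
      then obtain \<delta> where "\<delta> > 0" "\<forall>y. \<bar>y - x\<bar> < \<delta> \<longrightarrow> replaced c F y = c y"
        using replaced_near_out[of x c F] fx by auto
      moreover have "const_near c x" unfolding const_near_def using \<delta>1 by blast
      ultimately show ?thesis using const_near_cong by blast
    next
      case True
      then obtain i where i: "i < n" "x \<in> {a i..b i}" by (auto simp: region_def)
      moreover have "x \<notin> {a i<..<b i}" using x i(1) by (auto simp: interior_def)
      ultimately obtain e where e: "e = 1 \<or> e = -1" "x = of_strand i e" by (rule strand_end_cases)
      have x01: "0 < x" "x < 1" using strand_sub[OF i] by auto
      have Fe: "F i e = c x" using ends[OF i(1) e(1)] e(2) by simp
      have "germ (F i) e (- e) (F i e)"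
        using e(1) strand_coloringD(3,4)[OF F i(1)] by auto
      then obtain \<delta>3 where \<delta>3: "\<delta>3 > 0" "\<And>h. 0 < h \<Longrightarrow> h < \<delta>3 \<Longrightarrow> F i (e + - e * h) = c x"
        unfolding germ_def Fe by blast
      let ?r = "(b i - a i) / 2"
      have r: "?r > 0" using ab[OF i(1)] by simp
      \<comment> \<open>Within this distance \<open>c\<close> is constant, only strand
        \<open>i\<close> is met, \<open>F i\<close> is constant on its side of the end, and no
        integer is passed. The factor \<open>?r\<close> converts lengths in the strand coordinate
        into lengths of parameters.\<close>
      define \<delta> where "\<delta> = min (min (min \<delta>1 \<delta>2) (?r * \<delta>3)) (min x (1 - x))"
      have "replaced c F y = c x" if y: "\<bar>y - x\<bar> < \<delta>" for y
      proof -
        have y': "\<bar>y - x\<bar> < \<delta>1" "\<bar>y - x\<bar> < \<delta>2" "\<bar>y - x\<bar> < ?r * \<delta>3" "\<bar>y - x\<bar> < x" "\<bar>y - x\<bar> < 1 - x"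
          using y by (simp_all add: \<delta>_def)
        have fy: "frac y = y" using y'(4,5) by (simp add: frac_eq abs_less_iff)
        show ?thesis
        proof (cases "frac y \<in> region")
          case False
          then show ?thesis using replaced_out[OF False, of c F] \<delta>1(2)[OF y'(1)] by simp
        next
          case True
          then obtain j where j: "j < n" "frac y \<in> {a j..b j}" by (auto simp: region_def)
          then have "x \<in> {a j..b j}" using \<delta>2(2)[OF y'(2)] fx by simp
          then have "j = i" using strand_unique[OF j(1) i(1)] i(2) by blast
          with j fy have yi: "frac y \<in> {a i..b i}" by simp
          define u where "u = to_strand i y"
          have yu: "y = of_strand i u" unfolding u_def using of_to_strand[OF i(1)] by simp
          have u: "u \<in> {-1..1}" using yi yu fy of_strand_in[OF i(1), of u] by simp
          have "\<bar>of_strand i u - of_strand i e\<bar> < ?r * \<delta>3" using yu e(2) y'(3) by simp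
          then have "?r * \<bar>u - e\<bar> < ?r * \<delta>3"
            using r eps_abs[OF i(1)] by (simp add: of_strand_diff[OF i(1)] abs_mult)
          then have ue: "\<bar>u - e\<bar> < \<delta>3" using r by simp
          have "F i u = c x"
          proof (cases "u = e")
            case False
            have "0 < \<bar>u - e\<bar>" "e + - e * \<bar>u - e\<bar> = u" using e(1) u False by auto
            then show ?thesis using \<delta>3(2)[of "\<bar>u - e\<bar>"] ue by simp
          qed (simp add: Fe)
          then show ?thesis using replaced_in[OF i(1) yi, of c F] u_def fy by simp
        qed
      qed
      moreover have "\<delta> > 0" using \<delta>1(1) \<delta>2(1) \<delta>3(1) r x01 by (simp add: \<delta>_def)
      moreover have "replaced c F x = c x" by (rule out) (use x fx in simp)
      ultimately show ?thesis unfolding const_near_def by metis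
    qed
  qed
  have g_in: "germ (replaced c F) (of_strand i p) (\<epsilon> i * d) v"
    if i: "i < n" and p: "p \<in> {-1<..<1}" and d: "\<bar>d\<bar> = 1" and g: "germ (F i) p d v" for i p d v
  proof (rule germ_cong_nbhd)
    show "germ (\<lambda>x. F i (to_strand i x)) (of_strand i p) (\<epsilon> i * d) v"
      by (rule germ_to_strand[OF i]) (simp add: to_of_strand[OF i] g)
    show "\<bar>\<epsilon> i * d\<bar> = 1" by (simp add: abs_mult d eps_abs[OF i])
    have "of_strand i p \<in> {a i<..<b i}" using of_strand_in_open[OF i] p by blast
    then show "\<exists>\<delta>>0. \<forall>y. \<bar>y - of_strand i p\<bar> < \<delta> \<longrightarrow> replaced c F y = F i (to_strand i y)"
      by (rule replaced_near_in[OF i])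
  qed
  show "coloring M X' \<sigma>' (replaced c F)"
    unfolding coloring_def
  proof (intro conjI allI impI ballI)
    fix x
    show "replaced c F x \<in> carrier M"
    proof (cases "frac x \<in> region")
      case True
      then obtain i where "i < n" "frac x \<in> {a i..b i}" by (auto simp: region_def)
      then show ?thesis using replaced_in[of _ x c F] strand_coloringD(1)[OF F] by metis
    next
      case False
      then show ?thesis using replaced_out[of x c F] coloring_carrier[OF c] by metis
    qed
    show "replaced c F (x + 1) = replaced c F x" by (rule per)
  next
    fix x assume x: "frac x \<notin> chord_ends X'"
    show "const_near (replaced c F) x"
    proof (rule const_near_frac[where c = "replaced c F", OF per])
      show "const_near (replaced c F) (frac x)"
      proof (cases "frac x \<in> interior")
        case False
        then show ?thesis using cn_out[of "frac x"] x by (simp add: frac_lt_1)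
      next
        case True
        then obtain i where i: "i < n" "frac x \<in> {a i<..<b i}" by (auto simp: interior_def)
        define u where "u = to_strand i (frac x)"
        have xu: "frac x = of_strand i u" unfolding u_def using of_to_strand[OF i(1)] by simp
        have u: "u \<in> {-1<..<1}" using of_strand_in_open[OF i(1), of u] xu i(2) by simp
        then have u': "u \<in> {-1..1}" by simp
        have "(i, u) \<notin> picture_ends Q'" using x xu split_ends_in[OF S' i(1) u'] by simp
        then have cn: "const_near (F i) u" using strand_coloringD(2)[OF F i(1)] u by simp
        have "germ (replaced c F) (frac x) (\<epsilon> i * d) (F i u)" if "\<bar>d\<bar> = 1" for d
          using g_in[OF i(1) u that germ_const_near[OF cn that]] xu by simp
        from this[of 1] this[of "-1"] have "germ (replaced c F) (frac x) 1 (F i u) \<and> germ (replaced c F) (frac x) (-1) (F i u)"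
          using eps[OF i(1)] by auto
        moreover have "replaced c F (frac x) = F i u"
          using replaced_in[OF i(1), of "frac x" c F] i(2) u_def by simp
        ultimately show ?thesis by (intro germ_const_nearI[of _ _ "F i u"]) auto
      qed
    qed
  next
    fix d assume d: "d \<in> X'"
    obtain v w where vw: "d = (v, w)" by (cases d)
    have "\<exists>aL aR bL bR. germ (replaced c F) v (- \<sigma>' d) aL \<and> germ (replaced c F) v (\<sigma>' d) aR \<and>
        germ (replaced c F) w (\<sigma>' d) bL \<and> germ (replaced c F) w (- \<sigma>' d) bR \<and>
        crossing_relation M (chord_type X' d) aL aR bL bR"
    proof (cases "d \<in> Y")
      case True
      have "(v, w) \<in> X" using True vw split_chordsD(1)[OF S] by simp
      from coloring_germs[OF c this] obtain aL aR bL bR where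
        g: "germ c v (- \<sigma>' d) aL" "germ c v (\<sigma>' d) aR" "germ c w (\<sigma>' d) bL" "germ c w (- \<sigma>' d) bR"
        and r: "crossing_relation M (chord_type X' d) aL aR bL bR"
        using Y[OF True] vw by metis
      have fr: "frac v \<notin> region" "frac w \<notin> region"
        using split_chordsD(2)[OF S True] vw by (simp_all add: frac_eq)
      have g': "germ (replaced c F) z k m" if gz: "germ c z k m" and rz: "frac z \<notin> region" for z k m
      proof -
        obtain \<delta> where \<delta>: "\<delta> > 0" "\<forall>y. \<bar>y - z\<bar> < \<delta> \<longrightarrow> replaced c F y = c y"
          using replaced_near_out[OF rz, of c F] by blast
        show ?thesis
        proof (rule germ_cong_near[OF gz])
          \<comment> \<open>The direction \<open>k\<close> is an arbitrary real number here, so the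
            step is shortened by a factor that bounds its length.\<close>
          show "\<delta> / (\<bar>k\<bar> + 1) > 0" using \<delta>(1) by simp
          fix h assume h: "0 < h" "h < \<delta> / (\<bar>k\<bar> + 1)"
          have "\<bar>k\<bar> * h \<le> (\<bar>k\<bar> + 1) * h" using h(1) by (simp add: distrib_right)
          also have "\<dots> < \<delta>" using h(2) by (simp add: pos_less_divide_eq mult.commute)
          finally show "replaced c F (z + k * h) = c (z + k * h)"
            using h(1) by (intro \<delta>(2)[rule_format]) (simp add: abs_mult)
        qed
      qed
      show ?thesis using g'[OF g(1) fr(1)] g'[OF g(2) fr(1)] g'[OF g(3) fr(2)] g'[OF g(4) fr(2)] r by blast
    next
      case False
      then have "d \<in> chord_of ` Q'" using d split_chordsD(1)[OF S'] by blast
      then obtain i p j q s t where Q: "((i, p), (j, q), s, t) \<in> Q'" and d': "d = (of_strand i p, of_strand j q)"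
        by (auto simp: chord_of_def)
      have q: "i < n" "j < n" "p \<in> {-1<..<1}" "q \<in> {-1<..<1}" "\<bar>s\<bar> = 1"
        "\<sigma>' d = s * \<epsilon> i * \<epsilon> j" "chord_type X' d = t"
        using split_chordsD(3)[OF S' Q] d' by simp_all
      from strand_coloring_crossing[OF F Q] obtain aL aR bL bR where
        g: "germ (F i) p (- s * \<epsilon> j) aL" "germ (F i) p (s * \<epsilon> j) aR"
        "germ (F j) q (s * \<epsilon> i) bL" "germ (F j) q (- s * \<epsilon> i) bR" and r: "crossing_relation M t aL aR bL bR" .
      have abs: "\<bar>- s * \<epsilon> j\<bar> = 1" "\<bar>s * \<epsilon> j\<bar> = 1" "\<bar>s * \<epsilon> i\<bar> = 1" "\<bar>- s * \<epsilon> i\<bar> = 1"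
        using q(5) eps_abs[OF q(1)] eps_abs[OF q(2)] by (simp_all add: abs_mult)
      have eqs: "\<epsilon> i * (- s * \<epsilon> j) = - \<sigma>' d" "\<epsilon> i * (s * \<epsilon> j) = \<sigma>' d" "\<epsilon> j * (s * \<epsilon> i) = \<sigma>' d" "\<epsilon> j * (- s * \<epsilon> i) = - \<sigma>' d"
        unfolding q(6) by (simp_all add: mult_ac)
      show ?thesis
        using g_in[OF q(1,3) abs(1) g(1)] g_in[OF q(1,3) abs(2) g(2)] g_in[OF q(2,4) abs(3) g(3)]
          g_in[OF q(2,4) abs(4) g(4)] r vw d' unfolding eqs q(7) by (metis prod.inject)
    qed
    then show "case d of (v, u) \<Rightarrow> \<exists>aL aR bL bR.
        germ (replaced c F) v (- \<sigma>' (v, u)) aL \<and> germ (replaced c F) v (\<sigma>' (v, u)) aR \<and>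
        germ (replaced c F) u (\<sigma>' (v, u)) bL \<and> germ (replaced c F) u (- \<sigma>' (v, u)) bR \<and>
        crossing_relation M (chord_type X' (v, u)) aL aR bL bR"
      unfolding vw prod.case .
  qed
qed

text \<open>The passage from local to global. The matched parameters leave out only the open strands
  and the ends of chords outside, so the ends of the strands are still matched. There the
  restrictions to the strands are compared: extension of pictures transfers colorings, rigidity
  makes the result unique.\<close>

lemma isomorphic_if_pictures_equivalent:
  assumes K: "virtual_knot_diagram K" and K': "virtual_knot_diagram K'"
    and S: "split_chords (crossings K) Y Q (crossing_sign K)"
    and S': "split_chords (crossings K') Y Q' (crossing_sign K')"
    and Y: "\<And>d. d \<in> Y \<Longrightarrow> chord_type (crossings K') d = chord_type (crossings K) d \<and>
      crossing_sign K' d = crossing_sign K d"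
    and P: "\<And>M :: (laurent set, (real set \<Rightarrow> laurent set) set) module. coeff_module M \<Longrightarrow>
      picture_extends M n \<epsilon> Q Q' \<and> picture_extends M n \<epsilon> Q' Q \<and> picture_rigid M n \<epsilon> Q \<and> picture_rigid M n \<epsilon> Q'"
  shows "module_isomorphic coeff_ring (knot_module K) (knot_module K')"
proof (rule knot_module_isomorphicI[OF K K', where e = "\<lambda>x. x" and e' = "\<lambda>x. x"
      and I = "{x. frac x \<notin> interior \<and> frac x \<notin> chord_ends Y}"])
  let ?I = "{x. frac x \<notin> interior \<and> frac x \<notin> chord_ends Y}"
  show "i \<in> ?I \<Longrightarrow> frac i \<notin> chord_ends (crossings K)" "i \<in> ?I \<Longrightarrow> frac i \<notin> chord_ends (crossings K')" for i
    using split_ends_out[OF S, of "frac i"] split_ends_out[OF S', of "frac i"] by auto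
  have transfer: "\<exists>c'. coloring M X' \<sigma>' c' \<and> (\<forall>x\<in>?I. c' x = c x)"
    if c: "coloring M X \<sigma> c" and S: "split_chords X Y R \<sigma>" and S': "split_chords X' Y R' \<sigma>'"
      and Y: "\<And>d. d \<in> Y \<Longrightarrow> chord_type X' d = chord_type X d \<and> \<sigma>' d = \<sigma> d"
      and E: "picture_extends M n \<epsilon> R R'"
    for M :: "(laurent set, (real set \<Rightarrow> laurent set) set) module" and c X \<sigma> R X' \<sigma>' R'
  proof -
    from E strand_coloring_restrict[OF S c] obtain F where
      F: "strand_coloring M n \<epsilon> R' F" "same_ends n (\<lambda>i u. c (of_strand i u)) F"
      unfolding picture_extends_def by blast
    from coloring_replaced[OF S S' c Y F] show ?thesis by blast
  qed
  have unique: "c1 x = c2 x"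
    if M: "picture_rigid M n \<epsilon> R" and c: "coloring M X \<sigma> c1" "coloring M X \<sigma> c2" and S: "split_chords X Y R \<sigma>"
      and eq: "\<And>i. i \<in> ?I \<Longrightarrow> c1 i = c2 i" and x: "frac x \<notin> chord_ends X"
    for M :: "(laurent set, (real set \<Rightarrow> laurent set) set) module" and c1 c2 x X \<sigma> R
  proof (cases "frac x \<in> interior")
    case False
    then show ?thesis using eq[of x] x split_ends_out[OF S False] by simp
  next
    case True
    then obtain i where i: "i < n" "frac x \<in> {a i<..<b i}" by (auto simp: interior_def)
    have reg_Y: "of_strand l e \<in> ?I" if "l < n" "e = 1 \<or> e = -1" for l e
    proof -
      have e: "e \<in> {-1..1}" "e \<notin> {-1<..<1}" using that(2) by auto
      have r: "of_strand l e \<in> {a l..b l}" "of_strand l e \<notin> {a l<..<b l}"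
        using of_strand_in[OF that(1)] of_strand_in_open[OF that(1)] e by blast+
      have "of_strand l e \<notin> interior"
      proof
        assume "of_strand l e \<in> interior"
        then obtain k where k: "k < n" "of_strand l e \<in> {a k<..<b k}" by (auto simp: interior_def)
        then have "k = l" using strand_unique[OF k(1) that(1), of "of_strand l e"] r(1) by auto
        then show False using k r by simp
      qed
      moreover have "of_strand l e \<notin> chord_ends Y"
        using split_chordsD(2)[OF S] r(1) that(1) by (fastforce simp: chord_ends_def region_def)
      ultimately show ?thesis using frac_of_strand[OF that(1) e(1)] by simp
    qed
    have "same_ends n (\<lambda>i u. c1 (of_strand i u)) (\<lambda>i u. c2 (of_strand i u))"
      unfolding same_ends_def using eq reg_Y by blast
    moreover define u where "u = to_strand i (frac x)"
    have xu: "frac x = of_strand i u" unfolding u_def using of_to_strand[OF i(1)] by simp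
    have u: "u \<in> {-1..1}" using of_strand_in_open[OF i(1), of u] xu i(2) by simp
    have "(i, u) \<notin> picture_ends R" using x xu split_ends_in[OF S i(1) u] by simp
    ultimately have "c1 (of_strand i u) = c2 (of_strand i u)"
      using M strand_coloring_restrict[OF S c(1)] strand_coloring_restrict[OF S c(2)] i(1) u
      unfolding picture_rigid_def by blast
    then show ?thesis using coloring_frac[OF c(1), of x] coloring_frac[OF c(2), of x] xu by simp
  qed
  fix M :: "(laurent set, (real set \<Rightarrow> laurent set) set) module" assume M: "coeff_module M"
  show "\<exists>c'. coloring M (crossings K') (crossing_sign K') c' \<and> (\<forall>i\<in>?I. c' i = c i)"
    if "coloring M (crossings K) (crossing_sign K) c" for c
    by (rule transfer[OF that S S' Y]) (use P[OF M] in blast)+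
  show "\<exists>c'. coloring M (crossings K) (crossing_sign K) c' \<and> (\<forall>i\<in>?I. c' i = c i)"
    if "coloring M (crossings K') (crossing_sign K') c" for c
    by (rule transfer[OF that S' S]) (use P[OF M] Y in auto)
  show "c1 x = c2 x" if "coloring M (crossings K) (crossing_sign K) c1" "coloring M (crossings K) (crossing_sign K) c2"
    "\<And>i. i \<in> ?I \<Longrightarrow> c1 i = c2 i" "frac x \<notin> chord_ends (crossings K)" for c1 c2 x
    by (rule unique[OF _ that(1,2) S that(3,4)]) (use P[OF M] in blast)+
  show "c1 x = c2 x" if "coloring M (crossings K') (crossing_sign K') c1" "coloring M (crossings K') (crossing_sign K') c2"
    "\<And>i. i \<in> ?I \<Longrightarrow> c1 i = c2 i" "frac x \<notin> chord_ends (crossings K')" for c1 c2 x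
    by (rule unique[OF _ that(1,2) S' that(3,4)]) (use P[OF M] in blast)+
qed

end

section \<open>The Reidemeister moves\<close>

lemma chords_intersect_swap:
  "chords_intersect (u, v) d = chords_intersect (v, u) d" "chords_intersect c (y, x) = chords_intersect c (x, y)"
  by (cases d; auto simp: chords_intersect_def min.commute max.commute)
     (cases c; auto simp: chords_intersect_def)

lemma chords_intersect_commute:
  assumes "{v, u} \<inter> {v', u'} = {}" "v \<noteq> u" "v' \<noteq> u'"
  shows "chords_intersect (v, u) (v', u') = chords_intersect (v', u') (v, u)"
proof -
  have ordered: "chords_intersect (v, u) (v', u') = chords_intersect (v', u') (v, u)"
    if "v < u" "v' < u'" "{v, u} \<inter> {v', u'} = {}" for v u v' u' :: real
    using that by (auto simp: chords_intersect_def min_def max_def)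
  have minmax: "chords_intersect (v, u) d = chords_intersect (min v u, max v u) d"
    "chords_intersect d (v, u) = chords_intersect d (min v u, max v u)" for v u d
    using chords_intersect_swap(1)[of v u d] chords_intersect_swap(2)[of d u v]
    by (cases "v \<le> u"; simp add: min_def max_def)+
  have "chords_intersect (min v u, max v u) (min v' u', max v' u') =
      chords_intersect (min v' u', max v' u') (min v u, max v u)"
    by (rule ordered) (use assms in \<open>auto simp: min_def max_def\<close>)
  then show ?thesis
    by (simp only: minmax(1)[of v u "(v', u')"] minmax(2)[of "(min v u, max v u)" v' u']
        minmax(1)[of v' u' "(v, u)"] minmax(2)[of "(min v' u', max v' u')" v u])
qed

section \<open>Chords outside the strands and their intersections with chords of the picture\<close>

context strands
begin

definition outer :: "vdiagram \<Rightarrow> (real \<times> real) set" where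
  "outer K = {d \<in> crossings K. fst d \<notin> region \<and> snd d \<notin> region}"

text \<open>A strand that contains no end of \<open>d\<close> lies entirely between the ends of
  \<open>d\<close> or entirely outside, so testing its left end suffices.\<close>

definition separates :: "real \<times> real \<Rightarrow> nat \<Rightarrow> bool" where
  "separates d i \<longleftrightarrow> a i \<in> {min (fst d) (snd d)<..<max (fst d) (snd d)}"

text \<open>The answer depends only on the strands that carry \<open>x\<close> and \<open>y\<close>.
  Hence moving ends within their strands is invisible to chords outside, and a chord with both ends
  on one strand meets none of them.\<close>

lemma outer_intersects:
  assumes d: "fst d \<notin> region" "snd d \<notin> region" and i: "i < n" "x \<in> {a i..b i}" and j: "j < n" "y \<in> {a j..b j}"
  shows "chords_intersect d (x, y) \<longleftrightarrow> separates d i \<noteq> separates d j"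
proof -
  have "x \<in> {min (fst d) (snd d)<..<max (fst d) (snd d)} \<longleftrightarrow> separates d i"
    if i: "i < n" "x \<in> {a i..b i}" for x i
  proof -
    have "fst d < a i \<or> b i < fst d" "snd d < a i \<or> b i < snd d"
      using d i(1) by (auto simp: region_def not_le)
    then show ?thesis using i(2) ab[OF i(1)] by (auto simp: separates_def min_def max_def)
  qed
  from this[OF i] this[OF j] show ?thesis
    by (simp only: chords_intersect_def case_prod_unfold fst_conv snd_conv)
qed

lemma outer_intersects':
  assumes d: "fst d \<notin> region" "snd d \<notin> region" "fst d \<noteq> snd d"
    and i: "i < n" "x \<in> {a i..b i}" and j: "j < n" "y \<in> {a j..b j}" and "x \<noteq> y"
  shows "chords_intersect (x, y) d \<longleftrightarrow> separates d i \<noteq> separates d j"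
proof -
  have "x \<in> region" "y \<in> region" using i j by (auto simp: region_def)
  then have "{x, y} \<inter> {fst d, snd d} = {}" using d by auto
  from chords_intersect_commute[OF this assms(8) d(3)] show ?thesis
    using outer_intersects[OF d(1,2) i j] by simp
qed

lemma strand_order:
  assumes "i < n" "j < n" "i \<noteq> j"
  shows "b i < a j \<or> b j < a i"
proof (rule ccontr)
  assume "\<not> ?thesis"
  then have "max (a i) (a j) \<in> {a i..b i}" "max (a i) (a j) \<in> {a j..b j}"
    using ab[OF assms(1)] ab[OF assms(2)] by auto
  then show False using strand_unique assms by blast
qed

text \<open>The two chords share the strand \<open>i\<close>, and their other ends lie on two
  different strands. Exchanging the ends on \<open>i\<close> moves one end of the second chord
  across an end of the first, while no other pair of ends changes its order.\<close>

lemma intersects_toggle: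
  assumes ijk: "i < n" "j < n" "k < n" "i \<noteq> j" "i \<noteq> k" "j \<noteq> k"
    and x: "{x, z, x', z'} \<subseteq> {a i..b i}" and y: "{y, y'} \<subseteq> {a j..b j}" and w: "{w, w'} \<subseteq> {a k..b k}"
    and ord: "x < z \<longleftrightarrow> z' < x'" "x \<noteq> z" "x' \<noteq> z'"
  shows "chords_intersect (x', y') (z', w') = (\<not> chords_intersect (x, y) (z, w))"
proof -
  note o = strand_order[OF ijk(1,2,4)] strand_order[OF ijk(1,3,5)] strand_order[OF ijk(2,3,6)]
  have B: "a i \<le> x" "x \<le> b i" "a i \<le> z" "z \<le> b i" "a i \<le> x'" "x' \<le> b i" "a i \<le> z'" "z' \<le> b i"
    "a j \<le> y" "y \<le> b j" "a j \<le> y'" "y' \<le> b j" "a k \<le> w" "w \<le> b k" "a k \<le> w'" "w' \<le> b k"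
    using x y w by auto
  have z: "z \<in> {min x y<..<max x y} \<longleftrightarrow> (if b i < a j then x < z else z < x)"
    "z' \<in> {min x' y'<..<max x' y'} \<longleftrightarrow> (if b i < a j then x' < z' else z' < x')"
    using o(1) B by (auto simp: min_def max_def)
  have w: "w \<in> {min x y<..<max x y} \<longleftrightarrow> w' \<in> {min x' y'<..<max x' y'}"
    using o B by (auto simp: min_def max_def)
  have zz: "(z' \<in> {min x' y'<..<max x' y'}) = (\<not> z \<in> {min x y<..<max x y})"
    unfolding z using ord by auto
  show ?thesis unfolding chords_intersect_def prod.case using w zz by blast
qed

lemma has_pictureD:
  assumes "has_picture n m a b \<epsilon> h K"
  shows "i < n \<Longrightarrow> x \<in> {a i..b i} \<Longrightarrow> curve K x = m i (to_strand i x)"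
    "x \<in> {0..1} \<Longrightarrow> x \<notin> region \<Longrightarrow> curve K x \<notin> square"
    "i < n \<Longrightarrow> j < n \<Longrightarrow> x \<in> {a i..b i} \<Longrightarrow> y \<in> {a j..b j} \<Longrightarrow> double_point K x y \<Longrightarrow>
      if i = j then x \<in> over K \<or> y \<in> over K else x \<in> over K \<longleftrightarrow> h j < h i"
proof -
  have 1: "\<forall>i<n. \<forall>x\<in>{a i..b i}. curve K x = m i (to_strand i x)"
    and 2: "\<forall>x\<in>{0..1} - region. curve K x \<notin> square"
    and 3: "\<forall>i<n. \<forall>j<n. \<forall>x\<in>{a i..b i}. \<forall>y\<in>{a j..b j}. double_point K x y \<longrightarrow>
        (if i = j then x \<in> over K \<or> y \<in> over K else x \<in> over K \<longleftrightarrow> h j < h i)"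
    using assms unfolding has_picture_def to_strand_def region_def by - (elim conjE, assumption)+
  show "i < n \<Longrightarrow> x \<in> {a i..b i} \<Longrightarrow> curve K x = m i (to_strand i x)" by (rule 1[rule_format])
  show "x \<in> {0..1} \<Longrightarrow> x \<notin> region \<Longrightarrow> curve K x \<notin> square" by (rule 2[rule_format]) (rule DiffI)
  show "i < n \<Longrightarrow> j < n \<Longrightarrow> x \<in> {a i..b i} \<Longrightarrow> y \<in> {a j..b j} \<Longrightarrow> double_point K x y \<Longrightarrow>
      if i = j then x \<in> over K \<or> y \<in> over K else x \<in> over K \<longleftrightarrow> h j < h i"
    by (rule 3[THEN spec, THEN mp, THEN spec, THEN mp, THEN bspec, THEN bspec, THEN mp])
qed

lemma picture_curve:
  assumes "has_picture n m a b \<epsilon> h K" "i < n" "u \<in> {-1..1}"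
  shows "curve K (of_strand i u) = m i u"
proof -
  have "of_strand i u \<in> {a i..b i}" using of_strand_in[OF assms(2)] assms(3) by blast
  then have "curve K (of_strand i u) = m i (to_strand i (of_strand i u))"
    by (rule has_pictureD(1)[OF assms(1,2)])
  then show ?thesis by (simp add: to_of_strand[OF assms(2)])
qed

lemma picture_velocity:
  assumes P: "has_picture n m a b \<epsilon> h K" and i: "i < n" and u: "u \<in> {-1<..<1}"
    and D: "(m i has_vector_derivative D) (at u)"
  shows "velocity K (of_strand i u) = (\<epsilon> i * 2 / (b i - a i)) *\<^sub>R D"
proof -
  let ?x = "of_strand i u"
  have "(to_strand i has_vector_derivative \<epsilon> i * 2 / (b i - a i)) (at ?x)"
    unfolding to_strand_def[abs_def] has_real_derivative_iff_has_vector_derivative[symmetric]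
    using ab[OF i] by (auto intro!: derivative_eq_intros)
  from vector_diff_chain_at[OF this, of "m i" D]
  have "((m i \<circ> to_strand i) has_vector_derivative (\<epsilon> i * 2 / (b i - a i)) *\<^sub>R D) (at ?x)"
    using D by (simp add: to_of_strand[OF i])
  moreover have "?x \<in> {a i<..<b i}" using of_strand_in_open[OF i] u by blast
  moreover have "(m i \<circ> to_strand i) y = curve K y" if "y \<in> {a i<..<b i}" for y
    using has_pictureD(1)[OF P i, of y] that by simp
  ultimately have "(curve K has_vector_derivative (\<epsilon> i * 2 / (b i - a i)) *\<^sub>R D) (at ?x)"
    by (rule has_vector_derivative_transform_within_open[OF _ open_greaterThanLessThan])
  then show ?thesis unfolding velocity_def by (rule vector_derivative_at)
qed

text \<open>Among parameters in \<open>{0..<1}\<close>, the curve is in the square exactly for those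
  on the strands. A crossing with one parameter on a strand therefore has both on strands and is a
  double point of the model curves.\<close>

lemma crossing_strands:
  assumes P: "has_picture n m a b \<epsilon> h K" and sq: "\<And>i u. i < n \<Longrightarrow> u \<in> {-1..1} \<Longrightarrow> m i u \<in> square"
    and c: "d \<in> crossings K" "d \<notin> outer K"
  obtains i p j q where "i < n" "j < n" "p \<in> {-1..1}" "q \<in> {-1..1}"
    "d = (of_strand i p, of_strand j q)" "m i p = m j q" "(i, p) \<noteq> (j, q)"
proof -
  obtain v w where d: "d = (v, w)" by (cases d)
  have vw: "v \<in> {0..<1}" "w \<in> {0..<1}" "curve K v = curve K w" "v \<noteq> w"
    using c(1) by (auto simp: d crossings_def double_point_def)
  have strand: "\<exists>i<n. \<exists>p\<in>{-1..1}. x = of_strand i p" if x: "x \<in> region" for x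
  proof -
    obtain i where i: "i < n" "x \<in> {a i..b i}" using x by (auto simp: region_def)
    have "x = of_strand i (to_strand i x)" by (rule of_to_strand[OF i(1), symmetric])
    moreover from this i have "to_strand i x \<in> {-1..1}" using of_strand_in[OF i(1), of "to_strand i x"] by simp
    ultimately show ?thesis using i(1) by blast
  qed
  have inner: "curve K x \<in> square \<longleftrightarrow> x \<in> region" if x: "x \<in> {0..<1}" for x
  proof
    assume "curve K x \<in> square"
    then show "x \<in> region" using has_pictureD(2)[OF P, of x] x by auto
  next
    assume "x \<in> region"
    then obtain i p where "i < n" "p \<in> {-1..1}" "x = of_strand i p" using strand by blast
    then show "curve K x \<in> square" using sq[of i p] picture_curve[OF P, of i p] by simp
  qed
  have "v \<in> region \<or> w \<in> region" using c by (auto simp: outer_def d)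
  then have "v \<in> region" "w \<in> region" using inner[OF vw(1)] inner[OF vw(2)] vw(3) by auto
  then obtain i p j q where ip: "i < n" "p \<in> {-1..1}" "v = of_strand i p"
    and jq: "j < n" "q \<in> {-1..1}" "w = of_strand j q"
    using strand by blast
  have "m i p = m j q" using vw(3) picture_curve[OF P ip(1,2)] picture_curve[OF P jq(1,2)] ip(3) jq(3) by simp
  moreover have "(i, p) \<noteq> (j, q)" using vw(4) ip(3) jq(3) by auto
  ultimately show ?thesis using that[OF ip(1) jq(1) ip(2) jq(2)] d ip(3) jq(3) by blast
qed

lemma local_move_outer:
  assumes K: "virtual_knot_diagram K" and K': "virtual_knot_diagram K'"
    and agree: "\<And>x. x \<in> {0..1} - region \<Longrightarrow> curve K' x = curve K x \<and> (x \<in> over K' \<longleftrightarrow> x \<in> over K)"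
  shows "outer K' = outer K" "d \<in> outer K \<Longrightarrow> crossing_sign K' d = crossing_sign K d"
proof -
  have "(v, w) \<in> outer K' \<longleftrightarrow> (v, w) \<in> outer K" for v w
    using agree[of v] agree[of w] by (auto simp: outer_def crossings_def double_point_def)
  then show "outer K' = outer K" by auto
  have vel: "velocity K' x = velocity K x" if x: "x \<in> {0..<1}" "x \<notin> region" for x
  proof (rule velocity_eq_if_agree[OF K' K])
    show "curve K' x = curve K x" using agree[of x] x by auto
    fix \<delta> :: real assume \<delta>: "\<delta> > 0"
    have fx: "frac x = x" using x by (simp add: frac_eq)
    obtain \<delta>' where \<delta>': "\<delta>' > 0"
      "\<And>y. \<bar>y - x\<bar> < \<delta>' \<Longrightarrow> \<forall>i<n. frac y \<in> {a i..b i} \<longrightarrow> frac x \<in> {a i..b i}"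
      using near_strands by blast
    \<comment> \<open>Points slightly to the right of \<open>x\<close> stay off the strands and
      below 1, where both curves are known to agree.\<close>
    define r where "r = min (min \<delta> \<delta>') (1 - x) / 2"
    have "0 < r" "r < \<delta>" "r < \<delta>'" "r < 1 - x" using \<delta> \<delta>'(1) x by (auto simp: r_def min_def)
    then obtain y where y: "x < y" "y < x + \<delta>" "y < x + \<delta>'" "y < 1" by (intro that[of "x + r"]) auto
    have fy: "frac y = y" using y x by (simp add: frac_eq)
    have "\<forall>i<n. frac y \<in> {a i..b i} \<longrightarrow> frac x \<in> {a i..b i}" by (rule \<delta>'(2)) (use y in simp)
    then have "y \<notin> region" using x(2) unfolding fx fy region_def by blast
    then have "curve K' y = curve K y" using agree[of y] y x by auto
    then show "\<exists>y. y \<noteq> x \<and> \<bar>y - x\<bar> < \<delta> \<and> curve K' y = curve K y"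
      using y by (intro exI[of _ y]) auto
  qed
  show "crossing_sign K' d = crossing_sign K d" if "d \<in> outer K"
    using that vel by (cases d) (auto simp: outer_def crossing_sign_def crossings_def)
qed

lemma outer_props:
  "d \<in> outer K \<Longrightarrow> fst d \<notin> region \<and> snd d \<notin> region \<and> fst d \<in> {0..<1} \<and> snd d \<in> {0..<1} \<and> fst d \<noteq> snd d"
  by (auto simp: outer_def crossings_def double_point_def)

lemma of_strand_region: "i < n \<Longrightarrow> u \<in> {-1..1} \<Longrightarrow> of_strand i u \<in> region"
  using of_strand_in[of i u] by (auto simp: region_def)

text \<open>For strands that are graphs over the horizontal axis, double points occur only at equal
  parameters \<open>p\<close>, and the directions \<open>(1, \<alpha>)\<close> and
  \<open>(1, \<beta>)\<close> have determinant \<open>\<beta> - \<alpha>\<close>, so the sign of a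
  crossing is that of a difference of slopes. All pictures have this form except the curl.\<close>

definition graph_picture ::
  "(nat \<Rightarrow> real \<Rightarrow> real) \<Rightarrow> (nat \<Rightarrow> real \<Rightarrow> real) \<Rightarrow> (nat \<Rightarrow> nat) \<Rightarrow> vdiagram \<Rightarrow> picture" where
  "graph_picture f f' h K = {((i, p), (j, p), sgn (f' j p - f' i p), chord_type (crossings K) (of_strand i p, of_strand j p)) | i j p.
     i < n \<and> j < n \<and> h j < h i \<and> p \<in> {-1..1} \<and> f i p = f j p}"

lemma graph_split:
  assumes K: "virtual_knot_diagram K" and P: "has_picture n (\<lambda>i u. Complex u (f i u)) a b \<epsilon> h K"
    and f: "\<And>i u. i < n \<Longrightarrow> u \<in> {-1..1} \<Longrightarrow> \<bar>f i u\<bar> \<le> 1"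
    and f': "\<And>i u. i < n \<Longrightarrow> (f i has_real_derivative f' i u) (at u)"
    and ends: "\<And>i j p. i < n \<Longrightarrow> j < n \<Longrightarrow> h j < h i \<Longrightarrow> p \<in> {-1..1} \<Longrightarrow> f i p = f j p \<Longrightarrow> p \<in> {-1<..<1}"
    and h: "inj_on h {..<n}"
  shows "split_chords (crossings K) (outer K) (graph_picture f f' h K) (crossing_sign K)"
proof -
  let ?Q = "graph_picture f f' h K"
  have sq: "Complex u (f i u) \<in> square" if "i < n" "u \<in> {-1..1}" for i u
    using f[OF that] that(2) by (auto simp: square_def abs_le_iff)
  have cross: "(of_strand i p, of_strand j p) \<in> crossings K"
    if ij: "i < n" "j < n" "h j < h i" and p: "p \<in> {-1..1}" "f i p = f j p" for i j p
  proof -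
    let ?v = "of_strand i p" and ?w = "of_strand j p"
    have ne: "i \<noteq> j" using ij by auto
    have in_s: "?v \<in> {a i..b i}" "?w \<in> {a j..b j}" using of_strand_in ij p(1) by blast+
    then have vw: "0 < ?v" "?v < 1" "0 < ?w" "?w < 1" using strand_sub ij by blast+
    have "?v \<noteq> ?w" using strand_unique[OF ij(1,2) in_s(1)] in_s(2) ne by auto
    then have "?v - ?w \<notin> \<int>" using diff_Ints_imp_eq[of ?v ?w] vw by auto
    moreover have "curve K ?v = curve K ?w"
      using picture_curve[OF P ij(1) p(1)] picture_curve[OF P ij(2) p(1)] p(2) by simp
    ultimately have dp: "double_point K ?v ?w" by (simp add: double_point_def)
    moreover have "?v \<in> over K \<longleftrightarrow> h j < h i"
      using has_pictureD(3)[OF P ij(1,2) in_s dp] ne by simp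
    ultimately show ?thesis using vw ij by (simp add: crossings_def)
  qed
  have "crossings K = outer K \<union> chord_of ` ?Q"
  proof
    show "outer K \<union> chord_of ` ?Q \<subseteq> crossings K"
      using cross by (auto simp: outer_def graph_picture_def chord_of_def)
    show "crossings K \<subseteq> outer K \<union> chord_of ` ?Q"
    proof
      fix d assume d: "d \<in> crossings K"
      show "d \<in> outer K \<union> chord_of ` ?Q"
      proof (cases "d \<in> outer K")
        case False
        obtain i p j q where ij: "i < n" "j < n" "p \<in> {-1..1}" "q \<in> {-1..1}"
          and dd: "d = (of_strand i p, of_strand j q)" "Complex p (f i p) = Complex q (f j q)" "(i, p) \<noteq> (j, q)"
          by (rule crossing_strands[OF P sq d False]) auto
        have pq: "q = p" "f i p = f j p" "i \<noteq> j" using dd by auto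
        have "of_strand i p \<in> over K" "double_point K (of_strand i p) (of_strand j p)"
          using d dd pq by (auto simp: crossings_def)
        moreover have "of_strand i p \<in> {a i..b i}" "of_strand j p \<in> {a j..b j}"
          using of_strand_in ij by blast+
        ultimately have "h j < h i"
          using has_pictureD(3)[OF P ij(1,2), of "of_strand i p" "of_strand j p"] pq(3) by simp
        then have "((i, p), (j, p), sgn (f' j p - f' i p), chord_type (crossings K) (of_strand i p, of_strand j p)) \<in> ?Q"
          unfolding graph_picture_def using ij pq
          by (intro CollectI exI[of _ i] exI[of _ j] exI[of _ p] conjI refl)
        then have "chord_of ((i, p), (j, p), sgn (f' j p - f' i p), chord_type (crossings K) (of_strand i p, of_strand j p)) \<in> chord_of ` ?Q"
          by (rule imageI)
        then show ?thesis using dd pq by (simp add: chord_of_def)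
      qed simp
    qed
  qed
  moreover have "i < n \<and> j < n \<and> p \<in> {-1<..<1} \<and> q \<in> {-1<..<1} \<and> \<bar>s\<bar> = 1 \<and>
        crossing_sign K (of_strand i p, of_strand j q) = s * \<epsilon> i * \<epsilon> j \<and>
        chord_type (crossings K) (of_strand i p, of_strand j q) = t"
    if "((i, p), (j, q), s, t) \<in> ?Q" for i p j q s t
  proof -
    have q: "i < n" "j < n" "h j < h i" "p \<in> {-1..1}" "f i p = f j p" "q = p" "s = sgn (f' j p - f' i p)"
      "t = chord_type (crossings K) (of_strand i p, of_strand j p)"
      using that by (auto simp: graph_picture_def)
    have p: "p \<in> {-1<..<1}" by (rule ends[OF q(1-5)])
    have D: "((\<lambda>u. Complex u (f l u)) has_vector_derivative Complex 1 (f' l p)) (at p)" if "l < n" for l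
    proof -
      have "((\<lambda>u. complex_of_real u + \<i> * complex_of_real (f l u)) has_vector_derivative
          (of_real 1 + \<i> * of_real (f' l p))) (at p)"
        using f'[OF that, of p]
        by (intro has_vector_derivative_add has_vector_derivative_mult_right has_vector_derivative_of_real)
           (auto intro!: derivative_eq_intros)
      then show ?thesis by (simp add: Complex_eq)
    qed
    have r: "0 < 2 / (b i - a i)" "0 < 2 / (b j - a j)" using ab[OF q(1)] ab[OF q(2)] by auto
    have det: "det2 (c *\<^sub>R Complex 1 \<alpha>) (d *\<^sub>R Complex 1 \<beta>) = c * (d * (\<beta> - \<alpha>))" for c d \<alpha> \<beta>
      by (simp add: det2_def algebra_simps)
    have sgn_scale: "sgn (\<epsilon> l * 2 / (b l - a l)) = \<epsilon> l" if "l < n" for l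
      using eps[OF that] ab[OF that] by auto
    have "crossing_sign K (of_strand i p, of_strand j p) =
        sgn ((\<epsilon> i * 2 / (b i - a i)) * ((\<epsilon> j * 2 / (b j - a j)) * (f' j p - f' i p)))"
      by (simp only: crossing_sign_def prod.case det
          picture_velocity[OF P q(1) p D[OF q(1)]] picture_velocity[OF P q(2) p D[OF q(2)]])
    also have "\<dots> = \<epsilon> i * (\<epsilon> j * sgn (f' j p - f' i p))"
      by (simp only: sgn_mult sgn_scale[OF q(1)] sgn_scale[OF q(2)])
    finally have sg: "crossing_sign K (of_strand i p, of_strand j p) = s * \<epsilon> i * \<epsilon> j"
      using q(7) by (simp add: mult_ac)
    have "\<bar>crossing_sign K (of_strand i p, of_strand j p)\<bar> = 1"
      using crossing_sign[OF K cross[OF q(1-5)]] by simp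
    then have "\<bar>s\<bar> = 1" using sg eps_abs[OF q(1)] eps_abs[OF q(2)] by (simp add: abs_mult)
    then show ?thesis using q p sg by simp
  qed
  then have "\<forall>((i, p), (j, q), s, t)\<in>?Q. i < n \<and> j < n \<and> p \<in> {-1<..<1} \<and> q \<in> {-1<..<1} \<and> \<bar>s\<bar> = 1 \<and>
        crossing_sign K (of_strand i p, of_strand j q) = s * \<epsilon> i * \<epsilon> j \<and>
        chord_type (crossings K) (of_strand i p, of_strand j q) = t"
    by (intro ballI) (simp only: split_paired_all prod.case)
  moreover have "\<forall>d\<in>outer K. fst d \<notin> region \<and> snd d \<notin> region \<and> fst d \<in> {0..<1} \<and> snd d \<in> {0..<1}"
    using outer_props by blast
  ultimately show ?thesis unfolding split_chords_def by (intro conjI)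
qed

lemma parallel_chords_outer:
  assumes K: "virtual_knot_diagram K" and ij: "i < n" "j < n" "i \<noteq> j" and u: "-1 \<le> u" "u \<le> 1" "-1 \<le> v" "v \<le> 1" "u \<noteq> v"
  shows "parallel_chords (outer K) (of_strand i u, of_strand j u) (of_strand i v, of_strand j v)"
proof -
  have in_s: "of_strand i u \<in> {a i..b i}" "of_strand j u \<in> {a j..b j}" "of_strand i v \<in> {a i..b i}" "of_strand j v \<in> {a j..b j}"
    using of_strand_in ij u by auto
  have reg: "of_strand i u \<in> region" "of_strand i v \<in> region" using of_strand_region ij u by auto
  have ne: "of_strand i x \<noteq> of_strand j y" if "x \<in> {u, v}" "y \<in> {u, v}" for x y
    using strand_unique[OF ij(1,2), of "of_strand i x"] in_s that ij(3) by auto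
  have ne': "of_strand i u \<noteq> of_strand i v" "of_strand j u \<noteq> of_strand j v"
    using of_strand_eq_iff ij u(5) by auto
  have "finite (outer K)" using chord_set_crossings[OF K] by (simp add: outer_def chord_set_def)
  moreover have "(of_strand i u, of_strand j u) \<notin> outer K" "(of_strand i v, of_strand j v) \<notin> outer K"
    using outer_props reg by fastforce+
  moreover have "chords_intersect (of_strand i u, of_strand j u) (of_strand i v, of_strand j v) =
      chords_intersect (of_strand i v, of_strand j v) (of_strand i u, of_strand j u)"
    using ne[of u v] ne[of v u] ne[of u u] ne[of v v] ne' by (intro chords_intersect_commute) auto
  moreover have "chords_intersect d (of_strand i u, of_strand j u) = chords_intersect d (of_strand i v, of_strand j v) \<and>
      chords_intersect (of_strand i u, of_strand j u) d = chords_intersect (of_strand i v, of_strand j v) d"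
    if "d \<in> outer K" for d
    using outer_props[OF that] outer_intersects[OF _ _ ij(1) in_s(1) ij(2) in_s(2), of d]
      outer_intersects[OF _ _ ij(1) in_s(3) ij(2) in_s(4), of d]
      outer_intersects'[OF _ _ _ ij(1) in_s(1) ij(2) in_s(2) ne[of u u], of d]
      outer_intersects'[OF _ _ _ ij(1) in_s(3) ij(2) in_s(4) ne[of v v], of d] by simp
  ultimately show ?thesis unfolding parallel_chords_def using ne' by auto
qed

lemma isolated_chord_outer:
  assumes K: "virtual_knot_diagram K" and i: "i < n" and u: "u \<in> {-1..1}" "v \<in> {-1..1}" "u \<noteq> v"
  shows "isolated_chord (outer K) (of_strand i u, of_strand i v)"
proof -
  have in_s: "of_strand i u \<in> {a i..b i}" "of_strand i v \<in> {a i..b i}" using of_strand_in i u by auto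
  have ne: "of_strand i u \<noteq> of_strand i v" using of_strand_eq_iff i u(3) by auto
  have "finite (outer K)" using chord_set_crossings[OF K] by (simp add: outer_def chord_set_def)
  moreover have "(of_strand i u, of_strand i v) \<notin> outer K"
    using outer_props of_strand_region[OF i u(1)] by fastforce
  moreover have "\<not> chords_intersect d (of_strand i u, of_strand i v) \<and> \<not> chords_intersect (of_strand i u, of_strand i v) d"
    if "d \<in> outer K" for d
    using outer_props[OF that] outer_intersects[OF _ _ i in_s(1) i in_s(2), of d]
      outer_intersects'[OF _ _ _ i in_s(1) i in_s(2) ne, of d] by simp
  ultimately show ?thesis unfolding isolated_chord_def by blast
qed

text \<open>A chord outside meets the chord between two strands iff it separates them, and of three
  separations the third is the exclusive disjunction of the other two. The reversed orders of the
  parameters along each strand toggle the intersections inside the triangle.\<close>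

lemma triangle_chords_outer:
  assumes K: "virtual_knot_diagram K" and TNB: "T < n" "N < n" "B < n" "T \<noteq> N" "T \<noteq> B" "N \<noteq> B"
    and C: "{x, y, z, x', y', z'} \<subseteq> {-1..1}" and ne: "x \<noteq> y" "x \<noteq> z" "y \<noteq> z" "x' \<noteq> y'" "x' \<noteq> z'" "y' \<noteq> z'"
    and ord: "x < y \<longleftrightarrow> y' < x'" "x < z \<longleftrightarrow> z' < x'" "y < z \<longleftrightarrow> z' < y'"
  shows "triangle_chords (outer K)
    ((of_strand T x, of_strand N x), (of_strand T y, of_strand B y), (of_strand N z, of_strand B z))
    ((of_strand T x', of_strand N x'), (of_strand T y', of_strand B y'), (of_strand N z', of_strand B z'))"
proof -
  let ?s = of_strand
  have s: "?s T u \<in> {a T..b T}" "?s N u \<in> {a N..b N}" "?s B u \<in> {a B..b B}" if "u \<in> {x, y, z, x', y', z'}" for u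
    using of_strand_in TNB C that by blast+
  have r: "?s T u \<in> region" "?s N u \<in> region" if "u \<in> {x, y, z, x', y', z'}" for u
    using of_strand_region TNB C that by blast+
  have neq: "?s T u \<noteq> ?s N v" "?s T u \<noteq> ?s B v" "?s N u \<noteq> ?s B v"
    if "u \<in> {x, y, z, x', y', z'}" "v \<in> {x, y, z, x', y', z'}" for u v
    using strand_unique[OF TNB(1,2) s(1)[OF that(1)]] strand_unique[OF TNB(1,3) s(1)[OF that(1)]]
      strand_unique[OF TNB(2,3) s(2)[OF that(1)]] s(2,3)[OF that(2)] TNB by metis+
  have eqs: "?s T u = ?s T v \<longleftrightarrow> u = v" "?s N u = ?s N v \<longleftrightarrow> u = v" "?s B u = ?s B v \<longleftrightarrow> u = v" for u v
    using of_strand_eq_iff TNB by auto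
  have less: "?s l u < ?s l v \<longleftrightarrow> ?s l v' < ?s l u'" if "l < n" "u < v \<longleftrightarrow> v' < u'" "u \<noteq> v" "u' \<noteq> v'" for l u v u' v'
    using of_strand_less_iff[OF that(1)] that by auto
  have fin: "finite (outer K)" using chord_set_crossings[OF K] by (simp add: outer_def chord_set_def)
  have nm: "(p, q) \<notin> outer K" if "p \<in> region" for p q
    using outer_props[of "(p, q)" K] that by auto
  have nin: "{(?s T x, ?s N x), (?s T y, ?s B y), (?s N z, ?s B z), (?s T x', ?s N x'), (?s T y', ?s B y'), (?s N z', ?s B z')} \<inter> outer K = {}"
    by (simp add: nm r)
  have dst: "distinct [(?s T x, ?s N x), (?s T y, ?s B y), (?s N z, ?s B z)]"
    "distinct [(?s T x', ?s N x'), (?s T y', ?s B y'), (?s N z', ?s B z')]"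
    by (simp_all add: neq eqs ne)
  have per: "(chords_intersect d (?s T u, ?s N u) = (separates d T \<noteq> separates d N)) \<and>
      (chords_intersect (?s T u, ?s N u) d = (separates d T \<noteq> separates d N)) \<and>
      (chords_intersect d (?s T u, ?s B u) = (separates d T \<noteq> separates d B)) \<and>
      (chords_intersect (?s T u, ?s B u) d = (separates d T \<noteq> separates d B)) \<and>
      (chords_intersect d (?s N u, ?s B u) = (separates d N \<noteq> separates d B)) \<and>
      (chords_intersect (?s N u, ?s B u) d = (separates d N \<noteq> separates d B))"
    if d: "d \<in> outer K" and u: "u \<in> {x, y, z, x', y', z'}" for d u
  proof -
    have o: "fst d \<notin> region" "snd d \<notin> region" "fst d \<noteq> snd d" using outer_props[OF d] by auto
    show ?thesis
      by (intro conjI outer_intersects[OF o(1,2)] outer_intersects'[OF o] TNB s[OF u] neq[OF u u])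
  qed
  have com:
    "chords_intersect (?s T x, ?s N x) (?s T y, ?s B y) = chords_intersect (?s T y, ?s B y) (?s T x, ?s N x)"
    "chords_intersect (?s T x, ?s N x) (?s N z, ?s B z) = chords_intersect (?s N z, ?s B z) (?s T x, ?s N x)"
    "chords_intersect (?s T y, ?s B y) (?s N z, ?s B z) = chords_intersect (?s N z, ?s B z) (?s T y, ?s B y)"
    "chords_intersect (?s T x', ?s N x') (?s T y', ?s B y') = chords_intersect (?s T y', ?s B y') (?s T x', ?s N x')"
    "chords_intersect (?s T x', ?s N x') (?s N z', ?s B z') = chords_intersect (?s N z', ?s B z') (?s T x', ?s N x')"
    "chords_intersect (?s T y', ?s B y') (?s N z', ?s B z') = chords_intersect (?s N z', ?s B z') (?s T y', ?s B y')"
    by (rule chords_intersect_commute; simp add: neq neq[THEN not_sym] eqs ne ne[THEN not_sym])+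
  have tog1: "chords_intersect (?s T x', ?s N x') (?s T y', ?s B y') = (\<not> chords_intersect (?s T x, ?s N x) (?s T y, ?s B y))"
    by (rule intersects_toggle[OF TNB _ _ _ less[OF TNB(1) ord(1) ne(1,4)]])
       ((intro insert_subsetI empty_subsetI s; simp), (intro insert_subsetI empty_subsetI s; simp),
        (intro insert_subsetI empty_subsetI s; simp), simp_all add: eqs ne)
  \<comment> \<open>The chords are rewritten so that their common strand comes first, here the
    middle one and below the bottom one.\<close>
  have "chords_intersect (?s N x', ?s T x') (?s N z', ?s B z') = (\<not> chords_intersect (?s N x, ?s T x) (?s N z, ?s B z))"
    by (rule intersects_toggle[OF TNB(2,1,3) TNB(4)[symmetric] TNB(6,5) _ _ _ less[OF TNB(2) ord(2) ne(2,5)]])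
       ((intro insert_subsetI empty_subsetI s; simp), (intro insert_subsetI empty_subsetI s; simp),
        (intro insert_subsetI empty_subsetI s; simp), simp_all add: eqs ne)
  then have tog2: "chords_intersect (?s T x', ?s N x') (?s N z', ?s B z') = (\<not> chords_intersect (?s T x, ?s N x) (?s N z, ?s B z))"
    by (simp only: chords_intersect_swap(1)[of "?s N x'" "?s T x'"] chords_intersect_swap(1)[of "?s N x" "?s T x"])
  have "chords_intersect (?s B y', ?s T y') (?s B z', ?s N z') = (\<not> chords_intersect (?s B y, ?s T y) (?s B z, ?s N z))"
    by (rule intersects_toggle[OF TNB(3,1,2) TNB(5)[symmetric] TNB(6)[symmetric] TNB(4) _ _ _ less[OF TNB(3) ord(3) ne(3,6)]])
       ((intro insert_subsetI empty_subsetI s; simp), (intro insert_subsetI empty_subsetI s; simp),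
        (intro insert_subsetI empty_subsetI s; simp), simp_all add: eqs ne)
  then have tog3: "chords_intersect (?s T y', ?s B y') (?s N z', ?s B z') = (\<not> chords_intersect (?s T y, ?s B y) (?s N z, ?s B z))"
    by (simp only: chords_intersect_swap(1)[of "?s B y'" "?s T y'"] chords_intersect_swap(1)[of "?s B y" "?s T y"]
        chords_intersect_swap(2)[of _ "?s B z'" "?s N z'"] chords_intersect_swap(2)[of _ "?s B z" "?s N z"])
  have tog': "chords_intersect (?s T y', ?s B y') (?s T x', ?s N x') = (\<not> chords_intersect (?s T y, ?s B y) (?s T x, ?s N x))"
    "chords_intersect (?s N z', ?s B z') (?s T x', ?s N x') = (\<not> chords_intersect (?s N z, ?s B z) (?s T x, ?s N x))"
    "chords_intersect (?s N z', ?s B z') (?s T y', ?s B y') = (\<not> chords_intersect (?s N z, ?s B z) (?s T y, ?s B y))"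
    unfolding com(1-3)[symmetric] com(4-6)[symmetric] by (rule tog1 tog2 tog3)+
  have out: "\<forall>d\<in>outer K.
       (chords_intersect d (?s T x, ?s N x) = chords_intersect d (?s T x', ?s N x')) \<and>
       (chords_intersect d (?s T y, ?s B y) = chords_intersect d (?s T y', ?s B y')) \<and>
       (chords_intersect d (?s N z, ?s B z) = chords_intersect d (?s N z', ?s B z')) \<and>
       (chords_intersect (?s T x, ?s N x) d = chords_intersect (?s T x', ?s N x') d) \<and>
       (chords_intersect (?s T y, ?s B y) d = chords_intersect (?s T y', ?s B y') d) \<and>
       (chords_intersect (?s N z, ?s B z) d = chords_intersect (?s N z', ?s B z') d) \<and>
       (chords_intersect (?s N z, ?s B z) d = (chords_intersect (?s T x, ?s N x) d \<noteq> chords_intersect (?s T y, ?s B y) d))"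
  proof
    fix d assume d: "d \<in> outer K"
    have mem: "x \<in> {x, y, z, x', y', z'}" "y \<in> {x, y, z, x', y', z'}" "z \<in> {x, y, z, x', y', z'}"
      "x' \<in> {x, y, z, x', y', z'}" "y' \<in> {x, y, z, x', y', z'}" "z' \<in> {x, y, z, x', y', z'}" by simp_all
    note p = per[OF d mem(1)] per[OF d mem(2)] per[OF d mem(3)] per[OF d mem(4)] per[OF d mem(5)] per[OF d mem(6)]
    show "(chords_intersect d (?s T x, ?s N x) = chords_intersect d (?s T x', ?s N x')) \<and>
       (chords_intersect d (?s T y, ?s B y) = chords_intersect d (?s T y', ?s B y')) \<and>
       (chords_intersect d (?s N z, ?s B z) = chords_intersect d (?s N z', ?s B z')) \<and>
       (chords_intersect (?s T x, ?s N x) d = chords_intersect (?s T x', ?s N x') d) \<and>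
       (chords_intersect (?s T y, ?s B y) d = chords_intersect (?s T y', ?s B y') d) \<and>
       (chords_intersect (?s N z, ?s B z) d = chords_intersect (?s N z', ?s B z') d) \<and>
       (chords_intersect (?s N z, ?s B z) d = (chords_intersect (?s T x, ?s N x) d \<noteq> chords_intersect (?s T y, ?s B y) d))"
      by (simp only: p) blast
  qed
  show ?thesis
    unfolding triangle_chords_def prod.case
    by (intro conjI fin nin dst out com(1-3) tog1 tog2 tog3 tog')
qed

end

lemma local_move_strands:
  assumes "local_move n m m' K K'"
  obtains a b \<epsilon> h where "strands n a b \<epsilon>" "inj_on h {..<n}" "has_picture n m a b \<epsilon> h K" "has_picture n m' a b \<epsilon> h K'"
    "\<And>x. x \<in> {0..1} - strands.region n a b \<Longrightarrow> curve K' x = curve K x \<and> (x \<in> over K' \<longleftrightarrow> x \<in> over K)"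
proof -
  from assms obtain a b \<epsilon> h where L: "\<forall>i<n. 0 < a i \<and> a i < b i \<and> b i < 1"
      "disjoint_family_on (\<lambda>i. {a i..b i}) {..<n}" "\<forall>i<n. \<epsilon> i = 1 \<or> \<epsilon> i = -1"
      "inj_on h {..<n}" "has_picture n m a b \<epsilon> h K" "has_picture n m' a b \<epsilon> h K'"
      "\<forall>x\<in>{0..1} - (\<Union>i<n. {a i..b i}). curve K' x = curve K x \<and> (x \<in> over K' \<longleftrightarrow> x \<in> over K)"
    unfolding local_move_def by - (elim exE conjE, rule that)
  have st: "strands n a b \<epsilon>" using L(1-3) by unfold_locales auto
  show ?thesis
    by (rule that[OF st L(4-6)]) (use L(7) in \<open>simp only: strands.region_def[OF st]\<close>)
qed

subsection \<open>The function \<open>bump\<close>\<close>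

lemma bump_range: "u \<in> {-1..1} \<Longrightarrow> 0 \<le> bump u \<and> bump u \<le> 1"
  and bump_eq_imp: "u \<in> {-1..1} \<Longrightarrow> v \<in> {-1..1} \<Longrightarrow> bump u = bump v \<Longrightarrow> \<bar>u\<bar> = \<bar>v\<bar>"
proof -
  have sq: "0 \<le> 1 - u\<^sup>2 \<and> 1 - u\<^sup>2 \<le> 1" if "u \<in> {-1..1}" for u :: real
    using that abs_square_le_1[of u] by (auto simp: abs_le_iff)
  show "0 \<le> bump u \<and> bump u \<le> 1" if "u \<in> {-1..1}"
    using sq[OF that] by (simp add: bump_def power_le_one)
  show "\<bar>u\<bar> = \<bar>v\<bar>" if "u \<in> {-1..1}" "v \<in> {-1..1}" "bump u = bump v"
  proof -
    have "1 - u\<^sup>2 = 1 - v\<^sup>2"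
      using that(3) sq[OF that(1)] sq[OF that(2)] unfolding bump_def by (simp add: power2_eq_iff_nonneg)
    then show ?thesis by (simp add: power2_eq_iff abs_eq_iff)
  qed
qed

lemma bump_minus [simp]: "bump (- u) = bump u"
  by (simp add: bump_def)

lemma bump_deriv: "(bump has_real_derivative - (4 * u * (1 - u\<^sup>2))) (at u)"
  unfolding bump_def[abs_def] by (auto intro!: derivative_eq_intros simp: algebra_simps)

lemma bump_half:
  obtains u0 where "0 < u0" "u0 < 1" "\<And>u. u \<in> {-1..1} \<Longrightarrow> bump u = 1 / 2 \<longleftrightarrow> \<bar>u\<bar> = u0"
proof -
  have "continuous_on {0..1} bump" unfolding bump_def[abs_def] by (intro continuous_intros)
  then obtain u0 where u0: "0 \<le> u0" "u0 \<le> 1" "bump u0 = 1 / 2"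
    using IVT2'[of bump 1 "1 / 2" 0] by (auto simp: bump_def)
  have "u0 \<noteq> 0" "u0 \<noteq> 1" using u0(3) by (auto simp: bump_def)
  moreover have "bump u = 1 / 2 \<longleftrightarrow> \<bar>u\<bar> = u0" if "u \<in> {-1..1}" for u
  proof
    assume "bump u = 1 / 2"
    then show "\<bar>u\<bar> = u0" using bump_eq_imp[OF that, of u0] u0 by simp
  next
    assume "\<bar>u\<bar> = u0"
    then have "u = u0 \<or> u = - u0" by auto
    then show "bump u = 1 / 2" using u0(3) by auto
  qed
  ultimately show ?thesis using that[of u0] u0 by simp
qed

subsection \<open>First move\<close>

lemma isomorphic_reidemeister1:
  assumes K: "virtual_knot_diagram K" and K': "virtual_knot_diagram K'" and R: "reidemeister1 K K'"
  shows "module_isomorphic coeff_ring (knot_module K) (knot_module K')"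
proof -
  obtain \<eta> :: real where \<eta>: "\<eta> = 1 \<or> \<eta> = -1" and L: "local_move 1 (\<lambda>_ u. Complex u 0)
      (\<lambda>_ u. Complex (u * (1 - 2 * bump u)) (\<eta> * bump u)) K K'"
    using R unfolding reidemeister1_def by blast
  let ?m = "\<lambda>(i::nat) u. Complex (u * (1 - 2 * bump u)) (\<eta> * bump u)"
  from L obtain a b \<epsilon> h where st: "strands 1 a b \<epsilon>" and h: "inj_on h {..<1}"
    and P: "has_picture 1 (\<lambda>_ u. Complex u 0) a b \<epsilon> h K" and P': "has_picture 1 ?m a b \<epsilon> h K'"
    and agree: "\<And>x. x \<in> {0..1} - strands.region 1 a b \<Longrightarrow> curve K' x = curve K x \<and> (x \<in> over K' \<longleftrightarrow> x \<in> over K)"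
    by (rule local_move_strands) blast
  interpret strands 1 a b \<epsilon> by (rule st)
  have out1: "outer K' = outer K" by (rule local_move_outer(1)[OF K K']) (rule agree)
  have out2: "crossing_sign K' d = crossing_sign K d" if "d \<in> outer K" for d
    by (rule local_move_outer(2)[OF K K' _ that]) (rule agree)
  \<comment> \<open>A segment is a single graph, so before the move the picture has no crossing and
    all crossings lie outside.\<close>
  have "split_chords (crossings K) (outer K) (graph_picture (\<lambda>_ _. 0) (\<lambda>_ _. 0) h K) (crossing_sign K)"
    by (rule graph_split[OF K _ _ _ _ h]) (use P in auto)
  moreover have "graph_picture (\<lambda>_ _. 0) (\<lambda>_ _. 0) h K = {}"
    unfolding graph_picture_def by auto
  ultimately have S: "split_chords (crossings K) (outer K) {} (crossing_sign K)" by simp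
  have X: "crossings K = outer K" using split_chordsD(1)[OF S] by simp
  obtain u0 where u0: "0 < u0" "u0 < 1" and half: "\<And>u. u \<in> {-1..1} \<Longrightarrow> bump u = 1 / 2 \<longleftrightarrow> \<bar>u\<bar> = u0"
    using bump_half by blast
  have sq: "?m i u \<in> square" if "u \<in> {-1..1}" for i u
  proof -
    have "\<bar>u\<bar> * \<bar>1 - 2 * bump u\<bar> \<le> 1 * 1"
      using bump_range[OF that] that by (intro mult_mono) (auto simp: abs_le_iff)
    then show ?thesis using bump_range[OF that] \<eta> by (auto simp: square_def abs_mult)
  qed
  have in_r: "u0 \<in> {-1..1}" "- u0 \<in> {-1..1}" using u0 by auto
  have b0: "bump u0 = 1 / 2" using half[OF in_r(1)] u0 by simp
  have lt: "(0::nat) < 1" by simp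
  let ?s = "of_strand 0"
  have s_in: "?s u0 \<in> {a 0..b 0}" "?s (- u0) \<in> {a 0..b 0}"
    using of_strand_in[OF lt] in_r by blast+
  have s01: "0 < ?s u0" "?s u0 < 1" "0 < ?s (- u0)" "?s (- u0) < 1"
    using strand_sub[OF lt s_in(1)] strand_sub[OF lt s_in(2)] by auto
  have "?s u0 \<noteq> ?s (- u0)" using of_strand_eq_iff[OF lt] u0 by auto
  then have "?s u0 - ?s (- u0) \<notin> \<int>" using diff_Ints_imp_eq[of "?s u0" "?s (- u0)"] s01 by auto
  moreover have "curve K' (?s u0) = curve K' (?s (- u0))"
    using picture_curve[OF P' lt in_r(1)] picture_curve[OF P' lt in_r(2)] b0 by simp
  ultimately have dp: "double_point K' (?s u0) (?s (- u0))" by (simp add: double_point_def)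
  \<comment> \<open>\<open>p\<close> is whichever of the two parameters is the overpass, so
    \<open>- p\<close> is the underpass and both kinds of curl are covered.\<close>
  obtain p where p: "p = u0 \<or> p = - u0" "?s p \<in> over K'"
    using has_pictureD(3)[OF P' lt lt s_in dp] by auto
  have dp': "double_point K' (?s p) (?s (- p))" using p(1) dp double_point_sym[OF dp] by auto
  have not_over: "?s (- p) \<notin> over K'" using virtual_knot_diagramD(8)[OF K' dp'] p(2) by blast
  let ?c = "(?s p, ?s (- p))"
  have c: "?c \<in> crossings K'" using dp' p s01 by (auto simp: crossings_def)
  have X': "crossings K' = insert ?c (outer K)"
  proof
    have "outer K' \<subseteq> crossings K'" unfolding outer_def by blast
    then show "insert ?c (outer K) \<subseteq> crossings K'" using c unfolding out1 by blast
    show "crossings K' \<subseteq> insert ?c (outer K)"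
    proof
      fix d assume d: "d \<in> crossings K'"
      show "d \<in> insert ?c (outer K)"
      proof (cases "d \<in> outer K'")
        case False
        obtain i x j y where ij: "i < (1::nat)" "j < (1::nat)" "x \<in> {-1..1}" "y \<in> {-1..1}"
          and dd: "d = (of_strand i x, of_strand j y)" "?m i x = ?m j y" "(i, x) \<noteq> (j, y)"
          by (rule crossing_strands[OF P' sq d False]) auto
        have m: "x * (1 - 2 * bump x) = y * (1 - 2 * bump y)" "bump x = bump y" "x \<noteq> y"
          using dd(2,3) ij(1,2) \<eta> by auto
        \<comment> \<open>Equal heights give parameters with equal absolute values. Equal abscissas
          then force the odd function \<open>x * (1 - 2 * bump x)\<close> to vanish, and since
          \<open>x\<close> is not 0 this leaves \<open>bump x = 1 / 2\<close>.\<close>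
        have "y = - x" using bump_eq_imp[OF ij(3,4) m(2)] m(3) by (auto simp: abs_eq_iff)
        have "x * (1 - 2 * bump x) = 0" using m(1) unfolding \<open>y = - x\<close> bump_minus by simp
        moreover have "x \<noteq> 0" using m(3) \<open>y = - x\<close> by auto
        ultimately have "bump x = 1 / 2" by simp
        then have "\<bar>x\<bar> = u0" using half[OF ij(3)] by blast
        then have "x = p \<or> x = - p" using p(1) by auto
        moreover have "?s x \<in> over K'" using d dd(1) ij by (simp add: crossings_def)
        ultimately have "x = p" using not_over by auto
        then show ?thesis using dd(1) ij \<open>y = - x\<close> by simp
      qed (use out1 in simp)
    qed
  qed
  have p_in: "p \<in> {-1..1}" "- p \<in> {-1..1}" "p \<noteq> - p" using p(1) u0 by auto
  have iso: "isolated_chord (outer K) ?c" by (rule isolated_chord_outer[OF K lt p_in])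
  \<comment> \<open>Both passages belong to strand 0, so its direction enters the sign twice and
    cancels.\<close>
  let ?Q = "{((0::nat, p), (0::nat, - p), crossing_sign K' ?c, 2::nat)}"
  have abs: "\<bar>crossing_sign K' ?c\<bar> = 1" using crossing_sign[OF K' c] by simp
  have S': "split_chords (crossings K') (outer K) ?Q (crossing_sign K')"
    unfolding split_chords_def
  proof (intro conjI)
    show "crossings K' = outer K \<union> chord_of ` ?Q" by (simp add: X' chord_of_def)
    show "\<forall>d\<in>outer K. fst d \<notin> region \<and> snd d \<notin> region \<and> fst d \<in> {0..<1} \<and> snd d \<in> {0..<1}"
      using outer_props by blast
    show "\<forall>((i, p), (j, q), s, t)\<in>?Q. i < 1 \<and> j < 1 \<and> p \<in> {-1<..<1} \<and> q \<in> {-1<..<1} \<and> \<bar>s\<bar> = 1 \<and>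
        crossing_sign K' (of_strand i p, of_strand j q) = s * \<epsilon> i * \<epsilon> j \<and>
        chord_type (crossings K') (of_strand i p, of_strand j q) = t"
      using p(1) u0 abs eps_sq[OF lt] isolated_chord_type(1)[OF iso] by (auto simp: X' mult.assoc)
  qed
  show ?thesis
  proof (rule isomorphic_if_pictures_equivalent[OF K K' S S'])
    fix d assume d: "d \<in> outer K"
    show "chord_type (crossings K') d = chord_type (crossings K) d \<and> crossing_sign K' d = crossing_sign K d"
      using isolated_chord_type(2)[OF iso d] out2[OF d] by (simp add: X X')
  next
    fix M :: "(laurent set, (real set \<Rightarrow> laurent set) set) module" assume M: "coeff_module M"
    have pu: "\<bar>p\<bar> = u0" using p(1) u0 by auto
    from coeff_module.curl_picture[where \<epsilon> = \<epsilon>, OF M pu u0 abs eps_abs[OF lt]]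
    show "picture_extends M 1 \<epsilon> {} ?Q \<and> picture_extends M 1 \<epsilon> ?Q {} \<and> picture_rigid M 1 \<epsilon> {} \<and> picture_rigid M 1 \<epsilon> ?Q"
      using picture_rigid_empty by blast
  qed
qed

subsection \<open>Second move\<close>

lemma isomorphic_reidemeister2:
  assumes K: "virtual_knot_diagram K" and K': "virtual_knot_diagram K'" and R: "reidemeister2 K K'"
  shows "module_isomorphic coeff_ring (knot_module K) (knot_module K')"
proof -
  define f :: "nat \<Rightarrow> real \<Rightarrow> real" where "f i u = (if i = 0 then 0 else 1 / 2)" for i u
  define g where "g i u = (if i = 0 then 0 else 1 / 2 - bump u)" for i :: nat and u
  define g' where "g' i u = (if i = 0 then 0 else 4 * u * (1 - u\<^sup>2))" for i :: nat and u :: real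
  have fg: "(\<lambda>i u. if i = 0 then Complex u 0 else Complex u (1 / 2)) = (\<lambda>i u. Complex u (f i u))"
    "(\<lambda>i u. if i = 0 then Complex u 0 else Complex u (1 / 2 - bump u)) = (\<lambda>i u. Complex u (g i u))"
    by (auto simp: f_def g_def fun_eq_iff)
  from R[unfolded reidemeister2_def fg] obtain a b \<epsilon> h where st: "strands 2 a b \<epsilon>" and h: "inj_on h {..<2}"
    and P: "has_picture 2 (\<lambda>i u. Complex u (f i u)) a b \<epsilon> h K" and P': "has_picture 2 (\<lambda>i u. Complex u (g i u)) a b \<epsilon> h K'"
    and agree: "\<And>x. x \<in> {0..1} - strands.region 2 a b \<Longrightarrow> curve K' x = curve K x \<and> (x \<in> over K' \<longleftrightarrow> x \<in> over K)"
    by (rule local_move_strands) blast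
  interpret strands 2 a b \<epsilon> by (rule st)
  have out1: "outer K' = outer K" by (rule local_move_outer(1)[OF K K']) (rule agree)
  have out2: "crossing_sign K' d = crossing_sign K d" if "d \<in> outer K" for d
    by (rule local_move_outer(2)[OF K K' _ that]) (rule agree)
  obtain u0 where u0: "0 < u0" "u0 < 1" and half: "\<And>u. u \<in> {-1..1} \<Longrightarrow> bump u = 1 / 2 \<longleftrightarrow> \<bar>u\<bar> = u0"
    using bump_half by blast
  have "h 0 \<noteq> h 1" using inj_onD[OF h, of 0 1] by auto
  then consider "h 0 < h 1" | "h 1 < h 0" by linarith
  then obtain i j :: nat where ij: "i < 2" "j < 2" "i \<noteq> j" "h j < h i"
  proof cases
    case 1
    show ?thesis by (rule that[of 1 0]) (use 1 in simp_all)
  next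
    case 2
    show ?thesis by (rule that[of 0 1]) (use 2 in simp_all)
  qed
  have pairs: "l = i \<and> l' = j" if "l < 2" "l' < 2" "h l' < h l" for l l'
  proof -
    have "l \<noteq> l'" using that(3) by auto
    then have "(l = i \<and> l' = j) \<or> (l = j \<and> l' = i)" using that(1,2) ij(1-3) by linarith
    then show ?thesis using that(3) ij(4) by auto
  qed
  have f_eq: "f i u \<noteq> f j u" for u using ij(1-3) by (auto simp: f_def)
  have S: "split_chords (crossings K) (outer K) {} (crossing_sign K)"
  proof -
    have "graph_picture f (\<lambda>_ _. 0) h K = {}"
      using pairs f_eq by (fastforce simp: graph_picture_def)
    moreover have "split_chords (crossings K) (outer K) (graph_picture f (\<lambda>_ _. 0) h K) (crossing_sign K)"
    proof (rule graph_split[OF K P _ _ _ h])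
      show "\<bar>f l u\<bar> \<le> 1" for l u by (simp add: f_def)
      show "(f l has_real_derivative 0) (at u)" for l u
        unfolding f_def[abs_def] by (cases "l = 0") simp_all
      show "p \<in> {-1<..<1}" if "l < 2" "l' < 2" "h l' < h l" "f l p = f l' p" for l l' p
        using pairs[OF that(1-3)] that(4) f_eq by auto
    qed
    ultimately show ?thesis by simp
  qed
  have X: "crossings K = outer K" using split_chordsD(1)[OF S] by simp
  have g_eq: "g i u = g j u \<longleftrightarrow> \<bar>u\<bar> = u0" if "u \<in> {-1..1}" for u
    using ij(1-3) half[OF that] by (auto simp: g_def)
  let ?c = "\<lambda>u. (of_strand i u, of_strand j u)"
  let ?t = "chord_type (crossings K')"
  define s where "s = sgn (g' j u0 - g' i u0)"
  \<comment> \<open>The slopes at \<open>u0\<close> and \<open>- u0\<close> are opposite, hence so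
    are the signs of the two crossings.\<close>
  have odd: "g' l (- u) = - g' l u" for l u by (simp add: g'_def)
  have s_minus: "sgn (g' j (- u0) - g' i (- u0)) = - s"
    unfolding odd s_def by (metis minus_diff_eq minus_diff_minus sgn_minus)
  have "4 * u0 * (1 - u0\<^sup>2) > 0" using u0 by (simp add: power_less_one_iff abs_square_less_1)
  then have s: "\<bar>s\<bar> = 1" using ij(1-3) by (auto simp: s_def g'_def)
  have G: "graph_picture g g' h K' = {((i, u0), (j, u0), s, ?t (?c u0)), ((i, - u0), (j, - u0), - s, ?t (?c (- u0)))}"
  proof -
    have mem: "x \<in> graph_picture g g' h K' \<longleftrightarrow> (\<exists>p\<in>{-1..1}. \<bar>p\<bar> = u0 \<and> x = ((i, p), (j, p), sgn (g' j p - g' i p), ?t (?c p)))" for x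
    proof
      assume "x \<in> graph_picture g g' h K'"
      then obtain l l' p where lp: "x = ((l, p), (l', p), sgn (g' l' p - g' l p), ?t (of_strand l p, of_strand l' p))"
        "l < 2" "l' < 2" "h l' < h l" "p \<in> {-1..1}" "g l p = g l' p" unfolding graph_picture_def by blast
      then show "\<exists>p\<in>{-1..1}. \<bar>p\<bar> = u0 \<and> x = ((i, p), (j, p), sgn (g' j p - g' i p), ?t (?c p))"
        using pairs[OF lp(2-4)] g_eq[OF lp(5)] by (intro bexI[of _ p]) auto
    next
      assume "\<exists>p\<in>{-1..1}. \<bar>p\<bar> = u0 \<and> x = ((i, p), (j, p), sgn (g' j p - g' i p), ?t (?c p))"
      then show "x \<in> graph_picture g g' h K'" using ij g_eq unfolding graph_picture_def by blast
    qed
    have root: "p \<in> {-1..1} \<and> \<bar>p\<bar> = u0 \<longleftrightarrow> p = u0 \<or> p = - u0" for p using u0 by auto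
    let ?E = "\<lambda>p. ((i, p), (j, p), sgn (g' j p - g' i p), ?t (?c p))"
    show ?thesis
    proof (rule Set.set_eqI)
      fix x
      have "x \<in> graph_picture g g' h K' \<longleftrightarrow> (\<exists>p. (p = u0 \<or> p = - u0) \<and> x = ?E p)"
        unfolding mem root[symmetric] by blast
      also have "\<dots> \<longleftrightarrow> x = ?E u0 \<or> x = ?E (- u0)" by blast
      finally show "x \<in> graph_picture g g' h K' \<longleftrightarrow>
          x \<in> {((i, u0), (j, u0), s, ?t (?c u0)), ((i, - u0), (j, - u0), - s, ?t (?c (- u0)))}"
        unfolding s_minus s_def[symmetric] by (simp only: insert_iff empty_iff simp_thms)
    qed
  qed
  have S'': "split_chords (crossings K') (outer K') (graph_picture g g' h K') (crossing_sign K')"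
  proof (rule graph_split[OF K' P' _ _ _ h])
    show "\<bar>g l u\<bar> \<le> 1" if "u \<in> {-1..1}" for l u using bump_range[OF that] by (auto simp: g_def abs_le_iff)
    show "(g l has_real_derivative g' l u) (at u)" for l u
      unfolding g_def[abs_def] g'_def using bump_deriv[of u] by (auto intro!: derivative_eq_intros)
    show "p \<in> {-1<..<1}" if "l < 2" "l' < 2" "h l' < h l" "p \<in> {-1..1}" "g l p = g l' p" for l l' p
      using pairs[OF that(1-3)] g_eq[OF that(4)] that(5) u0 by auto
  qed
  have X': "crossings K' = insert (?c u0) (insert (?c (- u0)) (outer K))"
    using split_chordsD(1)[OF S''] unfolding G out1 by (auto simp: chord_of_def)
  have par: "parallel_chords (outer K) (?c u0) (?c (- u0))"
    by (rule parallel_chords_outer[OF K ij(1-3)]) (use u0 in auto)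
  \<comment> \<open>Equal types of the two crossings are what gives the picture the form required in
    \<open>bigon_picture\<close>.\<close>
  have "?t (?c (- u0)) = ?t (?c u0)" using parallel_chords_type(1)[OF par] by (simp add: X')
  then have S': "split_chords (crossings K') (outer K)
      {((i, u0), (j, u0), s, ?t (?c u0)), ((i, - u0), (j, - u0), - s, ?t (?c u0))} (crossing_sign K')"
    using S'' unfolding G out1 by simp
  show ?thesis
  proof (rule isomorphic_if_pictures_equivalent[OF K K' S S'])
    fix d assume d: "d \<in> outer K"
    show "chord_type (crossings K') d = chord_type (crossings K) d \<and> crossing_sign K' d = crossing_sign K d"
      using parallel_chords_type(2)[OF par d] out2[OF d] by (simp add: X X')
  next
    fix M :: "(laurent set, (real set \<Rightarrow> laurent set) set) module" assume M: "coeff_module M"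
    from coeff_module.bigon_picture[where \<epsilon> = \<epsilon>, OF M ij(1-3) u0 s eps_abs[OF ij(1)] eps_abs[OF ij(2)]]
    show "picture_extends M 2 \<epsilon> {} {((i, u0), (j, u0), s, ?t (?c u0)), ((i, - u0), (j, - u0), - s, ?t (?c u0))} \<and>
      picture_extends M 2 \<epsilon> {((i, u0), (j, u0), s, ?t (?c u0)), ((i, - u0), (j, - u0), - s, ?t (?c u0))} {} \<and>
      picture_rigid M 2 \<epsilon> {} \<and>
      picture_rigid M 2 \<epsilon> {((i, u0), (j, u0), s, ?t (?c u0)), ((i, - u0), (j, - u0), - s, ?t (?c u0))}"
      using picture_rigid_empty by blast
  qed
qed

subsection \<open>Third move\<close>

text \<open>
  Slopes of the three strands at their crossings, and the parameters of the crossings up to a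
  common factor, which has opposite signs before and after the move.
\<close>

definition slope :: "nat \<Rightarrow> real" where
  "slope i = (if i = 0 then 1 / 2 else if i = 1 then -1 / 2 else 0)"

definition crossing_at :: "nat \<Rightarrow> nat \<Rightarrow> real" where
  "crossing_at i j = (if i < 2 \<and> j < 2 then 0 else if i = 0 \<or> j = 0 then -1 else 1)"

lemma strand_permutations:
  fixes T N B :: nat
  assumes "T < 3" "N < 3" "B < 3" "T \<noteq> N" "T \<noteq> B" "N \<noteq> B"
  shows "(T, N, B) \<in> {(0, 1, 2), (0, 2, 1), (1, 0, 2), (1, 2, 0), (2, 0, 1), (2, 1, 0)}"
proof -
  have "T = 0 \<or> T = 1 \<or> T = 2" "N = 0 \<or> N = 1 \<or> N = 2" "B = 0 \<or> B = 1 \<or> B = 2" using assms by linarith+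
  then show ?thesis using assms(4-6) by (elim disjE) simp_all
qed

text \<open>The last three equations say that the side of a strand on which the crossing of the two
  others lies is the same whether it is read off on one or on the other of them. They are checked
  for all six orders of heights.\<close>

lemma crossing_at_slope:
  assumes "T < 3" "N < 3" "B < 3" "T \<noteq> N" "T \<noteq> B" "N \<noteq> B"
  shows "crossing_at T N \<noteq> crossing_at T B" "crossing_at T N \<noteq> crossing_at N B" "crossing_at T B \<noteq> crossing_at N B"
    "sgn (crossing_at T N - crossing_at T B) * sgn (slope B - slope T) = sgn (crossing_at T N - crossing_at N B) * sgn (slope B - slope N)"
    "- (sgn (crossing_at T B - crossing_at T N) * sgn (slope N - slope T)) = sgn (crossing_at T B - crossing_at N B) * sgn (slope B - slope N)"
    "sgn (crossing_at N B - crossing_at T N) * sgn (slope N - slope T) = sgn (crossing_at N B - crossing_at T B) * sgn (slope B - slope T)"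
proof -
  have v: "crossing_at 0 1 = 0" "crossing_at 1 0 = 0" "crossing_at 0 2 = -1" "crossing_at 2 0 = -1"
    "crossing_at 1 2 = 1" "crossing_at 2 1 = 1" "slope 0 = 1 / 2" "slope 1 = - 1 / 2" "slope 2 = 0"
    by (simp_all add: crossing_at_def slope_def)
  consider "T = 0" "N = 1" "B = 2" | "T = 0" "N = 2" "B = 1" | "T = 1" "N = 0" "B = 2"
    | "T = 1" "N = 2" "B = 0" | "T = 2" "N = 0" "B = 1" | "T = 2" "N = 1" "B = 0"
    using strand_permutations[OF assms] by (simp only: insert_iff prod.inject empty_iff) blast
  then have "crossing_at T N \<noteq> crossing_at T B \<and> crossing_at T N \<noteq> crossing_at N B \<and> crossing_at T B \<noteq> crossing_at N B \<and>
    sgn (crossing_at T N - crossing_at T B) * sgn (slope B - slope T) =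
      sgn (crossing_at T N - crossing_at N B) * sgn (slope B - slope N) \<and>
    - (sgn (crossing_at T B - crossing_at T N) * sgn (slope N - slope T)) =
      sgn (crossing_at T B - crossing_at N B) * sgn (slope B - slope N) \<and>
    sgn (crossing_at N B - crossing_at T N) * sgn (slope N - slope T) =
      sgn (crossing_at N B - crossing_at T B) * sgn (slope B - slope T)"
    by cases (simp_all only: v, simp_all)
  then show "crossing_at T N \<noteq> crossing_at T B" "crossing_at T N \<noteq> crossing_at N B" "crossing_at T B \<noteq> crossing_at N B"
    "sgn (crossing_at T N - crossing_at T B) * sgn (slope B - slope T) =
      sgn (crossing_at T N - crossing_at N B) * sgn (slope B - slope N)"
    "- (sgn (crossing_at T B - crossing_at T N) * sgn (slope N - slope T)) =
      sgn (crossing_at T B - crossing_at N B) * sgn (slope B - slope N)"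
    "sgn (crossing_at N B - crossing_at T N) * sgn (slope N - slope T) =
      sgn (crossing_at N B - crossing_at T B) * sgn (slope B - slope T)" by blast+
qed

lemma slope_sgn: "i < 3 \<Longrightarrow> j < 3 \<Longrightarrow> i \<noteq> j \<Longrightarrow> \<bar>sgn (slope j - slope i)\<bar> = 1"
proof -
  assume "i < 3" "j < 3" "i \<noteq> j"
  then have "slope j - slope i \<noteq> 0"
    unfolding slope_def by (cases "i = 0"; cases "j = 0"; cases "i = 1"; cases "j = 1"; simp)
  then show ?thesis by (simp add: abs_sgn_eq)
qed

lemma abs_crossing_at: "\<bar>crossing_at i j\<bar> \<le> 1"
  by (simp add: crossing_at_def)

lemma triangle_order:
  fixes h :: "nat \<Rightarrow> nat"
  assumes "inj_on h {..<3}"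
  obtains T N B where "T < 3" "N < 3" "B < 3" "T \<noteq> N" "T \<noteq> B" "N \<noteq> B" "h N < h T" "h B < h N"
proof -
  have "h 0 \<noteq> h 1" "h 0 \<noteq> h 2" "h 1 \<noteq> h 2" using inj_onD[OF assms, of 0 1] inj_onD[OF assms, of 0 2] inj_onD[OF assms, of 1 2] by auto
  then consider "h 0 < h 1 \<and> h 1 < h 2" | "h 0 < h 2 \<and> h 2 < h 1" | "h 1 < h 0 \<and> h 0 < h 2"
    | "h 1 < h 2 \<and> h 2 < h 0" | "h 2 < h 0 \<and> h 0 < h 1" | "h 2 < h 1 \<and> h 1 < h 0" by linarith
  then show ?thesis
  proof cases
    case 1
    show ?thesis by (rule that[of 2 1 0]) (use 1 in simp_all)
  next
    case 2
    show ?thesis by (rule that[of 1 2 0]) (use 2 in simp_all)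
  next
    case 3
    show ?thesis by (rule that[of 2 0 1]) (use 3 in simp_all)
  next
    case 4
    show ?thesis by (rule that[of 0 2 1]) (use 4 in simp_all)
  next
    case 5
    show ?thesis by (rule that[of 1 0 2]) (use 5 in simp_all)
  next
    case 6
    show ?thesis by (rule that[of 0 1 2]) (use 6 in simp_all)
  qed
qed

section \<open>The sides of the crossings before and after the third move\<close>

context triangle
begin

text \<open>The sides are read off before the move. The two readings of a side involve the direction
  of the same third strand, which cancels, so their agreement is a relation between signs and order.
  After the move every difference of crossing parameters has changed its sign, hence every side is
  the opposite one.\<close>

lemma located_pair:
  assumes r: "{x, y, z} \<subseteq> {-1<..<1}" "x \<noteq> y" "x \<noteq> z" "y \<noteq> z" and r': "{x', y', z'} \<subseteq> {-1<..<1}"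
    and opp: "sgn (x' - y') = - sgn (x - y)" "sgn (x' - z') = - sgn (x - z)" "sgn (y' - z') = - sgn (y - z)"
    and rel: "sgn (x - y) * s2 = sgn (x - z) * s3" "- (sgn (y - x) * s1) = sgn (y - z) * s3"
      "sgn (z - x) * s1 = sgn (z - y) * s2"
  obtains \<tau>T \<tau>N \<tau>B where "located x y z \<tau>T \<tau>N \<tau>B" "located x' y' z' (\<not> \<tau>T) (\<not> \<tau>N) (\<not> \<tau>B)"
proof -
  have pm: "u = 1 \<or> u = -1" if "\<bar>u\<bar> = 1" for u :: real using that by linarith
  have eqv: "(u = \<sigma> * e) = (v = \<sigma>' * e)" if "\<bar>u\<bar> = 1" "\<bar>v\<bar> = 1" "\<bar>\<sigma>\<bar> = 1" "\<bar>\<sigma>'\<bar> = 1" "\<bar>e\<bar> = 1" "u * \<sigma> = v * \<sigma>'"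
    for u v \<sigma> \<sigma>' e :: real
    using that(6) pm[OF that(1)] pm[OF that(2)] pm[OF that(3)] pm[OF that(4)] pm[OF that(5)]
    by (elim disjE) simp_all
  have neg: "(- u = e) = (\<not> u = e)" if "\<bar>u\<bar> = 1" "\<bar>e\<bar> = 1" for u e :: real
    using pm[OF that(1)] pm[OF that(2)] by (elim disjE) simp_all
  have sg: "\<bar>sgn (u - v)\<bar> = 1" if "u \<noteq> v" for u v :: real using that by (simp add: abs_sgn_eq)
  have d: "\<bar>dTN\<bar> = 1" "\<bar>dTB\<bar> = 1" "\<bar>dNT\<bar> = 1" "\<bar>dNB\<bar> = 1" "\<bar>dBT\<bar> = 1" "\<bar>dBN\<bar> = 1"
    using \<epsilon> strands s by (simp_all add: dTN_def dTB_def dNT_def dNB_def dBT_def dBN_def abs_mult)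
  note n = r(2-4) r(2-4)[symmetric]
  have B: "(sgn (x - y) = dTB) = (sgn (x - z) = dNB)" unfolding dTB_def dNB_def
    by (rule eqv) (use rel(1) sg[OF n(1)] sg[OF n(2)] s \<epsilon> strands in simp_all)
  have N: "(sgn (y - x) = dTN) = (sgn (y - z) = dBN)" unfolding dTN_def dBN_def
    by (rule eqv) (use rel(2) sg[OF n(4)] sg[OF n(3)] s \<epsilon> strands in simp_all)
  have T: "(sgn (z - x) = dNT) = (sgn (z - y) = dBT)" unfolding dNT_def dBT_def
    by (rule eqv) (use rel(3) sg[OF n(5)] sg[OF n(6)] s \<epsilon> strands in simp_all)
  have opp': "sgn (y' - x') = - sgn (y - x)" "sgn (z' - x') = - sgn (z - x)" "sgn (z' - y') = - sgn (z - y)"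
    using opp by (metis minus_diff_eq sgn_minus)+
  have ne': "x' \<noteq> y'" "x' \<noteq> z'" "y' \<noteq> z'"
    using opp n(1-3) by (metis diff_self eq_iff_diff_eq_0 neg_0_equal_iff_equal sgn_0 sgn_0_0)+
  have N1: "(sgn (x' - y') = dTB) = (\<not> sgn (x - y) = dTB)" unfolding opp by (rule neg[OF sg[OF n(1)] d(2)])
  have N2: "(sgn (x' - z') = dNB) = (\<not> sgn (x - z) = dNB)" unfolding opp by (rule neg[OF sg[OF n(2)] d(4)])
  have N3: "(sgn (y' - z') = dBN) = (\<not> sgn (y - z) = dBN)" unfolding opp by (rule neg[OF sg[OF n(3)] d(6)])
  have N4: "(sgn (y' - x') = dTN) = (\<not> sgn (y - x) = dTN)" unfolding opp' by (rule neg[OF sg[OF n(4)] d(1)])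
  have N5: "(sgn (z' - x') = dNT) = (\<not> sgn (z - x) = dNT)" unfolding opp' by (rule neg[OF sg[OF n(5)] d(3)])
  have N6: "(sgn (z' - y') = dBT) = (\<not> sgn (z - y) = dBT)" unfolding opp' by (rule neg[OF sg[OF n(6)] d(5)])
  show ?thesis
  proof (rule that)
    show "located x y z (sgn (z - x) = dNT) (sgn (y - x) = dTN) (sgn (x - y) = dTB)"
      unfolding located_def using r B N T by blast
    show "located x' y' z' (\<not> sgn (z - x) = dNT) (\<not> sgn (y - x) = dTN) (\<not> sgn (x - y) = dTB)"
      unfolding located_def N1 N2 N3 N4 N5 N6 using r' ne' B N T by blast
  qed
qed

end

lemma (in strands) triangle_split:
  assumes n: "n = 3" and K: "virtual_knot_diagram K" and P: "has_picture n (\<lambda>i u. Complex u (f i u)) a b \<epsilon> h K"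
    and f: "\<And>i u. i < n \<Longrightarrow> u \<in> {-1..1} \<Longrightarrow> \<bar>f i u\<bar> \<le> 1"
    and f': "\<And>i u. i < n \<Longrightarrow> (f i has_real_derivative f' i u) (at u)"
    and c: "\<bar>c\<bar> < 1"
    and eq: "\<And>i j u. i < n \<Longrightarrow> j < n \<Longrightarrow> i \<noteq> j \<Longrightarrow> u \<in> {-1..1} \<Longrightarrow> f i u = f j u \<longleftrightarrow> u = c * crossing_at i j"
    and sg: "\<And>i j u. i < n \<Longrightarrow> j < n \<Longrightarrow> i \<noteq> j \<Longrightarrow> u \<in> {-1..1} \<Longrightarrow> sgn (f' j u - f' i u) = sgn (slope j - slope i)"
    and h: "inj_on h {..<n}"
    and TNB: "T < n" "N < n" "B < n" "T \<noteq> N" "T \<noteq> B" "N \<noteq> B" "h N < h T" "h B < h N"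
  defines "chord \<equiv> \<lambda>i j. (of_strand i (c * crossing_at i j), of_strand j (c * crossing_at i j))"
  shows "split_chords (crossings K) (outer K) (triangle_picture T N B
      (sgn (slope N - slope T)) (sgn (slope B - slope T)) (sgn (slope B - slope N))
      (chord_type (crossings K) (chord T N)) (chord_type (crossings K) (chord T B)) (chord_type (crossings K) (chord N B))
      (c * crossing_at T N) (c * crossing_at T B) (c * crossing_at N B)) (crossing_sign K)"
    "crossings K = insert (chord T N) (insert (chord T B) (insert (chord N B) (outer K)))"
proof -
  have range: "\<bar>c * crossing_at i j\<bar> < 1" for i j
    using c mult_left_mono[OF abs_crossing_at[of i j], of "\<bar>c\<bar>"] by (simp add: abs_mult)
  then have range': "c * crossing_at i j \<in> {-1..1}" "c * crossing_at i j \<in> {-1<..<1}" for i j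
    by (auto simp: abs_less_iff less_imp_le dest: spec)
  have pairs: "(i = T \<and> j = N) \<or> (i = T \<and> j = B) \<or> (i = N \<and> j = B)" if "i < n" "j < n" "h j < h i" for i j
  proof -
    have "i = T \<or> i = N \<or> i = B" "j = T \<or> j = N \<or> j = B" using that(1,2) TNB(1-6) n by linarith+
    then show ?thesis using that(3) TNB(7,8) by auto
  qed
  have S: "split_chords (crossings K) (outer K) (graph_picture f f' h K) (crossing_sign K)"
  proof (rule graph_split[OF K P f f' _ h])
    show "p \<in> {-1<..<1}" if "i < n" "j < n" "h j < h i" "p \<in> {-1..1}" "f i p = f j p" for i j p
    proof -
      have "i \<noteq> j" using that(3) by auto
      then show ?thesis using eq[OF that(1,2) _ that(4)] that(5) range'(2) by blast
    qed
  qed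
  let ?entry = "\<lambda>i j. ((i, c * crossing_at i j), (j, c * crossing_at i j), sgn (slope j - slope i), chord_type (crossings K) (chord i j))"
  have entry: "x \<in> graph_picture f f' h K \<longleftrightarrow> (\<exists>i j. i < n \<and> j < n \<and> h j < h i \<and> x = ?entry i j)" for x
  proof
    assume "x \<in> graph_picture f f' h K"
    then obtain i j p where x: "x = ((i, p), (j, p), sgn (f' j p - f' i p), chord_type (crossings K) (of_strand i p, of_strand j p))"
      and ij: "i < n" "j < n" "h j < h i" and p: "p \<in> {-1..1}" "f i p = f j p" unfolding graph_picture_def by blast
    have "i \<noteq> j" using ij(3) by auto
    then have "p = c * crossing_at i j" using eq[OF ij(1,2) _ p(1)] p(2) by blast
    moreover have "sgn (f' j p - f' i p) = sgn (slope j - slope i)" using sg[OF ij(1,2) \<open>i \<noteq> j\<close> p(1)] .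
    ultimately show "\<exists>i j. i < n \<and> j < n \<and> h j < h i \<and> x = ?entry i j"
      using x ij unfolding chord_def by blast
  next
    assume "\<exists>i j. i < n \<and> j < n \<and> h j < h i \<and> x = ?entry i j"
    then obtain i j where ij: "i < n" "j < n" "h j < h i" and x: "x = ?entry i j" by blast
    have "i \<noteq> j" using ij(3) by auto
    have "f i (c * crossing_at i j) = f j (c * crossing_at i j)" using eq[OF ij(1,2) \<open>i \<noteq> j\<close> range'(1)] by blast
    moreover have "sgn (f' j (c * crossing_at i j) - f' i (c * crossing_at i j)) = sgn (slope j - slope i)"
      by (rule sg[OF ij(1,2) \<open>i \<noteq> j\<close> range'(1)])
    ultimately show "x \<in> graph_picture f f' h K"
      unfolding graph_picture_def x chord_def mem_Collect_eq using ij range'(1)[of i j]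
      by (intro exI[of _ i] exI[of _ j] exI[of _ "c * crossing_at i j"]) simp
  qed
  have "graph_picture f f' h K = {?entry T N, ?entry T B, ?entry N B}"
  proof (rule Set.set_eqI, rule iffI)
    fix x assume "x \<in> graph_picture f f' h K"
    then obtain i j where ij: "i < n" "j < n" "h j < h i" and x: "x = ?entry i j" using entry by blast
    show "x \<in> {?entry T N, ?entry T B, ?entry N B}"
      using pairs[OF ij] unfolding x by (elim disjE conjE; simp only: insert_iff simp_thms)
  next
    fix x assume x: "x \<in> {?entry T N, ?entry T B, ?entry N B}"
    have "h B < h T" using TNB(7,8) by simp
    then show "x \<in> graph_picture f f' h K" using x TNB unfolding entry by blast
  qed
  then have G: "graph_picture f f' h K = triangle_picture T N B
      (sgn (slope N - slope T)) (sgn (slope B - slope T)) (sgn (slope B - slope N))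
      (chord_type (crossings K) (chord T N)) (chord_type (crossings K) (chord T B)) (chord_type (crossings K) (chord N B))
      (c * crossing_at T N) (c * crossing_at T B) (c * crossing_at N B)" unfolding triangle_picture_def .
  show "split_chords (crossings K) (outer K) (triangle_picture T N B
      (sgn (slope N - slope T)) (sgn (slope B - slope T)) (sgn (slope B - slope N))
      (chord_type (crossings K) (chord T N)) (chord_type (crossings K) (chord T B)) (chord_type (crossings K) (chord N B))
      (c * crossing_at T N) (c * crossing_at T B) (c * crossing_at N B)) (crossing_sign K)"
    using S unfolding G .
  from split_chordsD(1)[OF S[unfolded G]]
  show "crossings K = insert (chord T N) (insert (chord T B) (insert (chord N B) (outer K)))"
    unfolding triangle_picture_def chord_def by (auto simp: chord_of_def)
qed

text \<open>The left side is the absolute slope of strand 2 after it has been pushed, and 1/2 is the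
  absolute slope of strands 0 and 1. The bound keeps the order of the slopes, hence the signs of the
  crossings, and makes the points of intersection unique.\<close>

lemma cubic_bound:
  assumes "u \<in> {-1..1}"
  shows "\<bar>u * (1 - u\<^sup>2)\<bar> < (1::real) / 2"
proof -
  let ?a = "\<bar>u\<bar>"
  \<comment> \<open>An identity of polynomials: both sides are \<open>?a ^ 3 - ?a + 1 / 2\<close>,
    and the right one is visibly positive for nonnegative \<open>?a\<close>.\<close>
  have "1 / 2 - ?a * (1 - ?a\<^sup>2) = ?a * (?a - 1 / 2)\<^sup>2 + (?a - 5 / 8)\<^sup>2 + 7 / 64"
    by (simp add: power2_eq_square field_simps del: abs_mult_self_eq)
  moreover have "\<dots> > 0" by (intro add_nonneg_pos add_nonneg_nonneg mult_nonneg_nonneg) simp_all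
  moreover have "u\<^sup>2 \<le> 1" using assms abs_square_le_1[of u] by (auto simp: abs_le_iff)
  ultimately show ?thesis by (simp add: abs_mult)
qed

text \<open>The difference of the two heights is 1/8 at 0 and negative at 1, and by
  \<open>cubic_bound\<close> it is strictly decreasing, so it has exactly one zero.\<close>

lemma bump_line:
  obtains z where "0 < z" "z < 1" "\<And>u. u \<in> {-1..1} \<Longrightarrow> - 1 / 8 + bump u / 4 = u / 2 \<longleftrightarrow> u = z"
proof -
  let ?g = "\<lambda>u. - 1 / 8 + bump u / 4 - u / 2"
  have D: "(?g has_real_derivative (0 + - (4 * u * (1 - u\<^sup>2)) / 4) - 1 / 2) (at u)" for u
    by (intro DERIV_diff DERIV_add DERIV_const DERIV_cdivide bump_deriv DERIV_ident)
  have dec: "?g v < ?g u" if "u < v" "u \<in> {-1..1}" "v \<in> {-1..1}" for u v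
  proof (rule DERIV_neg_imp_decreasing[OF that(1)])
    fix x assume "u \<le> x" "x \<le> v"
    then have "x \<in> {-1..1}" using that by auto
    from cubic_bound[OF this] have "(0 + - (4 * x * (1 - x\<^sup>2)) / 4) - 1 / 2 < 0" by (simp add: abs_less_iff)
    then show "\<exists>y. (?g has_real_derivative y) (at x) \<and> y < 0" using D by blast
  qed
  have "continuous_on {0..1} ?g" by (rule DERIV_continuous_on[OF has_field_derivative_at_within[OF D]])
  then obtain z where z: "0 \<le> z" "z \<le> 1" "?g z = 0"
    using IVT2'[of ?g 1 0 0] by (auto simp: bump_def)
  have "z \<noteq> 0" "z \<noteq> 1" using z(3) by (auto simp: bump_def)
  moreover have "- 1 / 8 + bump u / 4 = u / 2 \<longleftrightarrow> u = z" if "u \<in> {-1..1}" for u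
  proof -
    have "z \<in> {-1..1}" using z by simp
    then show ?thesis using dec[of u z] dec[of z u] z(3) that by (cases u z rule: linorder_cases) auto
  qed
  ultimately show ?thesis using that[of z] z by simp
qed

lemma isomorphic_reidemeister3:
  assumes K: "virtual_knot_diagram K" and K': "virtual_knot_diagram K'" and R: "reidemeister3 K K'"
  shows "module_isomorphic coeff_ring (knot_module K) (knot_module K')"
proof -
  define f :: "nat \<Rightarrow> real \<Rightarrow> real" where "f i u = (if i = 0 then u / 2 else if i = 1 then - u / 2 else - 1 / 8)" for i u
  define g :: "nat \<Rightarrow> real \<Rightarrow> real" where
    "g i u = (if i = 0 then u / 2 else if i = 1 then - u / 2 else - 1 / 8 + bump u / 4)" for i u
  define g' :: "nat \<Rightarrow> real \<Rightarrow> real" where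
    "g' i u = (if i = 0 then 1 / 2 else if i = 1 then - 1 / 2 else - (u * (1 - u\<^sup>2)))" for i u
  have fg: "(\<lambda>i u. if i = 0 then Complex u (u / 2) else if i = 1 then Complex u (- u / 2) else Complex u (- 1 / 8)) =
      (\<lambda>i u. Complex u (f i u))"
    "(\<lambda>i u. if i = 0 then Complex u (u / 2) else if i = 1 then Complex u (- u / 2) else Complex u (- 1 / 8 + bump u / 4)) =
      (\<lambda>i u. Complex u (g i u))"
    by (auto simp: f_def g_def fun_eq_iff)
  from R[unfolded reidemeister3_def fg] obtain a b \<epsilon> h where st: "strands 3 a b \<epsilon>" and h: "inj_on h {..<3}"
    and P: "has_picture 3 (\<lambda>i u. Complex u (f i u)) a b \<epsilon> h K" and P': "has_picture 3 (\<lambda>i u. Complex u (g i u)) a b \<epsilon> h K'"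
    and agree: "\<And>x. x \<in> {0..1} - strands.region 3 a b \<Longrightarrow> curve K' x = curve K x \<and> (x \<in> over K' \<longleftrightarrow> x \<in> over K)"
    by (rule local_move_strands) blast
  interpret strands 3 a b \<epsilon> by (rule st)
  have out1: "outer K' = outer K" by (rule local_move_outer(1)[OF K K']) (rule agree)
  have out2: "crossing_sign K' d = crossing_sign K d" if "d \<in> outer K" for d
    by (rule local_move_outer(2)[OF K K' _ that]) (rule agree)
  obtain T N B where TNB: "T < 3" "N < 3" "B < 3" "T \<noteq> N" "T \<noteq> B" "N \<noteq> B" "h N < h T" "h B < h N"
    by (rule triangle_order[OF h])
  obtain z where z: "0 < z" "z < 1" and root: "\<And>u. u \<in> {-1..1} \<Longrightarrow> - 1 / 8 + bump u / 4 = u / 2 \<longleftrightarrow> u = z"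
    using bump_line by blast
  \<comment> \<open>Strand 1 is the mirror image of strand 0, and \<open>bump\<close> is
    even.\<close>
  have root': "- 1 / 8 + bump u / 4 = - u / 2 \<longleftrightarrow> u = - z" if "u \<in> {-1..1}" for u
    using root[of "- u"] that by auto
  have cases3: "i = 0 \<or> i = 1 \<or> i = 2" if "i < 3" for i :: nat using that by linarith
  have f1: "\<bar>f i u\<bar> \<le> 1" if "i < 3" "u \<in> {-1..1}" for i u using that(2) by (auto simp: f_def abs_le_iff)
  have g1: "\<bar>g i u\<bar> \<le> 1" if "i < 3" "u \<in> {-1..1}" for i u
    using that(2) bump_range[OF that(2)] by (auto simp: g_def abs_le_iff)
  have fd: "(f i has_real_derivative slope i) (at u)" if "i < 3" for i u
    using cases3[OF that] unfolding f_def[abs_def] slope_def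
    by (elim disjE) (auto intro!: derivative_eq_intros)
  have gd: "(g i has_real_derivative g' i u) (at u)" if "i < 3" for i u
  proof -
    have "((\<lambda>u. - 1 / 8 + bump u / 4) has_real_derivative 0 + - (4 * u * (1 - u\<^sup>2)) / 4) (at u)"
      by (intro DERIV_add DERIV_const DERIV_cdivide bump_deriv)
    then show ?thesis using cases3[OF that] unfolding g_def[abs_def] g'_def
      by (elim disjE) (auto intro!: derivative_eq_intros)
  qed
  have f_eq: "f i u = f j u \<longleftrightarrow> u = (1 / 4) * crossing_at i j" if "i < 3" "j < 3" "i \<noteq> j" "u \<in> {-1..1}" for i j u
    using cases3[OF that(1)] cases3[OF that(2)] that(3) unfolding f_def crossing_at_def
    by (elim disjE; simp; linarith)
  have g_eq: "g i u = g j u \<longleftrightarrow> u = (- z) * crossing_at i j" if "i < 3" "j < 3" "i \<noteq> j" "u \<in> {-1..1}" for i j u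
  proof -
    note r = root[OF that(4)] root'[OF that(4)]
    have r': "u / 2 = - 1 / 8 + bump u / 4 \<longleftrightarrow> u = z" "- u / 2 = - 1 / 8 + bump u / 4 \<longleftrightarrow> u = - z"
      using r by metis+
    have e0: "u / 2 = - u / 2 \<longleftrightarrow> u = 0" "- u / 2 = u / 2 \<longleftrightarrow> u = 0" by linarith+
    have v: "g 0 u = u / 2" "g 1 u = - u / 2" "g 2 u = - 1 / 8 + bump u / 4"
      "crossing_at 0 1 = 0" "crossing_at 1 0 = 0" "crossing_at 0 2 = -1" "crossing_at 2 0 = -1"
      "crossing_at 1 2 = 1" "crossing_at 2 1 = 1" "- z * 0 = 0" "- z * -1 = z" "- z * 1 = - z"
      by (simp_all add: g_def crossing_at_def)
    have "(i = 0 \<and> j = 1) \<or> (i = 1 \<and> j = 0) \<or> (i = 0 \<and> j = 2) \<or> (i = 2 \<and> j = 0) \<or> (i = 1 \<and> j = 2) \<or> (i = 2 \<and> j = 1)"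
      using cases3[OF that(1)] cases3[OF that(2)] that(3) by blast
    then show ?thesis
      by (elim disjE conjE) (simp_all only: v r r' e0)
  qed
  have f_sg: "sgn (slope j - slope i) = sgn (slope j - slope i)" for i j by simp
  have g_sg: "sgn (g' j u - g' i u) = sgn (slope j - slope i)" if "i < 3" "j < 3" "i \<noteq> j" "u \<in> {-1..1}" for i j u
  proof -
    define v where "v = u * (1 - u\<^sup>2)"
    have v: "- 1 / 2 < v" "v < 1 / 2" using cubic_bound[OF that(4)] by (simp_all add: v_def abs_less_iff)
    show ?thesis
      using cases3[OF that(1)] cases3[OF that(2)] that(3) v unfolding g'_def slope_def v_def[symmetric]
      by (elim disjE; simp add: sgn_real_def)
  qed
  define chord where "chord c i j = (of_strand i (c * crossing_at i j), of_strand j (c * crossing_at i j))" for c i j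
  \<comment> \<open>The line at height -1/8 meets strands 0 and 1 at -1/4 and 1/4; the pushed strand
    meets them at \<open>z\<close> and \<open>- z\<close>. The opposite signs of the two factors
    express that the ends of the chords on each strand have been swapped.\<close>
  let ?c = "1 / 4 :: real" and ?c' = "- z"
  have c: "\<bar>?c\<bar> < 1" "\<bar>?c'\<bar> < 1" using z by simp_all
  note split = triangle_split[OF refl K P f1 fd c(1) f_eq f_sg h TNB, folded chord_def]
  note split' = triangle_split[OF refl K' P' g1 gd c(2) g_eq g_sg h TNB, folded chord_def, unfolded out1]
  have range: "\<bar>d * crossing_at i j\<bar> < 1" if "\<bar>d\<bar> < 1" for d i j
    using that mult_left_mono[OF abs_crossing_at[of i j], of "\<bar>d\<bar>"] by (simp add: abs_mult)
  have open_r: "{d * crossing_at T N, d * crossing_at T B, d * crossing_at N B} \<subseteq> {-1<..<1}" if "\<bar>d\<bar> < 1" for d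
    using range[OF that, of T N] range[OF that, of T B] range[OF that, of N B] by (simp add: abs_less_iff)
  note ms = crossing_at_slope[OF TNB(1-6)]
  have T: "triangle_chords (outer K) (chord ?c T N, chord ?c T B, chord ?c N B) (chord ?c' T N, chord ?c' T B, chord ?c' N B)"
    unfolding chord_def
  proof (rule triangle_chords_outer[OF K TNB(1-6)])
    show "{?c * crossing_at T N, ?c * crossing_at T B, ?c * crossing_at N B, ?c' * crossing_at T N, ?c' * crossing_at T B, ?c' * crossing_at N B} \<subseteq> {-1..1}"
      using open_r[OF c(1)] open_r[OF c(2)] by auto
  qed (use ms(1-3) z in auto)
  note ty = triangle_chords_type[OF T]
  have X: "crossings K = insert (chord ?c T N) (insert (chord ?c T B) (insert (chord ?c N B) (outer K)))"
    by (rule split(2))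
  have X': "crossings K' = insert (chord ?c' T N) (insert (chord ?c' T B) (insert (chord ?c' N B) (outer K)))"
    by (rule split'(2))
  define t1 t2 t3 where "t1 = chord_type (crossings K) (chord ?c T N)"
    and "t2 = chord_type (crossings K) (chord ?c T B)" and "t3 = chord_type (crossings K) (chord ?c N B)"
  define s1 s2 s3 where "s1 = sgn (slope N - slope T)" and "s2 = sgn (slope B - slope T)" and "s3 = sgn (slope B - slope N)"
  let ?pic = "\<lambda>d. triangle_picture T N B s1 s2 s3 t1 t2 t3 (d * crossing_at T N) (d * crossing_at T B) (d * crossing_at N B)"
  have t: "t1 = chord_type (crossings K') (chord ?c' T N)" "t2 = chord_type (crossings K') (chord ?c' T B)"
    "t3 = chord_type (crossings K') (chord ?c' N B)" "triangle_types t1 t2 t3"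
    using ty(1-4) unfolding t1_def t2_def t3_def X[symmetric] X'[symmetric] by simp_all
  have S: "split_chords (crossings K) (outer K) (?pic ?c) (crossing_sign K)"
    using split(1) unfolding t1_def t2_def t3_def s1_def s2_def s3_def .
  have S': "split_chords (crossings K') (outer K) (?pic ?c') (crossing_sign K')"
    using split'(1) unfolding t(1-3)[symmetric] s1_def[symmetric] s2_def[symmetric] s3_def[symmetric] .
  show ?thesis
  proof (rule isomorphic_if_pictures_equivalent[OF K K' S S'])
    fix d assume d: "d \<in> outer K"
    show "chord_type (crossings K') d = chord_type (crossings K) d \<and> crossing_sign K' d = crossing_sign K d"
      using ty(5)[OF d] out2[OF d] unfolding X[symmetric] X'[symmetric] by simp
  next
    fix M :: "(laurent set, (real set \<Rightarrow> laurent set) set) module" assume M: "coeff_module M"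
    interpret C: coeff_module M by (rule M)
    interpret tri: triangle M T N B \<epsilon> s1 s2 s3 t1 t2 t3
      by unfold_locales (use TNB eps_abs slope_sgn in \<open>auto simp: s1_def s2_def s3_def\<close>)
    have sd: "sgn (d * u - d * v) = sgn d * sgn (u - v)" for d u v :: real
      by (simp add: sgn_mult flip: right_diff_distrib)
    have opp: "sgn (?c' * u - ?c' * v) = - sgn (?c * u - ?c * v)" for u v
      unfolding sd using z by simp
    have rel: "sgn (d * u - d * v) * \<sigma> = sgn (d * u' - d * v') * \<sigma>'"
      if "sgn (u - v) * \<sigma> = sgn (u' - v') * \<sigma>'" for d u v u' v' \<sigma> \<sigma>' :: real
      by (simp only: sd mult.assoc that)
    have rel': "- (sgn (d * u - d * v) * \<sigma>) = sgn (d * u' - d * v') * \<sigma>'"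
      if "- (sgn (u - v) * \<sigma>) = sgn (u' - v') * \<sigma>'" for d u v u' v' \<sigma> \<sigma>' :: real
      by (simp only: sd mult.assoc that[symmetric] mult_minus_right)
    have ne: "?c * u \<noteq> ?c * v" if "u \<noteq> v" for u v :: real using that by simp
    obtain \<tau>T \<tau>N \<tau>B where loc: "tri.located (?c * crossing_at T N) (?c * crossing_at T B) (?c * crossing_at N B) \<tau>T \<tau>N \<tau>B"
      and loc': "tri.located (?c' * crossing_at T N) (?c' * crossing_at T B) (?c' * crossing_at N B) (\<not> \<tau>T) (\<not> \<tau>N) (\<not> \<tau>B)"
      by (rule tri.located_pair[OF open_r[OF c(1)] ne[OF ms(1)] ne[OF ms(2)] ne[OF ms(3)] open_r[OF c(2)] opp opp opp
          rel[OF ms(4)[folded s1_def s2_def s3_def]] rel'[OF ms(5)[folded s1_def s2_def s3_def]]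
          rel[OF ms(6)[folded s1_def s2_def s3_def]]])
    \<comment> \<open>For the move in the other direction the same lemma is used with all sides
      negated; negating them twice gives back the original position.\<close>
    have loc'': "tri.located (?c * crossing_at T N) (?c * crossing_at T B) (?c * crossing_at N B) (\<not> \<not> \<tau>T) (\<not> \<not> \<tau>N) (\<not> \<not> \<tau>B)"
      using loc by simp
    show "picture_extends M 3 \<epsilon> (?pic ?c) (?pic ?c') \<and> picture_extends M 3 \<epsilon> (?pic ?c') (?pic ?c) \<and>
        picture_rigid M 3 \<epsilon> (?pic ?c) \<and> picture_rigid M 3 \<epsilon> (?pic ?c')"
      using tri.triangle_extends[OF loc loc' t(4)] tri.triangle_extends[OF loc' loc'' t(4)]
        tri.triangle_rigid[OF loc] tri.triangle_rigid[OF loc'] by blast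
  qed
qed

lemma virtual_move_isomorphic:
  assumes "virtual_move K K'"
  shows "module_isomorphic coeff_ring (knot_module K) (knot_module K')"
  using assms isomorphic_reparametrized isomorphic_planar_isotopic isomorphic_detour
    isomorphic_reidemeister1 isomorphic_reidemeister2 isomorphic_reidemeister3
  unfolding virtual_move_def by blast

theorem theorem2:
  fixes K K' :: vdiagram
  assumes "virtual_knot_diagram K" and "virtual_knot_diagram K'"
    and "virtually_equivalent K K'"
  shows "module_isomorphic coeff_ring (knot_module K) (knot_module K')"
  using assms(3) unfolding virtually_equivalent_def
proof (induction rule: equivclp_induct)
  case base
  show ?case by (rule module_isomorphic_refl)
next
  case (step y z)
  \<comment> \<open>A step of the equivalence is a move or the inverse of one; in the latter case
    the isomorphism is reversed.\<close>
  have "module_isomorphic coeff_ring (knot_module y) (knot_module z)"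
    using step.hyps(2) virtual_move_isomorphic module_isomorphic_sym[OF coeff_module_knot] by blast
  with step.IH show ?case by (rule module_isomorphic_trans)
qed

end
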